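(* Let $A=(a_{ij})\in M(d,\mathbb{Z})$ be a $d\times d$ integer matrix with $\det(A)\neq 0$, and let $\phi_A:\mathbb{P}^d\dashrightarrow\mathbb{P}^d$ be the corresponding (dominant) monomial rational map. Then for every $0\le k\le d$, $$\deg_k(\phi_A^n)\asymp \|\wedge^k A^n\|,$$ where $\wedge^k A:\wedge^k\mathbb{R}^d\to\wedge^k\mathbb{R}^d$ is the natural linear map induced by $A$, and $\|\cdot\|$ is any norm on $\mathrm{End}(\wedge^k\mathbb{R}^d)$.
   Context: All varieties are over $\mathbb{C}$. For $A=(a_{ij})\in M(d,\mathbb{Z})$, the monomial map is $\phi_A(x_1,\dots,x_d)=(\prod_j x_j^{a_{j1}},\dots,\prod_j x_j^{a_{jd}})$ on $(\mathbb{C}^* )^d$, extended as a rational map to the standard equivariant compactification $\mathbb{P}^d\supset(\mathbb{C}^* )^d$. It is dominant iff $\det A\ne0$, and $\phi_A^n=\phi_{A^n}$ ($n$-th iterate). For a dominant rational map $f:\mathbb{P}^d\dashrightarrow\mathbb{P}^d$ and $0\le k\le d$, $\deg_k(f)$ is the degree of $f^{-1}(L_k)$ for a generic linear subspace $L_k\subset\mathbb{P}^d$ of codimension $k$ (where $f^{-1}(L_k)$ is the closure of the preimage taken over the locus where $f$ is well behaved). Equivalently, if $\Gamma\subset \mathbb{P}^d\times\mathbb{P}^d$ is the closure of the graph of $f$, with projections $\pi_1,\pi_2$, and $h$ is the hyperplane class, then $\deg_k(f)=\int_\Gamma \pi_2^*h^k\cdot\pi_1^*h^{d-k}$. For sequences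 of positive reals, $a_n\asymp b_n$ means that there is $C>1$ with $C^{-1}\le a_n/b_n\le C$ for all $n$. *)

theory Defs
  imports Complex_Main "Jordan_Normal_Form.Determinant"
begin

section \<open>Projective space\<close>

text \<open>
  A point of the complex projective space of dimension \<open>d\<close> is a one-dimensional subspace of the
  vectors of length \<open>d + 1\<close>; homogeneous coordinates are indexed by \<open>0, \<dots>, d\<close>.
\<close>

definition line :: "complex vec \<Rightarrow> complex vec set" where
  "line v = {c \<cdot>\<^sub>v v | c. True}"

definition hcoords :: "nat \<Rightarrow> complex vec set" where
  "hcoords d = carrier_vec (Suc d) - {0\<^sub>v (Suc d)}"

definition proj_space :: "nat \<Rightarrow> complex vec set set" where
  "proj_space d = line ` hcoords d"

text \<open>Homogeneous forms of degree \<open>m\<close> in \<open>d + 1\<close> variables, as functions on vectors; the lists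
  \<open>\<alpha>\<close> are the exponent vectors of the monomials of degree \<open>m\<close>.\<close>

definition form :: "nat \<Rightarrow> nat \<Rightarrow> (complex vec \<Rightarrow> complex) \<Rightarrow> bool" where
  "form d m F \<longleftrightarrow> (\<exists>c. \<forall>v \<in> carrier_vec (Suc d).
     F v = (\<Sum>\<alpha> | length \<alpha> = Suc d \<and> sum_list \<alpha> = m. c \<alpha> * (\<Prod>i\<le>d. v $ i ^ (\<alpha> ! i))))"

definition zariski_closure :: "nat \<Rightarrow> complex vec set set \<Rightarrow> complex vec set set" where
  "zariski_closure d Z = {p \<in> proj_space d.
     \<forall>m F. form d m F \<and> (\<forall>q\<in>Z. \<forall>v\<in>q. F v = 0) \<longrightarrow> (\<forall>v\<in>p. F v = 0)}"


section \<open>Generic linear subspaces and degrees of subvarieties\<close>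

definition linear_subspace :: "nat \<Rightarrow> nat \<Rightarrow> complex mat \<Rightarrow> complex vec set set" where
  "linear_subspace d k M = {p \<in> proj_space d. \<forall>v\<in>p. M *\<^sub>v v = 0\<^sub>v k}"

definition entry_polynomial :: "nat \<Rightarrow> nat \<Rightarrow> (complex mat \<Rightarrow> complex) \<Rightarrow> bool" where
  "entry_polynomial r s G \<longleftrightarrow> (\<exists>(S :: (nat \<times> nat \<Rightarrow> nat) set) c. finite S \<and>
     (\<forall>M \<in> carrier_mat r s. G M = (\<Sum>\<alpha>\<in>S. c \<alpha> * (\<Prod>(i,j) \<in> {..<r} \<times> {..<s}. M $$ (i,j) ^ \<alpha> (i,j)))))"

text \<open>
  \<open>P\<close> holds for a generic linear subspace of codimension \<open>k\<close>: for those cut out by \<open>k\<close> linear forms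
  (the rows of \<open>M\<close>) outside a proper algebraic subset of the space of \<open>k\<close>-tuples of forms.
  Linear independence of the forms, hence codimension exactly \<open>k\<close>, is itself such an open condition
  (for \<open>k \<le> d + 1\<close>), so it need not be required separately: multiply \<open>G\<close> by a maximal minor.
\<close>

definition generic_subspace :: "nat \<Rightarrow> nat \<Rightarrow> (complex vec set set \<Rightarrow> bool) \<Rightarrow> bool" where
  "generic_subspace d k P \<longleftrightarrow> (\<exists>G. entry_polynomial k (Suc d) G \<and>
     (\<exists>M \<in> carrier_mat k (Suc d). G M \<noteq> 0) \<and>
     (\<forall>M \<in> carrier_mat k (Suc d). G M \<noteq> 0 \<longrightarrow> P (linear_subspace d k M)))"

text \<open>The degree of a closed subset \<open>Z\<close> of pure dimension \<open>e\<close>: the number of points of the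
  intersection with a generic linear subspace of codimension \<open>e\<close>.\<close>

definition has_degree :: "nat \<Rightarrow> nat \<Rightarrow> complex vec set set \<Rightarrow> nat \<Rightarrow> bool" where
  "has_degree d e Z N \<longleftrightarrow> generic_subspace d e (\<lambda>M. finite (Z \<inter> M) \<and> card (Z \<inter> M) = N)"


section \<open>Rational maps\<close>

text \<open>
  A rational self-map is given by a partial function on points whose domain is Zariski dense and
  which is given by homogeneous forms there. Two such functions agreeing on a dense open set
  are the same rational map. \<open>represents d f F\<close> says that the tuple \<open>F\<close> of forms of equal degree
  represents this rational map; it can then be evaluated at every point where \<open>F\<close> does not
  vanish, also outside \<open>dom f\<close>. The points where some representing tuple does not vanish form the
  domain of definition of the rational map, and \<open>rational_preimage\<close> is taken over it.
\<close>

definition represents ::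
  "nat \<Rightarrow> (complex vec set \<rightharpoonup> complex vec set) \<Rightarrow> (complex vec \<Rightarrow> complex vec) \<Rightarrow> bool" where
  "represents d f F \<longleftrightarrow>
     (\<forall>v \<in> carrier_vec (Suc d). F v \<in> carrier_vec (Suc d)) \<and>
     (\<exists>m. \<forall>i\<le>d. form d m (\<lambda>v. F v $ i)) \<and>
     (\<forall>v \<in> hcoords d. line v \<in> dom f \<and> F v \<noteq> 0\<^sub>v (Suc d) \<longrightarrow> f (line v) = Some (line (F v)))"

definition rational_preimage ::
  "nat \<Rightarrow> (complex vec set \<rightharpoonup> complex vec set) \<Rightarrow> complex vec set set \<Rightarrow> complex vec set set" where
  "rational_preimage d f L = zariski_closure d
     {line v | v. v \<in> hcoords d \<and>
        (\<exists>F. represents d f F \<and> F v \<noteq> 0\<^sub>v (Suc d) \<and> line (F v) \<in> L)}"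

definition deg_k :: "nat \<Rightarrow> nat \<Rightarrow> (complex vec set \<rightharpoonup> complex vec set) \<Rightarrow> nat" where
  "deg_k d k f = (THE N. generic_subspace d k (\<lambda>L. has_degree d (d - k) (rational_preimage d f L) N))"

definition rational_iterate ::
  "nat \<Rightarrow> (complex vec set \<rightharpoonup> complex vec set) \<Rightarrow> nat \<Rightarrow> (complex vec set \<rightharpoonup> complex vec set)" where
  "rational_iterate d f n = ((\<lambda>g. f \<circ>\<^sub>m g) ^^ n) (\<lambda>p. if p \<in> proj_space d then Some p else None)"


section \<open>Monomial maps\<close>

definition torus :: "nat \<Rightarrow> complex vec set" where
  "torus d = {x \<in> carrier_vec d. \<forall>i<d. x $ i \<noteq> 0}"

definition torus_embedding :: "complex vec \<Rightarrow> complex vec set" where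
  "torus_embedding x = line (vCons 1 x)"

text \<open>The exponents of the \<open>i\<close>-th component are the entries of the \<open>i\<close>-th column.\<close>

definition monomial_map :: "nat \<Rightarrow> int mat \<Rightarrow> complex vec \<Rightarrow> complex vec" where
  "monomial_map d A x = vec d (\<lambda>i. \<Prod>j<d. x $ j powi (A $$ (j, i)))"

definition monomial_rational_map :: "nat \<Rightarrow> int mat \<Rightarrow> (complex vec set \<rightharpoonup> complex vec set)" where
  "monomial_rational_map d A p =
     (if p \<in> torus_embedding ` torus d
      then Some (torus_embedding (monomial_map d A (the_inv_into (torus d) torus_embedding p)))
      else None)"


section \<open>Exterior powers\<close>

text \<open>
  The \<open>k\<close>-th exterior power of the real vectors of length \<open>d\<close> is identified with the real vectors of
  length \<open>d choose k\<close> by the basis of the \<open>e\<^sub>I = e\<^sub>i\<^sub>1 \<and> \<dots> \<and> e\<^sub>i\<^sub>k\<close> for the increasing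
  sequences \<open>I\<close> listed in \<open>increasing_seqs d k\<close>; its endomorphisms are the matrices in that basis.
  The coordinates of a wedge product of vectors are its maximal minors, and the map
  induced by \<open>A\<close> sends \<open>e\<^sub>J\<close> to \<open>A e\<^sub>j\<^sub>1 \<and> \<dots> \<and> A e\<^sub>j\<^sub>k\<close>.
\<close>

definition increasing_seqs :: "nat \<Rightarrow> nat \<Rightarrow> nat list list" where
  "increasing_seqs d k = filter (\<lambda>I. length I = k) (subseqs [0..<d])"

definition wedge :: "nat \<Rightarrow> real vec list \<Rightarrow> real vec" where
  "wedge d vs = (let k = length vs; Is = increasing_seqs d k in
     vec (length Is) (\<lambda>r. det (mat k k (\<lambda>(a, b). vs ! b $ (Is ! r ! a)))))"

definition exterior_power :: "nat \<Rightarrow> nat \<Rightarrow> real mat \<Rightarrow> real mat" where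
  "exterior_power d k A = mat_of_cols (d choose k)
     (map (\<lambda>J. wedge d (map (\<lambda>j. A *\<^sub>v unit_vec d j) J)) (increasing_seqs d k))"

lemma length_increasing_seqs: "length (increasing_seqs d k) = d choose k"
proof -
  have dist: "distinct (subseqs [0..<d])"
    using subseqs_distinctD[of _ "[0..<d]"] distinct_set_subseqs[of "[0..<d]"]
    by (simp add: distinct_map)
  have inj: "inj_on set (set (subseqs [0..<d]))"
    using distinct_set_subseqs[of "[0..<d]"] by (simp add: distinct_map)
  have "length (increasing_seqs d k) = card (set (increasing_seqs d k))"
    unfolding increasing_seqs_def by (rule distinct_card[symmetric]) (use dist in simp)
  also have "\<dots> = card (set ` set (increasing_seqs d k))"
    by (rule card_image[symmetric], rule inj_on_subset[OF inj]) (auto simp: increasing_seqs_def)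
  also have "set ` set (increasing_seqs d k) = {I. I \<subseteq> {0..<d} \<and> card I = k}"
  proof -
    have c: "card (set xs) = length xs" if "xs \<in> set (subseqs [0..<d])" for xs
      using subseqs_distinctD[OF that] by (simp add: distinct_card)
    have p: "set ` set (subseqs [0..<d]) = Pow {0..<d}"
      using subseqs_powset[of "[0..<d]"] by simp
    have "set ` set (increasing_seqs d k) = {I \<in> set ` set (subseqs [0..<d]). card I = k}"
      unfolding increasing_seqs_def set_filter using c by (auto simp del: subseqs_powset)
    then show ?thesis unfolding p by (simp add: Pow_def)
  qed
  also have "card \<dots> = d choose k" by (simp add: n_subsets)
  finally show ?thesis .
qed

lemma exterior_power_carrier: "exterior_power d k A \<in> carrier_mat (d choose k) (d choose k)"
  by (simp add: exterior_power_def length_increasing_seqs carrier_matI)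

definition matrix_space_norm :: "nat \<Rightarrow> (real mat \<Rightarrow> real) \<Rightarrow> bool" where
  "matrix_space_norm m \<nu> \<longleftrightarrow>
     (\<forall>B \<in> carrier_mat m m. \<nu> B \<ge> 0 \<and> (\<nu> B = 0 \<longleftrightarrow> B = 0\<^sub>m m m)) \<and>
     (\<forall>B \<in> carrier_mat m m. \<forall>c. \<nu> (c \<cdot>\<^sub>m B) = \<bar>c\<bar> * \<nu> B) \<and>
     (\<forall>B \<in> carrier_mat m m. \<forall>C \<in> carrier_mat m m. \<nu> (B + C) \<le> \<nu> B + \<nu> C)"


section \<open>Comparison of sequences\<close>

definition asymp_comparable :: "(nat \<Rightarrow> real) \<Rightarrow> (nat \<Rightarrow> real) \<Rightarrow> bool" (infix "\<asymp>" 50) where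
  "a \<asymp> b \<longleftrightarrow> (\<exists>C>1. \<forall>n. inverse C \<le> a n / b n \<and> a n / b n \<le> C)"

end

theory Submission
  imports "HOL-Analysis.Complex_Transcendental"
    "HOL-Computational_Algebra.Fundamental_Theorem_Algebra" Defs
begin

text \<open>
  The degree \<open>deg_k\<close> is the number of points of the torus that satisfy \<open>k\<close> generic
  linear equations in the monomials of the map and \<open>d - k\<close> generic linear equations in the
  coordinates; the closure adds no points, as Noether normalization provides enough forms that vanish
  on the preimage. This number is generically constant, so it can be counted for equations whose
  coefficients degenerate like powers of a parameter \<open>t\<close> tending to \<open>0\<close>. For small \<open>t\<close>,
  a set \<open>J\<close> of \<open>k\<close> coordinates and a set \<open>I\<close> of \<open>d - k\<close> monomials are small at a solution, the
  others being nearly determined by the equations, and in logarithmic coordinates the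
  solutions with given \<open>I\<close> and \<open>J\<close> are those of a small perturbation of \<open>k\<close> linear
  equations modulo \<open>2 \<pi> \<i> \<int>\<close>; their number is the absolute value of a \<open>k\<close>-minor
  of the matrix of exponents. Generic weights bound the degree from above by the sum of all such minors, and weights
  adapted to one pair \<open>(I, J)\<close> bound it from below by that minor. Up to a factor depending only on
  \<open>d\<close> and \<open>k\<close>, the largest of these minors is the largest entry of the exterior power of \<open>A\<^sup>n\<close>.
\<close>

text \<open>\<open>has_degree\<close> counts points without multiplicity, so the whole proof counts
  finite sets, and one parameter has to speak for all generic ones. What makes this possible is a
  zero-one law: a constructible condition on the parameters either holds generically or fails
  generically. By Chevalley's theorem "at least m solutions" is such a condition. A single parameter
  with few solutions then refutes a generic lower bound, and one with many solutions refutes a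
  generic upper bound, provided it can be moved off any given hypersurface; a degenerating family
  can, since a nonzero polynomial in t has no zeros for small t other than 0. How small t must be
  depends on the exponents, hence on n, without any uniformity; only the counts are compared across
  n. For the upper bound the small index sets are unknown in advance, so all pairs are summed. For
  the lower bound a pair is fixed first and the weights are fitted to it. The two bounds differ by a
  factor in d and k alone, which is just what the comparison permits.\<close>

section \<open>Polynomial functions and generic properties\<close>

text \<open>Over the infinite field of complex numbers a polynomial is determined by its function,
  so functions serve as polynomials. The index type is arbitrary: further unknowns are adjoined
  simply by using indices that do not occur yet.\<close>

inductive pfun :: "(('v \<Rightarrow> complex) \<Rightarrow> complex) \<Rightarrow> bool" where
  const: "pfun (\<lambda>_. c)"
| var: "pfun (\<lambda>\<theta>. \<theta> v)"
| add: "pfun f \<Longrightarrow> pfun g \<Longrightarrow> pfun (\<lambda>\<theta>. f \<theta> + g \<theta>)"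
| mult: "pfun f \<Longrightarrow> pfun g \<Longrightarrow> pfun (\<lambda>\<theta>. f \<theta> * g \<theta>)"

lemma pfun_sum: "(\<And>i. i \<in> I \<Longrightarrow> pfun (f i)) \<Longrightarrow> pfun (\<lambda>\<theta>. \<Sum>i\<in>I. f i \<theta>)"
  by (induction I rule: infinite_finite_induct) (auto intro: pfun.intros)

lemma pfun_prod: "(\<And>i. i \<in> I \<Longrightarrow> pfun (f i)) \<Longrightarrow> pfun (\<lambda>\<theta>. \<Prod>i\<in>I. f i \<theta>)"
  by (induction I rule: infinite_finite_induct) (auto intro: pfun.intros)

lemma pfun_power: "pfun f \<Longrightarrow> pfun (\<lambda>\<theta>. f \<theta> ^ n)"
  by (induction n) (auto intro: pfun.intros)

lemma pfun_uminus: "pfun f \<Longrightarrow> pfun (\<lambda>\<theta>. - f \<theta>)"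
  using pfun.mult[OF pfun.const[of "-1"]] by simp

lemma pfun_diff: "pfun f \<Longrightarrow> pfun g \<Longrightarrow> pfun (\<lambda>\<theta>. f \<theta> - g \<theta>)"
  using pfun.add[OF _ pfun_uminus] by fastforce

lemma pfun_if: "(b \<Longrightarrow> pfun f) \<Longrightarrow> (\<not> b \<Longrightarrow> pfun g) \<Longrightarrow> pfun (\<lambda>\<theta>. if b then f \<theta> else g \<theta>)"
  by (cases b) auto

lemmas pfun_intros = pfun.intros pfun_sum pfun_prod pfun_power pfun_uminus pfun_diff pfun_if

lemma pfun_subst:
  assumes "pfun f" "\<And>v. pfun (h v)"
  shows "pfun (\<lambda>\<theta>. f (\<lambda>v. h v \<theta>))"
  using assms by (induction) (auto intro: pfun.intros)

text \<open>A polynomial in one distinguished variable whose coefficients are polynomial functions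
  of \<theta>. The bound n is a formal degree: the coefficient of degree n may vanish for some
  \<theta> or for all.\<close>

definition pfam :: "nat \<Rightarrow> (('v \<Rightarrow> complex) \<Rightarrow> complex poly) \<Rightarrow> bool" where
  "pfam n P \<longleftrightarrow> (\<forall>\<theta>. degree (P \<theta>) \<le> n) \<and> (\<forall>r. pfun (\<lambda>\<theta>. coeff (P \<theta>) r))"

lemma pfam_degree: "pfam n P \<Longrightarrow> degree (P \<theta>) \<le> n"
  and pfam_coeff: "pfam n P \<Longrightarrow> pfun (\<lambda>\<theta>. coeff (P \<theta>) r)"
  by (auto simp: pfam_def)

lemma pfam_const: "pfun f \<Longrightarrow> pfam 0 (\<lambda>\<theta>. [:f \<theta>:])"
proof -
  assume "pfun f"
  then have "pfun (\<lambda>\<theta>. coeff [:f \<theta>:] r)" for r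
    by (cases r) (auto intro: pfun_intros)
  then show ?thesis by (simp add: pfam_def)
qed

lemma pfam_X: "pfam 1 (\<lambda>\<theta>. [:0, 1:])"
  by (auto simp: pfam_def intro: pfun_intros)

lemma pfam_add: "pfam n P \<Longrightarrow> pfam m Q \<Longrightarrow> pfam (max n m) (\<lambda>\<theta>. P \<theta> + Q \<theta>)"
  by (auto simp: pfam_def intro!: pfun_intros degree_add_le_max[THEN order_trans] max.mono)

lemma pfam_mult: "pfam n P \<Longrightarrow> pfam m Q \<Longrightarrow> pfam (n + m) (\<lambda>\<theta>. P \<theta> * Q \<theta>)"
  by (auto simp: pfam_def coeff_mult intro!: pfun_intros degree_mult_le[THEN order_trans] add_mono)

lemma pfam_power: "pfam n P \<Longrightarrow> pfam (m * n) (\<lambda>\<theta>. P \<theta> ^ m)"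
  by (induction m) (auto intro: pfam_mult simp: pfam_const[OF pfun.const[of 1], unfolded one_pCons[symmetric]])

text \<open>The common source of the one-variable arguments: restriction to a coordinate axis, to a
  line, to a scaling orbit and to the degenerating family are all substitutions of this
  kind.\<close>

lemma pfam_subst:
  assumes "pfun f" and H: "\<And>v. \<exists>n. pfam n (H v)"
  shows "\<exists>n P. pfam n P \<and> (\<forall>\<theta> t. f (\<lambda>v. poly (H v \<theta>) t) = poly (P \<theta>) t)"
  using assms(1)
proof induction
  case (const c)
  show ?case by (rule exI[of _ 0], rule exI[of _ "\<lambda>_. [:c:]"]) (auto intro: pfam_const pfun_intros)
next
  case (var v)
  show ?case using H[of v] by blast
next
  case (add f g)
  then show ?case using pfam_add by (metis poly_add)
next
  case (mult f g)
  then show ?case using pfam_mult by (metis poly_mult)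
qed

section \<open>Restriction to an axis and to a line\<close>

lemma pfun_upd_poly:
  assumes "pfun f"
  shows "\<exists>n P. pfam n P \<and> (\<forall>\<theta> t. f (\<theta>(y := t)) = poly (P \<theta>) t)"
proof -
  have "\<exists>n P. pfam n P \<and> (\<forall>(\<theta>::'a \<Rightarrow> complex) t. f (\<lambda>v. poly (if v = y then [:0,1:] else [:\<theta> v:]) t) = poly (P \<theta>) t)"
  proof (rule pfam_subst[OF assms])
    fix v show "\<exists>n. pfam n (\<lambda>\<theta>. if v = y then [:0,1:] else [:\<theta> v:])"
      using pfam_X pfam_const[OF pfun.var[of v]] by (cases "v = y") auto
  qed
  moreover have "(\<lambda>v. poly (if v = y then [:0,1:] else [:\<theta> v:]) t) = \<theta>(y := t)" for \<theta> :: "'a \<Rightarrow> complex" and t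
    by (rule ext) auto
  ultimately show ?thesis by simp
qed

lemma pfun_line:
  assumes "pfun f"
  shows "\<exists>p. \<forall>s. f (\<lambda>v. a v + s * (b v - a v)) = poly p s"
proof -
  have "\<exists>n P. pfam n P \<and> (\<forall>(\<theta>::'a \<Rightarrow> complex) t. f (\<lambda>v. poly [:a v, b v - a v:] t) = poly (P \<theta>) t)"
    by (rule pfam_subst[OF assms]) (auto simp: pfam_def coeff_pCons split: nat.split intro!: exI[of _ 1] pfun_intros)
  then show ?thesis by (auto simp: mult.commute)
qed

text \<open>On the line from a to b both functions become one-variable polynomials, nonzero because
  of their values at the two ends, so their product has a non-root. Coordinates in which a and b
  agree are constant along the line.\<close>

lemma pfun_common_nonzero:
  assumes "pfun f" "pfun g" "f a \<noteq> 0" "g b \<noteq> 0"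
  shows "\<exists>c. f c \<noteq> 0 \<and> g c \<noteq> 0 \<and> (\<forall>v. a v = b v \<longrightarrow> c v = a v)"
proof -
  obtain p where p: "\<And>s. f (\<lambda>v. a v + s * (b v - a v)) = poly p s" using pfun_line[OF assms(1)] by blast
  obtain q where q: "\<And>s. g (\<lambda>v. a v + s * (b v - a v)) = poly q s" using pfun_line[OF assms(2)] by blast
  have "p \<noteq> 0" "q \<noteq> 0" using p[of 0] q[of 1] assms(3,4) by auto
  then have "p * q \<noteq> 0" by simp
  then obtain s where "poly (p * q) s \<noteq> 0" using poly_all_0_iff_0 by blast
  then have "poly p s \<noteq> 0" "poly q s \<noteq> 0" by auto
  then show ?thesis using p[of s] q[of s]
    by (intro exI[of _ "\<lambda>v. a v + s * (b v - a v)"]) auto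
qed

text \<open>Truth on a nonempty basic Zariski-open set. \<open>pfun_common_nonzero\<close> says that
  two such sets meet, so generic properties are closed under finite conjunction.\<close>

definition generic :: "(('v \<Rightarrow> complex) \<Rightarrow> bool) \<Rightarrow> bool" where
  "generic P \<longleftrightarrow> (\<exists>G. pfun G \<and> (\<exists>\<theta>. G \<theta> \<noteq> 0) \<and> (\<forall>\<theta>. G \<theta> \<noteq> 0 \<longrightarrow> P \<theta>))"

lemma genericI: "pfun G \<Longrightarrow> G a \<noteq> 0 \<Longrightarrow> (\<And>\<theta>. G \<theta> \<noteq> 0 \<Longrightarrow> P \<theta>) \<Longrightarrow> generic P"
  unfolding generic_def by (rule exI[of _ G]) auto

lemma genericE:
  assumes "generic P"
  obtains G where "pfun G" "\<exists>a. G a \<noteq> 0" "\<forall>\<theta>. G \<theta> \<noteq> 0 \<longrightarrow> P \<theta>"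
  using assms unfolding generic_def by (rule exE) (elim conjE, rule that)

lemma generic_mono:
  assumes "generic P" "\<And>\<theta>. P \<theta> \<Longrightarrow> Q \<theta>" shows "generic Q"
proof (rule genericE[OF assms(1)])
  fix G assume G: "pfun G" "\<exists>a. G a \<noteq> 0" "\<forall>\<theta>. G \<theta> \<noteq> 0 \<longrightarrow> P \<theta>"
  then show ?thesis using assms(2) by (auto intro: genericI[of G])
qed

lemma generic_conj: assumes "generic P" "generic Q" shows "generic (\<lambda>\<theta>. P \<theta> \<and> Q \<theta>)"
proof (rule genericE[OF assms(1)], rule genericE[OF assms(2)])
  fix F G assume F: "pfun F" "\<exists>a. F a \<noteq> 0" "\<forall>\<theta>. F \<theta> \<noteq> 0 \<longrightarrow> P \<theta>"
    and G: "pfun G" "\<exists>a. G a \<noteq> 0" "\<forall>\<theta>. G \<theta> \<noteq> 0 \<longrightarrow> Q \<theta>"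
  obtain a b where "F a \<noteq> 0" "G b \<noteq> 0" using F(2) G(2) by auto
  then obtain c where "F c \<noteq> 0" "G c \<noteq> 0" using pfun_common_nonzero[OF F(1) G(1)] by metis
  then show ?thesis using F(3) G(3) by (intro genericI[OF pfun.mult[OF F(1) G(1)], of c]) auto
qed

lemma generic_True: "generic (\<lambda>_. True)"
  by (rule genericI[OF pfun.const[of 1]]) auto

lemma generic_ball:
  "finite I \<Longrightarrow> (\<And>i. i \<in> I \<Longrightarrow> generic (P i)) \<Longrightarrow> generic (\<lambda>\<theta>. \<forall>i\<in>I. P i \<theta>)"
proof (induction I rule: finite_induct)
  case empty then show ?case using generic_True by simp
next
  case (insert i I)
  then show ?case using generic_conj[of "P i" "\<lambda>\<theta>. \<forall>i\<in>I. P i \<theta>"] by simp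
qed

lemma generic_ex: "generic P \<Longrightarrow> \<exists>\<theta>. P \<theta>"
  by (erule genericE) auto

section \<open>Constructible sets and Chevalley's theorem\<close>

inductive constructible :: "(('v \<Rightarrow> complex) \<Rightarrow> bool) \<Rightarrow> bool" where
  zero: "pfun f \<Longrightarrow> constructible (\<lambda>\<theta>. f \<theta> = 0)"
| neg: "constructible P \<Longrightarrow> constructible (\<lambda>\<theta>. \<not> P \<theta>)"
| conj: "constructible P \<Longrightarrow> constructible Q \<Longrightarrow> constructible (\<lambda>\<theta>. P \<theta> \<and> Q \<theta>)"

text \<open>The zero-one law of irreducible spaces. The claim is symmetric under negation, which
  settles complements at once; for a conjunction, either both parts are generic or the failure of
  one is.\<close>

lemma constructible_generic:
  "constructible P \<Longrightarrow> generic P \<or> generic (\<lambda>\<theta>. \<not> P \<theta>)"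
proof (induction rule: constructible.induct)
  case (zero f)
  show ?case
  proof (cases "\<exists>\<theta>. f \<theta> \<noteq> 0")
    case True
    then show ?thesis using genericI[of f _ "\<lambda>\<theta>. f \<theta> \<noteq> 0"] zero by auto
  next
    case False
    then show ?thesis by (simp add: generic_True)
  qed
next
  case (neg P)
  from neg.IH show ?case unfolding not_not by (rule disjE) (erule disjI2, erule disjI1)
next
  case (conj P Q) then show ?case
    using generic_conj[of P Q] generic_mono[of "\<lambda>\<theta>. \<not> P \<theta>" "\<lambda>\<theta>. \<not> (P \<theta> \<and> Q \<theta>)"]
      generic_mono[of "\<lambda>\<theta>. \<not> Q \<theta>" "\<lambda>\<theta>. \<not> (P \<theta> \<and> Q \<theta>)"] by auto
qed

lemma constructible_disj: "constructible P \<Longrightarrow> constructible Q \<Longrightarrow> constructible (\<lambda>\<theta>. P \<theta> \<or> Q \<theta>)"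
  using constructible.neg[OF constructible.conj[OF constructible.neg constructible.neg], of P Q] by simp

lemma constructible_const: "constructible (\<lambda>_. b)"
  using constructible.zero[OF pfun.const[of "if b then 0 else 1"]] by (cases b) auto

lemma constructible_nonzero: "pfun f \<Longrightarrow> constructible (\<lambda>\<theta>. f \<theta> \<noteq> 0)"
  by (intro constructible.neg constructible.zero)

lemma constructible_ball:
  "finite I \<Longrightarrow> (\<And>i. i \<in> I \<Longrightarrow> constructible (P i)) \<Longrightarrow> constructible (\<lambda>\<theta>. \<forall>i\<in>I. P i \<theta>)"
proof (induction I rule: finite_induct)
  case (insert i I)
  then show ?case using constructible.conj[of "P i" "\<lambda>\<theta>. \<forall>i\<in>I. P i \<theta>"] by simp
qed (simp add: constructible_const)

lemma constructible_bex:
  "finite I \<Longrightarrow> (\<And>i. i \<in> I \<Longrightarrow> constructible (P i)) \<Longrightarrow> constructible (\<lambda>\<theta>. \<exists>i\<in>I. P i \<theta>)"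
proof (induction I rule: finite_induct)
  case (insert i I)
  then show ?case using constructible_disj[of "P i" "\<lambda>\<theta>. \<exists>i\<in>I. P i \<theta>"] by simp
qed (simp add: constructible_const)

section \<open>Elimination of one variable from polynomial equations with parameters\<close>

lemma pfam_zero_constructible:
  assumes "pfam n P" shows "constructible (\<lambda>\<theta>. P \<theta> = 0)"
proof -
  have "(P \<theta> = 0) = (\<forall>r\<in>{..n}. coeff (P \<theta>) r = 0)" for \<theta>
    using pfam_degree[OF assms, of \<theta>] leading_coeff_0_iff by (metis atMost_iff coeff_0)
  then show ?thesis using assms by (auto intro!: constructible_ball constructible.zero pfam_coeff)
qed

lemma degree_le_pred:
  assumes "degree p \<le> n" "coeff p n = 0" "n > 0" shows "degree p \<le> n - 1"
  using assms by (metis Suc_pred' degree_le leading_coeff_0_iff less_Suc_eq_le nat_less_le order.strict_trans2 coeff_eq_0 leI le_0_eq degree_0 not_less)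

text \<open>One division step of H by F, premultiplied by the coefficient of F so that no
  denominators in the parameters arise; the terms of degree m cancel.\<close>

definition pseudo_step :: "nat \<Rightarrow> nat \<Rightarrow> complex poly \<Rightarrow> complex poly \<Rightarrow> complex poly" where
  "pseudo_step n m F H = Polynomial.smult (coeff F n) H - monom (coeff H m) (m - n) * F"

lemma pfam_pseudo_step:
  assumes F: "pfam n F" and H: "pfam m H" and nm: "n \<le> m" "m > 0"
  shows "pfam (m - 1) (\<lambda>\<theta>. pseudo_step n m (F \<theta>) (H \<theta>))"
proof -
  have c: "pfun (\<lambda>\<theta>. coeff (pseudo_step n m (F \<theta>) (H \<theta>)) r)" for r
    unfolding pseudo_step_def
    by (auto simp: coeff_monom_mult intro!: pfun_intros pfam_coeff[OF F] pfam_coeff[OF H])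
  have "degree (pseudo_step n m (F \<theta>) (H \<theta>)) \<le> m - 1" for \<theta>
  proof (rule degree_le_pred)
    have "degree (monom (coeff (H \<theta>) m) (m - n) * F \<theta>) \<le> (m - n) + n"
      by (rule order_trans[OF degree_mult_le]) (intro add_mono degree_monom_le pfam_degree[OF F])
    then show "degree (pseudo_step n m (F \<theta>) (H \<theta>)) \<le> m"
      unfolding pseudo_step_def using nm pfam_degree[OF H, of \<theta>]
      by (intro degree_diff_le) (auto intro: order_trans[OF degree_smult_le])
    show "coeff (pseudo_step n m (F \<theta>) (H \<theta>)) m = 0"
      using nm by (simp add: pseudo_step_def coeff_monom_mult)
  qed (use nm in simp)
  then show ?thesis using c by (auto simp: pfam_def)
qed

text \<open>Division with remainder, uniformly in \<theta>: where the coefficient of degree n is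
  nonzero, a pseudo-division step preserves divisibility by F and lowers the formal degree of H,
  until that is below n and divisibility means H = 0. A constant F is a unit there.\<close>

lemma constructible_dvd:
  assumes F: "pfam n F" and "pfam m H"
  shows "constructible (\<lambda>\<theta>. coeff (F \<theta>) n \<noteq> 0 \<and> F \<theta> dvd H \<theta>)"
  using assms(2)
proof (induction m arbitrary: H rule: less_induct)
  case (less m)
  have a: "constructible (\<lambda>\<theta>. coeff (F \<theta>) n \<noteq> 0)"
    by (intro constructible_nonzero pfam_coeff[OF F])
  have deg: "coeff (F \<theta>) n \<noteq> 0 \<Longrightarrow> degree (F \<theta>) = n" for \<theta>
    using pfam_degree[OF F, of \<theta>] le_degree by (metis le_antisym)
  consider "n = 0" | "m < n" | "n > 0" "n \<le> m" by linarith
  then show ?case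
  proof cases
    case 1
    have "F \<theta> dvd H \<theta>" if "coeff (F \<theta>) n \<noteq> 0" for \<theta>
    proof (rule unit_imp_dvd)
      have "F \<theta> \<noteq> 0" using that by auto
      then show "is_unit (F \<theta>)" using deg[OF that] 1 by (simp add: is_unit_iff_degree)
    qed
    then have "(coeff (F \<theta>) n \<noteq> 0 \<and> F \<theta> dvd H \<theta>) = (coeff (F \<theta>) n \<noteq> 0)" for \<theta> by auto
    then show ?thesis using a by simp
  next
    case 2
    have "H \<theta> = 0" if "coeff (F \<theta>) n \<noteq> 0" "F \<theta> dvd H \<theta>" for \<theta>
    proof (rule ccontr)
      assume "H \<theta> \<noteq> 0"
      then have "degree (F \<theta>) \<le> degree (H \<theta>)" using that(2) by (rule dvd_imp_degree_le[rotated])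
      then show False using deg[OF that(1)] 2 pfam_degree[OF less.prems, of \<theta>] by simp
    qed
    then have "(coeff (F \<theta>) n \<noteq> 0 \<and> F \<theta> dvd H \<theta>) = (coeff (F \<theta>) n \<noteq> 0 \<and> H \<theta> = 0)" for \<theta> by auto
    then show ?thesis using constructible.conj[OF a pfam_zero_constructible[OF less.prems]] by simp
  next
    case 3
    have "F \<theta> dvd pseudo_step n m (F \<theta>) (H \<theta>) \<longleftrightarrow> F \<theta> dvd H \<theta>" if "coeff (F \<theta>) n \<noteq> 0" for \<theta>
    proof -
      have "F \<theta> dvd pseudo_step n m (F \<theta>) (H \<theta>) \<longleftrightarrow> F \<theta> dvd Polynomial.smult (coeff (F \<theta>) n) (H \<theta>)"
        unfolding pseudo_step_def by (rule dvd_diff_left_iff) simp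
      then show ?thesis using that dvd_smult_iff by blast
    qed
    then have "(coeff (F \<theta>) n \<noteq> 0 \<and> F \<theta> dvd H \<theta>)
        = (coeff (F \<theta>) n \<noteq> 0 \<and> F \<theta> dvd pseudo_step n m (F \<theta>) (H \<theta>))" for \<theta> by blast
    moreover have "constructible (\<lambda>\<theta>. coeff (F \<theta>) n \<noteq> 0 \<and> F \<theta> dvd pseudo_step n m (F \<theta>) (H \<theta>))"
      using 3 by (intro less.IH[of "m - 1"] pfam_pseudo_step[OF F less.prems]) auto
    ultimately show ?thesis by simp
  qed
qed


text \<open>The one-variable Nullstellensatz. The exponent n suffices since the degree n of F bounds
  the multiplicity of every root.\<close>

lemma ex_root_outside_iff:
  assumes "pfam n F" "coeff (F \<theta>) n \<noteq> 0"
  shows "(\<exists>t. poly (F \<theta>) t = 0 \<and> poly g t \<noteq> 0) \<longleftrightarrow> \<not> (F \<theta> dvd g ^ n)"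
proof -
  have "degree (F \<theta>) = n" using assms pfam_degree[OF assms(1), of \<theta>] le_degree by (metis le_antisym)
  moreover have "F \<theta> \<noteq> 0" using assms(2) by auto
  ultimately show ?thesis using nullstellensatz_univariate[of "F \<theta>" g] by auto
qed

lemma constructible_cases:
  assumes "constructible C" "constructible P" "constructible Q"
    and "\<And>\<theta>. C \<theta> \<Longrightarrow> R \<theta> = P \<theta>" "\<And>\<theta>. \<not> C \<theta> \<Longrightarrow> R \<theta> = Q \<theta>"
  shows "constructible R"
proof -
  have "R \<theta> = ((C \<theta> \<and> P \<theta>) \<or> (\<not> C \<theta> \<and> Q \<theta>))" for \<theta> using assms(4,5)[of \<theta>] by blast
  then have R: "R = (\<lambda>\<theta>. (C \<theta> \<and> P \<theta>) \<or> (\<not> C \<theta> \<and> Q \<theta>))" by (rule ext)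
  show ?thesis unfolding R
    by (rule constructible_disj[OF constructible.conj[OF assms(1,2)] constructible.conj[OF constructible.neg[OF assms(1)] assms(3)]])
qed

lemma poly_pseudo_step:
  assumes "poly F t = 0" "coeff F n \<noteq> 0"
  shows "poly (pseudo_step n m F H) t = 0 \<longleftrightarrow> poly H t = 0"
  using assms by (simp add: pseudo_step_def)

text \<open>Lowers the formal degree on the set of parameters where the coefficient of degree n
  vanishes.\<close>

definition trunc_poly :: "nat \<Rightarrow> complex poly \<Rightarrow> complex poly" where
  "trunc_poly n F = F - monom (coeff F n) n"

lemma pfam_trunc_poly:
  assumes F: "pfam n F" and "n > 0" shows "pfam (n - 1) (\<lambda>\<theta>. trunc_poly n (F \<theta>))"
proof -
  have "degree (trunc_poly n (F \<theta>)) \<le> n - 1" for \<theta>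
  proof (rule degree_le_pred)
    show "degree (trunc_poly n (F \<theta>)) \<le> n" unfolding trunc_poly_def
      by (intro degree_diff_le degree_monom_le pfam_degree[OF F])
  qed (use assms in \<open>auto simp: trunc_poly_def\<close>)
  moreover have "pfun (\<lambda>\<theta>. coeff (trunc_poly n (F \<theta>)) r)" for r
    unfolding trunc_poly_def by (auto intro!: pfun_intros pfam_coeff[OF F])
  ultimately show ?thesis by (auto simp: pfam_def)
qed

lemma trunc_poly_eq: "coeff F n = 0 \<Longrightarrow> trunc_poly n F = F"
  by (simp add: trunc_poly_def)

text \<open>Induction on the sum of the formal degrees: either a leading coefficient vanishes, or it can
  be used to reduce another polynomial; a single polynomial is handled by \<open>ex_root_outside_iff\<close>.\<close>

lemma constructible_ex_root:
  assumes "\<And>n F. (n, F) \<in> set L \<Longrightarrow> pfam n F" and G: "pfam ng G"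
  shows "constructible (\<lambda>\<theta>. \<exists>t. (\<forall>(n, F)\<in>set L. poly (F \<theta>) t = 0) \<and> poly (G \<theta>) t \<noteq> 0)"
  using assms(1)
\<comment> \<open>Each polynomial weighs one more than its formal degree, so that the removal of one
  of formal degree 0 also decreases the measure.\<close>
proof (induction "\<Sum>(n, F)\<leftarrow>L. Suc n" arbitrary: L rule: less_induct)
  case less
  define ok where "ok = (\<lambda>M::(nat \<times> (('a \<Rightarrow> complex) \<Rightarrow> complex poly)) list. constructible (\<lambda>\<theta>. \<exists>t. (\<forall>(n, F)\<in>set M. poly (F \<theta>) t = 0) \<and> poly (G \<theta>) t \<noteq> 0))"
  have IH: "ok M" if "(\<Sum>(n, F)\<leftarrow>M. Suc n) < (\<Sum>(n, F)\<leftarrow>L. Suc n)" "\<And>n F. (n, F) \<in> set M \<Longrightarrow> pfam n F" for M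
    unfolding ok_def by (rule less.hyps) (use that in auto)
  have okD: "ok M \<Longrightarrow> constructible (\<lambda>\<theta>. \<exists>t. (\<forall>(n, F)\<in>set M. poly (F \<theta>) t = 0) \<and> poly (G \<theta>) t \<noteq> 0)" for M
    by (simp add: ok_def)
  have lead: "constructible (\<lambda>\<theta>. coeff (F \<theta>) n = 0)" if "pfam n F" for n and F :: "('a \<Rightarrow> complex) \<Rightarrow> complex poly"
    by (intro constructible.zero pfam_coeff[OF that])
  \<comment> \<open>What remains of a polynomial where its coefficient of degree n vanishes. For n =
    0 it is the zero polynomial, which imposes no condition and leaves the list.\<close>
  define dropped where "dropped = (\<lambda>n F rest. if n = 0 then rest else (n - 1, \<lambda>\<theta>::'a \<Rightarrow> complex. trunc_poly n (F \<theta>)) # rest)"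
  have ok_dropped: "ok (dropped n F rest)"
    if "pfam n F" "\<And>n F. (n, F) \<in> set rest \<Longrightarrow> pfam n F" "Suc n + (\<Sum>(n, F)\<leftarrow>rest. Suc n) = (\<Sum>(n, F)\<leftarrow>L. Suc n)" for n F rest
  proof (rule IH)
    show "(\<Sum>(n, F)\<leftarrow>dropped n F rest. Suc n) < (\<Sum>(n, F)\<leftarrow>L. Suc n)"
      using that(3) by (auto simp: dropped_def)
    show "pfam a b" if "(a, b) \<in> set (dropped n F rest)" for a b
      using that \<open>pfam n F\<close> \<open>\<And>n F. (n, F) \<in> set rest \<Longrightarrow> pfam n F\<close>
      by (auto simp: dropped_def pfam_trunc_poly[unfolded One_nat_def] split: if_splits)
  qed
  have dropped_iff: "(\<forall>(n, F)\<in>set (dropped n F rest). poly (F \<theta>) t = 0)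
      \<longleftrightarrow> (\<forall>(n, F)\<in>set ((n, F) # rest). poly (F \<theta>) t = 0)"
    if "coeff (F \<theta>) n = 0" "pfam n F" for n F rest and \<theta> :: "'a \<Rightarrow> complex" and t
  proof (cases "n = 0")
    case True
    then have "F \<theta> = 0" using that pfam_degree[OF that(2), of \<theta>] leading_coeff_0_iff[of "F \<theta>"] by auto
    then show ?thesis using True by (simp add: dropped_def)
  qed (use that in \<open>simp add: dropped_def trunc_poly_eq\<close>)
  have two: "ok ((n1, F1) # (n2, F2) # rest)"
    if nn: "n1 \<le> n2" and p: "\<And>n F. (n, F) \<in> set ((n1, F1) # (n2, F2) # rest) \<Longrightarrow> pfam n F"
      and s: "(\<Sum>(n, F)\<leftarrow>(n1, F1) # (n2, F2) # rest. Suc n) = (\<Sum>(n, F)\<leftarrow>L. Suc n)" for n1 F1 n2 F2 rest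
  proof -
    have p1: "pfam n1 F1" and p2: "pfam n2 F2" using p by auto
    \<comment> \<open>The case of nonzero leading coefficient. For n1 = 0 the first polynomial is a
      nonzero constant without roots; this case is split off because a pseudo-division step lowers
      the formal degree n2 only if n2 > 0.\<close>
    define N where "N = (if n1 = 0 then (\<lambda>_. False) else (\<lambda>\<theta>. \<exists>t. (\<forall>(n, F)\<in>set ((n1, F1) # (n2 - 1, \<lambda>\<theta>. pseudo_step n1 n2 (F1 \<theta>) (F2 \<theta>)) # rest). poly (F \<theta>) t = 0) \<and> poly (G \<theta>) t \<noteq> 0))"
    have cN: "constructible N"
    proof (cases "n1 = 0")
      case False
      have "ok ((n1, F1) # (n2 - 1, \<lambda>\<theta>. pseudo_step n1 n2 (F1 \<theta>) (F2 \<theta>)) # rest)"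
      proof (rule IH)
        show "pfam a b" if "(a, b) \<in> set ((n1, F1) # (n2 - 1, \<lambda>\<theta>. pseudo_step n1 n2 (F1 \<theta>) (F2 \<theta>)) # rest)" for a b
          using that p p1 pfam_pseudo_step[OF p1 p2 nn, unfolded One_nat_def] False nn by auto
      qed (use s False nn in auto)
      then show ?thesis using False by (simp only: N_def ok_def if_False)
    qed (simp add: N_def constructible_const)
    show ?thesis unfolding ok_def
    proof (rule constructible_cases[OF lead[OF p1] okD[OF ok_dropped[of n1 F1 "(n2, F2) # rest"]] cN])
      show "(\<exists>t. (\<forall>(n, F)\<in>set ((n1, F1) # (n2, F2) # rest). poly (F \<theta>) t = 0) \<and> poly (G \<theta>) t \<noteq> 0)
        = (\<exists>t. (\<forall>(n, F)\<in>set (dropped n1 F1 ((n2, F2) # rest)). poly (F \<theta>) t = 0) \<and> poly (G \<theta>) t \<noteq> 0)"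
        if "coeff (F1 \<theta>) n1 = 0" for \<theta>
        using dropped_iff[OF that p1] by blast
      show "(\<exists>t. (\<forall>(n, F)\<in>set ((n1, F1) # (n2, F2) # rest). poly (F \<theta>) t = 0) \<and> poly (G \<theta>) t \<noteq> 0) = N \<theta>"
        if nz: "coeff (F1 \<theta>) n1 \<noteq> 0" for \<theta>
      proof (cases "n1 = 0")
        case True
        then have "degree (F1 \<theta>) = 0" using pfam_degree[OF p1, of \<theta>] by auto
        then obtain c where "F1 \<theta> = [:c:]" by (metis degree_eq_zeroE)
        then show ?thesis using nz True by (auto simp: N_def)
      next
        case False
        have "(\<forall>(n, F)\<in>set ((n1, F1) # (n2, F2) # rest). poly (F \<theta>) t = 0)
          = (\<forall>(n, F)\<in>set ((n1, F1) # (n2 - 1, \<lambda>\<theta>. pseudo_step n1 n2 (F1 \<theta>) (F2 \<theta>)) # rest). poly (F \<theta>) t = 0)" for t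
          using poly_pseudo_step[OF _ nz, of t n2 "F2 \<theta>"] by auto
        then show ?thesis using False by (simp only: N_def if_False)
      qed
    qed (use p1 p s in auto)
  qed
  show ?case
  proof (cases L)
    case Nil
    have "(\<exists>t. poly (G \<theta>) t \<noteq> 0) = (\<not> G \<theta> = 0)" for \<theta> using poly_all_0_iff_0 by blast
    then show ?thesis using Nil constructible.neg[OF pfam_zero_constructible[OF G]] by simp
  next
    case (Cons nF L')
    obtain n F where nF: "nF = (n, F)" by force
    have pF: "pfam n F" using less.prems Cons nF by auto
    show ?thesis
    proof (cases L')
      case Nil
      have gn: "pfam (n * ng) (\<lambda>\<theta>. G \<theta> ^ n)" by (rule pfam_power[OF G])
      show ?thesis
      proof (rule constructible_cases[OF lead[OF pF] okD[OF ok_dropped[of n F "[]"]]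
              constructible.neg[OF constructible_dvd[OF pF gn]]])
        show "(\<exists>t. (\<forall>(n, F)\<in>set L. poly (F \<theta>) t = 0) \<and> poly (G \<theta>) t \<noteq> 0)
          = (\<exists>t. (\<forall>(n, F)\<in>set (dropped n F []). poly (F \<theta>) t = 0) \<and> poly (G \<theta>) t \<noteq> 0)"
          if "coeff (F \<theta>) n = 0" for \<theta>
          using dropped_iff[OF that pF, of "[]"] Cons Nil nF by simp
        show "(\<exists>t. (\<forall>(n, F)\<in>set L. poly (F \<theta>) t = 0) \<and> poly (G \<theta>) t \<noteq> 0)
          = (\<not> (coeff (F \<theta>) n \<noteq> 0 \<and> F \<theta> dvd G \<theta> ^ n))"
          if "coeff (F \<theta>) n \<noteq> 0" for \<theta>
          using ex_root_outside_iff[OF pF that, of "G \<theta>"] that Cons Nil nF by simp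
      qed (use pF Cons Nil nF in auto)
    next
      case (Cons nF' L'')
      obtain n' F' where nF': "nF' = (n', F')" by force
      have L: "L = (n, F) # (n', F') # L''" using nF nF' Cons \<open>L = nF # L'\<close> by simp
      show ?thesis
      proof (cases "n \<le> n'")
        case True
        have "ok L" unfolding L by (rule two[OF True]) (use less.prems L in auto)
        then show ?thesis by (rule okD)
      next
        case False
        then have le: "n' \<le> n" by simp
        have sL: "set L = set ((n', F') # (n, F) # L'')" unfolding L by auto
        have "ok ((n', F') # (n, F) # L'')" by (rule two[OF le]) (use less.prems L in auto)
        then show ?thesis unfolding sL by (rule okD)
      qed
    qed
  qed
qed

text \<open>Disjunctive normal form with a single inequation per conjunct, several being merged into
  a product. This is the shape that \<open>constructible_ex_root\<close> treats.\<close>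

lemma constructible_dnf:
  assumes "constructible P"
  shows "\<exists>L. (\<forall>(fs, g)\<in>set L. (\<forall>f\<in>set fs. pfun f) \<and> pfun g) \<and>
    (\<forall>\<theta>. P \<theta> \<longleftrightarrow> (\<exists>(fs, g)\<in>set L. (\<forall>f\<in>set fs. f \<theta> = 0) \<and> g \<theta> \<noteq> 0))"
proof -
  define dnf where "dnf = (\<lambda>(P::('a \<Rightarrow> complex) \<Rightarrow> bool). \<exists>L. (\<forall>(fs, g)\<in>set L. (\<forall>f\<in>set fs. pfun f) \<and> pfun g) \<and>
    (\<forall>\<theta>. P \<theta> \<longleftrightarrow> (\<exists>(fs, g)\<in>set L. (\<forall>f\<in>set fs. f \<theta> = 0) \<and> g \<theta> \<noteq> 0)))"
  have conj: "dnf (\<lambda>\<theta>. P \<theta> \<and> Q \<theta>)" if PQ: "dnf P" "dnf Q" for P Q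
  proof -
    obtain L where L: "\<forall>(fs, g)\<in>set L. (\<forall>f\<in>set fs. pfun f) \<and> pfun g"
      "\<And>\<theta>. P \<theta> \<longleftrightarrow> (\<exists>(fs, g)\<in>set L. (\<forall>f\<in>set fs. f \<theta> = 0) \<and> g \<theta> \<noteq> 0)" using PQ(1) unfolding dnf_def by blast
    obtain M where M: "\<forall>(fs, g)\<in>set M. (\<forall>f\<in>set fs. pfun f) \<and> pfun g"
      "\<And>\<theta>. Q \<theta> \<longleftrightarrow> (\<exists>(fs, g)\<in>set M. (\<forall>f\<in>set fs. f \<theta> = 0) \<and> g \<theta> \<noteq> 0)" using PQ(2) unfolding dnf_def by blast
    define K where "K = map (\<lambda>((fs, g), (fs', g')). (fs @ fs', \<lambda>\<theta>. g \<theta> * g' \<theta>)) (List.product L M)"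
    have "\<forall>(fs, g)\<in>set K. (\<forall>f\<in>set fs. pfun f) \<and> pfun g"
      using L(1) M(1) unfolding K_def by (fastforce intro: pfun_intros)
    moreover have "(P \<theta> \<and> Q \<theta>) \<longleftrightarrow> (\<exists>(fs, g)\<in>set K. (\<forall>f\<in>set fs. f \<theta> = 0) \<and> g \<theta> \<noteq> 0)" for \<theta>
      unfolding L(2) M(2) K_def by (simp add: Bex_def split_beta) (fastforce simp: ball_Un)
    ultimately show ?thesis unfolding dnf_def by blast
  qed
  have disj: "dnf (\<lambda>\<theta>. P \<theta> \<or> Q \<theta>)" if PQ: "dnf P" "dnf Q" for P Q
  proof -
    obtain L where L: "\<forall>(fs, g)\<in>set L. (\<forall>f\<in>set fs. pfun f) \<and> pfun g"
      "\<And>\<theta>. P \<theta> \<longleftrightarrow> (\<exists>(fs, g)\<in>set L. (\<forall>f\<in>set fs. f \<theta> = 0) \<and> g \<theta> \<noteq> 0)" using PQ(1) unfolding dnf_def by blast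
    obtain M where M: "\<forall>(fs, g)\<in>set M. (\<forall>f\<in>set fs. pfun f) \<and> pfun g"
      "\<And>\<theta>. Q \<theta> \<longleftrightarrow> (\<exists>(fs, g)\<in>set M. (\<forall>f\<in>set fs. f \<theta> = 0) \<and> g \<theta> \<noteq> 0)" using PQ(2) unfolding dnf_def by blast
    show ?thesis unfolding dnf_def using L M by (intro exI[of _ "L @ M"]) auto
  qed
  have z: "dnf (\<lambda>\<theta>. f \<theta> = 0)" if "pfun f" for f
    unfolding dnf_def by (rule exI[of _ "[([f], \<lambda>_. 1)]"]) (use that in \<open>auto intro: pfun_intros\<close>)
  have nz: "dnf (\<lambda>\<theta>. f \<theta> \<noteq> 0)" if "pfun f" for f
    unfolding dnf_def by (rule exI[of _ "[([], f)]"]) (use that in \<open>auto intro: pfun_intros\<close>)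
  have ff: "dnf (\<lambda>\<theta>. False)" unfolding dnf_def by (rule exI[of _ "[]"]) auto
  have tt: "dnf (\<lambda>\<theta>. True)" using nz[OF pfun.const[of 1]] by simp
  have nl: "dnf (\<lambda>\<theta>. \<not> (\<forall>f\<in>set fs. f \<theta> = 0))" if "\<forall>f\<in>set fs. pfun f" for fs
    using that
  proof (induction fs)
    case (Cons f fs)
    have eq: "(\<lambda>\<theta>. \<not> (\<forall>f\<in>set (f # fs). f \<theta> = 0)) = (\<lambda>\<theta>. f \<theta> \<noteq> 0 \<or> \<not> (\<forall>f\<in>set fs. f \<theta> = 0))"
      by (rule ext) auto
    show ?case unfolding eq by (rule disj[OF nz]) (use Cons in auto)
  qed (simp add: ff)
  have neg: "dnf (\<lambda>\<theta>. \<not> P \<theta>)" if P: "dnf P" for P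
  proof -
    obtain L where L: "\<forall>(fs, g)\<in>set L. (\<forall>f\<in>set fs. pfun f) \<and> pfun g"
      "\<And>\<theta>. P \<theta> \<longleftrightarrow> (\<exists>(fs, g)\<in>set L. (\<forall>f\<in>set fs. f \<theta> = 0) \<and> g \<theta> \<noteq> 0)" using P unfolding dnf_def by blast
    have "dnf (\<lambda>\<theta>. \<not> (\<exists>(fs, g)\<in>set L. (\<forall>f\<in>set fs. f \<theta> = 0) \<and> g \<theta> \<noteq> 0))" using L(1)
    proof (induction L)
      case Nil then show ?case using tt by simp
    next
      case (Cons a L)
      obtain fs g where a: "a = (fs, g)" by force
      have eq: "(\<lambda>\<theta>. \<not> (\<exists>(fs, g)\<in>set (a # L). (\<forall>f\<in>set fs. f \<theta> = 0) \<and> g \<theta> \<noteq> 0))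
        = (\<lambda>\<theta>. (\<not> (\<forall>f\<in>set fs. f \<theta> = 0) \<or> g \<theta> = 0) \<and> \<not> (\<exists>(fs, g)\<in>set L. (\<forall>f\<in>set fs. f \<theta> = 0) \<and> g \<theta> \<noteq> 0))"
        unfolding a by (rule ext) auto
      show ?case unfolding eq by (rule conj[OF disj[OF nl z] Cons.IH]) (use Cons.prems a in auto)
    qed
    then show ?thesis using L(2) by simp
  qed
  have "dnf P" using assms by induction (rule z neg conj, assumption+)+
  then show ?thesis unfolding dnf_def .
qed

text \<open>The existential quantifier passes through the disjunction of the normal form; as
  functions of the coordinate y, the polynomials of each conjunct form a one-variable system with
  parameters.\<close>

theorem chevalley:
  assumes "constructible P" shows "constructible (\<lambda>\<theta>. \<exists>t. P (\<theta>(y := t)))"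
proof -
  obtain L where L: "\<And>fs g f. (fs, g) \<in> set L \<Longrightarrow> f \<in> set fs \<Longrightarrow> pfun f" "\<And>fs g. (fs, g) \<in> set L \<Longrightarrow> pfun g"
      "\<And>\<theta>. P \<theta> \<longleftrightarrow> (\<exists>(fs, g)\<in>set L. (\<forall>f\<in>set fs. f \<theta> = 0) \<and> g \<theta> \<noteq> 0)"
    using constructible_dnf[OF assms] by blast
  have "\<exists>nF. \<forall>f. pfun f \<longrightarrow> pfam (fst (nF f)) (snd (nF f)) \<and> (\<forall>\<theta> t. f (\<theta>(y := t)) = poly (snd (nF f) \<theta>) t)"
    using pfun_upd_poly[of _ y] by (intro choice) (metis fst_conv snd_conv)
  then obtain nF where nF: "\<And>f. pfun f \<Longrightarrow> pfam (fst (nF f)) (snd (nF f))"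
    "\<And>f \<theta> t. pfun f \<Longrightarrow> f (\<theta>(y := t)) = poly (snd (nF f) \<theta>) t" by blast
  have "(\<exists>t. P (\<theta>(y := t))) = (\<exists>a\<in>set L. \<exists>t. (\<forall>(n, F)\<in>set (map nF (fst a)). poly (F \<theta>) t = 0) \<and> poly (snd (nF (snd a)) \<theta>) t \<noteq> 0)" for \<theta>
  proof -
    have e: "((\<forall>f\<in>set (fst a). f (\<theta>(y := t)) = 0) \<and> snd a (\<theta>(y := t)) \<noteq> 0)
        = ((\<forall>(n, F)\<in>set (map nF (fst a)). poly (F \<theta>) t = 0) \<and> poly (snd (nF (snd a)) \<theta>) t \<noteq> 0)"
      if a: "a \<in> set L" for a t
    proof -
      have "(fst a, snd a) \<in> set L" using a by simp
      from L(1,2)[OF this] have "f (\<theta>(y := t)) = poly (snd (nF f) \<theta>) t" if "f \<in> insert (snd a) (set (fst a))" for f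
        using nF(2) that by auto
      then show ?thesis by (simp add: split_beta)
    qed
    have "(\<exists>t. P (\<theta>(y := t))) = (\<exists>a\<in>set L. \<exists>t. (\<forall>f\<in>set (fst a). f (\<theta>(y := t)) = 0) \<and> snd a (\<theta>(y := t)) \<noteq> 0)"
      unfolding L(3) split_beta by (rule iffI; elim exE bexE conjE; intro bexI exI conjI; assumption)
    also have "\<dots> = (\<exists>a\<in>set L. \<exists>t. (\<forall>(n, F)\<in>set (map nF (fst a)). poly (F \<theta>) t = 0) \<and> poly (snd (nF (snd a)) \<theta>) t \<noteq> 0)"
      by (rule bex_cong[OF refl]) (simp only: e)
    finally show ?thesis .
  qed
  moreover have "constructible (\<lambda>\<theta>. \<exists>a\<in>set L. \<exists>t. (\<forall>(n, F)\<in>set (map nF (fst a)). poly (F \<theta>) t = 0) \<and> poly (snd (nF (snd a)) \<theta>) t \<noteq> 0)"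
  proof (rule constructible_bex[OF finite_set], rule constructible_ex_root)
    fix a assume "a \<in> set L"
    then have a: "(fst a, snd a) \<in> set L" by simp
    show "pfam (fst (nF (snd a))) (snd (nF (snd a)))" by (rule nF(1)[OF L(2)[OF a]])
    show "pfam n F" if "(n, F) \<in> set (map nF (fst a))" for n F
    proof -
      obtain f where f: "f \<in> set (fst a)" "(n, F) = nF f" using \<open>(n, F) \<in> set (map nF (fst a))\<close> by auto
      show ?thesis using nF(1)[OF L(1)[OF a f(1)]] unfolding f(2)[symmetric] by simp
    qed
  qed
  ultimately show ?thesis by simp
qed

lemma chevalley_finite:
  assumes "constructible P" "finite Y"
  shows "constructible (\<lambda>\<theta>. \<exists>\<theta>'. (\<forall>v. v \<notin> Y \<longrightarrow> \<theta>' v = \<theta> v) \<and> P \<theta>')"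
  using assms(2)
proof (induction Y rule: finite_induct)
  case empty
  have "(\<exists>\<theta>'. (\<forall>v. v \<notin> {} \<longrightarrow> \<theta>' v = \<theta> v) \<and> P \<theta>') = P \<theta>" for \<theta> by (auto simp: fun_eq_iff[symmetric])
  then show ?case using assms(1) by simp
next
  case (insert y Y)
  have "(\<exists>\<theta>'. (\<forall>v. v \<notin> insert y Y \<longrightarrow> \<theta>' v = \<theta> v) \<and> P \<theta>')
     = (\<exists>t. \<exists>\<theta>'. (\<forall>v. v \<notin> Y \<longrightarrow> \<theta>' v = (\<theta>(y := t)) v) \<and> P \<theta>')" for \<theta>
  proof
    assume "\<exists>\<theta>'. (\<forall>v. v \<notin> insert y Y \<longrightarrow> \<theta>' v = \<theta> v) \<and> P \<theta>'"
    then obtain \<theta>' where "\<forall>v. v \<notin> insert y Y \<longrightarrow> \<theta>' v = \<theta> v" "P \<theta>'" by blast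
    then show "\<exists>t. \<exists>\<theta>'. (\<forall>v. v \<notin> Y \<longrightarrow> \<theta>' v = (\<theta>(y := t)) v) \<and> P \<theta>'"
      by (intro exI[of _ "\<theta>' y"] exI[of _ \<theta>']) auto
  next
    assume "\<exists>t. \<exists>\<theta>'. (\<forall>v. v \<notin> Y \<longrightarrow> \<theta>' v = (\<theta>(y := t)) v) \<and> P \<theta>'"
    then obtain t \<theta>' where "\<forall>v. v \<notin> Y \<longrightarrow> \<theta>' v = (\<theta>(y := t)) v" "P \<theta>'" by auto
    then show "\<exists>\<theta>'. (\<forall>v. v \<notin> insert y Y \<longrightarrow> \<theta>' v = \<theta> v) \<and> P \<theta>'" by (intro exI[of _ \<theta>']) auto
  qed
  then show ?case using chevalley[OF insert.IH, of y] by simp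
qed

section \<open>Monomial expansions and algebraic dependence\<close>

text \<open>Each exponent is bounded separately, so that the number of monomials is exactly a power,
  which the counting argument for algebraic dependence uses. The functions are extensional to make
  the set finite.\<close>

definition exps :: "'v set \<Rightarrow> nat \<Rightarrow> ('v \<Rightarrow> nat) set" where
  "exps V q = PiE V (\<lambda>_. {..q})"

definition monom_val :: "'v set \<Rightarrow> ('v \<Rightarrow> nat) \<Rightarrow> ('v \<Rightarrow> complex) \<Rightarrow> complex" where
  "monom_val V \<alpha> \<theta> = (\<Prod>v\<in>V. \<theta> v ^ \<alpha> v)"

text \<open>The identity is only asked on T: with the variables outside V frozen, a function of
  further variables also has an expansion in V.\<close>

definition expands :: "'v set \<Rightarrow> ('v \<Rightarrow> complex) set \<Rightarrow> nat \<Rightarrow> (('v \<Rightarrow> complex) \<Rightarrow> complex) \<Rightarrow> bool" where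
  "expands V T q f \<longleftrightarrow> (\<exists>c. \<forall>\<theta>\<in>T. f \<theta> = (\<Sum>\<alpha>\<in>exps V q. c \<alpha> * monom_val V \<alpha> \<theta>))"

lemma finite_exps: "finite V \<Longrightarrow> finite (exps V q)"
  unfolding exps_def by (rule finite_PiE) auto

lemma card_exps: "finite V \<Longrightarrow> card (exps V q) = (q + 1) ^ card V"
  unfolding exps_def by (simp add: card_PiE)

lemma expandsI: "(\<And>\<theta>. \<theta> \<in> T \<Longrightarrow> f \<theta> = (\<Sum>\<alpha>\<in>exps V q. c \<alpha> * monom_val V \<alpha> \<theta>)) \<Longrightarrow> expands V T q f"
  unfolding expands_def by (rule exI[of _ c]) auto

lemma expandsE:
  assumes "expands V T q f"
  obtains c where "\<forall>\<theta>\<in>T. f \<theta> = (\<Sum>\<alpha>\<in>exps V q. c \<alpha> * monom_val V \<alpha> \<theta>)"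
  using assms unfolding expands_def by (rule exE)

lemma expands_cong: "expands V T q f \<Longrightarrow> (\<And>\<theta>. \<theta> \<in> T \<Longrightarrow> f \<theta> = g \<theta>) \<Longrightarrow> expands V T q g"
  unfolding expands_def by simp

lemma expands_monom:
  assumes "finite V" "\<And>v. v \<in> V \<Longrightarrow> \<beta> v \<le> q"
  shows "expands V T q (\<lambda>\<theta>. b * monom_val V \<beta> \<theta>)"
proof (rule expandsI)
  fix \<theta>
  let ?\<beta> = "restrict \<beta> V"
  have "?\<beta> \<in> exps V q" using assms(2) by (auto simp: exps_def)
  then have "(\<Sum>\<alpha>\<in>exps V q. (if \<alpha> = ?\<beta> then b else 0) * monom_val V \<alpha> \<theta>) = b * monom_val V ?\<beta> \<theta>"
    using finite_exps[OF assms(1)] by (simp add: if_distrib[of "\<lambda>x. x * _"] sum.delta' cong: if_cong)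
  then show "b * monom_val V \<beta> \<theta> = (\<Sum>\<alpha>\<in>exps V q. (if \<alpha> = ?\<beta> then b else 0) * monom_val V \<alpha> \<theta>)"
    by (simp add: monom_val_def)
qed

lemma expands_add:
  assumes "expands V T q f" "expands V T q g" shows "expands V T q (\<lambda>\<theta>. f \<theta> + g \<theta>)"
proof -
  obtain c where c: "\<forall>\<theta>\<in>T. f \<theta> = (\<Sum>\<alpha>\<in>exps V q. c \<alpha> * monom_val V \<alpha> \<theta>)" by (rule expandsE[OF assms(1)])
  obtain d where d: "\<forall>\<theta>\<in>T. g \<theta> = (\<Sum>\<alpha>\<in>exps V q. d \<alpha> * monom_val V \<alpha> \<theta>)" by (rule expandsE[OF assms(2)])
  show ?thesis by (rule expandsI[where c = "\<lambda>\<alpha>. c \<alpha> + d \<alpha>"]) (simp add: c d sum.distrib distrib_right)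
qed

lemma expands_const: "finite V \<Longrightarrow> expands V T q (\<lambda>_. b)"
  using expands_monom[of V "\<lambda>_. 0" q T b] by (simp add: monom_val_def)

lemma expands_sum:
  assumes "finite V" "\<And>i. i \<in> I \<Longrightarrow> expands V T q (f i)" shows "expands V T q (\<lambda>\<theta>. \<Sum>i\<in>I. f i \<theta>)"
  using assms(2)
proof (induction I rule: infinite_finite_induct)
  case (insert i I)
  then show ?case using expands_add[of V T q "f i"] by simp
qed (simp_all add: expands_const assms(1))

lemma expands_mult:
  assumes V: "finite V" and "expands V T q f" "expands V T q' g"
  shows "expands V T (q + q') (\<lambda>\<theta>. f \<theta> * g \<theta>)"
proof -
  obtain c where c: "\<forall>\<theta>\<in>T. f \<theta> = (\<Sum>\<alpha>\<in>exps V q. c \<alpha> * monom_val V \<alpha> \<theta>)" by (rule expandsE[OF assms(2)])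
  obtain d where d: "\<forall>\<theta>\<in>T. g \<theta> = (\<Sum>\<alpha>\<in>exps V q'. d \<alpha> * monom_val V \<alpha> \<theta>)" by (rule expandsE[OF assms(3)])
  have "expands V T (q + q') (\<lambda>\<theta>. \<Sum>\<alpha>\<in>exps V q. \<Sum>\<beta>\<in>exps V q'. (c \<alpha> * d \<beta>) * monom_val V (\<lambda>v. \<alpha> v + \<beta> v) \<theta>)"
    by (intro expands_sum V expands_monom) (auto simp: exps_def PiE_def Pi_def intro: add_mono)
  then show ?thesis
    by (rule expands_cong)
      (simp add: c d sum_product monom_val_def power_add prod.distrib mult.assoc mult.left_commute)
qed

lemma expands_mono:
  assumes V: "finite V" and f: "expands V T q f" and "q \<le> q'" shows "expands V T q' f"
  using expands_mult[OF V f expands_const[OF V, of T "q' - q" 1]] assms(3) by simp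

lemma expands_power:
  assumes V: "finite V" and f: "expands V T q f" shows "expands V T (n * q) (\<lambda>\<theta>. f \<theta> ^ n)"
proof (induction n)
  case 0 show ?case using expands_const[OF V] by simp
next
  case (Suc n) then show ?case using expands_mult[OF V f Suc] by simp
qed

lemma expands_prod:
  assumes V: "finite V" and f: "\<And>w. w \<in> W \<Longrightarrow> expands V T q (f w)" and "finite W"
  shows "expands V T (card W * q) (\<lambda>\<theta>. \<Prod>w\<in>W. f w \<theta>)"
  using assms(3) f
proof (induction W rule: finite_induct)
  case empty show ?case using expands_const[OF V] by simp
next
  case (insert w W)
  then show ?case using expands_mult[OF V, of T q "f w" "card W * q" "\<lambda>\<theta>. \<Prod>w\<in>W. f w \<theta>"] by simp
qed

text \<open>The variables outside V, frozen at \<open>\<theta>0\<close>, are absorbed into the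
  coefficients.\<close>

lemma pfun_expands:
  assumes "pfun f" and V: "finite V"
  shows "\<exists>q. expands V {\<theta>. \<forall>v. v \<notin> V \<longrightarrow> \<theta> v = \<theta>0 v} q f"
  using assms(1)
proof induction
  case (const c) then show ?case using expands_const[OF V] by blast
next
  case (var v)
  show ?case
  proof (cases "v \<in> V")
    case True
    have "\<theta> v = 1 * monom_val V (\<lambda>u. if u = v then 1 else 0) \<theta>" for \<theta> :: "'a \<Rightarrow> complex"
      using True V by (simp add: monom_val_def if_distrib[of "\<lambda>n. _ ^ n"] prod.delta cong: if_cong)
    then show ?thesis
      using expands_monom[OF V, of "\<lambda>u. if u = v then 1 else 0" 1 _ 1] by (intro exI[of _ 1]) auto
  next
    case False
    show ?thesis
      by (rule exI[of _ 0], rule expands_cong[OF expands_const[OF V, of _ _ "\<theta>0 v"]]) (use False in auto)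
  qed
next
  case (add f g)
  then obtain q q' where "expands V {\<theta>. \<forall>v. v \<notin> V \<longrightarrow> \<theta> v = \<theta>0 v} q f" "expands V {\<theta>. \<forall>v. v \<notin> V \<longrightarrow> \<theta> v = \<theta>0 v} q' g"
    by auto
  then show ?case
    by (intro exI[of _ "q + q'"] expands_add) (auto intro: expands_mono[OF V])
next
  case (mult f g)
  then obtain q q' where "expands V {\<theta>. \<forall>v. v \<notin> V \<longrightarrow> \<theta> v = \<theta>0 v} q f" "expands V {\<theta>. \<forall>v. v \<notin> V \<longrightarrow> \<theta> v = \<theta>0 v} q' g"
    by auto
  then show ?case by (intro exI[of _ "q + q'"] expands_mult[OF V])
qed

definition depends_only :: "'v set \<Rightarrow> (('v \<Rightarrow> complex) \<Rightarrow> complex) \<Rightarrow> bool" where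
  "depends_only V f \<longleftrightarrow> (\<forall>\<theta> \<theta>'. (\<forall>v\<in>V. \<theta> v = \<theta>' v) \<longrightarrow> f \<theta> = f \<theta>')"

lemma depends_onlyI: "(\<And>\<theta> \<theta>'. (\<And>v. v \<in> V \<Longrightarrow> \<theta> v = \<theta>' v) \<Longrightarrow> f \<theta> = f \<theta>') \<Longrightarrow> depends_only V f"
  unfolding depends_only_def by blast

lemma depends_onlyD: "depends_only V f \<Longrightarrow> (\<And>v. v \<in> V \<Longrightarrow> \<theta> v = \<theta>' v) \<Longrightarrow> f \<theta> = f \<theta>'"
  unfolding depends_only_def by blast

lemma depends_only_mono: "depends_only V f \<Longrightarrow> V \<subseteq> W \<Longrightarrow> depends_only W f"
  unfolding depends_only_def by blast

lemma pfun_expands_UNIV: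
  assumes "pfun f" "depends_only V f" and V: "finite V"
  shows "\<exists>q. expands V UNIV q f"
proof -
  obtain q where "expands V {\<theta>. \<forall>v. v \<notin> V \<longrightarrow> \<theta> v = (\<lambda>_. 0) v} q f"
    using pfun_expands[OF assms(1) V, of "\<lambda>_. 0"] by auto
  then obtain c where c: "\<forall>\<theta>\<in>{\<theta>. \<forall>v. v \<notin> V \<longrightarrow> \<theta> v = (\<lambda>_. 0) v}. f \<theta> = (\<Sum>\<alpha>\<in>exps V q. c \<alpha> * monom_val V \<alpha> \<theta>)"
    by (rule expandsE)
  have "f \<theta> = (\<Sum>\<alpha>\<in>exps V q. c \<alpha> * monom_val V \<alpha> \<theta>)" for \<theta>
  proof -
    let ?\<theta> = "\<lambda>v. if v \<in> V then \<theta> v else 0"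
    have "f \<theta> = f ?\<theta>" by (rule depends_onlyD[OF assms(2)]) simp
    also have "\<dots> = (\<Sum>\<alpha>\<in>exps V q. c \<alpha> * monom_val V \<alpha> ?\<theta>)" using c by simp
    also have "\<dots> = (\<Sum>\<alpha>\<in>exps V q. c \<alpha> * monom_val V \<alpha> \<theta>)" by (simp add: monom_val_def)
    finally show ?thesis .
  qed
  then show ?thesis by (intro exI[of _ q] expandsI)
qed

text \<open>Gaussian elimination: a vector a0 with nonzero entry at b is used to clear that entry
  from the others, which leaves one vector and one coordinate fewer.\<close>

lemma linear_dependence:
  fixes c :: "'a \<Rightarrow> 'b \<Rightarrow> 'c::field"
  assumes "finite B" "finite A" "card B < card A"
  shows "\<exists>r. (\<exists>a\<in>A. r a \<noteq> 0) \<and> (\<forall>b\<in>B. (\<Sum>a\<in>A. r a * c a b) = 0)"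
  using assms
proof (induction B arbitrary: A c rule: finite_induct)
  case empty
  then obtain a where "a \<in> A" by (metis card_gt_0_iff card.empty ex_in_conv)
  then show ?case by (intro exI[of _ "\<lambda>_. 1"]) auto
next
  case (insert b B)
  show ?case
  proof (cases "\<forall>a\<in>A. c a b = 0")
    case True
    obtain r where "\<exists>a\<in>A. r a \<noteq> 0" "\<forall>b\<in>B. (\<Sum>a\<in>A. r a * c a b) = 0"
      using insert.IH[of A c] insert.prems insert.hyps by auto
    then show ?thesis using True by (intro exI[of _ r]) simp
  next
    case False
    then obtain a0 where a0: "a0 \<in> A" "c a0 b \<noteq> 0" by blast
    have "card B < card (A - {a0})" using insert.prems insert.hyps a0 by auto
    from insert.IH[OF _ this, of "\<lambda>a b'. c a b' - c a b / c a0 b * c a0 b'"] insert.prems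
    obtain r where r: "\<exists>a\<in>A - {a0}. r a \<noteq> 0"
      "\<forall>b'\<in>B. (\<Sum>a\<in>A - {a0}. r a * (c a b' - c a b / c a0 b * c a0 b')) = 0" by auto
    \<comment> \<open>The coefficient of a0 is chosen to make the combination vanish at b.\<close>
    define r' where "r' = r(a0 := - (\<Sum>a\<in>A - {a0}. r a * c a b) / c a0 b)"
    have s: "(\<Sum>a\<in>A. r' a * c a b') = (\<Sum>a\<in>A - {a0}. r a * c a b') - (\<Sum>a\<in>A - {a0}. r a * c a b) / c a0 b * c a0 b'" for b'
    proof -
      have "(\<Sum>a\<in>A. r' a * c a b') = r' a0 * c a0 b' + (\<Sum>a\<in>A - {a0}. r' a * c a b')"
        using insert.prems a0 by (simp add: sum.remove)
      also have "(\<Sum>a\<in>A - {a0}. r' a * c a b') = (\<Sum>a\<in>A - {a0}. r a * c a b')"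
        by (rule sum.cong) (auto simp: r'_def)
      finally show ?thesis by (simp add: r'_def)
    qed
    have "(\<Sum>a\<in>A. r' a * c a b') = 0" if "b' \<in> insert b B" for b'
    proof (cases "b' = b")
      case True then show ?thesis using s[of b] a0 by simp
    next
      case False
      then have "(\<Sum>a\<in>A - {a0}. r a * (c a b' - c a b / c a0 b * c a0 b')) = 0" using r(2) that by auto
      then show ?thesis unfolding s
        by (simp add: right_diff_distrib sum_subtractf sum_distrib_right sum_divide_distrib mult.assoc)
    qed
    moreover have "\<exists>a\<in>A. r' a \<noteq> 0" using r(1) by (auto simp: r'_def)
    ultimately show ?thesis by blast
  qed
qed

text \<open>Read as a polynomial in the variable w with the others fixed, the sum vanishes
  identically, so each coefficient does; the coefficients are expansions in the remaining
  variables.\<close>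

lemma monomials_independent:
  assumes "finite W" "\<forall>\<omega>. (\<Sum>\<alpha>\<in>exps W D. r \<alpha> * monom_val W \<alpha> \<omega>) = 0" "\<alpha> \<in> exps W D"
  shows "r \<alpha> = 0"
  using assms
proof (induction W arbitrary: r \<alpha> rule: finite_induct)
  case empty
  then show ?case by (simp add: exps_def monom_val_def)
next
  case (insert w W)
  have bij: "bij_betw (\<lambda>(i, \<beta>). \<beta>(w := i)) ({..D} \<times> exps W D) (exps (insert w W) D)"
    unfolding exps_def PiE_insert_eq bij_betw_def
    using insert.hyps(2) by (auto simp: inj_on_def fun_eq_iff PiE_def extensional_def split: if_splits)
  have mv: "monom_val (insert w W) (\<beta>(w := i)) (\<omega>(w := t)) = t ^ i * monom_val W \<beta> \<omega>" for \<beta> i \<omega> t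
  proof -
    have "(\<Prod>v\<in>W. (\<omega>(w := t)) v ^ (\<beta>(w := i)) v) = (\<Prod>v\<in>W. \<omega> v ^ \<beta> v)"
      using insert.hyps by (intro prod.cong) auto
    then show ?thesis using insert.hyps by (simp add: monom_val_def)
  qed
  have "(\<Sum>i\<le>D. (\<Sum>\<beta>\<in>exps W D. r (\<beta>(w := i)) * monom_val W \<beta> \<omega>) * t ^ i) = 0" for \<omega> t
  proof -
    have "(\<Sum>\<alpha>\<in>exps (insert w W) D. r \<alpha> * monom_val (insert w W) \<alpha> (\<omega>(w := t)))
       = (\<Sum>(i, \<beta>)\<in>{..D} \<times> exps W D. r (\<beta>(w := i)) * (t ^ i * monom_val W \<beta> \<omega>))"
      by (subst sum.reindex_bij_betw[OF bij, symmetric]) (auto intro!: sum.cong simp: mv)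
    also have "\<dots> = (\<Sum>i\<le>D. \<Sum>\<beta>\<in>exps W D. r (\<beta>(w := i)) * (t ^ i * monom_val W \<beta> \<omega>))"
      by (rule sum.cartesian_product[symmetric])
    finally show ?thesis using insert.prems(1) by (simp add: sum_distrib_left sum_distrib_right mult_ac)
  qed
  then have "\<forall>i\<le>D. (\<Sum>\<beta>\<in>exps W D. r (\<beta>(w := i)) * monom_val W \<beta> \<omega>) = 0" for \<omega>
    using polyfun_eq_0[of "\<lambda>i. \<Sum>\<beta>\<in>exps W D. r (\<beta>(w := i)) * monom_val W \<beta> \<omega>" D] by blast
  then have z: "r (\<beta>(w := i)) = 0" if "i \<le> D" "\<beta> \<in> exps W D" for i \<beta>
    using insert.IH[of "\<lambda>\<beta>. r (\<beta>(w := i))" \<beta>] that by blast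
  have "\<alpha> \<in> (\<lambda>(i, \<beta>). \<beta>(w := i)) ` ({..D} \<times> exps W D)"
    unfolding bij_betw_imp_surj_on[OF bij] by (rule insert.prems(2))
  then obtain i \<beta> where i\<beta>: "i \<le> D" "\<beta> \<in> exps W D" "\<alpha> = \<beta>(w := i)" by auto
  show ?case unfolding i\<beta>(3) by (rule z[OF i\<beta>(1,2)])
qed

text \<open>More polynomials than variables are algebraically dependent: there are more monomials of
  degree at most \<open>D\<close> in the polynomials than monomials in the variables that they involve.\<close>

lemma algebraic_dependence:
  fixes h :: "'w \<Rightarrow> ('v \<Rightarrow> complex) \<Rightarrow> complex"
  assumes W: "finite W" and V: "finite V" and lt: "card V < card W"
    and h: "\<And>w. w \<in> W \<Longrightarrow> pfun (h w)" "\<And>w. w \<in> W \<Longrightarrow> depends_only V (h w)"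
  shows "\<exists>R. pfun R \<and> (\<exists>\<omega>. R \<omega> \<noteq> 0) \<and> depends_only W R \<and> (\<forall>\<theta>. R (\<lambda>w. h w \<theta>) = 0)"
proof -
  have "\<exists>Q. \<forall>w. w \<in> W \<longrightarrow> expands V UNIV (Q w) (h w)"
    using pfun_expands_UNIV[OF h V] by (intro choice) blast
  then obtain Q where Q: "\<And>w. w \<in> W \<Longrightarrow> expands V UNIV (Q w) (h w)" by blast
  define q where "q = sum Q W"
  have q: "expands V UNIV q (h w)" if "w \<in> W" for w
    by (rule expands_mono[OF V Q[OF that]]) (use W that in \<open>simp add: q_def member_le_sum\<close>)
  \<comment> \<open>There are (D + 1) ^ card W monomials in W with exponents up to D. The monomials
    in V that express their values number at most D (D + 1) ^ card V by this choice of D, which is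
    less than (D + 1) ^ (card V + 1).\<close>
  define D where "D = (card W * q + 1) ^ card V"
  have "expands V UNIV (card W * (D * q)) (\<lambda>\<theta>. \<Prod>w\<in>W. h w \<theta> ^ \<alpha> w)" if "\<alpha> \<in> exps W D" for \<alpha>
  proof (rule expands_prod[OF V _ W])
    fix w assume "w \<in> W"
    then have "\<alpha> w \<le> D" using that by (auto simp: exps_def PiE_def Pi_def)
    then show "expands V UNIV (D * q) (\<lambda>\<theta>. h w \<theta> ^ \<alpha> w)"
      by (intro expands_mono[OF V expands_power[OF V q[OF \<open>w \<in> W\<close>]]]) simp
  qed
  then have "\<forall>\<alpha>. \<exists>c. \<alpha> \<in> exps W D \<longrightarrow> (\<forall>\<theta>. (\<Prod>w\<in>W. h w \<theta> ^ \<alpha> w) = (\<Sum>\<beta>\<in>exps V (card W * (D * q)). c \<beta> * monom_val V \<beta> \<theta>))"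
    unfolding expands_def by auto
  then obtain c where c: "\<And>\<alpha> \<theta>. \<alpha> \<in> exps W D \<Longrightarrow> (\<Prod>w\<in>W. h w \<theta> ^ \<alpha> w) = (\<Sum>\<beta>\<in>exps V (card W * (D * q)). c \<alpha> \<beta> * monom_val V \<beta> \<theta>)"
    by (metis (no_types))
  have "card (exps V (card W * (D * q))) < card (exps W D)"
  proof -
    have "card W * (D * q) + 1 \<le> (card W * q + 1) * (D + 1)" by (simp add: algebra_simps)
    then have "(card W * (D * q) + 1) ^ card V \<le> ((card W * q + 1) * (D + 1)) ^ card V" by (rule power_mono) simp
    also have "\<dots> = D * (D + 1) ^ card V" by (simp only: power_mult_distrib D_def)
    also have "\<dots> < (D + 1) ^ Suc (card V)" by simp
    also have "\<dots> \<le> (D + 1) ^ card W" using lt by (intro power_increasing) auto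
    finally show ?thesis using V W by (simp add: card_exps)
  qed
  then obtain r where r: "\<exists>\<alpha>\<in>exps W D. r \<alpha> \<noteq> 0" "\<forall>\<beta>\<in>exps V (card W * (D * q)). (\<Sum>\<alpha>\<in>exps W D. r \<alpha> * c \<alpha> \<beta>) = 0"
    using linear_dependence[OF finite_exps[OF V] finite_exps[OF W], of "card W * (D * q)" D c] by blast
  define R where "R = (\<lambda>\<omega>. \<Sum>\<alpha>\<in>exps W D. r \<alpha> * monom_val W \<alpha> \<omega>)"
  have "pfun R" unfolding R_def monom_val_def
    by (intro pfun_sum pfun.mult pfun.const pfun_prod pfun_power pfun.var)
  moreover have "\<exists>\<omega>. R \<omega> \<noteq> 0" using monomials_independent[OF W, where r = r and D = D] r(1) unfolding R_def by blast
  moreover have "depends_only W R" unfolding R_def monom_val_def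
    by (rule depends_onlyI) simp
  moreover have "R (\<lambda>w. h w \<theta>) = 0" for \<theta>
  proof -
    have "R (\<lambda>w. h w \<theta>) = (\<Sum>\<alpha>\<in>exps W D. \<Sum>\<beta>\<in>exps V (card W * (D * q)). r \<alpha> * c \<alpha> \<beta> * monom_val V \<beta> \<theta>)"
      unfolding R_def by (rule sum.cong[OF refl]) (simp add: c monom_val_def[of W] sum_distrib_left mult.assoc)
    also have "\<dots> = (\<Sum>\<beta>\<in>exps V (card W * (D * q)). (\<Sum>\<alpha>\<in>exps W D. r \<alpha> * c \<alpha> \<beta>) * monom_val V \<beta> \<theta>)"
      by (subst sum.swap) (simp add: sum_distrib_right)
    finally show ?thesis using r(2) by simp
  qed
  ultimately show ?thesis by (intro exI[of _ R]) simp
qed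

section \<open>Adjusting a relation: division by a variable, homogeneous components\<close>

lemma poly_eqI_all: "(\<And>t. poly p t = poly q t) \<Longrightarrow> p = (q :: complex poly)"
  by (metis poly_eq_poly_eq_iff ext)

text \<open>The largest power of the variable y that divides R is removed, so that the quotient does
  not vanish identically on the hyperplane where y is 0. It is on such a hyperplane that the
  relation is going to be evaluated.\<close>

lemma divide_out_variable:
  assumes R: "pfun R" "\<exists>\<omega>. R \<omega> \<noteq> 0" "depends_only W R"
  shows "\<exists>R' r. pfun R' \<and> (\<exists>\<omega>. R' (\<omega>(y := 0)) \<noteq> 0) \<and> (\<forall>\<omega>. R \<omega> = \<omega> y ^ r * R' \<omega>) \<and> depends_only (insert y W) R'"
proof -
  obtain n P where P: "pfam n P" "\<And>\<omega> t. R (\<omega>(y := t)) = poly (P \<omega>) t"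
    using pfun_upd_poly[OF R(1), of y] by auto
  have Pcong: "P \<omega> = P \<omega>'" if "\<And>v. v \<in> W \<Longrightarrow> v \<noteq> y \<Longrightarrow> \<omega> v = \<omega>' v" for \<omega> \<omega>'
    by (rule poly_eqI_all) (auto simp: P(2)[symmetric] that intro!: depends_onlyD[OF R(3)])
  obtain \<omega>0 where \<omega>0: "R \<omega>0 \<noteq> 0" using R(2) by auto
  have "R \<omega> = poly (P \<omega>) (\<omega> y)" for \<omega> using P(2)[of \<omega> "\<omega> y"] by simp
  note RP = this
  have ex: "\<exists>r \<omega>. coeff (P \<omega>) r \<noteq> 0" using RP[of \<omega>0] \<omega>0 by (metis poly_0 leading_coeff_0_iff)
  define r where "r = (LEAST r. \<exists>\<omega>. coeff (P \<omega>) r \<noteq> 0)"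
  have r: "\<exists>\<omega>. coeff (P \<omega>) r \<noteq> 0" unfolding r_def by (rule LeastI_ex[OF ex])
  have less: "coeff (P \<omega>) i = 0" if "i < r" for i \<omega>
    using not_less_Least[OF that[unfolded r_def]] by blast
  define R' where "R' = (\<lambda>\<omega>. \<Sum>i\<le>n. \<omega> y ^ i * coeff (P \<omega>) (i + r))"
  have "pfun R'" unfolding R'_def
    by (intro pfun_sum pfun.mult pfun_power pfun.var pfam_coeff[OF P(1)])
  moreover have "\<exists>\<omega>. R' (\<omega>(y := 0)) \<noteq> 0"
  proof -
    obtain \<omega> where \<omega>: "coeff (P \<omega>) r \<noteq> 0" using r by blast
    have "R' (\<omega>(y := 0)) = (\<Sum>i\<le>n. (if i = 0 then 1 else 0) * coeff (P (\<omega>(y := 0))) (i + r))"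
      unfolding R'_def by (rule sum.cong) auto
    also have "\<dots> = coeff (P (\<omega>(y := 0))) r" by (simp add: if_distrib[of "\<lambda>x. x * _"] cong: if_cong)
    also have "P (\<omega>(y := 0)) = P \<omega>" by (rule Pcong) simp
    finally have "R' (\<omega>(y := 0)) = coeff (P \<omega>) r" .
    with \<omega> show ?thesis by metis
  qed
  moreover have "R \<omega> = \<omega> y ^ r * R' \<omega>" for \<omega>
  proof -
    have "R \<omega> = (\<Sum>i\<le>n + r. coeff (P \<omega>) i * \<omega> y ^ i)"
      unfolding RP poly_altdef
      by (rule sum.mono_neutral_left) (use pfam_degree[OF P(1), of \<omega>] in \<open>auto simp: coeff_eq_0\<close>)
    also have "\<dots> = (\<Sum>i\<in>{r..n + r}. coeff (P \<omega>) i * \<omega> y ^ i)"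
      by (rule sum.mono_neutral_right) (auto simp: less)
    also have "\<dots> = (\<Sum>i\<in>{0..n}. coeff (P \<omega>) (i + r) * \<omega> y ^ (i + r))"
      using sum.shift_bounds_cl_nat_ivl[of "\<lambda>i. coeff (P \<omega>) i * \<omega> y ^ i" 0 r n] by simp
    finally show ?thesis unfolding R'_def by (simp add: sum_distrib_left power_add mult_ac atLeast0AtMost)
  qed
  moreover have "depends_only (insert y W) R'"
  proof (rule depends_onlyI)
    fix \<omega> \<omega>' :: "'a \<Rightarrow> complex" assume a: "\<And>v. v \<in> insert y W \<Longrightarrow> \<omega> v = \<omega>' v"
    have "P \<omega> = P \<omega>'" by (rule Pcong) (simp add: a)
    then show "R' \<omega> = R' \<omega>'" unfolding R'_def using a[of y] by simp
  qed
  ultimately show ?thesis by (intro exI[of _ R'] exI[of _ r]) simp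
qed

definition scale_on :: "'v set \<Rightarrow> complex \<Rightarrow> ('v \<Rightarrow> complex) \<Rightarrow> 'v \<Rightarrow> complex" where
  "scale_on Z s \<omega> = (\<lambda>v. if v \<in> Z then s * \<omega> v else \<omega> v)"

text \<open>Along the orbit of scaling the variables in Z, R is a polynomial in s, whose coefficient
  at s ^ D is the component of degree D. The components at \<open>\<omega>1\<close> sum to
  \<open>R \<omega>1\<close>, so one of them is nonzero there; all of them vanish at a point whose
  orbit lies in the zero set.\<close>

lemma homogeneous_component:
  assumes R: "pfun R" "R \<omega>1 \<noteq> 0" "depends_only W R"
  shows "\<exists>R' D. pfun R' \<and> R' \<omega>1 \<noteq> 0 \<and> depends_only W R' \<and> (\<forall>s \<omega>. R' (scale_on Z s \<omega>) = s ^ D * R' \<omega>)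
    \<and> (\<forall>\<omega>. (\<forall>s. s \<noteq> 0 \<longrightarrow> R (scale_on Z s \<omega>) = 0) \<longrightarrow> R' \<omega> = 0)"
proof -
  have "\<exists>n P. pfam n P \<and> (\<forall>(\<omega>::'a \<Rightarrow> complex) s. R (\<lambda>v. poly ((\<lambda>v \<omega>. if v \<in> Z then [:0, \<omega> v:] else [:\<omega> v:]) v \<omega>) s) = poly (P \<omega>) s)"
  proof (rule pfam_subst[OF R(1)])
    fix v :: 'a
    have "pfam 1 (\<lambda>\<omega>::'a \<Rightarrow> complex. [:0, 1:] * [:\<omega> v:])"
      using pfam_mult[OF pfam_X pfam_const[OF pfun.var[of v]]] by simp
    then show "\<exists>n. pfam n (\<lambda>\<omega>::'a \<Rightarrow> complex. if v \<in> Z then [:0, \<omega> v:] else [:\<omega> v:])"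
      using pfam_const[OF pfun.var[of v]] by (cases "v \<in> Z") auto
  qed
  then obtain n P where P: "pfam n P" "\<And>(\<omega>::'a \<Rightarrow> complex) s. R (\<lambda>v. poly (if v \<in> Z then [:0, \<omega> v:] else [:\<omega> v:]) s) = poly (P \<omega>) s"
    by auto
  have P2: "R (scale_on Z s \<omega>) = poly (P \<omega>) s" for s \<omega>
  proof -
    have "scale_on Z s \<omega> = (\<lambda>v. poly (if v \<in> Z then [:0, \<omega> v:] else [:\<omega> v:]) s)"
      by (rule ext) (simp add: scale_on_def)
    then show ?thesis using P(2) by simp
  qed
  have "scale_on Z 1 \<omega>1 = \<omega>1" by (rule ext) (simp add: scale_on_def)
  then have "P \<omega>1 \<noteq> 0" using P2[of 1 \<omega>1] R(2) by auto
  then obtain D where D: "coeff (P \<omega>1) D \<noteq> 0" using leading_coeff_0_iff by blast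
  define R' where "R' = (\<lambda>\<omega>. coeff (P \<omega>) D)"
  have "P (scale_on Z u \<omega>) = pcompose (P \<omega>) [:0, u:]" for u \<omega>
  proof (rule poly_eqI_all)
    fix t
    have "scale_on Z t (scale_on Z u \<omega>) = scale_on Z (t * u) \<omega>" by (rule ext) (simp add: scale_on_def)
    then show "poly (P (scale_on Z u \<omega>)) t = poly (pcompose (P \<omega>) [:0, u:]) t"
      using P2[of t "scale_on Z u \<omega>"] P2[of "t * u" \<omega>] by (simp add: poly_pcompose)
  qed
  then have hom: "R' (scale_on Z s \<omega>) = s ^ D * R' \<omega>" for s \<omega>
    unfolding R'_def by (simp add: coeff_pcompose_linear)
  have dep: "depends_only W R'"
  proof (rule depends_onlyI)
    fix \<omega> \<omega>' :: "'a \<Rightarrow> complex" assume a: "\<And>v. v \<in> W \<Longrightarrow> \<omega> v = \<omega>' v"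
    have "P \<omega> = P \<omega>'"
      by (rule poly_eqI_all, unfold P2[symmetric], rule depends_onlyD[OF R(3)]) (simp add: a scale_on_def)
    then show "R' \<omega> = R' \<omega>'" by (simp add: R'_def)
  qed
  have van: "R' \<omega> = 0" if z: "\<forall>s. s \<noteq> 0 \<longrightarrow> R (scale_on Z s \<omega>) = 0" for \<omega>
  proof -
    have "UNIV - {0} \<subseteq> {s. poly (P \<omega>) s = 0}" using z P2 by auto
    then have "infinite {s. poly (P \<omega>) s = 0}"
      using infinite_UNIV_char_0[where 'a = complex] by (meson finite_subset finite_Diff2 finite.emptyI finite_insert)
    then have "P \<omega> = 0" using poly_roots_finite by blast
    then show ?thesis by (simp add: R'_def)
  qed
  show ?thesis
    by (rule exI[of _ R'], rule exI[of _ D]) (use hom dep van D pfam_coeff[OF P(1)] in \<open>simp add: R'_def\<close>)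
qed

section \<open>Systems of monomial and linear equations\<close>

definition mon :: "nat \<Rightarrow> (nat \<Rightarrow> nat \<Rightarrow> nat) \<Rightarrow> nat \<Rightarrow> (nat \<Rightarrow> complex) \<Rightarrow> complex" where
  "mon d e i x = (\<Prod>j\<le>d. x j ^ e i j)"

text \<open>The rows \<open>a < k\<close> of \<open>\<theta>\<close> are the equations of \<open>L\<close>, imposed on the monomials; the rows
  \<open>k \<le> a < d\<close> are those of the complementary linear subspace, imposed on the coordinates.\<close>

definition sat :: "nat \<Rightarrow> nat \<Rightarrow> (nat \<Rightarrow> nat \<Rightarrow> nat) \<Rightarrow> (nat \<times> nat \<Rightarrow> complex) \<Rightarrow> (nat \<Rightarrow> complex) \<Rightarrow> bool" where
  "sat d k e \<theta> x \<longleftrightarrow> (\<forall>a<k. (\<Sum>i\<le>d. \<theta> (a, i) * mon d e i x) = 0)"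

definition lsat :: "nat \<Rightarrow> nat \<Rightarrow> (nat \<times> nat \<Rightarrow> complex) \<Rightarrow> (nat \<Rightarrow> complex) \<Rightarrow> bool" where
  "lsat d k \<theta> x \<longleftrightarrow> (\<forall>a\<in>{k..<d}. (\<Sum>j\<le>d. \<theta> (a, j) * x j) = 0)"

lemma mon_cong: "(\<And>j. j \<le> d \<Longrightarrow> x j = y j) \<Longrightarrow> mon d e i x = mon d e i y"
  by (simp add: mon_def)

lemma mon_nonzero_iff: "mon d e i x \<noteq> 0 \<longleftrightarrow> (\<forall>j\<le>d. x j = 0 \<longrightarrow> e i j = 0)"
  by (auto simp: mon_def)

lemma mon_scale: "(\<Sum>j\<le>d. e i j) = q \<Longrightarrow> mon d e i (\<lambda>j. s * x j) = s ^ q * mon d e i x"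
  by (auto simp: mon_def power_mult_distrib prod.distrib power_sum[symmetric])

lemma pfun_mon: "(\<And>j. pfun (\<lambda>\<theta>. h \<theta> j)) \<Longrightarrow> pfun (\<lambda>\<theta>. mon d e i (h \<theta>))"
  unfolding mon_def by (intro pfun_prod pfun_power)

section \<open>Forms vanishing on the preimage of a linear subspace\<close>

text \<open>The quantities among which a relation is sought, indexed by pairs: the parameters in the
  rows below d, then x s, x i and the values at x of the d - k linear forms of the source.\<close>

definition relvec :: "nat \<Rightarrow> nat \<Rightarrow> nat \<Rightarrow> nat \<Rightarrow> (nat \<times> nat \<Rightarrow> complex) \<Rightarrow> (nat \<Rightarrow> complex) \<Rightarrow> nat \<times> nat \<Rightarrow> complex" where
  "relvec d k s i \<theta> x = (\<lambda>(a, j). if a < d then \<theta> (a, j) else if a = d then x s else if a = Suc d then x i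
     else (\<Sum>j\<le>d. \<theta> (k + (a - Suc (Suc d)), j) * x j))"

definition relvars :: "nat \<Rightarrow> nat \<Rightarrow> (nat \<times> nat) set" where
  "relvars d k = {..<d} \<times> {..d} \<union> {(d, 0), (Suc d, 0)} \<union> (\<lambda>b. (Suc (Suc d) + b, 0)) ` {..<d - k}"

lemma finite_relvars: "finite (relvars d k)"
  by (simp add: relvars_def)

lemma card_relvars: assumes "k \<le> d" shows "card (relvars d k) = d * (d + 1) + 2 + (d - k)"
proof -
  have 1: "card ({..<d} \<times> {..d} \<union> {(d, 0), (Suc d, 0)}) = d * (d + 1) + 2"
    by (subst card_Un_disjoint) (auto simp: card_cartesian_product)
  have 2: "card ((\<lambda>b. (Suc (Suc d) + b, 0::nat)) ` {..<d - k}) = d - k"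
    by (subst card_image) (auto simp: inj_on_def)
  show ?thesis unfolding relvars_def
    by (subst card_Un_disjoint) (auto simp: 1[simplified] 2[simplified])
qed

lemma relvec_cong:
  assumes "\<And>a j. a < d \<Longrightarrow> j \<le> d \<Longrightarrow> \<theta> (a, j) = \<theta>' (a, j)" "\<And>j. j \<le> d \<Longrightarrow> x j = x' j"
    "w \<in> relvars d k" "s \<le> d" "i \<le> d"
  shows "relvec d k s i \<theta> x w = relvec d k s i \<theta>' x' w"
  using assms(3) unfolding relvars_def
proof (elim UnE)
  assume "w \<in> (\<lambda>b. (Suc (Suc d) + b, 0)) ` {..<d - k}"
  then obtain b where b: "b < d - k" "w = (Suc (Suc d) + b, 0)" by auto
  then show ?thesis using assms(1,2) by (auto simp: relvec_def intro!: sum.cong)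
qed (use assms in \<open>auto simp: relvec_def\<close>)

text \<open>A dimension count. S is the set of vanishing coordinates; as the monomial i0 is nonzero,
  each of the k equations determines one coefficient. The pairs of \<theta> and x therefore have d
  (d + 1) - k + (d + 1) - card S parameters, fewer than the quantities in \<open>relvec\<close>. The
  extra care goes into a relation that does not vanish identically for x s = 0.\<close>

lemma incidence_relation:
  assumes i0: "i0 \<le> d" and S: "S \<subseteq> {..d}" "\<forall>j\<in>S. e i0 j = 0" and i: "i \<le> d" and s: "s \<le> d" and k: "k \<le> d"
  shows "\<exists>R. pfun R \<and> (\<exists>\<omega>. R (\<omega>((d, 0) := 0)) \<noteq> 0) \<and> depends_only (relvars d k) R \<and>
    (\<forall>\<theta> x. (\<forall>j\<in>S. x j = 0) \<longrightarrow> (\<forall>j\<le>d. j \<notin> S \<longrightarrow> x j \<noteq> 0) \<longrightarrow> sat d k e \<theta> x \<longrightarrow> R (relvec d k s i \<theta> x) = 0)"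
proof -
  define xx where "xx = (\<lambda>(\<eta>::nat \<times> nat \<Rightarrow> complex) j. if j \<in> S then 0 else \<eta> (d, j))"
  \<comment> \<open>Each of the first k rows is recovered from its entries other than i0. Those are
    multiplied by the monomial i0, which makes the entry at i0 a polynomial as well.\<close>
  define par where "par = (\<lambda>(\<eta>::nat \<times> nat \<Rightarrow> complex) (a, j). if a < k then
      (if j = i0 then - (\<Sum>i\<in>{..d} - {i0}. \<eta> (a, i) * mon d e i (xx \<eta>)) else \<eta> (a, j) * mon d e i0 (xx \<eta>)) else \<eta> (a, j))"
  define h where "h = (\<lambda>w \<eta>. relvec d k s i (par \<eta>) (xx \<eta>) w)"
  define V where "V = {..<k} \<times> ({..d} - {i0}) \<union> {k..<d} \<times> {..d} \<union> {d} \<times> ({..d} - S)"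
  \<comment> \<open>If some coordinate vanishes, the count leaves room to omit x s from the relation
    altogether. Otherwise x s is nonzero at all points in question, and powers of it are divided out
    at the end.\<close>
  define W where "W = (if S = {} then relvars d k else relvars d k - {(d, 0)})"
  have finV: "finite V" by (simp add: V_def)
  have finW: "finite W" by (simp add: W_def finite_relvars)
  have cS: "card S \<le> d + 1" using card_mono[OF _ S(1)] by simp
  have finS: "finite S" using S(1) finite_subset by blast
  have cV: "card V = k * d + (d - k) * (d + 1) + (d + 1 - card S)"
  proof -
    have "card ({..<k} \<times> ({..d} - {i0}) \<union> {k..<d} \<times> {..d}) = k * d + (d - k) * (d + 1)"
      using i0 by (subst card_Un_disjoint) (auto simp: card_cartesian_product)
    moreover have "card ({d} \<times> ({..d} - S)) = d + 1 - card S"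
      using S(1) finS by (simp add: card_cartesian_product card_Diff_subset)
    ultimately show ?thesis unfolding V_def using k by (subst card_Un_disjoint) auto
  qed
  have cW: "card W = d * (d + 1) + 1 + (d - k) + (if S = {} then 1 else 0)"
  proof -
    have "(d, 0) \<in> relvars d k" by (simp add: relvars_def)
    then show ?thesis using card_relvars[OF k] finite_relvars[of d k] by (simp add: W_def)
  qed
  have lt: "card V < card W"
  proof -
    obtain m where m: "d = k + m" using le_Suc_ex[OF k] by blast
    have "k * d + (d - k) * (d + 1) + k = d * (d + 1)" unfolding m by (simp add: algebra_simps)
    moreover define x y where "x = k * d + (d - k) * (d + 1)" and "y = d * (d + 1)"
    ultimately have xy: "x + k = y" by simp
    show ?thesis
    proof (cases "S = {}")
      case True
      then show ?thesis unfolding cV cW x_def[symmetric] y_def[symmetric] using xy k by simp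
    next
      case False
      then have "card S > 0" using finS by auto
      then show ?thesis unfolding cV cW x_def[symmetric] y_def[symmetric] using xy k cS False by simp
    qed
  qed
  have px: "pfun (\<lambda>\<eta>. xx \<eta> j)" for j
    by (cases "j \<in> S") (simp_all add: xx_def pfun.const pfun.var)
  have pp: "pfun (\<lambda>\<eta>. par \<eta> (a, j))" for a j
    unfolding par_def prod.case
    by (intro pfun_if pfun_uminus pfun_sum pfun.mult pfun.var pfun_mon px)
  have ph: "pfun (h w)" for w
  proof -
    obtain a j where w: "w = (a, j)" by force
    show ?thesis unfolding h_def relvec_def w prod.case
      by (intro pfun_if pfun_sum pfun.mult px pp)
  qed
  have xcong: "xx \<eta> j = xx \<eta>' j" if "\<And>v. v \<in> V \<Longrightarrow> \<eta> v = \<eta>' v" "j \<le> d" for \<eta> \<eta>' j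
    using that(2) by (auto simp: xx_def V_def intro!: that(1))
  have pcong: "par \<eta> (a, j) = par \<eta>' (a, j)" if v: "\<And>v. v \<in> V \<Longrightarrow> \<eta> v = \<eta>' v" and "a < d" "j \<le> d" for \<eta> \<eta>' a j
  proof -
    have m: "mon d e l (xx \<eta>) = mon d e l (xx \<eta>')" for l by (rule mon_cong) (rule xcong[OF v])
    have "\<eta> (a, l) = \<eta>' (a, l)" if "a < k \<longrightarrow> l \<noteq> i0" "l \<le> d" for l
      using that \<open>a < d\<close> by (intro v) (auto simp: V_def)
    then show ?thesis using that(3) unfolding par_def prod.case m by (auto intro!: sum.cong)
  qed
  have dh: "depends_only V (h w)" if "w \<in> W" for w
  proof (rule depends_onlyI)
    fix \<eta> \<eta>' :: "nat \<times> nat \<Rightarrow> complex" assume v: "\<And>v. v \<in> V \<Longrightarrow> \<eta> v = \<eta>' v"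
    show "h w \<eta> = h w \<eta>'" unfolding h_def
      by (rule relvec_cong) (use that s i xcong[OF v] pcong[OF v] in \<open>auto simp: W_def split: if_splits\<close>)
  qed
  obtain R where R: "pfun R" "\<exists>\<omega>. R \<omega> \<noteq> 0" "depends_only W R" "\<forall>\<eta>. R (\<lambda>w. h w \<eta>) = 0"
  proof -
    have "\<exists>R. pfun R \<and> (\<exists>\<omega>. R \<omega> \<noteq> 0) \<and> depends_only W R \<and> (\<forall>\<eta>. R (\<lambda>w. h w \<eta>) = 0)"
      by (rule algebraic_dependence[OF finW finV lt ph dh])
    then show thesis by (rule exE, elim conjE) (rule that)
  qed
  have van: "R (relvec d k s i \<theta> x) = 0"
    if x: "\<forall>j\<in>S. x j = 0" "\<forall>j\<le>d. j \<notin> S \<longrightarrow> x j \<noteq> 0" and sat: "sat d k e \<theta> x" for \<theta> x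
  proof -
    have m0: "mon d e i0 x \<noteq> 0" unfolding mon_nonzero_iff using x S by auto
    \<comment> \<open>The inverse of the parametrization, defined where the monomial i0 is
      nonzero.\<close>
    define \<eta> where "\<eta> = (\<lambda>(a, j). if a < k then \<theta> (a, j) / mon d e i0 x else if a < d then \<theta> (a, j) else x j)"
    have xe: "xx \<eta> j = x j" for j using x k by (simp add: xx_def \<eta>_def)
    have m: "mon d e l (xx \<eta>) = mon d e l x" for l by (rule mon_cong) (rule xe)
    have \<eta>1: "\<eta> (a, j) = \<theta> (a, j) / mon d e i0 x" if "a < k" for a j using that by (simp add: \<eta>_def)
    have \<eta>2: "\<eta> (a, j) = \<theta> (a, j)" if "k \<le> a" "a < d" for a j using that by (simp add: \<eta>_def)
    have "par \<eta> (a, j) = \<theta> (a, j)" if "a < d" "j \<le> d" for a j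
    proof (cases "a < k \<and> j = i0")
      case True
      then have "(\<Sum>i\<le>d. \<theta> (a, i) * mon d e i x) = 0" using sat by (simp add: sat_def)
      then have "\<theta> (a, i0) * mon d e i0 x + (\<Sum>i\<in>{..d} - {i0}. \<theta> (a, i) * mon d e i x) = 0"
        using i0 by (simp add: sum.remove[of "{..d}" i0])
      then have "- (\<Sum>i\<in>{..d} - {i0}. \<theta> (a, i) * mon d e i x) = \<theta> (a, i0) * mon d e i0 x"
        by (simp add: add_eq_0_iff2)
      moreover have "par \<eta> (a, j) = - (\<Sum>i\<in>{..d} - {i0}. \<theta> (a, i) * mon d e i x) / mon d e i0 x"
        using True by (simp add: par_def m \<eta>1 sum_divide_distrib)
      ultimately show ?thesis using m0 True by simp
    next
      case False
      then show ?thesis using m0 that k by (auto simp: par_def m \<eta>1 \<eta>2)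
    qed
    then have "R (relvec d k s i \<theta> x) = R (\<lambda>w. h w \<eta>)"
      by (intro depends_onlyD[OF depends_only_mono[OF R(3), of "relvars d k"]])
        (auto simp: W_def h_def xe s i intro!: relvec_cong split: if_splits)
    then show ?thesis using R(4) by simp
  qed
  show ?thesis
  proof (cases "S = {}")
    case False
    obtain \<omega> where \<omega>: "R \<omega> \<noteq> 0" using R(2) by auto
    have "R (\<omega>((d, 0) := 0)) = R \<omega>" by (rule depends_onlyD[OF R(3)]) (use False in \<open>auto simp: W_def\<close>)
    moreover have "depends_only (relvars d k) R" by (rule depends_only_mono[OF R(3)]) (auto simp: W_def)
    ultimately show ?thesis using R(1) van \<omega> by (intro exI[of _ R]) (metis (no_types, lifting))
  next
    case True
    obtain R' r where R': "pfun R'" "\<exists>\<omega>. R' (\<omega>((d, 0) := 0)) \<noteq> 0" "\<forall>\<omega>. R \<omega> = \<omega> (d, 0) ^ r * R' \<omega>" "depends_only (insert (d, 0) W) R'"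
      using divide_out_variable[OF R(1-3), of "(d, 0)"] by auto
    have "insert (d, 0) W = relvars d k" using True by (auto simp: W_def relvars_def)
    moreover have "R' (relvec d k s i \<theta> x) = 0"
      if "\<forall>j\<in>S. x j = 0" "\<forall>j\<le>d. j \<notin> S \<longrightarrow> x j \<noteq> 0" "sat d k e \<theta> x" for \<theta> x
    proof -
      have "relvec d k s i \<theta> x (d, 0) \<noteq> 0" using that(2) True s by (simp add: relvec_def)
      then show ?thesis using van[OF that] R'(3) by (metis mult_eq_0_iff power_not_zero)
    qed
    ultimately show ?thesis using R' by (intro exI[of _ R']) simp
  qed
qed

text \<open>F vanishes on X, but at the points of the linear subspace with p s = 0 it is a nonzero
  multiple of a power of p i. Having such an F for every i excludes that the closure of X has points
  on the linear subspace with p s = 0.\<close>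

definition vanishing_form :: "nat \<Rightarrow> nat \<Rightarrow> nat \<Rightarrow> nat \<Rightarrow> (nat \<times> nat \<Rightarrow> complex) \<Rightarrow> (nat \<Rightarrow> complex) set \<Rightarrow> bool" where
  "vanishing_form d k s i \<theta> X \<longleftrightarrow> (\<exists>F m c. pfun F \<and> depends_only {..d} F \<and> (\<forall>u x. F (\<lambda>j. u * x j) = u ^ m * F x) \<and>
    (\<forall>x\<in>X. F x = 0) \<and> c \<noteq> 0 \<and> (\<forall>p. p s = 0 \<longrightarrow> lsat d k \<theta> p \<longrightarrow> F p = c * p i ^ m))"

text \<open>The parameter shift by \<open>\<epsilon>\<close> turns the relation into one that is monic in the coordinate
  \<open>x i\<close> modulo \<open>x s\<close> and the linear forms, as in Noether normalization.\<close>

lemma generic_vanishing_form: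
  assumes i0: "i0 \<le> d" and S: "S \<subseteq> {..d}" "\<forall>j\<in>S. e i0 j = 0" and i: "i \<le> d" and s: "s \<le> d" and k: "k \<le> d"
    and e: "\<And>i. i \<le> d \<Longrightarrow> (\<Sum>j\<le>d. e i j) = q"
  shows "generic (\<lambda>\<theta>. vanishing_form d k s i \<theta>
    {x. (\<forall>j\<in>S. x j = 0) \<and> (\<forall>j\<le>d. j \<notin> S \<longrightarrow> x j \<noteq> 0) \<and> sat d k e \<theta> x})"
proof -
  obtain R0 where R0: "pfun R0" "\<exists>\<omega>. R0 (\<omega>((d, 0) := 0)) \<noteq> 0" "depends_only (relvars d k) R0"
    "\<forall>\<theta> x. (\<forall>j\<in>S. x j = 0) \<longrightarrow> (\<forall>j\<le>d. j \<notin> S \<longrightarrow> x j \<noteq> 0) \<longrightarrow> sat d k e \<theta> x \<longrightarrow> R0 (relvec d k s i \<theta> x) = 0"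
    using incidence_relation[of i0 d S e i s k, OF i0 S i s k] by (rule exE, elim conjE) (rule that)
  \<comment> \<open>The entries of \<open>relvec\<close> that are linear in x; the others are
    parameters.\<close>
  define Z where "Z = {w :: nat \<times> nat. fst w \<ge> d}"
  obtain \<omega>0 where \<omega>0: "R0 (\<omega>0((d, 0) := 0)) \<noteq> 0" using R0(2) by auto
  obtain R D where R': "pfun R" "R (\<omega>0((d, 0) := 0)) \<noteq> 0" "depends_only (relvars d k) R"
    "\<forall>s \<omega>. R (scale_on Z s \<omega>) = s ^ D * R \<omega>"
    "\<forall>\<omega>. (\<forall>s. s \<noteq> 0 \<longrightarrow> R0 (scale_on Z s \<omega>) = 0) \<longrightarrow> R \<omega> = 0"
    using homogeneous_component[OF R0(1) \<omega>0 R0(3), of Z] by (rule exE, elim exE conjE) (rule that)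
  note R = R'(1-3) R'(4,5)[rule_format]
  have sc: "scale_on Z u (relvec d k s i \<theta> x) = relvec d k s i \<theta> (\<lambda>j. u * x j)" for u \<theta> x
    by (rule ext) (auto simp: scale_on_def relvec_def Z_def sum_distrib_left mult_ac)
  have R6: "R (relvec d k s i \<theta> x) = 0"
    if x: "\<forall>j\<in>S. x j = 0" "\<forall>j\<le>d. j \<notin> S \<longrightarrow> x j \<noteq> 0" "sat d k e \<theta> x" for \<theta> x
  proof (rule R(5), unfold sc)
    fix u :: complex assume "u \<noteq> 0"
    have "(\<Sum>i\<le>d. \<theta> (a, i) * mon d e i (\<lambda>j. u * x j)) = u ^ q * (\<Sum>i\<le>d. \<theta> (a, i) * mon d e i x)" for a
      unfolding sum_distrib_left by (rule sum.cong) (auto simp: mon_scale[OF e] mult_ac)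
    then have 3: "sat d k e \<theta> (\<lambda>j. u * x j)" using x(3) by (simp add: sat_def)
    have 2: "\<forall>j\<le>d. j \<notin> S \<longrightarrow> u * x j \<noteq> 0" using \<open>u \<noteq> 0\<close> x(2) by simp
    have 1: "\<forall>j\<in>S. u * x j = 0" using x(1) by simp
    show "R0 (relvec d k s i \<theta> (\<lambda>j. u * x j)) = 0"
      by (rule R0(4)[THEN spec, THEN spec, THEN mp, THEN mp, THEN mp, OF 1 2 3])
  qed
  have pz: "pfun (\<lambda>\<omega>. R (\<omega>((d, 0) := 0)))"
  proof -
    have "pfun (\<lambda>\<omega>. R (\<lambda>w. if w = (d, 0) then 0 else \<omega> w))"
      by (rule pfun_subst[OF R(1)]) (intro pfun_if pfun.const pfun.var)
    then show ?thesis by (simp only: fun_upd_def)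
  qed
  \<comment> \<open>A point where the relation survives x s = 0 and the entry of x i is nonzero;
    rescaling makes the latter 1.\<close>
  obtain \<omega>1 where \<omega>1: "R (\<omega>1((d, 0) := 0)) \<noteq> 0" "\<omega>1 (Suc d, 0) \<noteq> 0"
  proof -
    have "\<exists>c. R (c((d, 0) := 0)) \<noteq> 0 \<and> c (Suc d, 0) \<noteq> 0 \<and> (\<forall>v. \<omega>0 v = (\<lambda>_. 1) v \<longrightarrow> c v = \<omega>0 v)"
      by (rule pfun_common_nonzero[where f = "\<lambda>\<omega>. R (\<omega>((d, 0) := 0))" and g = "\<lambda>\<omega>. \<omega> (Suc d, 0)"])
        (rule pz pfun.var R(2) one_neq_zero)+
    then show thesis by (elim exE conjE) (rule that)
  qed
  define \<omega>2 where "\<omega>2 = scale_on Z (1 / \<omega>1 (Suc d, 0)) (\<omega>1((d, 0) := 0))"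
  have \<omega>2: "R \<omega>2 \<noteq> 0" "\<omega>2 (d, 0) = 0" "\<omega>2 (Suc d, 0) = 1"
    unfolding \<omega>2_def R(4) using \<omega>1 by (auto simp: scale_on_def Z_def)
  \<comment> \<open>The values of the linear forms at \<open>\<omega>2\<close>. Adding them to the
    coefficients of x i makes every form take the value \<epsilon> times x i on its former zero set,
    so there the relation with x s = 0 becomes a multiple of x i ^ D.\<close>
  define \<epsilon> where "\<epsilon> = (\<lambda>a. \<omega>2 (Suc (Suc d) + (a - k), 0))"
  define sh where "sh = (\<lambda>c (\<theta>::nat \<times> nat \<Rightarrow> complex) (a, j). if a \<in> {k..<d} \<and> j = i then \<theta> (a, j) + c * \<epsilon> a else \<theta> (a, j))"
  \<comment> \<open>The entries of \<open>relvec\<close> for the shifted parameters at a point of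
    the linear subspace with x s = 0 and x i = 1.\<close>
  define base where "base = (\<lambda>\<theta> (a, j). if a < d then sh 1 \<theta> (a, j) else \<omega>2 (a, j))"
  define G where "G = (\<lambda>\<theta>. R (base \<theta>))"
  have pG: "pfun G" unfolding G_def
  proof (rule pfun_subst[OF R(1)])
    fix v :: "nat \<times> nat" obtain a j where v: "v = (a, j)" by force
    show "pfun (\<lambda>\<theta>. base \<theta> v)" unfolding v base_def sh_def prod.case
      by (intro pfun_if pfun.add pfun.var pfun.const)
  qed
  have nz: "G (sh (-1) \<omega>2) \<noteq> 0"
  proof -
    have "base (sh (-1) \<omega>2) = \<omega>2" by (rule ext) (auto simp: base_def sh_def)
    then show ?thesis using \<omega>2 by (simp add: G_def)
  qed
  show ?thesis
  proof (rule genericI[OF pG, of "sh (-1) \<omega>2", OF nz])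
    fix \<theta> assume Gn: "G \<theta> \<noteq> 0"
    define F where "F = (\<lambda>x. R (relvec d k s i (sh 1 \<theta>) x))"
    have F1: "pfun F" unfolding F_def
    proof (rule pfun_subst[OF R(1)])
      fix v :: "nat \<times> nat" obtain a j where v: "v = (a, j)" by force
      show "pfun (\<lambda>x. relvec d k s i (sh 1 \<theta>) x v)" unfolding v relvec_def prod.case
        by (intro pfun_if pfun_sum pfun.mult pfun.var pfun.const)
    qed
    have F2: "depends_only {..d} F" unfolding F_def
      by (rule depends_onlyI, rule depends_onlyD[OF R(3)], rule relvec_cong) (use s i in auto)
    have F3: "\<forall>u x. F (\<lambda>j. u * x j) = u ^ D * F x"
      unfolding F_def sc[symmetric] R(4) by simp
    have F4: "F x = 0" if "\<forall>j\<in>S. x j = 0" "\<forall>j\<le>d. j \<notin> S \<longrightarrow> x j \<noteq> 0" "sat d k e \<theta> x" for x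
    proof -
      have "sat d k e (sh 1 \<theta>) x" using that(3) by (simp add: sat_def sh_def)
      then show ?thesis unfolding F_def using R6 that by blast
    qed
    have F5: "F p = G \<theta> * p i ^ D" if p: "p s = 0" "lsat d k \<theta> p" for p
    proof -
      have "R (relvec d k s i (sh 1 \<theta>) p) = R (scale_on Z (p i) (base \<theta>))"
      proof (rule depends_onlyD[OF R(3)])
        fix w assume "w \<in> relvars d k"
        then show "relvec d k s i (sh 1 \<theta>) p w = scale_on Z (p i) (base \<theta>) w"
          unfolding relvars_def
        proof (elim UnE)
          assume "w \<in> (\<lambda>b. (Suc (Suc d) + b, 0)) ` {..<d - k}"
          then obtain b where b: "b < d - k" "w = (Suc (Suc d) + b, 0)" by auto
          have "(\<Sum>j\<le>d. sh 1 \<theta> (k + b, j) * p j) = (\<Sum>j\<le>d. \<theta> (k + b, j) * p j + (if j = i then \<epsilon> (k + b) * p j else 0))"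
            by (rule sum.cong) (use b k in \<open>auto simp: sh_def algebra_simps\<close>)
          also have "\<dots> = \<epsilon> (k + b) * p i"
            using p(2) b k i by (simp add: lsat_def sum.distrib)
          finally show ?thesis using b by (simp add: relvec_def scale_on_def Z_def base_def \<epsilon>_def)
        qed (use \<omega>2 p in \<open>auto simp: relvec_def scale_on_def Z_def base_def\<close>)
      qed
      then show ?thesis by (simp add: F_def R(4) G_def)
    qed
    show "vanishing_form d k s i \<theta> {x. (\<forall>j\<in>S. x j = 0) \<and> (\<forall>j\<le>d. j \<notin> S \<longrightarrow> x j \<noteq> 0) \<and> sat d k e \<theta> x}"
      unfolding vanishing_form_def
      by (rule exI[of _ F], rule exI[of _ D], rule exI[of _ "G \<theta>"]) (use F1 F2 F3 F4 F5 Gn in simp)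
  qed
qed

text \<open>The product of the forms serves the union: on the linear subspace each factor is a
  multiple of a power of the same coordinate p i.\<close>

lemma vanishing_form_UN:
  assumes "finite I" "\<And>S. S \<in> I \<Longrightarrow> vanishing_form d k s i \<theta> (X S)"
  shows "vanishing_form d k s i \<theta> (\<Union>S\<in>I. X S)"
  using assms
proof (induction I rule: finite_induct)
  case empty
  show ?case unfolding vanishing_form_def
    by (rule exI[of _ "\<lambda>_. 1"], rule exI[of _ 0], rule exI[of _ 1]) (auto intro: pfun.const depends_onlyI)
next
  case (insert S I)
  have "vanishing_form d k s i \<theta> (X S)" "vanishing_form d k s i \<theta> (\<Union>S\<in>I. X S)"
    using insert.prems[of S] insert.IH insert.prems by simp_all
  note vf = this[unfolded vanishing_form_def]
  obtain F m c where F: "pfun F" "depends_only {..d} F" "\<forall>u x. F (\<lambda>j. u * x j) = u ^ m * F x"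
    "\<forall>x\<in>X S. F x = 0" "c \<noteq> 0" "\<forall>p. p s = 0 \<longrightarrow> lsat d k \<theta> p \<longrightarrow> F p = c * p i ^ m"
    using vf(1) by (elim exE conjE) (rule that)
  obtain F' m' c' where F': "pfun F'" "depends_only {..d} F'" "\<forall>u x. F' (\<lambda>j. u * x j) = u ^ m' * F' x"
    "\<forall>x\<in>\<Union>S\<in>I. X S. F' x = 0" "c' \<noteq> 0" "\<forall>p. p s = 0 \<longrightarrow> lsat d k \<theta> p \<longrightarrow> F' p = c' * p i ^ m'"
    using vf(2) by (elim exE conjE) (rule that)
  have "depends_only {..d} (\<lambda>x. F x * F' x)"
    by (rule depends_onlyI) (metis depends_onlyD[OF F(2)] depends_onlyD[OF F'(2)])
  then show ?case unfolding vanishing_form_def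
    by (intro exI[of _ "\<lambda>x. F x * F' x"] exI[of _ "m + m'"] exI[of _ "c * c'"])
      (use F F' in \<open>auto simp: power_add intro: pfun.mult\<close>)
qed

text \<open>The points are stratified by the set S of vanishing coordinates and a monomial i0 that
  is nonzero. There are finitely many strata, to each of which \<open>generic_vanishing_form\<close>
  applies.\<close>

lemma generic_vanishing_forms:
  assumes k: "k \<le> d" and e: "\<And>i. i \<le> d \<Longrightarrow> (\<Sum>j\<le>d. e i j) = q"
  shows "generic (\<lambda>\<theta>. \<forall>s\<le>d. \<forall>i\<le>d. vanishing_form d k s i \<theta> {x. sat d k e \<theta> x \<and> (\<exists>i\<le>d. mon d e i x \<noteq> 0)})"
proof -
  define I where "I = {(S, i0). i0 \<le> d \<and> S \<subseteq> {..d} \<and> (\<forall>j\<in>S. e i0 j = 0)}"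
  define X where "X = (\<lambda>\<theta> (S :: nat set, i0 :: nat). {x. (\<forall>j\<in>S. x j = 0) \<and> (\<forall>j\<le>d. j \<notin> S \<longrightarrow> x j \<noteq> 0) \<and> sat d k e \<theta> x})"
  have fin: "finite I" by (rule finite_subset[of _ "Pow {..d} \<times> {..d}"]) (auto simp: I_def)
  have XI: "{x. sat d k e \<theta> x \<and> (\<exists>i\<le>d. mon d e i x \<noteq> 0)} \<subseteq> (\<Union>S\<in>I. X \<theta> S)" for \<theta>
  proof
    fix x assume "x \<in> {x. sat d k e \<theta> x \<and> (\<exists>i\<le>d. mon d e i x \<noteq> 0)}"
    then obtain i0 where i0: "sat d k e \<theta> x" "i0 \<le> d" "mon d e i0 x \<noteq> 0" by auto
    define S where "S = {j. j \<le> d \<and> x j = 0}"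
    have "(S, i0) \<in> I" using i0 unfolding mon_nonzero_iff by (auto simp: I_def S_def)
    moreover have "x \<in> X \<theta> (S, i0)" using i0 by (auto simp: X_def S_def)
    ultimately show "x \<in> (\<Union>S\<in>I. X \<theta> S)" by blast
  qed
  have "generic (\<lambda>\<theta>. \<forall>s\<in>{..d}. \<forall>i\<in>{..d}. \<forall>S\<in>I. vanishing_form d k s i \<theta> (X \<theta> S))"
  proof (intro generic_ball fin finite_atMost)
    fix s i Si0 assume si: "s \<in> {..d}" "i \<in> {..d}" "Si0 \<in> I"
    obtain S i0 where S: "Si0 = (S, i0)" by force
    show "generic (\<lambda>\<theta>. vanishing_form d k s i \<theta> (X \<theta> Si0))"
      by (rule generic_mono[OF generic_vanishing_form[OF _ _ _ _ _ k e, where ?i0.0 = i0 and S = S and i = i and s = s]])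
        (use si S in \<open>auto simp: I_def X_def\<close>)
  qed
  then show ?thesis
  proof (rule generic_mono)
    fix \<theta> assume a: "\<forall>s\<in>{..d}. \<forall>i\<in>{..d}. \<forall>S\<in>I. vanishing_form d k s i \<theta> (X \<theta> S)"
    show "\<forall>s\<le>d. \<forall>i\<le>d. vanishing_form d k s i \<theta> {x. sat d k e \<theta> x \<and> (\<exists>i\<le>d. mon d e i x \<noteq> 0)}"
    proof (intro allI impI)
      fix s i assume "s \<le> d" "i \<le> d"
      then have "vanishing_form d k s i \<theta> (\<Union>S\<in>I. X \<theta> S)" using a by (intro vanishing_form_UN fin) auto
      then show "vanishing_form d k s i \<theta> {x. sat d k e \<theta> x \<and> (\<exists>i\<le>d. mon d e i x \<noteq> 0)}"
        unfolding vanishing_form_def using XI[of \<theta>] by (meson subsetD)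
    qed
  qed
qed

section \<open>Representatives of the integer vectors modulo a nonsingular matrix\<close>

definition mat_lattice :: "int mat \<Rightarrow> int vec set" where
  "mat_lattice Q = {Q *\<^sub>v m | m. m \<in> carrier_vec (dim_col Q)}"

lemma mat_lattice_mult_subset:
  assumes "Q \<in> carrier_mat n n" "P \<in> carrier_mat n n"
  shows "mat_lattice (Q * P) \<subseteq> mat_lattice Q"
proof
  fix x assume "x \<in> mat_lattice (Q * P)"
  then obtain m where m: "m \<in> carrier_vec n" "x = Q * P *\<^sub>v m" using assms by (auto simp: mat_lattice_def)
  then have "x = Q *\<^sub>v (P *\<^sub>v m)" "P *\<^sub>v m \<in> carrier_vec (dim_col Q)"
    using assms by (auto simp: assoc_mult_mat_vec)
  then show "x \<in> mat_lattice Q" unfolding mat_lattice_def by blast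
qed

lemma addcol_carrier_mat: "Q \<in> carrier_mat n m \<Longrightarrow> addcol a i j Q \<in> carrier_mat n m"
  by (auto intro: carrier_matI)

lemma mat_lattice_addcol:
  assumes Q: "Q \<in> carrier_mat n n" and "i < n" "j < n" "i \<noteq> j"
  shows "mat_lattice (addcol a i j Q) = mat_lattice Q"
proof
  have sub: "mat_lattice (addcol a i j Q) \<subseteq> mat_lattice Q" if "Q \<in> carrier_mat n n" for a Q
    unfolding addcol_mat[OF that \<open>j < n\<close>] by (rule mat_lattice_mult_subset[OF that]) simp
  show "mat_lattice (addcol a i j Q) \<subseteq> mat_lattice Q" by (rule sub[OF Q])
  have "addcol (-a) i j (addcol a i j Q) = Q"
    using assms by (intro eq_matI) auto
  then show "mat_lattice Q \<subseteq> mat_lattice (addcol a i j Q)"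
    using sub[of "addcol a i j Q" "-a"] addcol_carrier_mat[OF Q] by simp
qed

lemma mat_lattice_swapcols:
  assumes Q: "Q \<in> carrier_mat n n" and "i < n" "j < n"
  shows "mat_lattice (swapcols i j Q) = mat_lattice Q"
proof
  have sub: "mat_lattice (swapcols i j Q) \<subseteq> mat_lattice Q" if "Q \<in> carrier_mat n n" for Q
    unfolding swapcols_mat[OF that assms(2,3)] by (rule mat_lattice_mult_subset[OF that]) simp
  show "mat_lattice (swapcols i j Q) \<subseteq> mat_lattice Q" by (rule sub[OF Q])
  have "swapcols i j (swapcols i j Q) = Q" using assms by (intro eq_matI) auto
  then show "mat_lattice Q \<subseteq> mat_lattice (swapcols i j Q)"
    using sub[of "swapcols i j Q"] Q by simp
qed

text \<open>The index of the lattice L in the integer vectors is N, expressed through a transversal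
  instead of a quotient group.\<close>

definition has_reps :: "nat \<Rightarrow> int vec set \<Rightarrow> nat \<Rightarrow> bool" where
  "has_reps n L N \<longleftrightarrow> (\<exists>T. finite T \<and> card T = N \<and> T \<subseteq> carrier_vec n \<and>
     (\<forall>x\<in>carrier_vec n. \<exists>!r. r \<in> T \<and> x - r \<in> L))"

text \<open>Column operations by Euclid's algorithm clear the first row up to its first entry.\<close>

lemma has_reps_clear_first_row:
  assumes Q: "Q \<in> carrier_mat n n" and n: "0 < n" and det: "det Q \<noteq> 0"
  shows "\<exists>Q'. Q' \<in> carrier_mat n n \<and> \<bar>det Q'\<bar> = \<bar>det Q\<bar> \<and> mat_lattice Q' = mat_lattice Q
    \<and> (\<forall>j. 0 < j \<longrightarrow> j < n \<longrightarrow> Q' $$ (0, j) = 0)"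
  using Q det
proof (induction "\<Sum>j<n. nat \<bar>Q $$ (0, j)\<bar>" arbitrary: Q rule: less_induct)
  case less
  note Q = less.prems(1)
  show ?case
  proof (cases "\<exists>i j. i < n \<and> j < n \<and> i \<noteq> j \<and> Q $$ (0, i) \<noteq> 0 \<and> Q $$ (0, j) \<noteq> 0 \<and> \<bar>Q $$ (0, j)\<bar> \<le> \<bar>Q $$ (0, i)\<bar>")
    case True
    then obtain i j where ij: "i < n" "j < n" "i \<noteq> j" "Q $$ (0, i) \<noteq> 0" "Q $$ (0, j) \<noteq> 0" "\<bar>Q $$ (0, j)\<bar> \<le> \<bar>Q $$ (0, i)\<bar>"
      by auto
    define a where "a = (if (Q $$ (0, i) > 0) = (Q $$ (0, j) > 0) then - 1 else 1 :: int)"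
    define P where "P = addcol a i j Q"
    have P: "P \<in> carrier_mat n n" unfolding P_def by (rule addcol_carrier_mat[OF Q])
    have Pl: "P $$ (0, l) = (if l = i then a * Q $$ (0, j) + Q $$ (0, i) else Q $$ (0, l))" if "l < n" for l
      using that Q n by (simp add: P_def)
    have "(\<Sum>l<n. nat \<bar>P $$ (0, l)\<bar>) < (\<Sum>l<n. nat \<bar>Q $$ (0, l)\<bar>)"
    proof (rule sum_strict_mono_ex1)
      show "\<forall>l\<in>{..<n}. nat \<bar>P $$ (0, l)\<bar> \<le> nat \<bar>Q $$ (0, l)\<bar>"
        using ij by (auto simp: Pl a_def)
      show "\<exists>l\<in>{..<n}. nat \<bar>P $$ (0, l)\<bar> < nat \<bar>Q $$ (0, l)\<bar>"
        using ij by (intro bexI[of _ i]) (auto simp: Pl a_def)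
    qed simp
    moreover have dP: "det P = det Q" unfolding P_def by (rule det_addcol[OF ij(2,3) Q])
    moreover have "mat_lattice P = mat_lattice Q" unfolding P_def by (rule mat_lattice_addcol[OF Q ij(1-3)])
    ultimately show ?thesis using less.hyps[OF _ P] less.prems(2) by metis
  next
    case False
    have "\<exists>i<n. Q $$ (0, i) \<noteq> 0"
    proof (rule ccontr)
      assume "\<not> (\<exists>i<n. Q $$ (0, i) \<noteq> 0)"
      then have "det Q = 0" using laplace_expansion_row[OF Q n] by simp
      then show False using less.prems(2) by simp
    qed
    then obtain i where i: "i < n" "Q $$ (0, i) \<noteq> 0" by blast
    have other: "Q $$ (0, j) = 0" if "j < n" "j \<noteq> i" for j
      using False that i by (metis linear)
    show ?thesis
    proof (cases "i = 0")
      case True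
      then show ?thesis using Q other by (intro exI[of _ Q]) auto
    next
      case False
      have "\<bar>det (swapcols 0 i Q)\<bar> = \<bar>det Q\<bar>" using det_swapcols[OF n i(1) _ Q] False by simp
      then show ?thesis using Q other i n False mat_lattice_swapcols[OF Q n i(1)]
        by (intro exI[of _ "swapcols 0 i Q"]) auto
    qed
  qed
qed

text \<open>With first row (g, 0, ..., 0) a lattice vector has first entry g q and tail in q c plus
  the lattice of the minor M, where c is the rest of the first column. A transversal is therefore
  given by the residues modulo |g| together with a transversal for M, and the determinant is g times
  that of M.\<close>

lemma has_reps_det:
  assumes "Q \<in> carrier_mat n n" "det Q \<noteq> 0"
  shows "has_reps n (mat_lattice Q) (nat \<bar>det Q\<bar>)"
  using assms
proof (induction n arbitrary: Q)
  case 0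
  have c0: "x = 0\<^sub>v 0" if "x \<in> carrier_vec 0" for x :: "int vec" using that by auto
  have "det Q = 1" using 0 by (simp add: det_dim_zero)
  moreover have "has_reps 0 (mat_lattice Q) 1"
    unfolding has_reps_def
  proof (intro exI[of _ "{0\<^sub>v 0}"] conjI ballI)
    fix x :: "int vec" assume x: "x \<in> carrier_vec 0"
    have "x - 0\<^sub>v 0 = Q *\<^sub>v 0\<^sub>v 0" by (rule eq_vecI) (use x 0 in auto)
    then have "x - 0\<^sub>v 0 \<in> mat_lattice Q" using 0(1) by (auto simp: mat_lattice_def)
    then show "\<exists>!r. r \<in> {0\<^sub>v 0} \<and> x - r \<in> mat_lattice Q" by auto
  qed auto
  ultimately show ?case by simp
next
  case (Suc n)
  obtain Q' where Q': "Q' \<in> carrier_mat (Suc n) (Suc n)" "\<bar>det Q'\<bar> = \<bar>det Q\<bar>" "mat_lattice Q' = mat_lattice Q"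
    "\<And>j. 0 < j \<Longrightarrow> j < Suc n \<Longrightarrow> Q' $$ (0, j) = 0"
    using has_reps_clear_first_row[OF Suc.prems(1) _ Suc.prems(2)] by auto
  define g where "g = Q' $$ (0, 0)"
  define M where "M = mat_delete Q' 0 0"
  define c where "c = vec n (\<lambda>i. Q' $$ (Suc i, 0))"
  have M: "M \<in> carrier_mat n n" using Q'(1) by (simp add: M_def mat_delete_def)
  have "det Q' = (\<Sum>j<Suc n. Q' $$ (0, j) * cofactor Q' 0 j)" by (rule laplace_expansion_row[OF Q'(1)]) simp
  also have "\<dots> = g * cofactor Q' 0 0"
    by (simp add: sum.lessThan_Suc_shift Q'(4) g_def del: sum.lessThan_Suc)
  finally have detQ': "det Q' = g * det M" by (simp add: cofactor_def M_def)
  then have gM: "g \<noteq> 0" "det M \<noteq> 0" using Q'(2) Suc.prems(2) by auto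
  obtain T where T: "finite T" "card T = nat \<bar>det M\<bar>" "T \<subseteq> carrier_vec n"
    "\<And>x. x \<in> carrier_vec n \<Longrightarrow> \<exists>!r. r \<in> T \<and> x - r \<in> mat_lattice M"
    using Suc.IH[OF M gM(2)] unfolding has_reps_def by auto
  have mult: "Q' *\<^sub>v vCons a m = vCons (g * a) (a \<cdot>\<^sub>v c + M *\<^sub>v m)" if "m \<in> carrier_vec n" for a m
  proof (rule eq_vecI)
    fix i assume "i < dim_vec (vCons (g * a) (a \<cdot>\<^sub>v c + M *\<^sub>v m))"
    then have i: "i < Suc n" using M by (simp add: c_def)
    have "(Q' *\<^sub>v vCons a m) $ i = (\<Sum>j<Suc n. Q' $$ (i, j) * vCons a m $ j)"
      using Q'(1) i that by (auto simp: scalar_prod_def atLeast0LessThan intro!: sum.cong)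
    also have "\<dots> = Q' $$ (i, 0) * a + (\<Sum>j<n. Q' $$ (i, Suc j) * m $ j)"
      by (simp add: sum.lessThan_Suc_shift del: sum.lessThan_Suc)
    also have "\<dots> = vCons (g * a) (a \<cdot>\<^sub>v c + M *\<^sub>v m) $ i"
    proof (cases i)
      case 0
      then show ?thesis using Q'(4) by (simp add: g_def)
    next
      case (Suc i')
      have "M $$ (i', j) = Q' $$ (Suc i', Suc j)" if "j < n" for j
        using that Q'(1) Suc i by (simp add: M_def mat_delete_def)
      then show ?thesis using Suc i that M
        by (auto simp: c_def scalar_prod_def atLeast0LessThan mult.commute intro!: sum.cong)
    qed
    finally show "(Q' *\<^sub>v vCons a m) $ i = vCons (g * a) (a \<cdot>\<^sub>v c + M *\<^sub>v m) $ i" .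
  qed (use Q'(1) M in \<open>simp add: c_def\<close>)
  have dec: "\<exists>a m. x = vCons a m \<and> m \<in> carrier_vec n" if "x \<in> carrier_vec (Suc n)" for x :: "int vec"
    using that by (cases x) auto
  \<comment> \<open>The first entries fix q, which then only translates the tail by q c.\<close>
  have lat: "vCons a x - vCons b y \<in> mat_lattice Q' \<longleftrightarrow> (\<exists>q. a - b = g * q \<and> (x - q \<cdot>\<^sub>v c) - y \<in> mat_lattice M)"
    if xy: "x \<in> carrier_vec n" "y \<in> carrier_vec n" for a b x y
  proof -
    have "vCons a x - vCons b y = vCons (a - b) (x - y)" using xy
      by (intro eq_vecI) (auto simp: vCons_def split: nat.splits)
    moreover have "vCons (a - b) (x - y) \<in> mat_lattice Q' \<longleftrightarrow> (\<exists>q m. m \<in> carrier_vec n \<and> vCons (a - b) (x - y) = vCons (g * q) (q \<cdot>\<^sub>v c + M *\<^sub>v m))"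
    proof
      assume "vCons (a - b) (x - y) \<in> mat_lattice Q'"
      then obtain z where z: "z \<in> carrier_vec (Suc n)" "vCons (a - b) (x - y) = Q' *\<^sub>v z"
        using Q'(1) by (auto simp: mat_lattice_def)
      then obtain q m where "z = vCons q m" "m \<in> carrier_vec n" using dec by blast
      then show "\<exists>q m. m \<in> carrier_vec n \<and> vCons (a - b) (x - y) = vCons (g * q) (q \<cdot>\<^sub>v c + M *\<^sub>v m)"
        using z mult by auto
    next
      assume "\<exists>q m. m \<in> carrier_vec n \<and> vCons (a - b) (x - y) = vCons (g * q) (q \<cdot>\<^sub>v c + M *\<^sub>v m)"
      then obtain q m where "m \<in> carrier_vec n" "vCons (a - b) (x - y) = Q' *\<^sub>v vCons q m" using mult by auto
      then show "vCons (a - b) (x - y) \<in> mat_lattice Q'" using Q'(1)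
        by (auto simp: mat_lattice_def intro!: exI[of _ "vCons q m"])
    qed
    moreover have "(x - y = q \<cdot>\<^sub>v c + M *\<^sub>v m) = (x - q \<cdot>\<^sub>v c - y = M *\<^sub>v m)" if "m \<in> carrier_vec n" for q m
    proof -
      have d: "dim_vec c = n" "dim_vec x = n" "dim_vec y = n" "dim_vec (M *\<^sub>v m) = n" using xy M by (auto simp: c_def)
      show ?thesis using d unfolding vec_eq_iff by (auto simp: algebra_simps)
    qed
    ultimately show ?thesis using M unfolding mat_lattice_def by auto
  qed
  define T' where "T' = (\<lambda>(b, y). vCons b y) ` ({0..<\<bar>g\<bar>} \<times> T)"
  have inj: "inj_on (\<lambda>(b, y). vCons b y) ({0..<\<bar>g\<bar>} \<times> T)" by (auto simp: inj_on_def vCons_eq_vCons)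
  have "card T' = nat \<bar>g\<bar> * nat \<bar>det M\<bar>" unfolding T'_def card_image[OF inj] using T(2) by (simp add: card_cartesian_product)
  then have cT': "card T' = nat \<bar>det Q\<bar>" using detQ' Q'(2) by (metis abs_ge_zero abs_mult nat_mult_distrib)
  have "\<exists>!r. r \<in> T' \<and> x - r \<in> mat_lattice Q'" if x: "x \<in> carrier_vec (Suc n)" for x
  proof -
    obtain a z where az: "x = vCons a z" "z \<in> carrier_vec n" using dec[OF x] by blast
    define b where "b = a mod \<bar>g\<bar>"
    define q where "q = (a - b) div g"
    have b: "b \<in> {0..<\<bar>g\<bar>}" using gM by (simp add: b_def)
    have "\<bar>g\<bar> dvd a - b" by (simp add: b_def)
    then have q: "a - b = g * q" using gM by (simp add: q_def)
    have zq: "z - q \<cdot>\<^sub>v c \<in> carrier_vec n" using az by (simp add: c_def)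
    obtain r where r: "r \<in> T" "z - q \<cdot>\<^sub>v c - r \<in> mat_lattice M"
      "\<And>r'. r' \<in> T \<Longrightarrow> z - q \<cdot>\<^sub>v c - r' \<in> mat_lattice M \<Longrightarrow> r' = r" using T(4)[OF zq] by blast
    show ?thesis
    proof (rule ex1I[of _ "vCons b r"])
      show "vCons b r \<in> T' \<and> x - vCons b r \<in> mat_lattice Q'"
      proof
        show "vCons b r \<in> T'" unfolding T'_def
          by (rule image_eqI[of _ _ "(b, r)"]) (use b r(1) in auto)
        have rc: "r \<in> carrier_vec n" using r(1) T(3) by blast
        show "x - vCons b r \<in> mat_lattice Q'" unfolding az(1) lat[OF az(2) rc] using q r(2) by blast
      qed
      fix y assume y: "y \<in> T' \<and> x - y \<in> mat_lattice Q'"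
      then obtain b' r' where b': "b' \<in> {0..<\<bar>g\<bar>}" "r' \<in> T" "y = vCons b' r'" by (auto simp: T'_def)
      then obtain q' where q': "a - b' = g * q'" "z - q' \<cdot>\<^sub>v c - r' \<in> mat_lattice M"
      proof -
        have rc: "r' \<in> carrier_vec n" using b'(2) T(3) by blast
        have "\<exists>q. a - b' = g * q \<and> z - q \<cdot>\<^sub>v c - r' \<in> mat_lattice M"
          using y unfolding b'(3) az(1) lat[OF az(2) rc] by blast
        then show thesis using that by blast
      qed
      have "b' = a mod \<bar>g\<bar>"
      proof -
        have "a = b' + g * q'" using q'(1) by simp
        then have "a mod \<bar>g\<bar> = b' mod \<bar>g\<bar>" by (metis abs_dvd_iff dvd_triv_left mod_add_right_eq add.right_neutral mod_0_imp_dvd dvd_imp_mod_0)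
        then show ?thesis using b'(1) by simp
      qed
      then have "b' = b" by (simp add: b_def)
      then have "q' = q" using q q'(1) gM by simp
      then show "y = vCons b r" using b' r(3) q'(2) \<open>b' = b\<close> by simp
    qed
  qed
  then have "has_reps (Suc n) (mat_lattice Q') (nat \<bar>det Q\<bar>)"
    unfolding has_reps_def using cT' T(1,3) by (intro exI[of _ T']) (auto simp: T'_def)
  then show ?case using Q'(3) by simp
qed

section \<open>Matrices indexed by finite sets of natural numbers\<close>

definition enum :: "nat set \<Rightarrow> nat \<Rightarrow> nat" where
  "enum S i = sorted_list_of_set S ! i"

lemma bij_betw_enum: "finite S \<Longrightarrow> bij_betw (enum S) {..<card S} S"
  unfolding enum_def using bij_betw_nth[of "sorted_list_of_set S" "{..<card S}" S] by simp

lemma enum_mem: "finite S \<Longrightarrow> i < card S \<Longrightarrow> enum S i \<in> S"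
  using bij_betw_enum bij_betwE by blast

lemma sum_enum: "finite S \<Longrightarrow> (\<Sum>i<card S. f (enum S i)) = sum f S"
  by (rule sum.reindex_bij_betw[OF bij_betw_enum])

lemma enumE:
  assumes "finite S" "x \<in> S" obtains i where "i < card S" "x = enum S i"
  using bij_betw_imp_surj_on[OF bij_betw_enum[OF assms(1)]] assms(2) by auto

lemma enum_inj: "finite S \<Longrightarrow> i < card S \<Longrightarrow> j < card S \<Longrightarrow> enum S i = enum S j \<longleftrightarrow> i = j"
  using bij_betw_imp_inj_on[OF bij_betw_enum] by (metis inj_onD lessThan_iff)

definition submat :: "nat set \<Rightarrow> nat set \<Rightarrow> (nat \<Rightarrow> nat \<Rightarrow> 'a) \<Rightarrow> 'a mat" where
  "submat R K A = mat (card R) (card R) (\<lambda>(a, b). A (enum R a) (enum K b))"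

lemma submat_carrier: "submat R K A \<in> carrier_mat (card R) (card R)"
  by (simp add: submat_def)

text \<open>Inverse matrices as functions on index sets. They serve twice: to solve linear equations
  for a chosen set of coordinates, and as the matrix V of \<open>log_system\<close>.\<close>

lemma submat_inverse:
  fixes A :: "nat \<Rightarrow> nat \<Rightarrow> 'a::field"
  assumes R: "finite R" and K: "finite K" and c: "card R = card K" and det: "det (submat R K A) \<noteq> 0"
  shows "\<exists>B. (\<forall>a\<in>K. \<forall>b\<in>K. (\<Sum>r\<in>R. B a r * A r b) = (if a = b then 1 else 0)) \<and>
    (\<forall>r\<in>R. \<forall>r'\<in>R. (\<Sum>a\<in>K. A r a * B a r') = (if r = r' then 1 else 0))"
proof -
  define n where "n = card R"
  define M where "M = submat R K A"
  have M: "M \<in> carrier_mat n n" by (simp add: M_def n_def submat_def)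
  obtain N where N: "N \<in> carrier_mat n n" "N * M = 1\<^sub>m n" "M * N = 1\<^sub>m n"
    using det_non_zero_imp_unit[OF M det[folded M_def], of "()"]
    unfolding Units_def ring_mat_def by auto
  define B where "B = (\<lambda>x y. N $$ (the_inv_into {..<n} (enum K) x, the_inv_into {..<n} (enum R) y))"
  have inv: "the_inv_into {..<n} (enum K) (enum K i) = i" "the_inv_into {..<n} (enum R) (enum R i) = i" if "i < n" for i
    using that bij_betw_imp_inj_on[OF bij_betw_enum[OF K]] bij_betw_imp_inj_on[OF bij_betw_enum[OF R]] c
    by (auto simp: n_def intro!: the_inv_into_f_f)
  show ?thesis
  proof (intro exI[of _ B] conjI ballI)
    fix a b assume ab: "a \<in> K" "b \<in> K"
    obtain i where i: "i < n" "a = enum K i" using enumE[OF K ab(1)] c by (auto simp: n_def)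
    obtain j where j: "j < n" "b = enum K j" using enumE[OF K ab(2)] c by (auto simp: n_def)
    have "(\<Sum>r\<in>R. B a r * A r b) = (\<Sum>l<n. N $$ (i, l) * M $$ (l, j))"
      unfolding sum_enum[OF R, symmetric] n_def[symmetric] i(2) j(2) B_def
      by (rule sum.cong) (use i j inv in \<open>auto simp: M_def submat_def n_def\<close>)
    also have "\<dots> = (N * M) $$ (i, j)" using i j N(1) M by (simp add: scalar_prod_def atLeast0LessThan)
    finally show "(\<Sum>r\<in>R. B a r * A r b) = (if a = b then 1 else 0)"
      using N(2) i j enum_inj[OF K, of i j] c by (simp add: n_def)
  next
    fix r r' assume ab: "r \<in> R" "r' \<in> R"
    obtain i where i: "i < n" "r = enum R i" using enumE[OF R ab(1)] by (auto simp: n_def)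
    obtain j where j: "j < n" "r' = enum R j" using enumE[OF R ab(2)] by (auto simp: n_def)
    have "(\<Sum>a\<in>K. A r a * B a r') = (\<Sum>l<n. M $$ (i, l) * N $$ (l, j))"
      unfolding sum_enum[OF K, symmetric] c[symmetric] n_def[symmetric] i(2) j(2) B_def
      by (rule sum.cong) (use i j inv in \<open>auto simp: M_def submat_def n_def\<close>)
    also have "\<dots> = (M * N) $$ (i, j)" using i j N(1) M by (simp add: scalar_prod_def atLeast0LessThan)
    finally show "(\<Sum>a\<in>K. A r a * B a r') = (if r = r' then 1 else 0)"
      using N(3) i j enum_inj[OF R, of i j] by (simp add: n_def)
  qed
qed

text \<open>A kernel vector of the transposed matrix; the integers are an integral domain, so it can
  be taken with integer entries.\<close>

lemma submat_singular:
  fixes A :: "nat \<Rightarrow> nat \<Rightarrow> int"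
  assumes R: "finite R" and K: "finite K" and c: "card R = card K" and det: "det (submat R K A) = 0"
  shows "\<exists>h. (\<exists>r\<in>R. h r \<noteq> 0) \<and> (\<forall>b\<in>K. (\<Sum>r\<in>R. h r * A r b) = 0)"
proof -
  define n where "n = card R"
  define M where "M = transpose_mat (submat R K A)"
  have M: "M \<in> carrier_mat n n" by (simp add: M_def n_def submat_def)
  have "det M = 0" unfolding M_def using det det_transpose[OF submat_carrier] by metis
  then obtain v where v: "v \<in> carrier_vec n" "v \<noteq> 0\<^sub>v n" "M *\<^sub>v v = 0\<^sub>v n"
    using det_0_iff_vec_prod_zero[OF M] by blast
  define h where "h = (\<lambda>x. v $ the_inv_into {..<n} (enum R) x)"
  have hi: "h (enum R i) = v $ i" if "i < n" for i
    using that bij_betw_imp_inj_on[OF bij_betw_enum[OF R]] by (simp add: h_def n_def the_inv_into_f_f)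
  obtain i where "i < n" "v $ i \<noteq> 0" using v(1,2) by (metis eq_vecI carrier_vecD index_zero_vec(1,2))
  then have "\<exists>r\<in>R. h r \<noteq> 0" using hi enum_mem[OF R] by (metis n_def)
  moreover have "(\<Sum>r\<in>R. h r * A r b) = 0" if bK: "b \<in> K" for b
  proof -
    obtain j where j: "j < n" "b = enum K j" using enumE[OF K bK] c by (auto simp: n_def)
    have "(\<Sum>r\<in>R. h r * A r b) = (\<Sum>l<n. M $$ (j, l) * v $ l)"
      unfolding sum_enum[OF R, symmetric] n_def[symmetric] j(2)
      by (rule sum.cong) (use j hi in \<open>auto simp: M_def submat_def n_def\<close>)
    also have "\<dots> = (M *\<^sub>v v) $ j" using j v(1) M by (simp add: scalar_prod_def atLeast0LessThan)
    finally show ?thesis using v(3) j by simp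
  qed
  ultimately show ?thesis by blast
qed

section \<open>Solutions in logarithmic coordinates\<close>

lemma norm_exp_diff_le:
  assumes "Re a \<le> ln r" "Re b \<le> ln r" "r > 0"
  shows "cmod (exp a - exp b) \<le> r * cmod (a - b)"
proof (rule field_differentiable_bound[of "{z. Re z \<le> ln r}" exp exp])
  show "cmod (exp z) \<le> r" if "z \<in> {z. Re z \<le> ln r}" for z
    using that assms(3) by (simp add: norm_exp_eq_Re) (metis exp_le_cancel_iff exp_ln)
  show "(exp has_field_derivative exp z) (at z within {z. Re z \<le> ln r})" for z :: complex
    by (auto intro!: derivative_eq_intros)
qed (use assms in \<open>auto simp: convex_halfspace_Re_le\<close>)

lemma norm_Ln_diff_le:
  assumes "cmod a \<le> 1 / 2" "cmod b \<le> 1 / 2"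
  shows "cmod (Ln (1 + a) - Ln (1 + b)) \<le> 2 * cmod (a - b)"
proof (rule field_differentiable_bound[of "cball 0 (1/2)" "\<lambda>z. Ln (1 + z)" "\<lambda>z. 1 / (1 + z)"])
  fix z :: complex assume z: "z \<in> cball 0 (1/2)"
  have "Re (1 + z) > 0" using z abs_Re_le_cmod[of z] by auto
  then have nz: "1 + z \<notin> \<real>\<^sub>\<le>\<^sub>0" by (simp only: complex_nonpos_Reals_iff not_le de_Morgan_conj) simp
  have "((\<lambda>z. 1 + z) has_field_derivative 1) (at z within cball 0 (1/2))"
    using DERIV_add[OF DERIV_const DERIV_ident] by simp
  then have "((\<lambda>z. Ln (1 + z)) has_field_derivative inverse (1 + z) * 1) (at z within cball 0 (1/2))"
    by (rule DERIV_chain2[where f = Ln and g = "\<lambda>z. 1 + z" and x = z, OF has_field_derivative_Ln[OF nz]])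
  then show "((\<lambda>z. Ln (1 + z)) has_field_derivative 1 / (1 + z)) (at z within cball 0 (1/2))"
    by (simp only: divide_inverse mult_1 mult_1_right)
  have "1 / 2 \<le> cmod (1 + z)" using z norm_triangle_ineq4[of "1 + z" z] by auto
  then show "cmod (1 / (1 + z)) \<le> 2" by (simp add: norm_divide divide_le_eq)
qed (use assms in auto)

text \<open>Banach iteration from Z0. The sum over J is only a seminorm on functions on all natural
  numbers, so convergence is established coordinatewise on J. The constants 1/2 keep the n-th
  iterate within distance 1 - (1/2) ^ n of Z0, inside the ball where the contraction estimate
  holds.\<close>

lemma contraction_fixed_point:
  fixes \<Phi> :: "(nat \<Rightarrow> complex) \<Rightarrow> nat \<Rightarrow> complex"
  assumes J: "finite J"
    and lip: "\<And>Z Z'. (\<Sum>j\<in>J. cmod (Z j - Z0 j)) \<le> 1 \<Longrightarrow> (\<Sum>j\<in>J. cmod (Z' j - Z0 j)) \<le> 1 \<Longrightarrow>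
      (\<Sum>j\<in>J. cmod (\<Phi> Z j - \<Phi> Z' j)) \<le> 1 / 2 * (\<Sum>j\<in>J. cmod (Z j - Z' j))"
    and start: "(\<Sum>j\<in>J. cmod (\<Phi> Z0 j - Z0 j)) \<le> 1 / 2"
  shows "\<exists>Z. (\<Sum>j\<in>J. cmod (Z j - Z0 j)) \<le> 1 \<and> (\<forall>j\<in>J. \<Phi> Z j = Z j)"
proof -
  define N where "N = (\<lambda>Z Z' :: nat \<Rightarrow> complex. \<Sum>j\<in>J. cmod (Z j - Z' j))"
  have tri: "N a c \<le> N a b + N b c" for a b c unfolding N_def sum.distrib[symmetric]
  proof (rule sum_mono)
    fix j show "cmod (a j - c j) \<le> cmod (a j - b j) + cmod (b j - c j)"
      using norm_triangle_ineq[of "a j - b j" "b j - c j"] by simp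
  qed
  define X where "X = (\<lambda>n. (\<Phi> ^^ n) Z0)"
  have XS: "X (Suc n) = \<Phi> (X n)" for n by (simp add: X_def)
  have lip: "N Z Z0 \<le> 1 \<Longrightarrow> N Z' Z0 \<le> 1 \<Longrightarrow> N (\<Phi> Z) (\<Phi> Z') \<le> 1 / 2 * N Z Z'" for Z Z'
    unfolding N_def by (rule lip)
  have X: "N (X n) Z0 \<le> 1 - (1 / 2) ^ n \<and> N (X (Suc n)) (X n) \<le> (1 / 2) ^ Suc n" for n
  proof (induction n)
    case 0 show ?case using start by (simp add: X_def N_def)
  next
    case (Suc n)
    have p: "(1 / 2 :: real) ^ Suc n = (1 / 2) ^ n / 2" "(1 / 2 :: real) ^ Suc (Suc n) = (1 / 2) ^ Suc n / 2" by simp_all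
    have b: "N (X (Suc n)) Z0 \<le> 1 - (1 / 2) ^ Suc n"
      using tri[of "X (Suc n)" Z0 "X n"] Suc p(1) by linarith
    have "N (X (Suc (Suc n))) (X (Suc n)) \<le> 1 / 2 * N (X (Suc n)) (X n)"
      unfolding XS[of "Suc n"] XS[of n]
    proof (rule lip)
      show "N (\<Phi> (X n)) Z0 \<le> 1" using b unfolding XS by (rule order_trans) simp
      show "N (X n) Z0 \<le> 1" using Suc by (rule conjE) (erule order_trans, simp)
    qed
    then show ?case using b Suc p by (intro conjI) linarith+
  qed
  have sX: "summable (\<lambda>n. X (Suc n) j - X n j)" if "j \<in> J" for j
  proof (rule summable_comparison_test[of _ "\<lambda>n. (1/2) ^ Suc n"])
    have "cmod (X (Suc n) j - X n j) \<le> N (X (Suc n)) (X n)" for n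
      unfolding N_def using J that by (intro member_le_sum) auto
    then show "\<exists>n0. \<forall>n\<ge>n0. cmod (X (Suc n) j - X n j) \<le> (1/2) ^ Suc n"
      using X order_trans by blast
    show "summable (\<lambda>n. (1/2::real) ^ Suc n)" by (intro summable_mult summable_geometric[THEN summable_Suc_iff[THEN iffD2]]) auto
  qed
  define Z where "Z = (\<lambda>j. lim (\<lambda>n. X n j))"
  have conv: "(\<lambda>n. X n j) \<longlonglongrightarrow> Z j" if "j \<in> J" for j
  proof -
    have "(\<lambda>n. \<Sum>i<n. X (Suc i) j - X i j) = (\<lambda>n. X n j - X 0 j)"
      by (rule ext) (rule sum_lessThan_telescope)
    then have "convergent (\<lambda>n. X n j - X 0 j)" using sX[OF that] summable_iff_convergent by metis
    then have "convergent (\<lambda>n. X n j)" by (simp add: convergent_diff_const_right_iff)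
    then show ?thesis unfolding Z_def by (simp add: convergent_LIMSEQ_iff)
  qed
  have Nlim: "(\<lambda>n. N (X n) Y) \<longlonglongrightarrow> N Z Y" for Y
    unfolding N_def by (intro tendsto_sum tendsto_norm tendsto_diff conv tendsto_const)
  have Z1: "N Z Z0 \<le> 1"
    by (rule LIMSEQ_le_const2[OF Nlim]) (use X in \<open>metis diff_le_eq le_add_same_cancel1 order_trans zero_le_power zero_le_divide_1_iff zero_le_numeral\<close>)
  have "N (\<Phi> Z) Z \<le> 0"
  proof (rule LIMSEQ_le_const[of "\<lambda>n. 1 / 2 * N (X n) Z + N (X (Suc n)) Z"])
    have "(\<lambda>n. 1 / 2 * N (X n) Z + N (X (Suc n)) Z) \<longlonglongrightarrow> 1 / 2 * N Z Z + N Z Z"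
      using LIMSEQ_Suc[OF Nlim[of Z]] by (intro tendsto_intros Nlim) auto
    then show "(\<lambda>n. 1 / 2 * N (X n) Z + N (X (Suc n)) Z) \<longlonglongrightarrow> 0" by (simp add: N_def)
    have "N (\<Phi> Z) Z \<le> 1 / 2 * N (X n) Z + N (X (Suc n)) Z" for n
    proof -
      have "N (X n) Z0 \<le> 1" using X[of n] by (rule conjE) (erule order_trans, simp)
      then have "N (\<Phi> Z) (\<Phi> (X n)) \<le> 1 / 2 * N Z (X n)" using Z1 by (intro lip)
      moreover have "N Z (X n) = N (X n) Z" by (simp add: N_def norm_minus_commute)
      ultimately show ?thesis using tri[of "\<Phi> Z" Z "\<Phi> (X n)"] by (simp add: XS)
    qed
    then show "\<exists>n0. \<forall>n\<ge>n0. N (\<Phi> Z) Z \<le> 1 / 2 * N (X n) Z + N (X (Suc n)) Z" by blast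
  qed
  then have "(\<Sum>j\<in>J. cmod (\<Phi> Z j - Z j)) = 0" unfolding N_def by (intro antisym sum_nonneg) auto
  then have "\<forall>j\<in>J. \<Phi> Z j = Z j" using J by (simp add: sum_nonneg_eq_0_iff)
  then show ?thesis using Z1 unfolding N_def by blast
qed

text \<open>In the coordinates \<open>Z j = log (x j)\<close> for \<open>j \<in> J\<close>, the other coordinates of a point of the
  source subspace are \<open>x j = exp (P j) * (1 + \<Sum> A j l * x l)\<close>, and the ratios of the monomials are
  \<open>exp (Y i)\<close>; membership in the target subspace says that \<open>E i\<close> is a multiple of \<open>2 * pi * \<i>\<close>.
  Up to a perturbation with a small Lipschitz constant, \<open>E\<close> is affine with linear part \<open>g\<close>.\<close>

locale log_system =
  fixes d :: nat and I J K :: "nat set" and g :: "nat \<Rightarrow> nat \<Rightarrow> int"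
    and \<alpha> P Q :: "nat \<Rightarrow> complex" and A B V :: "nat \<Rightarrow> nat \<Rightarrow> complex" and C \<delta> :: real
  assumes J: "J \<subseteq> {..d}" and I: "I \<subseteq> {..d}" and K: "K \<subseteq> {..d}"
    and C: "C \<ge> 1" "real (card J) \<le> C"
    and A: "\<And>j. j \<le> d \<Longrightarrow> (\<Sum>l\<in>J. cmod (A j l)) \<le> C"
    and B: "\<And>i. i \<le> d \<Longrightarrow> (\<Sum>l\<in>I. cmod (B i l)) \<le> C"
    and g: "\<And>i. i \<le> d \<Longrightarrow> (\<Sum>j\<le>d. \<bar>real_of_int (g i j)\<bar>) \<le> C"
    and V: "\<And>j. j \<in> J \<Longrightarrow> (\<Sum>b\<in>K. cmod (V j b)) \<le> C"
    and left_inv: "\<And>a b. a \<in> J \<Longrightarrow> b \<in> J \<Longrightarrow> (\<Sum>i\<in>K. V a i * of_int (g i b)) = (if a = b then 1 else 0)"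
    and right_inv: "\<And>a b. a \<in> K \<Longrightarrow> b \<in> K \<Longrightarrow> (\<Sum>j\<in>J. of_int (g a j) * V j b) = (if a = b then 1 else 0)"
    and \<delta>: "\<delta> > 0" "8 * C ^ 4 * \<delta> \<le> 1"
begin

definition "u j Z = (\<Sum>l\<in>J. A j l * exp (Z l))"
definition "lx j Z = (if j \<in> J then Z j else P j + Ln (1 + u j Z))"
definition "Y i Z = \<alpha> i + (\<Sum>j\<le>d. of_int (g i j) * lx j Z)"
definition "v i Z = (\<Sum>l\<in>I. B i l * exp (Y l Z))"
definition "E i Z = Y i Z - Q i - Ln (1 + v i Z)"
definition "\<beta> i = \<alpha> i + (\<Sum>j\<in>{..d} - J. of_int (g i j) * P j) - Q i"
definition "pert i Z = (\<Sum>j\<in>{..d} - J. of_int (g i j) * Ln (1 + u j Z)) - Ln (1 + v i Z)"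
definition "N Z Z' = (\<Sum>j\<in>J. cmod (Z j - Z' j))" for Z Z' :: "nat \<Rightarrow> complex"
text \<open>Only real parts are restricted, so the domain is invariant under shifts by integer
  multiples of 2 pi i. On it u and v have modulus at most C times \<delta>, hence at most 1/8, which
  keeps 1 + u and 1 + v away from 0 and from the cut of \<open>Ln\<close>.\<close>

definition "small_dom = {Z. (\<forall>j\<in>J. Re (Z j) \<le> ln \<delta>) \<and> (\<forall>l\<in>I. Re (Y l Z) \<le> ln \<delta>)}"

lemma finJ: "finite J" and finI: "finite I" and finK: "finite K"
  using J I K by (auto intro: finite_subset)

lemma Y_split: "Y i Z = \<alpha> i + (\<Sum>j\<in>J. of_int (g i j) * Z j)
    + (\<Sum>j\<in>{..d} - J. of_int (g i j) * P j) + (\<Sum>j\<in>{..d} - J. of_int (g i j) * Ln (1 + u j Z))"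
proof -
  have "(\<Sum>j\<le>d. of_int (g i j) * lx j Z) = (\<Sum>j\<in>{..d} - J. of_int (g i j) * lx j Z) + (\<Sum>j\<in>J. of_int (g i j) * lx j Z)"
    by (rule sum.subset_diff[OF J finite_atMost])
  moreover have "(\<Sum>j\<in>J. of_int (g i j) * lx j Z) = (\<Sum>j\<in>J. of_int (g i j) * Z j)"
    by (rule sum.cong) (simp_all add: lx_def)
  moreover have "(\<Sum>j\<in>{..d} - J. of_int (g i j) * lx j Z)
      = (\<Sum>j\<in>{..d} - J. of_int (g i j) * P j) + (\<Sum>j\<in>{..d} - J. of_int (g i j) * Ln (1 + u j Z))"
    unfolding sum.distrib[symmetric] by (rule sum.cong) (simp_all add: lx_def distrib_left)
  ultimately show ?thesis unfolding Y_def by (simp only: ac_simps)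
qed

lemma E_split: "E i Z = (\<Sum>j\<in>J. of_int (g i j) * Z j) + \<beta> i + pert i Z"
  unfolding E_def Y_split \<beta>_def pert_def by simp

lemma N_nonneg: "N Z Z' \<ge> 0" unfolding N_def by (rule sum_nonneg) simp

lemma C\<delta>: "C * \<delta> \<le> 1 / 8"
proof -
  have "C * 1 \<le> C * C ^ 3" using C by (intro mult_left_mono) auto
  then have "C \<le> C ^ 4" by (simp add: power4_eq_xxxx power3_eq_cube mult.assoc)
  then have "8 * (C * \<delta>) \<le> 8 * C ^ 4 * \<delta>" using \<delta>(1) by (simp add: mult_right_mono)
  then show ?thesis using \<delta>(2) by simp
qed

lemma lin_comb_bound:
  assumes "\<And>l. l \<in> S \<Longrightarrow> cmod (z l) \<le> r" "(\<Sum>l\<in>S. cmod (c l)) \<le> D" "r \<ge> 0"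
  shows "cmod (\<Sum>l\<in>S. c l * z l) \<le> D * r"
proof -
  have "cmod (\<Sum>l\<in>S. c l * z l) \<le> (\<Sum>l\<in>S. cmod (c l) * r)"
    by (rule sum_norm_le) (auto simp: norm_mult intro!: mult_left_mono assms)
  also have "\<dots> \<le> D * r" using assms by (simp add: sum_distrib_right[symmetric] mult_right_mono)
  finally show ?thesis .
qed

lemma norm_exp_le: "Re z \<le> ln \<delta> \<Longrightarrow> cmod (exp z) \<le> \<delta>"
  using \<delta>(1) by (simp add: norm_exp_eq_Re) (metis exp_le_cancel_iff exp_ln)

lemma u_small: assumes "\<forall>j\<in>J. Re (Z j) \<le> ln \<delta>" "j \<le> d" shows "cmod (u j Z) \<le> C * \<delta>"
  unfolding u_def by (rule lin_comb_bound) (use assms A \<delta> norm_exp_le in auto)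

lemma v_small: assumes "Z \<in> small_dom" "i \<le> d" shows "cmod (v i Z) \<le> C * \<delta>"
  unfolding v_def by (rule lin_comb_bound) (use assms B \<delta> norm_exp_le in \<open>auto simp: small_dom_def\<close>)

lemma g_sum_le: assumes "i \<le> d" "S \<subseteq> {..d}" shows "(\<Sum>j\<in>S. cmod (of_int (g i j))) \<le> C"
proof -
  have "(\<Sum>j\<in>S. cmod (of_int (g i j))) \<le> (\<Sum>j\<le>d. \<bar>real_of_int (g i j)\<bar>)"
    using assms by (simp add: sum_mono2)
  then show ?thesis using g[OF assms(1)] by linarith
qed

lemma member_le_N: "j \<in> J \<Longrightarrow> cmod (Z j - Z' j) \<le> N Z Z'"
  unfolding N_def using finJ by (intro member_le_sum) auto

lemma u_lip:
  assumes "\<forall>j\<in>J. Re (Z j) \<le> ln \<delta>" "\<forall>j\<in>J. Re (Z' j) \<le> ln \<delta>" "j \<le> d"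
  shows "cmod (Ln (1 + u j Z) - Ln (1 + u j Z')) \<le> 2 * C * \<delta> * N Z Z'"
proof -
  have "u j Z - u j Z' = (\<Sum>l\<in>J. A j l * (exp (Z l) - exp (Z' l)))"
    by (simp add: u_def sum_subtractf right_diff_distrib)
  moreover have "cmod (\<Sum>l\<in>J. A j l * (exp (Z l) - exp (Z' l))) \<le> C * (\<delta> * N Z Z')"
  proof (rule lin_comb_bound)
    fix l assume l: "l \<in> J"
    have "cmod (exp (Z l) - exp (Z' l)) \<le> \<delta> * cmod (Z l - Z' l)"
      using assms l \<delta> by (intro norm_exp_diff_le) auto
    also have "\<dots> \<le> \<delta> * N Z Z'" using \<delta> member_le_N[OF l] by (intro mult_left_mono) auto
    finally show "cmod (exp (Z l) - exp (Z' l)) \<le> \<delta> * N Z Z'" .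
  qed (use A assms \<delta> N_nonneg in auto)
  moreover have "cmod (Ln (1 + u j Z) - Ln (1 + u j Z')) \<le> 2 * cmod (u j Z - u j Z')"
    using u_small[of Z j] u_small[of Z' j] assms C\<delta> by (intro norm_Ln_diff_le) auto
  ultimately show ?thesis by (simp add: mult.assoc)
qed

lemma Y_lip:
  assumes "\<forall>j\<in>J. Re (Z j) \<le> ln \<delta>" "\<forall>j\<in>J. Re (Z' j) \<le> ln \<delta>" "i \<le> d"
  shows "cmod (Y i Z - Y i Z') \<le> C * N Z Z'"
proof -
  have "Y i Z - Y i Z' = (\<Sum>j\<le>d. of_int (g i j) * (lx j Z - lx j Z'))"
    by (simp add: Y_def sum_subtractf right_diff_distrib)
  also have "cmod \<dots> \<le> C * N Z Z'"
  proof (rule lin_comb_bound)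
    fix j assume "j \<in> {..d}"
    then have "cmod (Ln (1 + u j Z) - Ln (1 + u j Z')) \<le> 2 * C * \<delta> * N Z Z'"
      by (intro u_lip[OF assms(1,2)]) auto
    also have "\<dots> \<le> 1 * N Z Z'" using C\<delta> N_nonneg by (intro mult_right_mono) auto
    finally show "cmod (lx j Z - lx j Z') \<le> N Z Z'" using member_le_N by (auto simp: lx_def)
  qed (use assms(3) g_sum_le N_nonneg in auto)
  finally show ?thesis .
qed

text \<open>The parts of \<open>pert\<close> coming from u and from v contribute 2 C^2 \<delta>
  each: the derivative of \<open>Ln\<close> costs 2, exponentials of modulus at most \<delta> give
  \<delta>, and the coefficients, including those hidden in Y, give two factors C.\<close>

lemma pert_lip:
  assumes "Z \<in> small_dom" "Z' \<in> small_dom" "i \<le> d"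
  shows "cmod (pert i Z - pert i Z') \<le> 4 * C ^ 2 * \<delta> * N Z Z'"
proof -
  have Zr: "\<forall>j\<in>J. Re (Z j) \<le> ln \<delta>" "\<forall>j\<in>J. Re (Z' j) \<le> ln \<delta>" using assms by (auto simp: small_dom_def)
  have 1: "cmod (\<Sum>j\<in>{..d} - J. of_int (g i j) * (Ln (1 + u j Z) - Ln (1 + u j Z'))) \<le> C * (2 * C * \<delta> * N Z Z')"
    by (rule lin_comb_bound) (use u_lip[OF Zr] g_sum_le[OF assms(3)] N_nonneg C \<delta> in auto)
  have "v i Z - v i Z' = (\<Sum>l\<in>I. B i l * (exp (Y l Z) - exp (Y l Z')))"
    by (simp add: v_def sum_subtractf right_diff_distrib)
  moreover have "cmod (\<Sum>l\<in>I. B i l * (exp (Y l Z) - exp (Y l Z'))) \<le> C * (\<delta> * (C * N Z Z'))"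
  proof (rule lin_comb_bound)
    fix l assume l: "l \<in> I"
    have "cmod (exp (Y l Z) - exp (Y l Z')) \<le> \<delta> * cmod (Y l Z - Y l Z')"
      using assms l \<delta> by (intro norm_exp_diff_le) (auto simp: small_dom_def)
    also have "\<dots> \<le> \<delta> * (C * N Z Z')" using \<delta> l I by (intro mult_left_mono Y_lip[OF Zr]) auto
    finally show "cmod (exp (Y l Z) - exp (Y l Z')) \<le> \<delta> * (C * N Z Z')" .
  qed (use B assms C \<delta> N_nonneg in auto)
  moreover have "cmod (Ln (1 + v i Z) - Ln (1 + v i Z')) \<le> 2 * cmod (v i Z - v i Z')"
    using v_small[OF assms(1,3)] v_small[OF assms(2,3)] C\<delta> by (intro norm_Ln_diff_le) auto
  ultimately have 2: "cmod (Ln (1 + v i Z) - Ln (1 + v i Z')) \<le> 2 * (C * (\<delta> * (C * N Z Z')))" by simp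
  have "pert i Z - pert i Z' = (\<Sum>j\<in>{..d} - J. of_int (g i j) * (Ln (1 + u j Z) - Ln (1 + u j Z'))) - (Ln (1 + v i Z) - Ln (1 + v i Z'))"
    by (simp add: pert_def sum_subtractf right_diff_distrib)
  then have "cmod (pert i Z - pert i Z') \<le> cmod (\<Sum>j\<in>{..d} - J. of_int (g i j) * (Ln (1 + u j Z) - Ln (1 + u j Z'))) + cmod (Ln (1 + v i Z) - Ln (1 + v i Z'))"
    by (simp only: norm_triangle_ineq4)
  then have "cmod (pert i Z - pert i Z') \<le> C * (2 * C * \<delta> * N Z Z') + 2 * (C * (\<delta> * (C * N Z Z')))"
    using 1 2 by linarith
  also have "\<dots> = 4 * C ^ 2 * \<delta> * N Z Z'" by (simp add: power2_eq_square)
  finally show ?thesis .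
qed

lemma pert_bound: assumes "Z \<in> small_dom" "i \<le> d" shows "cmod (pert i Z) \<le> 4 * C ^ 2 * \<delta>"
proof -
  have Ln: "cmod (Ln (1 + z)) \<le> 2 * (C * \<delta>)" if "cmod z \<le> C * \<delta>" for z
  proof -
    have "cmod z < 1 / 2" using that C\<delta> by linarith
    then have "cmod (Ln (1 + z)) \<le> 2 * cmod z" by (rule norm_Ln_le)
    then show ?thesis using that by simp
  qed
  have Zr: "\<forall>j\<in>J. Re (Z j) \<le> ln \<delta>" using assms by (auto simp: small_dom_def)
  have "cmod (\<Sum>j\<in>{..d} - J. of_int (g i j) * Ln (1 + u j Z)) \<le> C * (2 * (C * \<delta>))"
    by (rule lin_comb_bound) (use Ln u_small[OF Zr] g_sum_le[OF assms(2)] C \<delta> in auto)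
  moreover have "cmod (Ln (1 + v i Z)) \<le> 2 * (C * \<delta>)" by (rule Ln[OF v_small[OF assms]])
  moreover have "C * \<delta> \<le> C * (C * \<delta>)" using C \<delta> mult_right_mono[of 1 C "C * \<delta>"] by simp
  ultimately have "cmod (pert i Z) \<le> 4 * (C * (C * \<delta>))"
    unfolding pert_def using norm_triangle_ineq4[of "\<Sum>j\<in>{..d} - J. of_int (g i j) * Ln (1 + u j Z)" "Ln (1 + v i Z)"] by simp
  then show ?thesis by (simp add: power2_eq_square)
qed

lemma V_sum_bound:
  assumes "\<And>b. b \<in> K \<Longrightarrow> cmod (z b) \<le> r" "r \<ge> 0"
  shows "(\<Sum>a\<in>J. cmod (\<Sum>b\<in>K. V a b * z b)) \<le> C * (C * r)"
proof -
  have "(\<Sum>a\<in>J. cmod (\<Sum>b\<in>K. V a b * z b)) \<le> (\<Sum>a\<in>J. C * r)"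
    by (rule sum_mono, rule lin_comb_bound) (use assms V in auto)
  also have "\<dots> \<le> C * (C * r)" using C assms by (simp add: mult_right_mono)
  finally show ?thesis .
qed

text \<open>Origin of the bound on \<delta>: the Lipschitz constant 4 C^2 \<delta> of
  \<open>pert\<close>, multiplied by C for the entries in a row of V and by C for the number of
  rows, becomes at most 1/2.\<close>

lemma C4: "C * (C * (4 * C ^ 2 * \<delta> * r)) \<le> 1 / 2 * r" if "r \<ge> 0"
proof -
  have "C * (C * (4 * C ^ 2 * \<delta> * r)) = 1 / 2 * ((8 * C ^ 4 * \<delta>) * r)" by (simp add: power2_eq_square power4_eq_xxxx)
  also have "\<dots> \<le> 1 / 2 * (1 * r)" using \<delta> that by (intro mult_left_mono mult_right_mono) auto
  finally show ?thesis by simp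
qed

lemma V_apply: "a \<in> J \<Longrightarrow> (\<Sum>b\<in>K. V a b * (\<Sum>j\<in>J. of_int (g b j) * z j)) = z a"
proof -
  assume a: "a \<in> J"
  have "(\<Sum>b\<in>K. V a b * (\<Sum>j\<in>J. of_int (g b j) * z j)) = (\<Sum>j\<in>J. (\<Sum>b\<in>K. V a b * of_int (g b j)) * z j)"
    unfolding sum_distrib_left sum_distrib_right by (subst sum.swap) (simp add: mult.assoc)
  also have "\<dots> = (\<Sum>j\<in>J. (if a = j then 1 else 0) * z j)" using left_inv[OF a] by (intro sum.cong) auto
  finally show ?thesis using a finJ by (simp add: if_distrib[of "\<lambda>x. x * _"] cong: if_cong)
qed

text \<open>The difference of two solutions is V applied to a difference of perturbations, hence at
  most half as large as itself.\<close>

lemma unique: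
  assumes "Z \<in> small_dom" "Z' \<in> small_dom" "\<And>i. i \<in> K \<Longrightarrow> E i Z = E i Z'" "j \<in> J"
  shows "Z j = Z' j"
proof -
  have "Z a - Z' a = (\<Sum>b\<in>K. V a b * (pert b Z' - pert b Z))" if a: "a \<in> J" for a
  proof -
    have "(\<Sum>j\<in>J. of_int (g b j) * (Z j - Z' j)) = pert b Z' - pert b Z" if "b \<in> K" for b
      using assms(3)[OF that] unfolding E_split by (simp add: right_diff_distrib sum_subtractf algebra_simps)
    then show ?thesis using V_apply[OF a, of "\<lambda>j. Z j - Z' j"] by simp
  qed
  then have "N Z Z' = (\<Sum>a\<in>J. cmod (\<Sum>b\<in>K. V a b * (pert b Z' - pert b Z)))" unfolding N_def by simp
  also have "\<dots> \<le> C * (C * (4 * C ^ 2 * \<delta> * N Z Z'))"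
  proof (rule V_sum_bound)
    show "cmod (pert b Z' - pert b Z) \<le> 4 * C ^ 2 * \<delta> * N Z Z'" if "b \<in> K" for b
      using pert_lip[OF assms(1,2), of b] that K by (auto simp: norm_minus_commute)
  qed (use \<delta> N_nonneg in auto)
  also have "\<dots> \<le> 1 / 2 * N Z Z'" by (rule C4[OF N_nonneg])
  finally have "N Z Z' = 0" using N_nonneg[of Z Z'] by simp
  then show ?thesis using member_le_N[OF assms(4), of Z Z'] by simp
qed

text \<open>The equation E = c is the fixed point problem Z = V (c - \<beta> - pert Z), and Z0
  solves it without the perturbation. The unit ball around Z0 in the domain leaves room for the
  iteration.\<close>

lemma exists:
  assumes ball: "\<And>Z. N Z Z0 \<le> 1 \<Longrightarrow> Z \<in> small_dom"
    and Z0: "\<And>a. a \<in> J \<Longrightarrow> Z0 a = (\<Sum>b\<in>K. V a b * (c b - \<beta> b))"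
  shows "\<exists>Z\<in>small_dom. \<forall>i\<in>K. E i Z = c i"
proof -
  define \<Phi> where "\<Phi> = (\<lambda>Z a. \<Sum>b\<in>K. V a b * (c b - \<beta> b - pert b Z))"
  have "\<exists>Z. (\<Sum>j\<in>J. cmod (Z j - Z0 j)) \<le> 1 \<and> (\<forall>j\<in>J. \<Phi> Z j = Z j)"
  proof (rule contraction_fixed_point[OF finJ])
    fix Z Z' :: "nat \<Rightarrow> complex" assume "(\<Sum>j\<in>J. cmod (Z j - Z0 j)) \<le> 1" "(\<Sum>j\<in>J. cmod (Z' j - Z0 j)) \<le> 1"
    then have Z: "Z \<in> small_dom" "Z' \<in> small_dom" using ball unfolding N_def by auto
    have "(\<Sum>j\<in>J. cmod (\<Phi> Z j - \<Phi> Z' j)) = (\<Sum>a\<in>J. cmod (\<Sum>b\<in>K. V a b * (pert b Z' - pert b Z)))"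
      by (rule sum.cong) (auto simp: \<Phi>_def sum_subtractf[symmetric] right_diff_distrib[symmetric])
    also have "\<dots> \<le> C * (C * (4 * C ^ 2 * \<delta> * N Z Z'))"
    proof (rule V_sum_bound)
      show "cmod (pert b Z' - pert b Z) \<le> 4 * C ^ 2 * \<delta> * N Z Z'" if "b \<in> K" for b
        using pert_lip[OF Z, of b] that K by (auto simp: norm_minus_commute)
    qed (use \<delta> N_nonneg in auto)
    also have "\<dots> \<le> 1 / 2 * N Z Z'" by (rule C4[OF N_nonneg])
    finally show "(\<Sum>j\<in>J. cmod (\<Phi> Z j - \<Phi> Z' j)) \<le> 1 / 2 * (\<Sum>j\<in>J. cmod (Z j - Z' j))" unfolding N_def .
  next
    have d0: "Z0 \<in> small_dom" by (rule ball) (simp add: N_def)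
    have "(\<Sum>j\<in>J. cmod (\<Phi> Z0 j - Z0 j)) = (\<Sum>a\<in>J. cmod (\<Sum>b\<in>K. V a b * (- pert b Z0)))"
      by (rule sum.cong) (auto simp: \<Phi>_def Z0 sum_subtractf[symmetric] right_diff_distrib[symmetric])
    also have "\<dots> \<le> C * (C * (4 * C ^ 2 * \<delta> * 1))"
      by (rule V_sum_bound) (use pert_bound[OF d0] K \<delta> in auto)
    also have "\<dots> \<le> 1 / 2" using C4[of 1] by simp
    finally show "(\<Sum>j\<in>J. cmod (\<Phi> Z0 j - Z0 j)) \<le> 1 / 2" .
  qed
  then obtain Z where Z: "N Z Z0 \<le> 1" "\<forall>j\<in>J. \<Phi> Z j = Z j" unfolding N_def by auto
  have "E i Z = c i" if i: "i \<in> K" for i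
  proof -
    have "(\<Sum>j\<in>J. of_int (g i j) * Z j) = (\<Sum>j\<in>J. of_int (g i j) * (\<Sum>b\<in>K. V j b * (c b - \<beta> b - pert b Z)))"
      using Z(2) by (intro sum.cong) (auto simp: \<Phi>_def)
    also have "\<dots> = (\<Sum>b\<in>K. (\<Sum>j\<in>J. of_int (g i j) * V j b) * (c b - \<beta> b - pert b Z))"
      unfolding sum_distrib_left sum_distrib_right by (subst sum.swap) (simp add: mult.assoc)
    also have "\<dots> = (\<Sum>b\<in>K. (if i = b then 1 else 0) * (c b - \<beta> b - pert b Z))"
      using right_inv[OF i] by (intro sum.cong) auto
    also have "\<dots> = c i - \<beta> i - pert i Z" using i finK by (simp add: if_distrib[of "\<lambda>x. x * _"] cong: if_cong)
    finally show ?thesis unfolding E_split by simp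
  qed
  then show ?thesis using ball[OF Z(1)] by blast
qed

text \<open>The functions u and v depend on exponentials of Z and Y only and do not notice the
  shift, so only the linear part of E moves.\<close>

lemma shift:
  assumes "\<And>j. j \<in> J \<Longrightarrow> Z' j = Z j + 2 * of_real pi * \<i> * of_int (m j)" "i \<le> d"
  shows "E i Z' = E i Z + 2 * of_real pi * \<i> * of_int (\<Sum>j\<in>J. g i j * m j)"
    and "Z \<in> small_dom \<Longrightarrow> Z' \<in> small_dom"
proof -
  have ex: "exp (Z' j) = exp (Z j)" if "j \<in> J" for j
    unfolding assms(1)[OF that] exp_add by (simp add: exp_eq_1 mult.commute mult.left_commute)
  then have u: "u j Z' = u j Z" for j unfolding u_def by simp
  have Y: "Y l Z' = Y l Z + 2 * of_real pi * \<i> * of_int (\<Sum>j\<in>J. g l j * m j)" for l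
  proof -
    have "(\<Sum>j\<in>J. of_int (g l j) * Z' j) = (\<Sum>j\<in>J. of_int (g l j) * Z j) + 2 * of_real pi * \<i> * of_int (\<Sum>j\<in>J. g l j * m j)"
      unfolding of_int_sum sum_distrib_left sum.distrib[symmetric]
      by (rule sum.cong) (auto simp: assms(1) algebra_simps)
    then show ?thesis unfolding Y_split u by simp
  qed
  have eY: "exp (Y l Z') = exp (Y l Z)" for l
    unfolding Y exp_add by (simp add: exp_eq_1 mult.commute mult.left_commute del: of_int_sum)
  then have "v i Z' = v i Z" unfolding v_def by simp
  then show "E i Z' = E i Z + 2 * of_real pi * \<i> * of_int (\<Sum>j\<in>J. g i j * m j)"
    unfolding E_def Y by simp
  have "Re (Y l Z') = Re (Y l Z)" for l unfolding Y by simp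
  moreover have "Re (Z' j) = Re (Z j)" if "j \<in> J" for j using assms(1)[OF that] by simp
  ultimately show "Z \<in> small_dom \<Longrightarrow> Z' \<in> small_dom" unfolding small_dom_def by simp
qed

lemma exp_lx_notin: "j \<le> d \<Longrightarrow> j \<notin> J \<Longrightarrow> \<forall>j\<in>J. Re (Z j) \<le> ln \<delta> \<Longrightarrow> exp (lx j Z) = exp (P j) * (1 + u j Z)"
proof -
  assume "j \<le> d" "j \<notin> J" "\<forall>j\<in>J. Re (Z j) \<le> ln \<delta>"
  then have "cmod (u j Z) \<le> 1 / 8" using u_small C\<delta> order_trans by blast
  then have "1 + u j Z \<noteq> 0" using norm_minus_cancel[of 1] by (auto simp: add_eq_0_iff)
  then show ?thesis using \<open>j \<notin> J\<close> by (simp add: lx_def exp_add)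
qed

lemma exp_E_eq_1_iff: "i \<le> d \<Longrightarrow> Z \<in> small_dom \<Longrightarrow> exp (E i Z) = 1 \<longleftrightarrow> exp (Y i Z) = exp (Q i) * (1 + v i Z)"
proof -
  assume a: "i \<le> d" "Z \<in> small_dom"
  have "cmod (v i Z) \<le> 1 / 8" using v_small[OF a(2,1)] C\<delta> by simp
  then have "1 + v i Z \<noteq> 0" using norm_minus_cancel[of 1] by (auto simp: add_eq_0_iff)
  then show ?thesis by (simp add: E_def exp_diff)
qed

end

section \<open>Generic linear subspaces and the solutions of the system\<close>

text \<open>All maximal minors of the rows R are nonzero, so any card R of the d + 1 coordinates can
  be solved for in terms of the others.\<close>

definition uniform_rows :: "nat \<Rightarrow> nat set \<Rightarrow> (nat \<times> nat \<Rightarrow> complex) \<Rightarrow> bool" where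
  "uniform_rows d R \<theta> \<longleftrightarrow> (\<forall>K. K \<subseteq> {..d} \<longrightarrow> card K = card R \<longrightarrow> det (submat R K (\<lambda>a i. \<theta> (a, i))) \<noteq> 0)"

definition lin_eqs :: "nat \<Rightarrow> nat set \<Rightarrow> (nat \<times> nat \<Rightarrow> complex) \<Rightarrow> (nat \<Rightarrow> complex) \<Rightarrow> bool" where
  "lin_eqs d R \<theta> y \<longleftrightarrow> (\<forall>a\<in>R. (\<Sum>i\<le>d. \<theta> (a, i) * y i) = 0)"

lemma uniform_rows_generic: assumes R: "finite R" shows "generic (uniform_rows d R)"
proof -
  have "generic (\<lambda>\<theta>. \<forall>K\<in>{K. K \<subseteq> {..d} \<and> card K = card R}. det (submat R K (\<lambda>a i. \<theta> (a, i))) \<noteq> 0)"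
  proof (rule generic_ball)
    fix K assume "K \<in> {K. K \<subseteq> {..d} \<and> card K = card R}"
    then have K: "finite K" "card K = card R" using finite_subset by auto
    define G where "G = (\<lambda>\<theta> :: nat \<times> nat \<Rightarrow> complex. det (submat R K (\<lambda>a i. \<theta> (a, i))))"
    have "G = (\<lambda>\<theta>. \<Sum>p\<in>{p. p permutes {0..<card R}}. signof p * (\<Prod>i = 0..<card R. submat R K (\<lambda>a i. \<theta> (a, i)) $$ (i, p i)))"
      unfolding G_def by (rule ext) (rule det_def'[OF submat_carrier])
    also have "\<dots> = (\<lambda>\<theta>. \<Sum>p\<in>{p. p permutes {0..<card R}}. signof p * (\<Prod>i = 0..<card R. \<theta> (enum R i, enum K (p i))))"
    proof (intro ext sum.cong refl arg_cong2[of _ _ _ _ "(*)"] prod.cong)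
      fix \<theta> :: "nat \<times> nat \<Rightarrow> complex" and p i
      assume "p \<in> {p. p permutes {0..<card R}}" "i \<in> {0..<card R}"
      then show "submat R K (\<lambda>a i. \<theta> (a, i)) $$ (i, p i) = \<theta> (enum R i, enum K (p i))"
        using permutes_in_image[of p "{0..<card R}" i] by (simp add: submat_def)
    qed
    finally have pG: "pfun G" by (simp only:) (intro pfun_sum pfun.mult pfun.const pfun_prod pfun.var)
    \<comment> \<open>A partial permutation matrix whose block with rows R and columns K is the
      identity.\<close>
    define \<theta>1 where "\<theta>1 = (\<lambda>(x, y). if \<exists>i<card R. x = enum R i \<and> y = enum K i then 1 else 0 :: complex)"
    have "submat R K (\<lambda>a i. \<theta>1 (a, i)) = 1\<^sub>m (card R)"
      unfolding submat_def \<theta>1_def using enum_inj[OF R] enum_inj[OF K(1)] K(2) by (intro eq_matI) auto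
    then have "G \<theta>1 \<noteq> 0" by (simp add: G_def)
    then show "generic (\<lambda>\<theta>. det (submat R K (\<lambda>a i. \<theta> (a, i))) \<noteq> 0)"
      by (rule genericI[OF pG]) (simp add: G_def)
  qed simp
  then show ?thesis by (rule generic_mono) (simp add: uniform_rows_def)
qed

text \<open>Inverting the block of columns K gives s. If s i l were 0, the solution with y l = 1 and
  the other free coordinates 0 would be supported on K with i replaced by l, against the
  nonsingularity of those columns.\<close>

lemma uniform_rows_solve:
  assumes R: "finite R" and un: "uniform_rows d R \<theta>" and K: "K \<subseteq> {..d}" "card K = card R"
  shows "\<exists>s. (\<forall>y. lin_eqs d R \<theta> y \<longleftrightarrow> (\<forall>i\<in>K. y i = (\<Sum>l\<in>{..d} - K. s i l * y l))) \<and>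
    (\<forall>i\<in>K. \<forall>l\<in>{..d} - K. s i l \<noteq> 0)"
proof -
  have inv: "\<exists>B. (\<forall>a\<in>K. \<forall>b\<in>K. (\<Sum>r\<in>R. B a r * \<theta> (r, b)) = (if a = b then 1 else 0)) \<and>
      (\<forall>r\<in>R. \<forall>r'\<in>R. (\<Sum>a\<in>K. \<theta> (r, a) * B a r') = (if r = r' then 1 else 0))"
    if "K \<subseteq> {..d}" "card K = card R" for K
    by (rule submat_inverse[OF R, of K "\<lambda>r b. \<theta> (r, b)"])
      (use that un finite_subset in \<open>auto simp: uniform_rows_def\<close>)
  have fK: "finite K" using K(1) finite_subset by blast
  obtain B where B0: "(\<forall>a\<in>K. \<forall>b\<in>K. (\<Sum>r\<in>R. B a r * \<theta> (r, b)) = (if a = b then 1 else 0)) \<and>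
      (\<forall>r\<in>R. \<forall>r'\<in>R. (\<Sum>a\<in>K. \<theta> (r, a) * B a r') = (if r = r' then 1 else 0))"
    using inv[OF K] by (rule exE)
  note B = B0[THEN conjunct1, rule_format] B0[THEN conjunct2, rule_format]
  define s where "s = (\<lambda>i l. - (\<Sum>a\<in>R. B i a * \<theta> (a, l)))"
  have split: "(\<Sum>i\<le>d. \<theta> (a, i) * y i) = (\<Sum>l\<in>{..d} - K. \<theta> (a, l) * y l) + (\<Sum>i\<in>K. \<theta> (a, i) * y i)" for a y
    by (rule sum.subset_diff[OF K(1) finite_atMost])
  have fwd: "y i = (\<Sum>l\<in>{..d} - K. s i l * y l)" if y: "lin_eqs d R \<theta> y" and i: "i \<in> K" for y i
  proof -
    have e: "(\<Sum>b\<in>K. \<theta> (a, b) * y b) = - (\<Sum>l\<in>{..d} - K. \<theta> (a, l) * y l)" if "a \<in> R" for a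
      using y that split[of a y] by (simp add: lin_eqs_def add_eq_0_iff)
    have "y i = (\<Sum>b\<in>K. (if i = b then 1 else 0) * y b)"
      using i fK by (simp add: if_distrib[of "\<lambda>x. x * _"] cong: if_cong)
    also have "\<dots> = (\<Sum>b\<in>K. (\<Sum>r\<in>R. B i r * \<theta> (r, b)) * y b)" using B(1)[OF i] by (intro sum.cong) auto
    also have "\<dots> = (\<Sum>r\<in>R. B i r * (\<Sum>b\<in>K. \<theta> (r, b) * y b))"
      unfolding sum_distrib_left sum_distrib_right by (subst sum.swap) (simp add: mult.assoc)
    also have "\<dots> = (\<Sum>r\<in>R. B i r * - (\<Sum>l\<in>{..d} - K. \<theta> (r, l) * y l))" by (intro sum.cong) (auto simp: e)
    also have "\<dots> = (\<Sum>r\<in>R. \<Sum>l\<in>{..d} - K. - (B i r * \<theta> (r, l) * y l))"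
      by (simp add: sum_distrib_left sum_negf mult.assoc)
    also have "\<dots> = (\<Sum>l\<in>{..d} - K. s i l * y l)"
      by (subst sum.swap) (simp add: s_def sum_negf sum_distrib_right)
    finally show ?thesis .
  qed
  have bwd: "lin_eqs d R \<theta> y" if y: "\<And>i. i \<in> K \<Longrightarrow> y i = (\<Sum>l\<in>{..d} - K. s i l * y l)" for y
    unfolding lin_eqs_def
  proof
    fix a assume a: "a \<in> R"
    have "(\<Sum>i\<in>K. \<theta> (a, i) * y i) = (\<Sum>i\<in>K. \<Sum>l\<in>{..d} - K. \<Sum>r\<in>R. - (\<theta> (a, i) * B i r * (\<theta> (r, l) * y l)))"
      by (rule sum.cong) (auto simp: y s_def sum_distrib_left sum_distrib_right sum_negf mult.assoc)
    also have "\<dots> = (\<Sum>l\<in>{..d} - K. \<Sum>i\<in>K. \<Sum>r\<in>R. - (\<theta> (a, i) * B i r * (\<theta> (r, l) * y l)))" by (rule sum.swap)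
    also have "\<dots> = (\<Sum>l\<in>{..d} - K. \<Sum>r\<in>R. - ((\<Sum>i\<in>K. \<theta> (a, i) * B i r) * (\<theta> (r, l) * y l)))"
      by (rule sum.cong[OF refl], subst sum.swap) (simp add: sum_negf sum_distrib_right)
    also have "\<dots> = (\<Sum>l\<in>{..d} - K. \<Sum>r\<in>R. (if a = r then - (\<theta> (r, l) * y l) else 0))"
      using B(2)[OF a] by (intro sum.cong) auto
    also have "\<dots> = (\<Sum>l\<in>{..d} - K. - (\<theta> (a, l) * y l))" using a R by simp
    finally show "(\<Sum>i\<le>d. \<theta> (a, i) * y i) = 0" unfolding split by (simp add: sum_negf)
  qed
  have "s i l \<noteq> 0" if il: "i \<in> K" "l \<in> {..d} - K" for i l
  proof
    assume s0: "s i l = 0"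
    define K' where "K' = insert l (K - {i})"
    have "card K > 0" using il fK by (auto simp: card_gt_0_iff)
    then have K': "K' \<subseteq> {..d}" "card K' = card R" "finite K'" using K il fK by (auto simp: K'_def)
    define y where "y = (\<lambda>j. if j = l then 1 else if j \<in> K then s j l else 0)"
    have "lin_eqs d R \<theta> y"
    proof (rule bwd)
      fix j assume j: "j \<in> K"
      have "(\<Sum>l'\<in>{..d} - K. s j l' * y l') = (\<Sum>l'\<in>{..d} - K. if l' = l then s j l else 0)"
        by (rule sum.cong) (auto simp: y_def)
      then show "y j = (\<Sum>l\<in>{..d} - K. s j l * y l)" using il j by (auto simp: y_def)
    qed
    moreover have y0: "y j = 0" if "j \<notin> K'" for j using that s0 by (auto simp: y_def K'_def)
    ultimately have z: "(\<Sum>b\<in>K'. \<theta> (r, b) * y b) = 0" if "r \<in> R" for r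
    proof -
      have "(\<Sum>b\<in>K'. \<theta> (r, b) * y b) = (\<Sum>b\<le>d. \<theta> (r, b) * y b)"
        by (rule sum.mono_neutral_left) (use K' y0 in auto)
      then show ?thesis using \<open>lin_eqs d R \<theta> y\<close> that by (simp add: lin_eqs_def)
    qed
    obtain B' where B0': "(\<forall>a\<in>K'. \<forall>b\<in>K'. (\<Sum>r\<in>R. B' a r * \<theta> (r, b)) = (if a = b then 1 else 0)) \<and>
        (\<forall>r\<in>R. \<forall>r'\<in>R. (\<Sum>a\<in>K'. \<theta> (r, a) * B' a r') = (if r = r' then 1 else 0))"
      using inv[OF K'(1,2)] by (rule exE)
    note B' = B0'[THEN conjunct1, rule_format]
    have l: "l \<in> K'" by (simp add: K'_def)
    have "y l = (\<Sum>b\<in>K'. (if l = b then 1 else 0) * y b)"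
      using l K'(3) by (simp add: if_distrib[of "\<lambda>x. x * _"] cong: if_cong)
    also have "\<dots> = (\<Sum>b\<in>K'. (\<Sum>r\<in>R. B' l r * \<theta> (r, b)) * y b)" using B'[OF l] by (intro sum.cong) auto
    also have "\<dots> = (\<Sum>r\<in>R. B' l r * (\<Sum>b\<in>K'. \<theta> (r, b) * y b))"
      unfolding sum_distrib_left sum_distrib_right by (subst sum.swap) (simp add: mult.assoc)
    also have "\<dots> = 0" using z by simp
    finally show False by (simp add: y_def)
  qed
  then show ?thesis using fwd bwd by (intro exI[of _ s]) blast
qed

text \<open>The coordinates outside J and j0 are solved for, with x j0 = 1. The coefficients of x j0
  are nonzero and thus exponentials; factoring them out leaves 1 plus a combination of the
  coordinates in J, which are the small ones later. At j0 itself P and A are 0, so that the equation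
  there is trivial.\<close>

lemma uniform_rows_chart:
  assumes R: "finite R" and un: "uniform_rows d R \<theta>" and J: "J \<subseteq> {..d}" and j0: "j0 \<in> {..d} - J"
    and c: "card J + card R = d"
  shows "\<exists>P A. exp (P j0) = 1 \<and> (\<forall>l. A j0 l = 0) \<and> (\<forall>x. x j0 = 1 \<longrightarrow>
    (lin_eqs d R \<theta> x \<longleftrightarrow> (\<forall>j\<in>{..d} - J. x j = exp (P j) * (1 + (\<Sum>l\<in>J. A j l * x l)))))"
proof -
  define K where "K = {..d} - J - {j0}"
  have fJ: "finite J" using J finite_subset by blast
  have K: "K \<subseteq> {..d}" "card K = card R" using c j0 J fJ by (auto simp: K_def card_Diff_subset)
  obtain s where s0: "(\<forall>y. lin_eqs d R \<theta> y \<longleftrightarrow> (\<forall>i\<in>K. y i = (\<Sum>l\<in>{..d} - K. s i l * y l))) \<and>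
    (\<forall>i\<in>K. \<forall>l\<in>{..d} - K. s i l \<noteq> 0)"
    using uniform_rows_solve[OF R un K] by (rule exE)
  note s = s0[THEN conjunct1, THEN spec] s0[THEN conjunct2, rule_format]
  have co: "{..d} - K = insert j0 J" using J j0 by (auto simp: K_def)
  have j0': "j0 \<notin> J" "j0 \<notin> K" using j0 by (auto simp: K_def)
  define P where "P = (\<lambda>j. if j = j0 then 0 else Ln (s j j0))"
  define A where "A = (\<lambda>j l. if j = j0 then 0 else s j l / s j j0)"
  have "lin_eqs d R \<theta> x \<longleftrightarrow> (\<forall>j\<in>{..d} - J. x j = exp (P j) * (1 + (\<Sum>l\<in>J. A j l * x l)))" if x: "x j0 = 1" for x
  proof -
    have "(\<Sum>l\<in>{..d} - K. s i l * x l) = exp (P i) * (1 + (\<Sum>l\<in>J. A i l * x l))" if i: "i \<in> K" for i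
    proof -
      have nz: "s i j0 \<noteq> 0" using s(2)[OF i] co by auto
      then have "(\<Sum>l\<in>{..d} - K. s i l * x l) = s i j0 * (1 + (\<Sum>l\<in>J. s i l / s i j0 * x l))"
        unfolding co using fJ j0' x by (simp add: distrib_left sum_distrib_left)
      then show ?thesis using i j0' nz by (auto simp: P_def A_def)
    qed
    moreover have "{..d} - J = insert j0 K" using j0 by (auto simp: K_def)
    ultimately show ?thesis unfolding s(1) using x by (simp add: P_def A_def)
  qed
  then show ?thesis by (intro exI[of _ P] exI[of _ A]) (auto simp: P_def A_def)
qed

text \<open>The index of the column lattice, carried over to functions indexed by K and J. This is
  where a number of solutions becomes a determinant.\<close>

lemma integer_reps:
  assumes K: "finite K" and J: "finite J" and c: "card K = card J" and det: "det (submat K J g) \<noteq> 0"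
  shows "\<exists>T :: (nat \<Rightarrow> int) set. finite T \<and> card T = nat \<bar>det (submat K J g)\<bar> \<and>
    (\<forall>n. \<exists>r\<in>T. \<exists>m. \<forall>i\<in>K. n i - r i = (\<Sum>j\<in>J. g i j * m j)) \<and>
    (\<forall>r\<in>T. \<forall>r'\<in>T. (\<exists>m. \<forall>i\<in>K. r i - r' i = (\<Sum>j\<in>J. g i j * m j)) \<longrightarrow> r = r')"
proof -
  define n where "n = card K"
  define M where "M = submat K J g"
  have M: "M \<in> carrier_mat n n" by (simp add: M_def n_def submat_def)
  obtain T where T: "finite T" "card T = nat \<bar>det M\<bar>" "T \<subseteq> carrier_vec n"
    "\<And>x. x \<in> carrier_vec n \<Longrightarrow> \<exists>!r. r \<in> T \<and> x - r \<in> mat_lattice M"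
    using has_reps_det[OF M det[folded M_def]] unfolding has_reps_def by auto
  define fn where "fn = (\<lambda>r :: int vec. \<lambda>i. if i \<in> K then r $ the_inv_into {..<n} (enum K) i else 0)"
  have invK: "the_inv_into {..<n} (enum K) (enum K i) = i" if "i < n" for i
    using that bij_betw_imp_inj_on[OF bij_betw_enum[OF K]] by (auto simp: n_def intro!: the_inv_into_f_f)
  have invJ: "the_inv_into {..<n} (enum J) (enum J i) = i" if "i < n" for i
    using that bij_betw_imp_inj_on[OF bij_betw_enum[OF J]] c by (auto simp: n_def intro!: the_inv_into_f_f)
  have fn: "fn r (enum K i) = r $ i" if "i < n" for r i
    using that invK enum_mem[OF K] by (simp add: fn_def n_def)
  have lat: "(\<exists>m. \<forall>i\<in>K. x i - y i = (\<Sum>j\<in>J. g i j * m j)) \<longleftrightarrow> vec n (\<lambda>i. x (enum K i)) - vec n (\<lambda>i. y (enum K i)) \<in> mat_lattice M" for x y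
  proof
    assume "\<exists>m. \<forall>i\<in>K. x i - y i = (\<Sum>j\<in>J. g i j * m j)"
    then obtain m where m: "\<And>i. i \<in> K \<Longrightarrow> x i - y i = (\<Sum>j\<in>J. g i j * m j)" by blast
    have "vec n (\<lambda>i. x (enum K i)) - vec n (\<lambda>i. y (enum K i)) = M *\<^sub>v vec n (\<lambda>j. m (enum J j))"
    proof (rule eq_vecI)
      fix i assume "i < dim_vec (M *\<^sub>v vec n (\<lambda>j. m (enum J j)))"
      then have i: "i < n" using M by simp
      have "(M *\<^sub>v vec n (\<lambda>j. m (enum J j))) $ i = (\<Sum>j<n. g (enum K i) (enum J j) * m (enum J j))"
        using i M by (auto simp: scalar_prod_def atLeast0LessThan M_def submat_def n_def intro!: sum.cong)
      also have "\<dots> = (\<Sum>j\<in>J. g (enum K i) j * m j)" unfolding n_def c by (rule sum_enum[OF J])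
      finally show "(vec n (\<lambda>i. x (enum K i)) - vec n (\<lambda>i. y (enum K i))) $ i = (M *\<^sub>v vec n (\<lambda>j. m (enum J j))) $ i"
        using i m[OF enum_mem[OF K]] by (simp add: n_def)
    qed (use M in simp)
    then show "vec n (\<lambda>i. x (enum K i)) - vec n (\<lambda>i. y (enum K i)) \<in> mat_lattice M"
      unfolding mat_lattice_def using M by (intro CollectI exI[of _ "vec n (\<lambda>j. m (enum J j))"]) auto
  next
    assume "vec n (\<lambda>i. x (enum K i)) - vec n (\<lambda>i. y (enum K i)) \<in> mat_lattice M"
    then obtain v where v: "v \<in> carrier_vec n" "vec n (\<lambda>i. x (enum K i)) - vec n (\<lambda>i. y (enum K i)) = M *\<^sub>v v"
      using M by (auto simp: mat_lattice_def)
    define m where "m = (\<lambda>j. v $ the_inv_into {..<n} (enum J) j)"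
    have "x i - y i = (\<Sum>j\<in>J. g i j * m j)" if iK: "i \<in> K" for i
    proof -
      obtain a where a: "a < n" "i = enum K a" using enumE[OF K iK] by (auto simp: n_def)
      have "x i - y i = (vec n (\<lambda>i. x (enum K i)) - vec n (\<lambda>i. y (enum K i))) $ a" using a by simp
      also have "\<dots> = (\<Sum>j<n. g (enum K a) (enum J j) * v $ j)" unfolding v(2)
        using a(1) v(1) M by (auto simp: scalar_prod_def atLeast0LessThan M_def submat_def n_def intro!: sum.cong)
      also have "\<dots> = (\<Sum>j<n. g (enum K a) (enum J j) * m (enum J j))"
        by (rule sum.cong) (auto simp: m_def invJ)
      also have "\<dots> = (\<Sum>j\<in>J. g (enum K a) j * m j)" unfolding n_def c by (rule sum_enum[OF J])
      finally show ?thesis using a by simp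
    qed
    then show "\<exists>m. \<forall>i\<in>K. x i - y i = (\<Sum>j\<in>J. g i j * m j)" by blast
  qed
  have fr: "vec n (\<lambda>i. fn r (enum K i)) = r" if "r \<in> T" for r
    using that T(3) by (intro eq_vecI) (auto simp: fn)
  have inj: "inj_on fn T" by (rule inj_on_inverseI[of _ "\<lambda>f. vec n (\<lambda>i. f (enum K i))"]) (rule fr)
  show ?thesis
  proof (intro exI[of _ "fn ` T"] conjI)
    show "card (fn ` T) = nat \<bar>det (submat K J g)\<bar>" using card_image[OF inj] T(2) by (simp add: M_def)
    show "\<forall>x. \<exists>r\<in>fn ` T. \<exists>m. \<forall>i\<in>K. x i - r i = (\<Sum>j\<in>J. g i j * m j)"
    proof
      fix x :: "nat \<Rightarrow> int"
      obtain r where "r \<in> T" "vec n (\<lambda>i. x (enum K i)) - r \<in> mat_lattice M"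
        using T(4)[of "vec n (\<lambda>i. x (enum K i))"] by auto
      then show "\<exists>r\<in>fn ` T. \<exists>m. \<forall>i\<in>K. x i - r i = (\<Sum>j\<in>J. g i j * m j)"
        unfolding lat using fr by (intro bexI[of _ "fn r"]) auto
    qed
    show "\<forall>r\<in>fn ` T. \<forall>r'\<in>fn ` T. (\<exists>m. \<forall>i\<in>K. r i - r' i = (\<Sum>j\<in>J. g i j * m j)) \<longrightarrow> r = r'"
      unfolding lat
    proof (clarsimp simp: fr)
      fix r r' assume r: "r \<in> T" "r' \<in> T" "r - r' \<in> mat_lattice M"
      have rc: "r \<in> carrier_vec n" using r T(3) by blast
      have "r - r = M *\<^sub>v 0\<^sub>v n" using rc M by (intro eq_vecI) (auto simp: scalar_prod_def)
      then have "r - r \<in> mat_lattice M" using M by (auto simp: mat_lattice_def)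
      then have "r = r'" using T(4)[OF rc] r by blast
      then show "fn r = fn r'" by simp
    qed
  qed (use T in simp)
qed

section \<open>The solution set and the degenerating family\<close>

lemma sat_iff_lin_eqs: "sat d k e \<theta> x \<longleftrightarrow> lin_eqs d {..<k} \<theta> (\<lambda>i. mon d e i x)"
  by (simp add: sat_def lin_eqs_def Ball_def)

lemma lsat_iff_lin_eqs: "lsat d k \<theta> x \<longleftrightarrow> lin_eqs d {k..<d} \<theta> x"
  by (simp add: lsat_def lin_eqs_def)

lemma lin_eqs_cong: "(\<And>i. i \<le> d \<Longrightarrow> x i = y i) \<Longrightarrow> lin_eqs d R \<theta> x \<longleftrightarrow> lin_eqs d R \<theta> y"
  by (simp add: lin_eqs_def)

lemma lin_eqs_scale: "c \<noteq> 0 \<Longrightarrow> lin_eqs d R \<theta> (\<lambda>i. c * x i) \<longleftrightarrow> lin_eqs d R \<theta> x"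
proof -
  assume c: "c \<noteq> 0"
  have "(\<Sum>i\<le>d. \<theta> (a, i) * (c * x i)) = c * (\<Sum>i\<le>d. \<theta> (a, i) * x i)" for a
    by (simp add: sum_distrib_left mult.left_commute)
  then show ?thesis using c by (simp add: lin_eqs_def)
qed

text \<open>Each projective point of the torus is represented once: one coordinate is normalized to
  1 and the function is 0 beyond d.\<close>

definition torus_sols :: "nat \<Rightarrow> nat \<Rightarrow> (nat \<Rightarrow> nat \<Rightarrow> nat) \<Rightarrow> (nat \<times> nat \<Rightarrow> complex) \<Rightarrow> nat \<Rightarrow> (nat \<Rightarrow> complex) set" where
  "torus_sols d k e \<theta> j0 = {x. x j0 = 1 \<and> (\<forall>j\<le>d. x j \<noteq> 0) \<and> (\<forall>j>d. x j = 0) \<and> sat d k e \<theta> x \<and> lsat d k \<theta> x}"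

text \<open>The degenerating family of parameters, with \<open>t = exp \<tau>\<close> tending to \<open>0\<close>.\<close>

definition degen :: "nat \<Rightarrow> (nat \<Rightarrow> nat) \<Rightarrow> real \<Rightarrow> (nat \<times> nat \<Rightarrow> complex) \<Rightarrow> nat \<times> nat \<Rightarrow> complex" where
  "degen k w \<tau> \<theta> = (\<lambda>(a, i). if a < k then \<theta> (a, i) * of_real (exp (\<tau> * real (w i))) else \<theta> (a, i))"

lemma sat_degen: "sat d k e (degen k w \<tau> \<theta>) x \<longleftrightarrow> lin_eqs d {..<k} \<theta> (\<lambda>i. of_real (exp (\<tau> * real (w i))) * mon d e i x)"
  by (simp add: sat_def lin_eqs_def degen_def mult.assoc Ball_def)

lemma lsat_degen: "lsat d k (degen k w \<tau> \<theta>) x \<longleftrightarrow> lin_eqs d {k..<d} \<theta> x"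
  by (simp add: lsat_def lin_eqs_def degen_def)

text \<open>Along the family G is a polynomial in t = exp \<tau>, not the zero polynomial because t
  = 1 gives back \<theta>. Its nonzero roots stay away from 0.\<close>

lemma degen_nonzero:
  assumes "pfun G" "G \<theta> \<noteq> 0"
  shows "\<exists>\<tau>1. \<forall>\<tau>\<le>\<tau>1. G (degen k w \<tau> \<theta>) \<noteq> 0"
proof -
  define H where "H = (\<lambda>(v :: nat \<times> nat) (\<eta> :: nat \<times> nat \<Rightarrow> complex). if fst v < k then [:\<eta> v:] * [:0, 1:] ^ w (snd v) else [:\<eta> v:])"
  have "\<exists>n. pfam n (H v)" for v
  proof (cases "fst v < k")
    case True
    then show ?thesis using pfam_mult[OF pfam_const[OF pfun.var[of v]] pfam_power[OF pfam_X, of "w (snd v)"]]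
      by (auto simp: H_def)
  next
    case False
    then show ?thesis using pfam_const[OF pfun.var[of v]] by (auto simp: H_def)
  qed
  then obtain n S where S: "\<forall>\<eta> t. G (\<lambda>v. poly (H v \<eta>) t) = poly (S \<eta>) t"
    using pfam_subst[OF assms(1), of H] by auto
  have d: "degen k w \<tau> \<theta> = (\<lambda>v. poly (H v \<theta>) (of_real (exp \<tau>)))" for \<tau>
    by (rule ext) (auto simp: degen_def H_def exp_of_nat_mult[symmetric] mult.commute exp_of_real[symmetric])
  have "degen k w 0 \<theta> = \<theta>" by (rule ext) (auto simp: degen_def)
  then have "S \<theta> \<noteq> 0" using assms(2) d[of 0] S[THEN spec, THEN spec, of \<theta> 1] by auto
  then have fin: "finite {t. poly (S \<theta>) t = 0}" by (rule poly_roots_finite)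
  \<comment> \<open>The element 1 keeps the set nonempty if there are no nonzero roots.\<close>
  define m where "m = Min (insert 1 ((\<lambda>t. cmod t) ` ({t. poly (S \<theta>) t = 0} - {0})))"
  have m: "m > 0" using fin by (auto simp: m_def Min_gr_iff)
  have "G (degen k w \<tau> \<theta>) \<noteq> 0" if "\<tau> \<le> ln (m / 2)" for \<tau>
  proof
    assume "G (degen k w \<tau> \<theta>) = 0"
    then have "of_real (exp \<tau>) \<in> {t. poly (S \<theta>) t = 0} - {0}" using d S by (simp del: of_real_exp)
    then have "cmod (of_real (exp \<tau>)) \<in> insert 1 (cmod ` ({t. poly (S \<theta>) t = 0} - {0}))"
      by (rule insertI2[OF imageI])
    then have "m \<le> cmod (of_real (exp \<tau>))" unfolding m_def using fin by (intro Min_le) auto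
    moreover have "exp \<tau> \<le> m / 2" using that m by (metis exp_le_cancel_iff exp_ln half_gt_zero)
    ultimately show False using m unfolding norm_of_real by simp
  qed
  then show ?thesis by blast
qed

definition exp_diff_mat :: "(nat \<Rightarrow> nat \<Rightarrow> nat) \<Rightarrow> nat \<Rightarrow> nat \<Rightarrow> nat \<Rightarrow> int" where
  "exp_diff_mat e i0 i j = int (e i j) - int (e i0 j)"

text \<open>The logarithmic system attached to a degenerate parameter. J and I index the small
  coordinates and monomials, j0 and i0 the ones normalized to 1, and K the monomials that remain:
  their card K = card J equations determine the logarithms on J. The constant \<alpha> is the
  logarithm of the ratio of weights t ^ (w i - w i0).\<close>

locale monomial_system = log_system d I J K "exp_diff_mat e i0" \<alpha> P Q A B V C \<delta>
  for d I J K e i0 \<alpha> P Q A B V C \<delta> +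
  fixes k :: nat and w :: "nat \<Rightarrow> nat" and \<tau> :: real and \<theta> :: "nat \<times> nat \<Rightarrow> complex" and j0 :: nat
  assumes i0: "i0 \<in> {..d} - I" and j0: "j0 \<in> {..d} - J" and KI: "K = {..d} - I - {i0}"
    and \<alpha>: "\<And>i. \<alpha> i = of_real ((real (w i) - real (w i0)) * \<tau>)"
    and P0: "exp (P j0) = 1" "\<And>l. A j0 l = 0" and Q0: "exp (Q i0) = 1" "\<And>l. B i0 l = 0"
    and source: "\<And>x. x j0 = 1 \<Longrightarrow> lin_eqs d {k..<d} \<theta> x \<longleftrightarrow> (\<forall>j\<in>{..d} - J. x j = exp (P j) * (1 + (\<Sum>l\<in>J. A j l * x l)))"
    and target: "\<And>y. y i0 = 1 \<Longrightarrow> lin_eqs d {..<k} \<theta> y \<longleftrightarrow> (\<forall>i\<in>{..d} - I. y i = exp (Q i) * (1 + (\<Sum>l\<in>I. B i l * y l)))"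
    and cKJ: "card K = card J" and det: "det (submat K J (exp_diff_mat e i0)) \<noteq> 0"
begin

definition "xz Z = (\<lambda>j. if j \<le> d then exp (lx j Z) else 0)"
definition "good Z \<longleftrightarrow> Z \<in> small_dom \<and> (\<forall>i\<in>K. exp (E i Z) = 1)"

lemma mon_xz: "mon d e i (xz Z) = exp (\<Sum>j\<le>d. of_nat (e i j) * lx j Z)"
  by (simp add: mon_def xz_def exp_sum exp_of_nat_mult)

lemma mon_ratio: "of_real (exp (\<tau> * real (w i))) * mon d e i (xz Z)
    = (of_real (exp (\<tau> * real (w i0))) * mon d e i0 (xz Z)) * exp (Y i Z)"
proof -
  have "Y i Z + (of_real (\<tau> * real (w i0)) + (\<Sum>j\<le>d. of_nat (e i0 j) * lx j Z))
    = of_real (\<tau> * real (w i)) + (\<Sum>j\<le>d. of_nat (e i j) * lx j Z)"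
    unfolding Y_def \<alpha> exp_diff_mat_def by (simp add: algebra_simps sum_subtractf)
  from arg_cong[OF this, of exp] show ?thesis
    unfolding mon_xz of_real_exp exp_add by (simp only: ac_simps)
qed

lemma Y_i0: "exp (Y i0 Z) = 1"
  by (simp add: Y_def \<alpha> exp_diff_mat_def)

lemma sat_xz_iff: "sat d k e (degen k w \<tau> \<theta>) (xz Z) \<longleftrightarrow> lin_eqs d {..<k} \<theta> (\<lambda>i. exp (Y i Z))"
proof -
  have eq: "(\<lambda>i. of_real (exp (\<tau> * real (w i))) * mon d e i (xz Z))
      = (\<lambda>i. (of_real (exp (\<tau> * real (w i0))) * mon d e i0 (xz Z)) * exp (Y i Z))"
    by (rule ext) (rule mon_ratio)
  show ?thesis unfolding sat_degen eq by (rule lin_eqs_scale) (simp add: mon_xz)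
qed

lemma xz_j0: "xz Z j0 = 1" if "Z \<in> small_dom"
  using exp_lx_notin[of j0 Z] that j0 P0 by (simp add: xz_def small_dom_def u_def)

lemma xz_lin_eqs: "lin_eqs d {k..<d} \<theta> (xz Z)" if Z: "Z \<in> small_dom"
  unfolding source[of "xz Z", OF xz_j0[OF Z]]
proof
  fix j assume j: "j \<in> {..d} - J"
  have "(\<Sum>l\<in>J. A j l * xz Z l) = u j Z" unfolding u_def
    by (rule sum.cong) (use J in \<open>auto simp: xz_def lx_def\<close>)
  then show "xz Z j = exp (P j) * (1 + (\<Sum>l\<in>J. A j l * xz Z l))"
    using exp_lx_notin[of j Z] j Z by (simp add: xz_def small_dom_def)
qed

lemma lin_eqs_Y_iff: "lin_eqs d {..<k} \<theta> (\<lambda>i. exp (Y i Z)) \<longleftrightarrow> (\<forall>i\<in>K. exp (E i Z) = 1)" if Z: "Z \<in> small_dom"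
proof -
  have "{..d} - I = insert i0 K" using i0 by (auto simp: KI)
  moreover have "exp (Y i0 Z) = exp (Q i0) * (1 + v i0 Z)" by (simp add: Y_i0 Q0 v_def)
  moreover have "exp (E i Z) = 1 \<longleftrightarrow> exp (Y i Z) = exp (Q i) * (1 + v i Z)" if "i \<in> K" for i
    using exp_E_eq_1_iff[of i Z] that Z K by auto
  ultimately show ?thesis unfolding target[of "\<lambda>i. exp (Y i Z)", OF Y_i0] v_def[symmetric] by simp
qed

lemma good_torus_sols: assumes "good Z" shows "xz Z \<in> torus_sols d k e (degen k w \<tau> \<theta>) j0"
proof -
  have Z: "Z \<in> small_dom" "\<forall>i\<in>K. exp (E i Z) = 1" using assms by (auto simp: good_def)
  have "\<forall>j\<le>d. xz Z j \<noteq> 0" "\<forall>j>d. xz Z j = 0" by (simp_all add: xz_def)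
  then show ?thesis unfolding torus_sols_def sat_xz_iff lsat_degen
    using xz_j0[OF Z(1)] xz_lin_eqs[OF Z(1)] lin_eqs_Y_iff[OF Z(1)] Z(2)
    by (simp add: sat_xz_iff lsat_degen)
qed

text \<open>Principal logarithms of the coordinates in J give Z; the two smallness assumptions are
  exactly what \<open>small_dom\<close> asks of Z and Y.\<close>

lemma torus_sols_good:
  assumes x: "x \<in> torus_sols d k e (degen k w \<tau> \<theta>) j0" and xJ: "\<And>j. j \<in> J \<Longrightarrow> cmod (x j) \<le> \<delta>"
    and yI: "\<And>l. l \<in> I \<Longrightarrow> cmod (of_real (exp (\<tau> * real (w l))) * mon d e l x)
      \<le> \<delta> * cmod (of_real (exp (\<tau> * real (w i0))) * mon d e i0 x)"
  shows "\<exists>Z. good Z \<and> xz Z = x"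
proof -
  have x1: "x j0 = 1" "\<And>j. j \<le> d \<Longrightarrow> x j \<noteq> 0" "\<And>j. j > d \<Longrightarrow> x j = 0"
    and sat: "sat d k e (degen k w \<tau> \<theta>) x" and lsat: "lin_eqs d {k..<d} \<theta> x"
    using x by (auto simp: torus_sols_def lsat_degen)
  define Z where "Z = (\<lambda>j. Ln (x j))"
  have eZ: "exp (Z j) = x j" if "j \<in> J" for j using that x1(2) J by (auto simp: Z_def)
  have ReZ: "\<forall>j\<in>J. Re (Z j) \<le> ln \<delta>"
  proof
    fix j assume j: "j \<in> J"
    then have "x j \<noteq> 0" using x1(2) J by auto
    then show "Re (Z j) \<le> ln \<delta>" using xJ[OF j] \<delta>(1) by (simp add: Z_def)
  qed
  have "exp (lx j Z) = x j" if j: "j \<le> d" for j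
  proof (cases "j \<in> J")
    case True then show ?thesis using eZ by (simp add: lx_def)
  next
    case False
    have "u j Z = (\<Sum>l\<in>J. A j l * x l)" unfolding u_def by (rule sum.cong) (auto simp: eZ)
    moreover have "x j = exp (P j) * (1 + (\<Sum>l\<in>J. A j l * x l))" using lsat source[of x, OF x1(1)] False j by auto
    ultimately show ?thesis using exp_lx_notin[OF j False ReZ] by simp
  qed
  then have xz: "xz Z = x" using x1(3) by (intro ext) (auto simp: xz_def)
  have "Re (Y l Z) \<le> ln \<delta>" if l: "l \<in> I" for l
  proof -
    define c where "c = cmod (of_real (exp (\<tau> * real (w i0))) * mon d e i0 x)"
    have c: "c > 0" using xz mon_xz[of i0 Z] by (simp add: c_def)
    have "c * cmod (exp (Y l Z)) \<le> \<delta> * c" using yI[OF l] mon_ratio[of l Z] unfolding xz c_def by (simp add: norm_mult)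
    then have "exp (Re (Y l Z)) \<le> \<delta>" using c by (simp add: norm_exp_eq_Re mult.commute)
    then show ?thesis using \<delta>(1) by (metis exp_gt_zero ln_exp ln_le_cancel_iff)
  qed
  then have Zd: "Z \<in> small_dom" using ReZ by (simp add: small_dom_def)
  then have "good Z" using lin_eqs_Y_iff[OF Zd] sat sat_xz_iff[of Z] unfolding xz by (simp add: good_def)
  then show ?thesis using xz by blast
qed

lemma exp_eq_1_int: "exp z = 1 \<Longrightarrow> \<exists>n. z = 2 * of_real pi * \<i> * of_int n" for z :: complex
proof -
  assume "exp z = 1"
  then obtain n where "Re z = 0" "Im z = of_int (2 * n) * pi" using exp_eq_1[of z] by auto
  then show ?thesis by (intro exI[of _ n]) (simp add: complex_eq_iff)
qed

lemma xz_eq_shift: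
  assumes "xz Z = xz Z'"
  shows "\<exists>m. \<forall>j\<in>J. Z' j = Z j + 2 * of_real pi * \<i> * of_int (m j)"
proof -
  have "\<exists>m. \<forall>j\<in>J. Z' j - Z j = 2 * of_real pi * \<i> * of_int (m j)"
  proof (rule bchoice, rule ballI)
    fix j assume j: "j \<in> J"
    then have "j \<le> d" using J by auto
    then have "exp (Z j) = exp (Z' j)" using fun_cong[OF assms, of j] j by (simp add: xz_def lx_def)
    then have "exp (Z' j - Z j) = 1" by (simp add: exp_diff)
    then show "\<exists>n. Z' j - Z j = 2 * of_real pi * \<i> * of_int n" by (rule exp_eq_1_int)
  qed
  then obtain m where "\<forall>j\<in>J. Z' j - Z j = 2 * of_real pi * \<i> * of_int (m j)" by blast
  then show ?thesis by (intro exI[of _ m]) (simp add: algebra_simps)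
qed

lemma xz_cong: "(\<And>j. j \<in> J \<Longrightarrow> Z j = Z' j) \<Longrightarrow> xz Z = xz Z'"
  by (rule ext) (simp add: xz_def lx_def u_def)

lemma xz_shift: assumes "\<And>j. j \<in> J \<Longrightarrow> Z' j = Z j + 2 * of_real pi * \<i> * of_int (m j)" shows "xz Z' = xz Z"
proof -
  have ex: "exp (Z' j) = exp (Z j)" if "j \<in> J" for j
    unfolding assms[OF that] exp_add by (simp add: exp_eq_1 mult.commute mult.left_commute)
  show ?thesis by (rule ext) (simp add: xz_def lx_def u_def ex)
qed

text \<open>A good Z has E = 2 pi i n with an integer vector n, and shifting Z by periods moves n
  within its class modulo the lattice of the exponents. If two points have the same class, a shift
  makes their values of E equal, and uniqueness identifies them.\<close>

lemma card_good_le: "finite (xz ` Collect good) \<and> card (xz ` Collect good) \<le> nat \<bar>det (submat K J (exp_diff_mat e i0))\<bar>"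
proof -
  obtain T :: "(nat \<Rightarrow> int) set" where T: "finite T" "card T = nat \<bar>det (submat K J (exp_diff_mat e i0))\<bar>"
    "\<forall>n. \<exists>r\<in>T. \<exists>m. \<forall>i\<in>K. n i - r i = (\<Sum>j\<in>J. exp_diff_mat e i0 i j * m j)"
    using integer_reps[OF finK finJ cKJ det] by (elim exE conjE) (rule that)
  have logs: "\<exists>n. \<forall>i\<in>K. E i Z = 2 * of_real pi * \<i> * of_int (n i)" if "good Z" for Z
    using that exp_eq_1_int by (intro bchoice) (auto simp: good_def)
  have "\<forall>Z. \<exists>r. good Z \<longrightarrow> r \<in> T \<and> (\<exists>n. (\<forall>i\<in>K. E i Z = 2 * of_real pi * \<i> * of_int (n i)) \<and>
     (\<exists>m. \<forall>i\<in>K. n i - r i = (\<Sum>j\<in>J. exp_diff_mat e i0 i j * m j)))"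
  proof (rule allI)
    fix Z show "\<exists>r. good Z \<longrightarrow> r \<in> T \<and> (\<exists>n. (\<forall>i\<in>K. E i Z = 2 * of_real pi * \<i> * of_int (n i)) \<and>
     (\<exists>m. \<forall>i\<in>K. n i - r i = (\<Sum>j\<in>J. exp_diff_mat e i0 i j * m j)))"
    proof (cases "good Z")
      case True
      from logs[OF True] obtain n where n: "\<forall>i\<in>K. E i Z = 2 * of_real pi * \<i> * of_int (n i)" by (rule exE)
      from T(3)[THEN spec, of n] obtain r where r: "r \<in> T" "\<exists>m. \<forall>i\<in>K. n i - r i = (\<Sum>j\<in>J. exp_diff_mat e i0 i j * m j)"
        by (rule bexE)
      show ?thesis by (rule exI[of _ r], intro impI conjI r(1) exI[of _ n] n r(2))
    qed simp
  qed
  from choice[OF this] obtain rep where rep0: "\<forall>Z. good Z \<longrightarrow> rep Z \<in> T \<and> (\<exists>n. (\<forall>i\<in>K. E i Z = 2 * of_real pi * \<i> * of_int (n i)) \<and>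
     (\<exists>m. \<forall>i\<in>K. n i - rep Z i = (\<Sum>j\<in>J. exp_diff_mat e i0 i j * m j)))" by (rule exE)
  have rep: "\<And>Z. good Z \<Longrightarrow> rep Z \<in> T" "\<And>Z. good Z \<Longrightarrow> \<exists>n. (\<forall>i\<in>K. E i Z = 2 * of_real pi * \<i> * of_int (n i)) \<and>
     (\<exists>m. \<forall>i\<in>K. n i - rep Z i = (\<Sum>j\<in>J. exp_diff_mat e i0 i j * m j))"
    using rep0[THEN spec, THEN mp] by simp_all
  have same: "xz Z = xz Z'" if Z: "good Z" "good Z'" and eq: "rep Z = rep Z'" for Z Z'
  proof -
    obtain n m where n: "\<And>i. i \<in> K \<Longrightarrow> E i Z = 2 * of_real pi * \<i> * of_int (n i)"
      "\<And>i. i \<in> K \<Longrightarrow> n i - rep Z i = (\<Sum>j\<in>J. exp_diff_mat e i0 i j * m j)" using rep(2)[OF Z(1)] by auto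
    obtain n' m' where n': "\<And>i. i \<in> K \<Longrightarrow> E i Z' = 2 * of_real pi * \<i> * of_int (n' i)"
      "\<And>i. i \<in> K \<Longrightarrow> n' i - rep Z' i = (\<Sum>j\<in>J. exp_diff_mat e i0 i j * m' j)" using rep(2)[OF Z(2)] by auto
    \<comment> \<open>Both n - \<open>rep Z\<close> and n' - \<open>rep Z'\<close> lie in the
      lattice, with coefficients m and m'; as the representatives agree, shifting by m - m' turns n'
      into n.\<close>
    define Z2 where "Z2 = (\<lambda>j. Z' j + 2 * of_real pi * \<i> * of_int (m j - m' j))"
    have "Z2 \<in> small_dom" by (rule shift(2)[of Z2 Z' "\<lambda>j. m j - m' j" 0]) (use Z in \<open>auto simp: Z2_def good_def\<close>)
    moreover have "E i Z = E i Z2" if i: "i \<in> K" for i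
    proof -
      have "E i Z2 = E i Z' + 2 * of_real pi * \<i> * of_int (\<Sum>j\<in>J. exp_diff_mat e i0 i j * (m j - m' j))"
        by (rule shift(1)) (use i K in \<open>auto simp: Z2_def\<close>)
      also have "(\<Sum>j\<in>J. exp_diff_mat e i0 i j * (m j - m' j)) = n i - n' i"
        using n(2)[OF i] n'(2)[OF i] eq by (simp add: right_diff_distrib sum_subtractf)
      finally show ?thesis using n(1)[OF i] n'(1)[OF i] by (simp add: algebra_simps)
    qed
    ultimately have "Z j = Z2 j" if "j \<in> J" for j using unique[of Z Z2 j] Z that by (auto simp: good_def)
    then have "xz Z = xz Z2" by (rule xz_cong)
    also have "\<dots> = xz Z'" by (rule xz_shift[of Z2 Z' "\<lambda>j. m j - m' j"]) (simp add: Z2_def)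
    finally show ?thesis .
  qed
  define sel where "sel = inv_into (Collect good) xz"
  have sel: "good (sel x) \<and> xz (sel x) = x" if "x \<in> xz ` Collect good" for x
    using inv_into_into[OF that] f_inv_into_f[OF that] by (simp add: sel_def)
  have inj: "inj_on (\<lambda>x. rep (sel x)) (xz ` Collect good)"
  proof (rule inj_onI)
    fix x y assume a: "x \<in> xz ` Collect good" "y \<in> xz ` Collect good" "rep (sel x) = rep (sel y)"
    then have "xz (sel x) = xz (sel y)" by (intro same) (use sel in auto)
    then show "x = y" using sel[OF a(1)] sel[OF a(2)] by simp
  qed
  have sub: "(\<lambda>x. rep (sel x)) ` (xz ` Collect good) \<subseteq> T" using rep(1) sel by blast
  show ?thesis using inj_on_finite[OF inj sub T(1)] card_inj_on_le[OF inj sub T(1)] T(2) by simp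
qed

text \<open>Equal points have logarithms that differ by periods, so their integer vectors are
  congruent and, being representatives, equal.\<close>

lemma card_reps_le:
  assumes T: "\<forall>r\<in>T. \<forall>r'\<in>T. (\<exists>m. \<forall>i\<in>K. r i - r' i = (\<Sum>j\<in>J. exp_diff_mat e i0 i j * m j)) \<longrightarrow> r = r'"
    and Z: "\<And>r. r \<in> T \<Longrightarrow> \<exists>Z\<in>small_dom. \<forall>i\<in>K. E i Z = 2 * of_real pi * \<i> * of_int (r i)"
  shows "card T \<le> card (xz ` Collect good)"
proof -
  have "\<forall>r\<in>T. \<exists>Z. Z \<in> small_dom \<and> (\<forall>i\<in>K. E i Z = 2 * of_real pi * \<i> * of_int (r i))" using Z by blast
  from bchoice[OF this] obtain sel where sel0: "\<forall>r\<in>T. sel r \<in> small_dom \<and> (\<forall>i\<in>K. E i (sel r) = 2 * of_real pi * \<i> * of_int (r i))"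
    by (rule exE)
  have sel: "\<And>r. r \<in> T \<Longrightarrow> sel r \<in> small_dom" "\<And>r i. r \<in> T \<Longrightarrow> i \<in> K \<Longrightarrow> E i (sel r) = 2 * of_real pi * \<i> * of_int (r i)"
    using sel0[THEN bspec] by simp_all
  have good: "good (sel r)" if "r \<in> T" for r
  proof -
    have "exp (2 * of_real pi * \<i> * of_int n) = (1::complex)" for n
      by (simp add: exp_eq_1 mult.commute mult.left_commute)
    then show ?thesis using sel that by (simp add: good_def)
  qed
  have "inj_on (\<lambda>r. xz (sel r)) T"
  proof (rule inj_onI)
    fix r r' assume r: "r \<in> T" "r' \<in> T" "xz (sel r) = xz (sel r')"
    obtain m where m: "\<forall>j\<in>J. sel r' j = sel r j + 2 * of_real pi * \<i> * of_int (m j)" using xz_eq_shift[OF r(3)] by blast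
    have "r' i - r i = (\<Sum>j\<in>J. exp_diff_mat e i0 i j * m j)" if i: "i \<in> K" for i
    proof -
      have "E i (sel r') = E i (sel r) + 2 * of_real pi * \<i> * of_int (\<Sum>j\<in>J. exp_diff_mat e i0 i j * m j)"
        by (rule shift(1)) (use m i K in auto)
      then have "2 * of_real pi * \<i> * (of_int (r' i) :: complex) = 2 * of_real pi * \<i> * of_int (r i + (\<Sum>j\<in>J. exp_diff_mat e i0 i j * m j))"
        unfolding sel(2)[OF r(1) i] sel(2)[OF r(2) i] by (simp only: of_int_add distrib_left)
      then have "(of_int (r' i) :: complex) = of_int (r i + (\<Sum>j\<in>J. exp_diff_mat e i0 i j * m j))"
        by (simp only: mult_cancel_left) simp
      then show ?thesis unfolding of_int_eq_iff by simp
    qed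
    then show "r = r'" using T r by metis
  qed
  moreover have "(\<lambda>r. xz (sel r)) ` T \<subseteq> xz ` Collect good" using good by auto
  ultimately show ?thesis using card_good_le by (intro card_inj_on_le) auto
qed

end

section \<open>Counting the solutions of a degenerating system\<close>

lemma member_le_sum_sum:
  fixes f :: "nat \<Rightarrow> nat \<Rightarrow> real"
  assumes "finite S" "i \<in> S" "\<And>i j. f i j \<ge> 0" shows "(\<Sum>j\<in>T. f i j) \<le> (\<Sum>i\<in>S. \<Sum>j\<in>T. f i j)"
  using assms by (intro member_le_sum[of i S "\<lambda>i. \<Sum>j\<in>T. f i j"]) (auto intro: sum_nonneg)

text \<open>The charts and the matrix V depend on neither the weights nor \<tau>, hence neither does
  \<open>\<delta>0\<close>. This order of quantifiers lets \<delta> be fixed first and \<tau> be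
  made very negative afterwards.\<close>

lemma monomial_system_exists:
  assumes un: "uniform_rows d {..<k} \<theta>" "uniform_rows d {k..<d} \<theta>" and k: "k \<le> d"
    and I: "I \<subseteq> {..d}" "card I = d - k" and J: "J \<subseteq> {..d}" "card J = k"
    and i0: "i0 \<in> {..d} - I" and j0: "j0 \<in> {..d} - J" and K: "K = {..d} - I - {i0}"
    and det: "det (submat K J (exp_diff_mat e i0)) \<noteq> 0"
  shows "\<exists>P Q A B V C \<delta>0. \<delta>0 > 0 \<and> (\<forall>w \<tau> \<delta>. 0 < \<delta> \<longrightarrow> \<delta> \<le> \<delta>0 \<longrightarrow>
    monomial_system d I J K e i0 (\<lambda>i. of_real ((real (w i) - real (w i0)) * \<tau>)) P Q A B V C \<delta> k w \<tau> \<theta> j0)"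
proof -
  let ?g = "exp_diff_mat e i0"
  have fin: "finite I" "finite J" "finite K" using I J K finite_subset by auto
  have cK: "card K = card J" using i0 I J K k fin by (simp add: card_Diff_subset)
  have cc: "card J + card {k..<d} = d" "card I + card {..<k} = d" using I(2) J(2) k by auto
  obtain P A where PA: "exp (P j0) = 1" "\<forall>l. A j0 l = 0" "\<forall>x. x j0 = 1 \<longrightarrow>
    (lin_eqs d {k..<d} \<theta> x \<longleftrightarrow> (\<forall>j\<in>{..d} - J. x j = exp (P j) * (1 + (\<Sum>l\<in>J. A j l * x l))))"
    using uniform_rows_chart[OF finite_atLeastLessThan un(2) J(1) j0 cc(1)] by (elim exE conjE) (rule that)
  obtain Q B where QB: "exp (Q i0) = 1" "\<forall>l. B i0 l = 0" "\<forall>x. x i0 = 1 \<longrightarrow>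
    (lin_eqs d {..<k} \<theta> x \<longleftrightarrow> (\<forall>j\<in>{..d} - I. x j = exp (Q j) * (1 + (\<Sum>l\<in>I. B j l * x l))))"
    using uniform_rows_chart[OF finite_lessThan un(1) I(1) i0 cc(2)] by (elim exE conjE) (rule that)
  have "det (submat K J (\<lambda>i j. of_int (?g i j) :: complex)) = of_int (det (submat K J ?g))"
  proof -
    have "submat K J (\<lambda>i j. of_int (?g i j) :: complex) = map_mat of_int (submat K J ?g)"
      by (rule eq_matI) (auto simp: submat_def)
    then show ?thesis by (simp add: of_int_hom.hom_det)
  qed
  then have "det (submat K J (\<lambda>i j. of_int (?g i j) :: complex)) \<noteq> 0" using det by simp
  from submat_inverse[OF fin(3,2) cK this]
  obtain V where V: "(\<forall>a\<in>J. \<forall>b\<in>J. (\<Sum>r\<in>K. V a r * of_int (?g r b)) = (if a = b then 1 else 0)) \<and>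
    (\<forall>r\<in>K. \<forall>r'\<in>K. (\<Sum>a\<in>J. of_int (?g r a) * V a r') = (if r = r' then 1 else (0::complex)))" by (rule exE)
  define cA cB cg cV where "cA = (\<Sum>j\<le>d. \<Sum>l\<in>J. cmod (A j l))" and "cB = (\<Sum>j\<le>d. \<Sum>l\<in>I. cmod (B j l))"
    and "cg = (\<Sum>i\<le>d. \<Sum>j\<le>d. \<bar>real_of_int (?g i j)\<bar>)" and "cV = (\<Sum>a\<in>J. \<Sum>b\<in>K. cmod (V a b))"
  define C where "C = 1 + real (card J) + cA + cB + cg + cV"
  have nn: "cA \<ge> 0" "cB \<ge> 0" "cg \<ge> 0" "cV \<ge> 0" unfolding cA_def cB_def cg_def cV_def by (intro sum_nonneg; simp)+
  define \<delta>0 where "\<delta>0 = 1 / (8 * C ^ 4)"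
  have C1: "C \<ge> 1" using nn by (simp add: C_def)
  have bA: "(\<Sum>l\<in>J. cmod (A j l)) \<le> C" if "j \<le> d" for j
  proof -
    have "(\<Sum>l\<in>J. cmod (A j l)) \<le> cA" unfolding cA_def by (rule member_le_sum_sum) (use that in auto)
    then show ?thesis using nn by (simp add: C_def)
  qed
  have bB: "(\<Sum>l\<in>I. cmod (B j l)) \<le> C" if "j \<le> d" for j
  proof -
    have "(\<Sum>l\<in>I. cmod (B j l)) \<le> cB" unfolding cB_def by (rule member_le_sum_sum) (use that in auto)
    then show ?thesis using nn by (simp add: C_def)
  qed
  have bg: "(\<Sum>j\<le>d. \<bar>real_of_int (?g i j)\<bar>) \<le> C" if "i \<le> d" for i
  proof -
    have "(\<Sum>j\<le>d. \<bar>real_of_int (?g i j)\<bar>) \<le> cg" unfolding cg_def by (rule member_le_sum_sum) (use that in auto)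
    then show ?thesis using nn by (simp add: C_def)
  qed
  have bV: "(\<Sum>b\<in>K. cmod (V a b)) \<le> C" if "a \<in> J" for a
  proof -
    have "(\<Sum>b\<in>K. cmod (V a b)) \<le> cV" unfolding cV_def by (rule member_le_sum_sum) (use that fin in auto)
    then show ?thesis using nn by (simp add: C_def)
  qed
  have "monomial_system d I J K e i0 (\<lambda>i. of_real ((real (w i) - real (w i0)) * \<tau>)) P Q A B V C \<delta> k w \<tau> \<theta> j0"
    if \<delta>: "0 < \<delta>" "\<delta> \<le> \<delta>0" for w \<tau> \<delta>
  proof unfold_locales
    show "8 * C ^ 4 * \<delta> \<le> 1" using \<delta> C1 by (simp add: \<delta>0_def field_simps)
    show "(\<Sum>i\<in>K. V a i * of_int (?g i b)) = (if a = b then 1 else 0)" if "a \<in> J" "b \<in> J" for a b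
      using V[THEN conjunct1] that by blast
    show "(\<Sum>j\<in>J. of_int (?g a j) * V j b) = (if a = b then 1 else 0)" if "a \<in> K" "b \<in> K" for a b
      using V[THEN conjunct2] that by blast
    show "lin_eqs d {k..<d} \<theta> x \<longleftrightarrow> (\<forall>j\<in>{..d} - J. x j = exp (P j) * (1 + (\<Sum>l\<in>J. A j l * x l)))" if "x j0 = 1" for x
      using PA(3) that by blast
    show "lin_eqs d {..<k} \<theta> y \<longleftrightarrow> (\<forall>i\<in>{..d} - I. y i = exp (Q i) * (1 + (\<Sum>l\<in>I. B i l * y l)))" if "y i0 = 1" for y
      using QB(3) that by blast
    show "real (card J) \<le> C" using nn by (simp add: C_def)
  qed (use I J K i0 j0 C1 bA bB bg bV \<delta> PA QB cK det in auto)
  moreover have "\<delta>0 > 0" using C1 by (simp add: \<delta>0_def)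
  ultimately show ?thesis
    by (intro exI[of _ P] exI[of _ Q] exI[of _ A] exI[of _ B] exI[of _ V] exI[of _ C] exI[of _ \<delta>0]) simp
qed

text \<open>With these weights, the coordinates \<open>x j\<close> for \<open>j \<in> J\<close> and the monomials with index in
  \<open>I\<close> of size about \<open>exp \<tau>\<close> are compatible, so all solutions allowed by \<open>(I, J)\<close> occur.\<close>

lemma torus_sols_lower:
  assumes G: "pfun G" "\<exists>\<theta>. G \<theta> \<noteq> 0" and k: "k \<le> d"
    and I: "I \<subseteq> {..d}" "card I = d - k" "0 \<notin> I" and J: "J \<subseteq> {..d}" "card J = k" "0 \<notin> J"
    and det: "det (submat ({..d} - I - {0}) J (exp_diff_mat e 0)) \<noteq> 0"
  shows "\<exists>\<theta>. G \<theta> \<noteq> 0 \<and> (\<exists>X \<subseteq> torus_sols d k e \<theta> 0. finite X \<and>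
    card X \<ge> nat \<bar>det (submat ({..d} - I - {0}) J (exp_diff_mat e 0))\<bar>)"
proof -
  define K where "K = {..d} - I - {0}"
  let ?g = "exp_diff_mat e 0"
  have "generic (\<lambda>\<theta>. G \<theta> \<noteq> 0)" using G by (auto intro: genericI[of G])
  then have "generic (\<lambda>\<theta>. G \<theta> \<noteq> 0 \<and> uniform_rows d {..<k} \<theta> \<and> uniform_rows d {k..<d} \<theta>)"
    by (intro generic_conj uniform_rows_generic) auto
  then obtain \<theta> where \<theta>: "G \<theta> \<noteq> 0" "uniform_rows d {..<k} \<theta>" "uniform_rows d {k..<d} \<theta>" using generic_ex by blast
  have fin: "finite I" "finite J" "finite K" using I J K_def finite_subset by auto
  have cK: "card K = card J" using I J K_def k fin by (simp add: card_Diff_subset)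
  have zI: "0 \<in> {..d} - I" and zJ: "0 \<in> {..d} - J" using I(3) J(3) by auto
  obtain P Q A B V C \<delta> where \<delta>: "\<delta> > 0" and ms: "\<forall>w \<tau> \<delta>'. 0 < \<delta>' \<longrightarrow> \<delta>' \<le> \<delta> \<longrightarrow>
    monomial_system d I J K e 0 (\<lambda>i. of_real ((real (w i) - real (w 0)) * \<tau>)) P Q A B V C \<delta>' k w \<tau> \<theta> 0"
    using monomial_system_exists[OF \<theta>(2,3) k I(1,2) J(1,2) zI zJ K_def det[folded K_def]]
    by (elim exE conjE) (rule that)
  obtain T :: "(nat \<Rightarrow> int) set" where T: "finite T" "card T = nat \<bar>det (submat K J ?g)\<bar>"
    "\<forall>r\<in>T. \<forall>r'\<in>T. (\<exists>m. \<forall>i\<in>K. r i - r' i = (\<Sum>j\<in>J. ?g i j * m j)) \<longrightarrow> r = r'"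
    using integer_reps[OF fin(3,2) cK det[folded K_def]] by (elim exE conjE) (rule that)
  \<comment> \<open>If x j is of order t for j in J and of order 1 otherwise, the weighted monomial
    i has the exponent \<open>w i + (\<Sum>j\<in>J. e i j)\<close> as its order in t, which is W + 1
    for i in I and W for the others. W is large enough for the subtraction in w.\<close>
  define W where "W = (\<Sum>i\<le>d. \<Sum>j\<in>J. e i j)"
  define w where "w = (\<lambda>i. W + (if i \<in> I then 1 else 0) - (\<Sum>j\<in>J. e i j))"
  have w: "real (w i) - real (w 0) = (if i \<in> I then 1 else 0) - (\<Sum>j\<in>J. real_of_int (?g i j))" if "i \<le> d" for i
  proof -
    have "real (w i) = real W + (if i \<in> I then 1 else 0) - (\<Sum>j\<in>J. real (e i j))" if "i \<le> d" for i
    proof -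
      have "(\<Sum>j\<in>J. e i j) \<le> W" unfolding W_def
        by (rule member_le_sum[of i "{..d}" "\<lambda>i. \<Sum>j\<in>J. e i j"]) (use that in auto)
      then have "(\<Sum>j\<in>J. e i j) \<le> W + (if i \<in> I then 1 else 0)" by simp
      then show ?thesis unfolding w_def by (subst of_nat_diff) auto
    qed
    from this[OF that] this[of 0] show ?thesis using I(3)
      by (simp add: exp_diff_mat_def sum_subtractf)
  qed
  define \<kappa> where "\<kappa> = (\<lambda>b. (\<Sum>j\<in>{..d} - J. of_int (?g b j) * P j) - Q b)"
  \<comment> \<open>The weights contribute to the linear equations precisely the exponents applied
    to the constant vector \<tau>. The unperturbed solution is thus \<tau> + z0 with z0 independent
    of \<tau>.\<close>
  define z0 where "z0 = (\<lambda>(r :: nat \<Rightarrow> int) a. \<Sum>b\<in>K. V a b * (2 * of_real pi * \<i> * of_int (r b) - \<kappa> b))"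
  define M' where "M' = 1 + (\<Sum>r\<in>T. \<Sum>a\<in>J. cmod (z0 r a))"
  define X where "X = (\<lambda>l. \<Sum>j\<in>{..d} - J. of_int (?g l j) * P j)"
  \<comment> \<open>Bounds the distance from \<tau> of all Z j with j in J and all Y l with l in I,
    over the unit balls around the unperturbed solutions.\<close>
  define M where "M = C * M' + (\<Sum>l\<in>I. cmod (X l)) + C + M'"
  obtain \<tau>1 where \<tau>1: "\<forall>\<tau>\<le>\<tau>1. G (degen k w \<tau> \<theta>) \<noteq> 0" using degen_nonzero[OF G(1) \<theta>(1)] by blast
  \<comment> \<open>Below \<open>\<tau>1\<close> the parameter is off the zero set of G; \<tau> + M
    \<le> ln \<delta> puts the unit balls inside \<open>small_dom\<close>.\<close>
  define \<tau> where "\<tau> = min \<tau>1 (ln \<delta> - M)"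
  have \<tau>M: "\<tau> + M \<le> ln \<delta>" by (simp add: \<tau>_def)
  interpret S: monomial_system d I J K e 0 "\<lambda>i. of_real ((real (w i) - real (w 0)) * \<tau>)" P Q A B V C \<delta> k w \<tau> \<theta> 0
    using ms \<delta> by blast
  have z0M: "cmod (z0 r a) + 1 \<le> M'" if "r \<in> T" "a \<in> J" for r a
  proof -
    have "cmod (z0 r a) \<le> (\<Sum>a\<in>J. cmod (z0 r a))" using fin that by (intro member_le_sum) auto
    also have "\<dots> \<le> (\<Sum>r\<in>T. \<Sum>a\<in>J. cmod (z0 r a))"
      using T(1) that by (intro member_le_sum[of r T "\<lambda>r. \<Sum>a\<in>J. cmod (z0 r a)"]) (auto intro: sum_nonneg)
    finally show ?thesis by (simp add: M'_def)
  qed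
  have M'0: "M' \<ge> 1" unfolding M'_def by (simp add: sum_nonneg)
  have "C * M' \<ge> 0" using S.C M'0 by simp
  moreover have "(\<Sum>l\<in>I. cmod (X l)) \<ge> 0" by (rule sum_nonneg) simp
  ultimately have MM': "M' \<le> M" using S.C by (simp add: M_def)
  have MX: "C * M' + cmod (X l) + C \<le> M" if "l \<in> I" for l
  proof -
    have "cmod (X l) \<le> (\<Sum>l\<in>I. cmod (X l))" using fin that by (intro member_le_sum) auto
    then show ?thesis using M'0 by (simp add: M_def)
  qed
  have "\<exists>Z\<in>S.small_dom. \<forall>i\<in>K. S.E i Z = 2 * of_real pi * \<i> * of_int (r i)" if r: "r \<in> T" for r
  proof (rule S.exists[of "\<lambda>a. of_real \<tau> + z0 r a"])
    fix a assume a: "a \<in> J"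
    have b: "2 * of_real pi * \<i> * of_int (r b) - S.\<beta> b = (2 * of_real pi * \<i> * of_int (r b) - \<kappa> b) + (\<Sum>j\<in>J. of_int (?g b j) * of_real \<tau>)"
      if "b \<in> K" for b
    proof -
      have bd: "b \<le> d" "b \<notin> I" using that by (auto simp: K_def)
      have "S.\<beta> b = of_real ((real (w b) - real (w 0)) * \<tau>) + \<kappa> b" unfolding S.\<beta>_def \<kappa>_def by simp
      also have "(real (w b) - real (w 0)) * \<tau> = - (\<Sum>j\<in>J. real_of_int (?g b j) * \<tau>)"
        unfolding w[OF bd(1)] using bd(2) by (simp add: sum_distrib_right)
      finally show ?thesis by (simp add: sum_distrib_right)
    qed
    have "(\<Sum>b\<in>K. V a b * (2 * of_real pi * \<i> * of_int (r b) - S.\<beta> b))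
      = z0 r a + (\<Sum>b\<in>K. V a b * (\<Sum>j\<in>J. of_int (?g b j) * of_real \<tau>))"
      unfolding z0_def sum.distrib[symmetric] distrib_left[symmetric] by (rule sum.cong[OF refl]) (simp only: b)
    then show "of_real \<tau> + z0 r a = (\<Sum>b\<in>K. V a b * (2 * of_real pi * \<i> * of_int (r b) - S.\<beta> b))"
      using S.V_apply[OF a, of "\<lambda>_. of_real \<tau>"] by simp
  next
    fix Z assume "S.N Z (\<lambda>a. of_real \<tau> + z0 r a) \<le> 1"
    then have Za: "cmod (Z a - of_real \<tau>) \<le> M'" if "a \<in> J" for a
      using S.member_le_N[OF that, of Z "\<lambda>a. of_real \<tau> + z0 r a"] z0M[OF r that]
        norm_triangle_ineq[of "Z a - (of_real \<tau> + z0 r a)" "z0 r a"] by simp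
    have ReZ: "\<forall>a\<in>J. Re (Z a) \<le> ln \<delta>"
    proof
      fix a assume "a \<in> J"
      then have "Re (Z a) - \<tau> \<le> M'" using Za[of a] complex_Re_le_cmod[of "Z a - of_real \<tau>"] by simp
      then show "Re (Z a) \<le> ln \<delta>" using MM' \<tau>M by simp
    qed
    moreover have "Re (S.Y l Z) \<le> ln \<delta>" if l: "l \<in> I" for l
    proof -
      have ld: "l \<le> d" using l I by auto
      have "S.Y l Z = of_real ((real (w l) - real (w 0)) * \<tau>) + (\<Sum>j\<in>J. of_int (?g l j) * Z j)
        + X l + (\<Sum>j\<in>{..d} - J. of_int (?g l j) * Ln (1 + S.u j Z))" unfolding S.Y_split X_def by simp
      also have "(real (w l) - real (w 0)) * \<tau> = \<tau> - (\<Sum>j\<in>J. real_of_int (?g l j) * \<tau>)"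
        unfolding w[OF ld] using l by (simp add: left_diff_distrib sum_distrib_right)
      finally have Y: "S.Y l Z - of_real \<tau> = (\<Sum>j\<in>J. of_int (?g l j) * (Z j - of_real \<tau>)) + X l
        + (\<Sum>j\<in>{..d} - J. of_int (?g l j) * Ln (1 + S.u j Z))"
        by (simp add: right_diff_distrib sum_subtractf)
      have 1: "cmod (\<Sum>j\<in>J. of_int (?g l j) * (Z j - of_real \<tau>)) \<le> C * M'"
        by (rule S.lin_comb_bound) (use Za S.g_sum_le[OF ld J(1)] M'0 in auto)
      have 2: "cmod (\<Sum>j\<in>{..d} - J. of_int (?g l j) * Ln (1 + S.u j Z)) \<le> C * 1"
      proof (rule S.lin_comb_bound)
        fix j assume j: "j \<in> {..d} - J"
        then have "cmod (S.u j Z) \<le> 1 / 8" using S.u_small[OF ReZ, of j] S.C\<delta> by simp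
        then show "cmod (Ln (1 + S.u j Z)) \<le> 1" using norm_Ln_le[of "S.u j Z"] by simp
      qed (use S.g_sum_le[OF ld, of "{..d} - J"] in auto)
      have "cmod (S.Y l Z - of_real \<tau>) \<le> C * M' + cmod (X l) + C"
        unfolding Y using 1 2 by (intro norm_triangle_le add_mono) auto
      then have "Re (S.Y l Z) - \<tau> \<le> M" using MX[OF l] complex_Re_le_cmod[of "S.Y l Z - of_real \<tau>"] by simp
      then show ?thesis using \<tau>M by simp
    qed
    ultimately show "Z \<in> S.small_dom" unfolding S.small_dom_def by blast
  qed
  then have "card T \<le> card (S.xz ` Collect S.good)" by (rule S.card_reps_le[OF T(3)])
  moreover have "S.xz ` Collect S.good \<subseteq> torus_sols d k e (degen k w \<tau> \<theta>) 0" using S.good_torus_sols by auto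
  moreover have "finite (S.xz ` Collect S.good)" using S.card_good_le by blast
  moreover have "G (degen k w \<tau> \<theta>) \<noteq> 0" using \<tau>1 by (simp add: \<tau>_def)
  ultimately show ?thesis using T(2) unfolding K_def
    by (intro exI[of _ "degen k w \<tau> \<theta>"] conjI exI[of _ "S.xz ` Collect S.good"]) (simp_all add: K_def)
qed

text \<open>With D bounding the coefficient sums of the solved equations, d + 1 - card R coordinates
  of size at most b bound all others by D b. Too many small coordinates would thus contradict the
  one of size m. If their number is extremal, they and any further j already control that
  coordinate, which bounds y j from below.\<close>

lemma small_coordinates:
  assumes R: "finite R" and un: "uniform_rows d R \<theta>" and cR: "card R \<le> d"
  shows "\<exists>c. 0 < c \<and> c \<le> 1 \<and> (\<forall>\<delta> y m. 0 < \<delta> \<longrightarrow> \<delta> \<le> c \<longrightarrow> lin_eqs d R \<theta> y \<longrightarrow> (\<exists>i\<le>d. cmod (y i) = m) \<longrightarrow> m > 0 \<longrightarrow>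
    card {i\<in>{..d}. cmod (y i) < \<delta> * m} \<le> d - card R \<and>
    (card {i\<in>{..d}. cmod (y i) < \<delta> * m} = d - card R \<longrightarrow> (\<forall>j\<in>{..d} - {i\<in>{..d}. cmod (y i) < \<delta> * m}. c * m \<le> cmod (y j))))"
proof -
  define KK where "KK = {K. K \<subseteq> {..d} \<and> card K = card R}"
  have finKK: "finite KK" unfolding KK_def by simp
  have "\<forall>K\<in>KK. \<exists>s. \<forall>y. lin_eqs d R \<theta> y \<longrightarrow> (\<forall>i\<in>K. y i = (\<Sum>l\<in>{..d} - K. s i l * y l))"
  proof
    fix K assume "K \<in> KK"
    then have "K \<subseteq> {..d}" "card K = card R" by (auto simp: KK_def)
    from uniform_rows_solve[OF R un this] obtain s where
      "(\<forall>y. lin_eqs d R \<theta> y \<longleftrightarrow> (\<forall>i\<in>K. y i = (\<Sum>l\<in>{..d} - K. s i l * y l))) \<and> (\<forall>i\<in>K. \<forall>l\<in>{..d} - K. s i l \<noteq> 0)"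
      by (rule exE)
    then show "\<exists>s. \<forall>y. lin_eqs d R \<theta> y \<longrightarrow> (\<forall>i\<in>K. y i = (\<Sum>l\<in>{..d} - K. s i l * y l))"
      by (intro exI[of _ s]) simp
  qed
  from bchoice[OF this] obtain s where s: "\<forall>K\<in>KK. \<forall>y. lin_eqs d R \<theta> y \<longrightarrow> (\<forall>i\<in>K. y i = (\<Sum>l\<in>{..d} - K. s K i l * y l))"
    by (rule exE)
  define D where "D = 1 + (\<Sum>K\<in>KK. \<Sum>i\<in>K. \<Sum>l\<in>{..d} - K. cmod (s K i l))"
  have D1: "D \<ge> 1" unfolding D_def by (simp add: sum_nonneg)
  have F: "cmod (y i) \<le> D * b"
    if y: "lin_eqs d R \<theta> y" and L: "L \<subseteq> {..d}" "card L = d + 1 - card R" and b: "\<And>l. l \<in> L \<Longrightarrow> cmod (y l) \<le> b" "b \<ge> 0" and i: "i \<le> d" for y L b i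
  proof (cases "i \<in> L")
    case True
    have "b \<le> D * b" using D1 b(2) by (simp add: mult_right_mono[of 1 D b, simplified])
    then show ?thesis using b(1)[OF True] by linarith
  next
    case False
    define K where "K = {..d} - L"
    have fL: "finite L" using L(1) finite_subset by blast
    have K: "K \<in> KK" using L cR fL by (auto simp: K_def KK_def card_Diff_subset)
    have iK: "i \<in> K" "{..d} - K = L" using False i L by (auto simp: K_def)
    have fK: "finite K" by (simp add: K_def)
    have "(\<Sum>l\<in>L. cmod (s K i l)) \<le> (\<Sum>i\<in>K. \<Sum>l\<in>L. cmod (s K i l))"
      by (rule member_le_sum_sum[OF fK iK(1)]) simp
    also have "\<dots> = (\<Sum>i\<in>K. \<Sum>l\<in>{..d} - K. cmod (s K i l))" by (simp only: iK(2))
    also have "\<dots> \<le> (\<Sum>K\<in>KK. \<Sum>i\<in>K. \<Sum>l\<in>{..d} - K. cmod (s K i l))"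
      by (rule member_le_sum[OF K _ finKK, of "\<lambda>K. \<Sum>i\<in>K. \<Sum>l\<in>{..d} - K. cmod (s K i l)"]) (intro sum_nonneg norm_ge_zero)
    finally have le: "(\<Sum>l\<in>L. cmod (s K i l)) \<le> D" by (simp add: D_def)
    have "y i = (\<Sum>l\<in>{..d} - K. s K i l * y l)" using s[THEN bspec, OF K] y iK(1) by blast
    then have "y i = (\<Sum>l\<in>L. s K i l * y l)" by (simp only: iK(2))
    then have "cmod (y i) \<le> (\<Sum>l\<in>L. cmod (s K i l) * b)"
      using b by (auto simp: norm_mult intro!: sum_norm_le mult_left_mono)
    also have "\<dots> \<le> D * b" using le b(2) by (simp add: sum_distrib_right[symmetric] mult_right_mono)
    finally show ?thesis .
  qed
  \<comment> \<open>The factor 2 leaves entries below c m under m / 2 even after amplification by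
    D.\<close>
  define c where "c = 1 / (2 * D)"
  show ?thesis
  proof (intro exI[of _ c] conjI allI impI ballI)
    show "0 < c" "c \<le> 1" using D1 by (simp_all add: c_def)
    fix \<delta> y m assume \<delta>: "0 < \<delta>" "\<delta> \<le> c" and y: "lin_eqs d R \<theta> y" and mx: "\<exists>i\<le>d. cmod (y i) = m" and m: "m > 0"
    define S where "S = {i\<in>{..d}. cmod (y i) < \<delta> * m}"
    obtain i where i: "i \<le> d" "cmod (y i) = m" using mx by blast
    have "D * \<delta> \<le> 1 / 2" using \<delta>(2) D1 by (simp add: c_def field_simps)
    then have Dm: "D * (\<delta> * m) < m" using m mult_right_mono[of "D * \<delta>" "1/2" m] by simp
    have fS: "finite S" by (simp add: S_def)
    show cS: "card {i\<in>{..d}. cmod (y i) < \<delta> * m} \<le> d - card R"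
    proof (rule ccontr)
      assume "\<not> ?thesis"
      then have "d + 1 - card R \<le> card S" using cR by (simp add: S_def)
      then obtain L where L: "L \<subseteq> S" "card L = d + 1 - card R" using obtain_subset_with_card_n by metis
      have "cmod (y i) \<le> D * (\<delta> * m)"
        by (rule F[OF y _ L(2) _ _ i(1)]) (use L \<delta> m in \<open>auto simp: S_def\<close>)
      then show False using Dm i by simp
    qed
    fix j assume c: "card {i\<in>{..d}. cmod (y i) < \<delta> * m} = d - card R" and "j \<in> {..d} - {i\<in>{..d}. cmod (y i) < \<delta> * m}"
    then have j: "j \<le> d" "j \<notin> S" by (auto simp: S_def)
    have "m \<le> D * max (cmod (y j)) (\<delta> * m)" unfolding i(2)[symmetric]
      by (rule F[OF y _ _ _ _ i(1), of "insert j S"]) (use j c fS cR \<delta> m in \<open>auto simp: S_def i(2)\<close>)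
    then have "m \<le> D * cmod (y j)" using Dm by (auto simp: max_def split: if_splits)
    then have "m / (2 * D) \<le> cmod (y j)" using D1 m by (simp add: field_simps)
    then show "c * m \<le> cmod (y j)" by (simp add: c_def)
  qed
qed

text \<open>Logarithms of absolute values turn the monomials into linear functions, to which the
  functional h is applied. The terms of small monomials and of small coordinates drop out; all other
  logarithms lie within ln (1/\<delta>) of ln my or ln mx, and these reference values cancel as h
  sums to 0 and all monomials have the same degree. What is left bounds \<tau> unless h vanishes on
  the weights.\<close>

lemma monomial_valuation_bound:
  fixes h :: "nat \<Rightarrow> real"
  assumes x: "\<And>j. j \<le> d \<Longrightarrow> x j \<noteq> 0" and e: "\<And>i. i \<le> d \<Longrightarrow> (\<Sum>j\<le>d. e i j) = q"
    and y: "\<And>i. i \<le> d \<Longrightarrow> y i = of_real (exp (\<tau> * real (w i))) * mon d e i x"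
    and \<delta>: "0 < \<delta>" "\<delta> \<le> 1" and m: "0 < mx" "0 < my"
    and bx: "\<And>j. j \<le> d \<Longrightarrow> cmod (x j) \<le> mx" and by': "\<And>i. i \<le> d \<Longrightarrow> cmod (y i) \<le> my"
    and h0: "\<And>i. i \<le> d \<Longrightarrow> cmod (y i) < \<delta> * my \<Longrightarrow> h i = 0" and h1: "(\<Sum>i\<le>d. h i) = 0"
    and h2: "\<And>j. j \<le> d \<Longrightarrow> cmod (x j) < \<delta> * mx \<Longrightarrow> (\<Sum>i\<le>d. h i * real (e i j)) = 0"
  shows "\<bar>\<tau>\<bar> * \<bar>\<Sum>i\<le>d. h i * real (w i)\<bar> \<le> ln (1 / \<delta>) * (\<Sum>i\<le>d. \<bar>h i\<bar> * (1 + real q))"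
proof -
  define L where "L = ln (1 / \<delta>)"
  have L0: "L \<ge> 0" using \<delta> by (simp add: L_def)
  define c where "c = (\<lambda>j. \<Sum>i\<le>d. h i * real (e i j))"
  have bound: "\<bar>ln (cmod z) - ln m\<bar> \<le> L" if "\<delta> * m \<le> cmod z" "cmod z \<le> m" "m > 0" for z :: complex and m
  proof -
    have dm: "\<delta> * m > 0" using that(3) \<delta> by simp
    then have p: "cmod z > 0" using that(1) by linarith
    have "ln (cmod z) \<le> ln m" by (rule iffD2[OF ln_le_cancel_iff[OF p that(3)] that(2)])
    moreover have "ln (\<delta> * m) \<le> ln (cmod z)" by (rule iffD2[OF ln_le_cancel_iff[OF dm p] that(1)])
    moreover have "ln (\<delta> * m) = ln m - L" using \<delta> that by (simp add: L_def ln_mult ln_div)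
    ultimately show ?thesis by simp
  qed
  have ly: "ln (cmod (y i)) = \<tau> * real (w i) + (\<Sum>j\<le>d. real (e i j) * ln (cmod (x j)))" if "i \<le> d" for i
  proof -
    have pos: "(\<Prod>j\<le>d. cmod (x j) ^ e i j) > 0" using x by (intro prod_pos) auto
    have "cmod (y i) = exp (\<tau> * real (w i)) * (\<Prod>j\<le>d. cmod (x j) ^ e i j)"
      unfolding y[OF that] norm_mult norm_of_real mon_def by (simp add: prod_norm[symmetric] norm_power)
    then have "ln (cmod (y i)) = \<tau> * real (w i) + ln (\<Prod>j\<le>d. cmod (x j) ^ e i j)"
      by (simp only: ln_mult_pos[OF exp_gt_zero pos] ln_exp)
    also have "ln (\<Prod>j\<le>d. cmod (x j) ^ e i j) = (\<Sum>j\<le>d. ln (cmod (x j) ^ e i j))"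
      by (rule ln_prod) (use x in auto)
    also have "\<dots> = (\<Sum>j\<le>d. real (e i j) * ln (cmod (x j)))" using x by (intro sum.cong) (auto simp: ln_realpow)
    finally show ?thesis .
  qed
  have 1: "\<bar>\<Sum>i\<le>d. h i * ln (cmod (y i))\<bar> \<le> (\<Sum>i\<le>d. \<bar>h i\<bar> * L)"
  proof -
    have "(\<Sum>i\<le>d. h i * ln (cmod (y i))) = (\<Sum>i\<le>d. h i * (ln (cmod (y i)) - ln my))"
      using h1 by (simp add: right_diff_distrib sum_subtractf sum_distrib_right[symmetric])
    also have "\<bar>\<dots>\<bar> \<le> (\<Sum>i\<le>d. \<bar>h i * (ln (cmod (y i)) - ln my)\<bar>)" by (rule sum_abs)
    also have "\<dots> \<le> (\<Sum>i\<le>d. \<bar>h i\<bar> * L)"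
    proof (rule sum_mono)
      fix i assume i: "i \<in> {..d}"
      show "\<bar>h i * (ln (cmod (y i)) - ln my)\<bar> \<le> \<bar>h i\<bar> * L"
      proof (cases "cmod (y i) < \<delta> * my")
        case True then show ?thesis using h0 i by simp
      next
        case False
        then show ?thesis unfolding abs_mult using bound[of my "y i"] by' i m by (intro mult_left_mono) auto
      qed
    qed
    finally show ?thesis .
  qed
  have csum: "(\<Sum>j\<le>d. c j * r) = 0" for r
  proof -
    have "(\<Sum>j\<le>d. c j) = (\<Sum>i\<le>d. h i * real (\<Sum>j\<le>d. e i j))"
      unfolding c_def by (subst sum.swap) (simp add: sum_distrib_left)
    also have "\<dots> = (\<Sum>i\<le>d. h i * real q)" using e by (intro sum.cong) auto
    finally show ?thesis using h1 by (simp add: sum_distrib_right[symmetric])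
  qed
  have 2: "\<bar>\<Sum>j\<le>d. c j * ln (cmod (x j))\<bar> \<le> (\<Sum>i\<le>d. \<bar>h i\<bar> * real q * L)"
  proof -
    have "(\<Sum>j\<le>d. c j * ln (cmod (x j))) = (\<Sum>j\<le>d. c j * (ln (cmod (x j)) - ln mx))"
      using csum by (simp add: right_diff_distrib sum_subtractf)
    also have "\<bar>\<dots>\<bar> \<le> (\<Sum>j\<le>d. \<bar>c j * (ln (cmod (x j)) - ln mx)\<bar>)" by (rule sum_abs)
    also have "\<dots> \<le> (\<Sum>j\<le>d. (\<Sum>i\<le>d. \<bar>h i\<bar> * real (e i j)) * L)"
    proof (rule sum_mono)
      fix j assume j: "j \<in> {..d}"
      show "\<bar>c j * (ln (cmod (x j)) - ln mx)\<bar> \<le> (\<Sum>i\<le>d. \<bar>h i\<bar> * real (e i j)) * L"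
      proof (cases "cmod (x j) < \<delta> * mx")
        case True then show ?thesis using h2[of j] j L0 by (simp add: c_def sum_nonneg)
      next
        case False
        have "\<bar>c j\<bar> \<le> (\<Sum>i\<le>d. \<bar>h i\<bar> * real (e i j))" unfolding c_def
          by (rule order_trans[OF sum_abs]) (simp add: abs_mult)
        then show ?thesis unfolding abs_mult using False bound[of mx "x j"] bx j m by (intro mult_mono) (auto simp: sum_nonneg)
      qed
    qed
    also have "\<dots> = (\<Sum>i\<le>d. \<bar>h i\<bar> * real (\<Sum>j\<le>d. e i j) * L)"
      unfolding sum_distrib_right by (subst sum.swap) (simp add: sum_distrib_left sum_distrib_right mult.assoc)
    also have "\<dots> = (\<Sum>i\<le>d. \<bar>h i\<bar> * real q * L)" using e by (intro sum.cong) auto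
    finally show ?thesis .
  qed
  have "(\<Sum>i\<le>d. h i * ln (cmod (y i))) = \<tau> * (\<Sum>i\<le>d. h i * real (w i)) + (\<Sum>j\<le>d. c j * ln (cmod (x j)))"
  proof -
    have "(\<Sum>i\<le>d. h i * ln (cmod (y i))) = (\<Sum>i\<le>d. \<tau> * (h i * real (w i)) + (\<Sum>j\<le>d. h i * real (e i j) * ln (cmod (x j))))"
      by (rule sum.cong) (auto simp: ly distrib_left sum_distrib_left mult_ac)
    also have "\<dots> = \<tau> * (\<Sum>i\<le>d. h i * real (w i)) + (\<Sum>i\<le>d. \<Sum>j\<le>d. h i * real (e i j) * ln (cmod (x j)))"
      by (simp add: sum.distrib sum_distrib_left)
    also have "(\<Sum>i\<le>d. \<Sum>j\<le>d. h i * real (e i j) * ln (cmod (x j))) = (\<Sum>j\<le>d. c j * ln (cmod (x j)))"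
      by (subst sum.swap) (simp add: c_def sum_distrib_right)
    finally show ?thesis .
  qed
  then have "\<bar>\<tau> * (\<Sum>i\<le>d. h i * real (w i))\<bar> \<le> (\<Sum>i\<le>d. \<bar>h i\<bar> * L) + (\<Sum>i\<le>d. \<bar>h i\<bar> * real q * L)"
    using 1 2 by linarith
  also have "\<dots> = L * (\<Sum>i\<le>d. \<bar>h i\<bar> * (1 + real q))"
    by (simp add: sum_distrib_left sum.distrib[symmetric] algebra_simps)
  finally show ?thesis by (simp add: abs_mult L_def)
qed

text \<open>Its absolute value bounds the number of solutions with small index sets I and J. The
  base monomial i0 is an arbitrary choice: another one changes the sign at most.\<close>

definition mixed_det :: "nat \<Rightarrow> nat \<Rightarrow> (nat \<Rightarrow> nat \<Rightarrow> nat) \<Rightarrow> nat set \<times> nat set \<Rightarrow> int" where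
  "mixed_det d k e = (\<lambda>(I, J). let i0 = Min ({..d} - I) in det (submat ({..d} - I - {i0}) J (exp_diff_mat e i0)))"

definition index_pairs :: "nat \<Rightarrow> nat \<Rightarrow> (nat set \<times> nat set) set" where
  "index_pairs d k = {(I, J). I \<subseteq> {..d} \<and> card I = d - k \<and> J \<subseteq> {..d} \<and> card J = k}"

lemma finite_index_pairs: "finite (index_pairs d k)"
  by (rule finite_subset[of _ "Pow {..d} \<times> Pow {..d}"]) (auto simp: index_pairs_def)

text \<open>The conditions on h are card I + card J + 1 homogeneous linear equations in d + 1
  unknowns. If card I + card J < d there are more unknowns than equations. If the count is exact,
  eliminating the entries in I and the entry i0 leaves the square system of
  \<open>mixed_det\<close>, which is singular.\<close>

lemma degenerate_pair_functional:
  assumes I: "I \<subseteq> {..d}" "card I \<le> d - k" and J: "J \<subseteq> {..d}" "card J \<le> k" and k: "k \<le> d"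
    and bad: "\<not> ((I, J) \<in> index_pairs d k \<and> mixed_det d k e (I, J) \<noteq> 0)"
  shows "\<exists>h :: nat \<Rightarrow> real. (\<exists>i\<le>d. h i \<noteq> 0) \<and> (\<forall>i\<in>I. h i = 0) \<and> (\<Sum>i\<le>d. h i) = 0 \<and> (\<forall>j\<in>J. (\<Sum>i\<le>d. h i * real (e i j)) = 0)"
proof (cases "(I, J) \<in> index_pairs d k")
  case True
  then have cI: "card I = d - k" and cJ: "card J = k" by (auto simp: index_pairs_def)
  define i0 where "i0 = Min ({..d} - I)"
  have fin: "finite I" "finite J" using I J finite_subset by auto
  have "card ({..d} - I) > 0" using fin I cI by (simp add: card_Diff_subset)
  then have ne: "{..d} - I \<noteq> {}" by (metis card.empty less_numeral_extra(3))
  have i0: "i0 \<in> {..d} - I" unfolding i0_def by (rule Min_in) (use ne in auto)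
  define K where "K = {..d} - I - {i0}"
  have cK: "card K = card J" "finite K" using fin I cI cJ i0 k by (auto simp: K_def card_Diff_subset)
  have "det (submat K J (exp_diff_mat e i0)) = 0" using bad True by (simp add: mixed_det_def i0_def[symmetric] K_def Let_def)
  then obtain h0 where h0: "\<exists>r\<in>K. h0 r \<noteq> 0" "\<forall>b\<in>J. (\<Sum>r\<in>K. h0 r * exp_diff_mat e i0 r b) = 0"
    using submat_singular[OF cK(2) fin(2) cK(1)] by blast
  \<comment> \<open>The value at i0 makes h sum to 0.\<close>
  define h where "h = (\<lambda>i. if i \<in> K then real_of_int (h0 i) else if i = i0 then - (\<Sum>r\<in>K. real_of_int (h0 r)) else 0)"
  have i0K: "i0 \<notin> K" "insert i0 K = {..d} - I" using i0 by (auto simp: K_def)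
  have sp: "(\<Sum>i\<le>d. h i * f i) = (\<Sum>r\<in>K. real_of_int (h0 r) * (f r - f i0))" for f
  proof -
    have "(\<Sum>i\<le>d. h i * f i) = (\<Sum>i\<in>insert i0 K. h i * f i)"
      by (rule sum.mono_neutral_right) (use i0K in \<open>auto simp: h_def K_def\<close>)
    also have "\<dots> = h i0 * f i0 + (\<Sum>i\<in>K. h i * f i)" by (rule sum.insert[OF cK(2) i0K(1)])
    also have "(\<Sum>i\<in>K. h i * f i) = (\<Sum>r\<in>K. real_of_int (h0 r) * f r)" by (rule sum.cong) (simp_all add: h_def)
    also have "h i0 = - (\<Sum>r\<in>K. real_of_int (h0 r))" using i0K(1) by (simp add: h_def)
    finally show ?thesis by (simp add: right_diff_distrib sum_subtractf sum_distrib_right)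
  qed
  have "(\<Sum>i\<le>d. h i * real (e i j)) = 0" if "j \<in> J" for j
  proof -
    have "(\<Sum>i\<le>d. h i * real (e i j)) = real_of_int (\<Sum>r\<in>K. h0 r * exp_diff_mat e i0 r j)"
      unfolding sp by (simp add: exp_diff_mat_def)
    then show ?thesis using h0(2) that by simp
  qed
  moreover have "(\<Sum>i\<le>d. h i) = 0" using sp[of "\<lambda>_. 1"] by simp
  moreover have "\<exists>i\<le>d. h i \<noteq> 0" using h0(1) by (auto simp: h_def K_def)
  moreover have "\<forall>i\<in>I. h i = 0" using i0 by (auto simp: h_def K_def)
  ultimately show ?thesis by blast
next
  case False
  have fin: "finite I" "finite J" using I J finite_subset by auto
  \<comment> \<open>One index per equation: \<open>Inl i\<close> for h i = 0,
    \<open>Inr None\<close> for the sum, \<open>Inr (Some j)\<close> for column j of the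
    exponents.\<close>
  define Bs where "Bs = Inl ` I \<union> Inr ` (Some ` J \<union> {None})"
  have "card (Inl ` I) = card I" by (rule card_image) simp
  moreover have "card (Inr ` (Some ` J \<union> {None})) = card J + 1"
    using fin by (subst card_image) (auto simp: card_image)
  ultimately have "card Bs \<le> card I + (card J + 1)" unfolding Bs_def by (metis card_Un_le)
  moreover have "card I + card J < d" using False I J k by (auto simp: index_pairs_def)
  ultimately have lt: "card Bs < card {..d}" by simp
  define cf where "cf = (\<lambda>i b. case b of Inl i' \<Rightarrow> (if i = i' then 1 else 0) | Inr None \<Rightarrow> 1 | Inr (Some j) \<Rightarrow> real (e i j))"
  have "finite Bs" using fin by (simp add: Bs_def)
  from linear_dependence[OF this finite_atMost lt, of cf]
  obtain r where r: "\<exists>a\<in>{..d}. r a \<noteq> 0" "\<forall>b\<in>Bs. (\<Sum>a\<le>d. r a * cf a b) = 0" by blast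
  have "r i = 0" if "i \<in> I" for i
  proof -
    have "i \<le> d" using that I by auto
    have "(\<Sum>a\<le>d. r a * cf a (Inl i)) = 0" using r(2) that by (simp add: Bs_def)
    then show ?thesis using \<open>i \<le> d\<close> by (simp add: cf_def if_distrib[of "\<lambda>x. _ * x"] cong: if_cong)
  qed
  moreover have "(\<Sum>a\<le>d. r a * cf a (Inr None)) = 0" using r(2) by (simp add: Bs_def)
  moreover have "(\<Sum>a\<le>d. r a * cf a (Inr (Some j))) = 0" if "j \<in> J" for j using r(2) that by (simp add: Bs_def)
  ultimately show ?thesis using r(1) by (intro exI[of _ r]) (auto simp: cf_def)
qed

text \<open>Points of the moment curve (1, N, N^2, ...) avoid finitely many hyperplanes, as each
  meets the curve in the roots of a nonzero polynomial.\<close>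

lemma exists_power_weights:
  fixes h :: "'p \<Rightarrow> nat \<Rightarrow> real"
  assumes "finite F" "\<And>p. p \<in> F \<Longrightarrow> \<exists>i\<le>d. h p i \<noteq> 0"
  shows "\<exists>N::nat. \<forall>p\<in>F. (\<Sum>i\<le>d. h p i * real (N ^ i)) \<noteq> 0"
proof -
  have "finite (\<Union>p\<in>F. {t::real. (\<Sum>i\<le>d. h p i * t ^ i) = 0})"
    using assms by (intro finite_UN_I) (simp_all add: polyfun_finite_roots)
  then have "finite ((\<lambda>n. real n) -` (\<Union>p\<in>F. {t::real. (\<Sum>i\<le>d. h p i * t ^ i) = 0}))"
    by (rule finite_vimageI) simp
  then obtain N where "N \<notin> (\<lambda>n. real n) -` (\<Union>p\<in>F. {t::real. (\<Sum>i\<le>d. h p i * t ^ i) = 0})"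
    using ex_new_if_finite infinite_UNIV_nat by blast
  then show ?thesis by (intro exI[of _ N]) auto
qed

lemma torus_sols_rescale:
  assumes x: "x \<in> torus_sols d k e \<theta> j0" and j1: "j1 \<le> d" and e: "\<And>i. i \<le> d \<Longrightarrow> (\<Sum>j\<le>d. e i j) = q"
  shows "(\<lambda>j. x j / x j1) \<in> torus_sols d k e \<theta> j1"
proof -
  define s where "s = 1 / x j1"
  have nz: "x j1 \<noteq> 0" using x j1 by (auto simp: torus_sols_def)
  have eq: "(\<lambda>j. x j / x j1) = (\<lambda>j. s * x j)" by (simp add: s_def)
  have "lin_eqs d {..<k} \<theta> (\<lambda>i. mon d e i (\<lambda>j. s * x j)) \<longleftrightarrow> lin_eqs d {..<k} \<theta> (\<lambda>i. s ^ q * mon d e i x)"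
    by (rule lin_eqs_cong) (simp add: mon_scale[OF e])
  also have "\<dots> \<longleftrightarrow> lin_eqs d {..<k} \<theta> (\<lambda>i. mon d e i x)" by (rule lin_eqs_scale) (simp add: s_def nz)
  finally have "sat d k e \<theta> (\<lambda>j. s * x j)" using x by (simp add: torus_sols_def sat_iff_lin_eqs)
  moreover have "lsat d k \<theta> (\<lambda>j. s * x j)"
    using x lin_eqs_scale[of s d "{k..<d}" \<theta> x] by (simp add: torus_sols_def lsat_iff_lin_eqs s_def nz)
  ultimately show ?thesis unfolding eq using x nz by (auto simp: torus_sols_def s_def)
qed

text \<open>For \<open>t = exp \<tau>\<close> small, every solution has exactly \<open>k\<close> small coordinates and \<open>d - k\<close> small
  monomials, with a nonsingular pair of index sets, since the weights \<open>N ^ i\<close> avoid the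
  hyperplanes defined by the degenerate pairs.\<close>

lemma torus_sols_upper:
  assumes G: "pfun G" "\<exists>\<theta>. G \<theta> \<noteq> 0" and k: "k \<le> d" and e: "\<And>i. i \<le> d \<Longrightarrow> (\<Sum>j\<le>d. e i j) = q"
  shows "\<exists>\<theta>. G \<theta> \<noteq> 0 \<and> finite (torus_sols d k e \<theta> 0) \<and>
    card (torus_sols d k e \<theta> 0) \<le> (\<Sum>p\<in>index_pairs d k. nat \<bar>mixed_det d k e p\<bar>)"
proof -
  have "generic (\<lambda>\<theta>. G \<theta> \<noteq> 0)" using G by (auto intro: genericI[of G])
  then have "generic (\<lambda>\<theta>. G \<theta> \<noteq> 0 \<and> uniform_rows d {..<k} \<theta> \<and> uniform_rows d {k..<d} \<theta>)"
    by (intro generic_conj uniform_rows_generic) auto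
  then obtain \<theta> where \<theta>: "G \<theta> \<noteq> 0" "uniform_rows d {..<k} \<theta>" "uniform_rows d {k..<d} \<theta>" using generic_ex by blast
  define good where "good = {p \<in> index_pairs d k. mixed_det d k e p \<noteq> 0}"
  \<comment> \<open>All pairs whose cardinalities allow them to be the small index sets of a
    solution, apart from the nonsingular ones.\<close>
  define bad where "bad = {(I, J). I \<subseteq> {..d} \<and> card I \<le> d - k \<and> J \<subseteq> {..d} \<and> card J \<le> k \<and> (I, J) \<notin> good}"
  have fgood: "finite good" unfolding good_def using finite_index_pairs by simp
  have fbad: "finite bad" by (rule finite_subset[of _ "Pow {..d} \<times> Pow {..d}"]) (auto simp: bad_def)
  have "\<forall>p\<in>bad. \<exists>h :: nat \<Rightarrow> real. (\<exists>i\<le>d. h i \<noteq> 0) \<and> (\<forall>i\<in>fst p. h i = 0) \<and> (\<Sum>i\<le>d. h i) = 0 \<and> (\<forall>j\<in>snd p. (\<Sum>i\<le>d. h i * real (e i j)) = 0)"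
  proof
    fix p assume "p \<in> bad"
    then have "fst p \<subseteq> {..d}" "card (fst p) \<le> d - k" "snd p \<subseteq> {..d}" "card (snd p) \<le> k" "\<not> ((fst p, snd p) \<in> index_pairs d k \<and> mixed_det d k e (fst p, snd p) \<noteq> 0)"
      by (auto simp: bad_def good_def)
    then show "\<exists>h :: nat \<Rightarrow> real. (\<exists>i\<le>d. h i \<noteq> 0) \<and> (\<forall>i\<in>fst p. h i = 0) \<and> (\<Sum>i\<le>d. h i) = 0 \<and> (\<forall>j\<in>snd p. (\<Sum>i\<le>d. h i * real (e i j)) = 0)"
      by (rule degenerate_pair_functional[OF _ _ _ _ k])
  qed
  from bchoice[OF this] obtain h :: "nat set \<times> nat set \<Rightarrow> nat \<Rightarrow> real" where h: "\<forall>p\<in>bad. (\<exists>i\<le>d. h p i \<noteq> 0) \<and> (\<forall>i\<in>fst p. h p i = 0) \<and> (\<Sum>i\<le>d. h p i) = 0 \<and> (\<forall>j\<in>snd p. (\<Sum>i\<le>d. h p i * real (e i j)) = 0)"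
    by (rule exE)
  obtain N :: nat where N: "\<forall>p\<in>bad. (\<Sum>i\<le>d. h p i * real (N ^ i)) \<noteq> 0"
    using exists_power_weights[OF fbad, of d h] h by blast
  define w where "w = (\<lambda>i. N ^ i)"
  define i0 where "i0 = (\<lambda>I :: nat set. Min ({..d} - I))"
  have i0: "i0 I \<in> {..d} - I" if "I \<subseteq> {..d}" "card I \<le> d" for I
  proof -
    have "card ({..d} - I) > 0" using that finite_subset[of I "{..d}"] by (simp add: card_Diff_subset)
    then have "{..d} - I \<noteq> {}" by (metis card.empty less_numeral_extra(3))
    then show ?thesis unfolding i0_def by (intro Min_in) auto
  qed
  have "\<forall>p\<in>good. \<exists>\<delta>0>0. \<forall>\<tau> \<delta>. 0 < \<delta> \<longrightarrow> \<delta> \<le> \<delta>0 \<longrightarrow> (\<exists>Y. finite Y \<and> card Y \<le> nat \<bar>mixed_det d k e p\<bar> \<and>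
      (\<forall>x\<in>torus_sols d k e (degen k w \<tau> \<theta>) (i0 (snd p)). (\<forall>j\<in>snd p. cmod (x j) \<le> \<delta>) \<longrightarrow>
        (\<forall>l\<in>fst p. cmod (of_real (exp (\<tau> * real (w l))) * mon d e l x) \<le> \<delta> * cmod (of_real (exp (\<tau> * real (w (i0 (fst p))))) * mon d e (i0 (fst p)) x)) \<longrightarrow> x \<in> Y))"
  proof
    fix p assume p: "p \<in> good"
    obtain I J where IJ: "p = (I, J)" by force
    have I: "I \<subseteq> {..d}" "card I = d - k" and J: "J \<subseteq> {..d}" "card J = k" and det: "mixed_det d k e (I, J) \<noteq> 0"
      using p by (auto simp: good_def index_pairs_def IJ)
    have zI: "i0 I \<in> {..d} - I" and zJ: "i0 J \<in> {..d} - J" using i0 I J k by auto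
    have md: "mixed_det d k e (I, J) = det (submat ({..d} - I - {i0 I}) J (exp_diff_mat e (i0 I)))"
      by (simp add: mixed_det_def i0_def Let_def)
    obtain P Q A B V C \<delta>0 where \<delta>0: "\<delta>0 > 0" and ms: "\<forall>w \<tau> \<delta>. 0 < \<delta> \<longrightarrow> \<delta> \<le> \<delta>0 \<longrightarrow>
      monomial_system d I J ({..d} - I - {i0 I}) e (i0 I) (\<lambda>i. of_real ((real (w i) - real (w (i0 I))) * \<tau>)) P Q A B V C \<delta> k w \<tau> \<theta> (i0 J)"
      using monomial_system_exists[OF \<theta>(2,3) k I J zI zJ refl det[unfolded md]] by (elim exE conjE) (rule that)
    show "\<exists>\<delta>0>0. \<forall>\<tau> \<delta>. 0 < \<delta> \<longrightarrow> \<delta> \<le> \<delta>0 \<longrightarrow> (\<exists>Y. finite Y \<and> card Y \<le> nat \<bar>mixed_det d k e p\<bar> \<and>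
      (\<forall>x\<in>torus_sols d k e (degen k w \<tau> \<theta>) (i0 (snd p)). (\<forall>j\<in>snd p. cmod (x j) \<le> \<delta>) \<longrightarrow>
        (\<forall>l\<in>fst p. cmod (of_real (exp (\<tau> * real (w l))) * mon d e l x) \<le> \<delta> * cmod (of_real (exp (\<tau> * real (w (i0 (fst p))))) * mon d e (i0 (fst p)) x)) \<longrightarrow> x \<in> Y))"
    proof (intro exI[of _ \<delta>0] conjI allI impI \<delta>0)
      fix \<tau> \<delta> :: real assume \<delta>: "0 < \<delta>" "\<delta> \<le> \<delta>0"
      interpret S: monomial_system d I J "{..d} - I - {i0 I}" e "i0 I" "\<lambda>i. of_real ((real (w i) - real (w (i0 I))) * \<tau>)" P Q A B V C \<delta> k w \<tau> \<theta> "i0 J"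
        using ms \<delta> by blast
      show "\<exists>Y. finite Y \<and> card Y \<le> nat \<bar>mixed_det d k e p\<bar> \<and>
        (\<forall>x\<in>torus_sols d k e (degen k w \<tau> \<theta>) (i0 (snd p)). (\<forall>j\<in>snd p. cmod (x j) \<le> \<delta>) \<longrightarrow>
        (\<forall>l\<in>fst p. cmod (of_real (exp (\<tau> * real (w l))) * mon d e l x) \<le> \<delta> * cmod (of_real (exp (\<tau> * real (w (i0 (fst p))))) * mon d e (i0 (fst p)) x)) \<longrightarrow> x \<in> Y)"
      proof (intro exI[of _ "S.xz ` Collect S.good"] conjI ballI impI)
        show "finite (S.xz ` Collect S.good)" "card (S.xz ` Collect S.good) \<le> nat \<bar>mixed_det d k e p\<bar>"
          using S.card_good_le unfolding IJ md by auto
        fix x assume "x \<in> torus_sols d k e (degen k w \<tau> \<theta>) (i0 (snd p))" "\<forall>j\<in>snd p. cmod (x j) \<le> \<delta>"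
          "\<forall>l\<in>fst p. cmod (of_real (exp (\<tau> * real (w l))) * mon d e l x) \<le> \<delta> * cmod (of_real (exp (\<tau> * real (w (i0 (fst p))))) * mon d e (i0 (fst p)) x)"
        then have "\<exists>Z. S.good Z \<and> S.xz Z = x" unfolding IJ fst_conv snd_conv by (intro S.torus_sols_good) auto
        then show "x \<in> S.xz ` Collect S.good" by auto
      qed
    qed
  qed
  from bchoice[OF this] obtain D where D: "\<forall>p\<in>good. D p > 0 \<and> (\<forall>\<tau> \<delta>. 0 < \<delta> \<longrightarrow> \<delta> \<le> D p \<longrightarrow> (\<exists>Y. finite Y \<and> card Y \<le> nat \<bar>mixed_det d k e p\<bar> \<and>
      (\<forall>x\<in>torus_sols d k e (degen k w \<tau> \<theta>) (i0 (snd p)). (\<forall>j\<in>snd p. cmod (x j) \<le> \<delta>) \<longrightarrow>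
        (\<forall>l\<in>fst p. cmod (of_real (exp (\<tau> * real (w l))) * mon d e l x) \<le> \<delta> * cmod (of_real (exp (\<tau> * real (w (i0 (fst p))))) * mon d e (i0 (fst p)) x)) \<longrightarrow> x \<in> Y)))"
    by (rule exE)
  \<comment> \<open>The element 1 covers the case that no pair is good, and gives \<delta> \<le>
    1.\<close>
  define \<delta> where "\<delta> = Min (insert 1 (D ` good))"
  have \<delta>: "\<delta> > 0" "\<delta> \<le> 1" "\<And>p. p \<in> good \<Longrightarrow> \<delta> \<le> D p"
    using fgood D by (auto simp: \<delta>_def)
  obtain c1 where c1: "0 < c1" "c1 \<le> 1" "\<forall>\<delta> y m. 0 < \<delta> \<longrightarrow> \<delta> \<le> c1 \<longrightarrow> lin_eqs d {k..<d} \<theta> y \<longrightarrow> (\<exists>i\<le>d. cmod (y i) = m) \<longrightarrow> m > 0 \<longrightarrow>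
    card {i\<in>{..d}. cmod (y i) < \<delta> * m} \<le> d - card {k..<d} \<and>
    (card {i\<in>{..d}. cmod (y i) < \<delta> * m} = d - card {k..<d} \<longrightarrow> (\<forall>j\<in>{..d} - {i\<in>{..d}. cmod (y i) < \<delta> * m}. c1 * m \<le> cmod (y j)))"
    using small_coordinates[OF _ \<theta>(3)] by auto
  obtain c2 where c2: "0 < c2" "c2 \<le> 1" "\<forall>\<delta> y m. 0 < \<delta> \<longrightarrow> \<delta> \<le> c2 \<longrightarrow> lin_eqs d {..<k} \<theta> y \<longrightarrow> (\<exists>i\<le>d. cmod (y i) = m) \<longrightarrow> m > 0 \<longrightarrow>
    card {i\<in>{..d}. cmod (y i) < \<delta> * m} \<le> d - card {..<k} \<and>
    (card {i\<in>{..d}. cmod (y i) < \<delta> * m} = d - card {..<k} \<longrightarrow> (\<forall>j\<in>{..d} - {i\<in>{..d}. cmod (y i) < \<delta> * m}. c2 * m \<le> cmod (y j)))"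
    using small_coordinates[OF _ \<theta>(2)] k by auto
  \<comment> \<open>Smallness is first measured against the largest entry, with
    \<open>\<delta>1\<close>. The factors c1 and c2 convert it into smallness by \<delta> against
    the entry with index \<open>i0 J\<close> or \<open>i0 I\<close>, which is at least c1 or c2
    times the largest.\<close>
  define \<delta>1 where "\<delta>1 = \<delta> * c1 * c2"
  have \<delta>1: "0 < \<delta>1" "\<delta>1 \<le> \<delta> * c1" "\<delta>1 \<le> \<delta> * c2" "\<delta>1 \<le> c1" "\<delta>1 \<le> c2" "\<delta>1 \<le> 1"
  proof -
    show "0 < \<delta>1" "\<delta>1 \<le> \<delta> * c1" using \<delta> c1 c2 by (simp_all add: \<delta>1_def mult_left_le)
    show 2: "\<delta>1 \<le> \<delta> * c2" unfolding \<delta>1_def using \<delta> c1 c2 by (simp add: mult_left_le mult.assoc mult_left_le_one_le)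
    show "\<delta>1 \<le> c1" using \<open>\<delta>1 \<le> \<delta> * c1\<close> \<delta> c1 by (meson mult_left_le_one_le less_imp_le order_trans)
    show "\<delta>1 \<le> c2" using 2 \<delta> c2 by (meson mult_left_le_one_le less_imp_le order_trans)
    then show "\<delta>1 \<le> 1" using c2 by simp
  qed
  \<comment> \<open>A bound on |\<tau>| for any solution whose small index sets form the bad pair
    p.\<close>
  define H where "H = (\<lambda>p. ln (1 / \<delta>1) * (\<Sum>i\<le>d. \<bar>h p i\<bar> * (1 + real q)) / \<bar>\<Sum>i\<le>d. h p i * real (w i)\<bar>)"
  define HM where "HM = (\<Sum>p\<in>bad. \<bar>H p\<bar>)"
  have HM: "H p \<le> HM" if "p \<in> bad" for p
  proof -
    have "\<bar>H p\<bar> \<le> HM" unfolding HM_def using fbad that by (intro member_le_sum) auto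
    then show ?thesis by simp
  qed
  obtain \<tau>1 where \<tau>1: "\<forall>\<tau>\<le>\<tau>1. G (degen k w \<tau> \<theta>) \<noteq> 0" using degen_nonzero[OF G(1) \<theta>(1)] by blast
  \<comment> \<open>Below \<open>\<tau>1\<close> to stay off the zero set of G, and with |\<tau>| >
    HM to exclude all bad pairs.\<close>
  define \<tau> where "\<tau> = min \<tau>1 (- 1 - HM)"
  have HM0: "HM \<ge> 0" unfolding HM_def by (rule sum_nonneg) simp
  have \<tau>H: "\<bar>\<tau>\<bar> > HM" using HM0 by (simp add: \<tau>_def)
  have "\<forall>p\<in>good. \<exists>Y. finite Y \<and> card Y \<le> nat \<bar>mixed_det d k e p\<bar> \<and>
      (\<forall>x\<in>torus_sols d k e (degen k w \<tau> \<theta>) (i0 (snd p)). (\<forall>j\<in>snd p. cmod (x j) \<le> \<delta>) \<longrightarrow>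
        (\<forall>l\<in>fst p. cmod (of_real (exp (\<tau> * real (w l))) * mon d e l x) \<le> \<delta> * cmod (of_real (exp (\<tau> * real (w (i0 (fst p))))) * mon d e (i0 (fst p)) x)) \<longrightarrow> x \<in> Y)"
    using D \<delta>(1,3) by simp
  from bchoice[OF this] obtain Y where Y: "\<forall>p\<in>good. finite (Y p) \<and> card (Y p) \<le> nat \<bar>mixed_det d k e p\<bar> \<and>
      (\<forall>x\<in>torus_sols d k e (degen k w \<tau> \<theta>) (i0 (snd p)). (\<forall>j\<in>snd p. cmod (x j) \<le> \<delta>) \<longrightarrow>
        (\<forall>l\<in>fst p. cmod (of_real (exp (\<tau> * real (w l))) * mon d e l x) \<le> \<delta> * cmod (of_real (exp (\<tau> * real (w (i0 (fst p))))) * mon d e (i0 (fst p)) x)) \<longrightarrow> x \<in> Y p)"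
    by (rule exE)
  have cover: "torus_sols d k e (degen k w \<tau> \<theta>) 0 \<subseteq> (\<Union>p\<in>good. (\<lambda>x j. x j / x 0) ` Y p)"
  proof
    fix x assume x: "x \<in> torus_sols d k e (degen k w \<tau> \<theta>) 0"
    have x1: "x 0 = 1" "\<And>j. j \<le> d \<Longrightarrow> x j \<noteq> 0" "lin_eqs d {k..<d} \<theta> x"
      using x by (auto simp: torus_sols_def lsat_degen)
    define y where "y = (\<lambda>i. of_real (exp (\<tau> * real (w i))) * mon d e i x)"
    have y1: "lin_eqs d {..<k} \<theta> y" using x by (simp add: torus_sols_def sat_degen y_def)
    have ynz: "y i \<noteq> 0" for i using x1(2) by (auto simp: y_def mon_def)
    define mx my where "mx = Max ((\<lambda>j. cmod (x j)) ` {..d})" and "my = Max ((\<lambda>j. cmod (y j)) ` {..d})"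
    have "mx \<in> (\<lambda>j. cmod (x j)) ` {..d}" "my \<in> (\<lambda>j. cmod (y j)) ` {..d}" unfolding mx_def my_def by (intro Max_in; simp)+
    then have mxy: "\<exists>i\<le>d. cmod (x i) = mx" "\<exists>i\<le>d. cmod (y i) = my" by auto
    then have pos: "mx > 0" "my > 0" using x1(2) ynz by (metis zero_less_norm_iff)+
    have bx: "cmod (x j) \<le> mx" and by': "cmod (y j) \<le> my" if "j \<le> d" for j
      unfolding mx_def my_def using that by (intro Max_ge; simp)+
    define I where "I = {i\<in>{..d}. cmod (y i) < \<delta>1 * my}"
    define J where "J = {i\<in>{..d}. cmod (x i) < \<delta>1 * mx}"
    have cJ: "card J \<le> k" "card J = k \<Longrightarrow> j \<in> {..d} - J \<Longrightarrow> c1 * mx \<le> cmod (x j)" for j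
      using c1(3)[rule_format, of \<delta>1 x mx] \<delta>1 x1(3) mxy(1) pos(1) k unfolding J_def by auto
    have cI: "card I \<le> d - k" "card I = d - k \<Longrightarrow> j \<in> {..d} - I \<Longrightarrow> c2 * my \<le> cmod (y j)" for j
      using c2(3)[rule_format, of \<delta>1 y my] \<delta>1 y1 mxy(2) pos(2) k unfolding I_def by auto
    have good: "(I, J) \<in> good"
    proof (rule ccontr)
      assume "(I, J) \<notin> good"
      then have b: "(I, J) \<in> bad" using cI(1) cJ(1) by (auto simp: bad_def I_def J_def)
      from h[THEN bspec, OF b] have hb: "\<forall>i\<in>I. h (I, J) i = 0" "(\<Sum>i\<le>d. h (I, J) i) = 0" "\<forall>j\<in>J. (\<Sum>i\<le>d. h (I, J) i * real (e i j)) = 0"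
        by auto
      have "\<bar>\<tau>\<bar> * \<bar>\<Sum>i\<le>d. h (I, J) i * real (w i)\<bar> \<le> ln (1 / \<delta>1) * (\<Sum>i\<le>d. \<bar>h (I, J) i\<bar> * (1 + real q))"
        by (rule monomial_valuation_bound[of d x e q y \<tau> w \<delta>1 mx my])
          (use x1(2) e \<delta>1 pos bx by' hb in \<open>auto simp: y_def I_def J_def\<close>)
      moreover have "\<bar>\<Sum>i\<le>d. h (I, J) i * real (w i)\<bar> > 0" using N b by (simp add: w_def)
      ultimately have "\<bar>\<tau>\<bar> \<le> H (I, J)" by (simp add: H_def pos_le_divide_eq)
      then show False using HM[OF b] \<tau>H by simp
    qed
    then have cards: "card I = d - k" "card J = k" by (auto simp: good_def index_pairs_def)
    have i0I: "i0 I \<in> {..d} - I" by (rule i0) (use cards(1) in \<open>simp_all add: I_def subset_iff\<close>)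
    have i0J: "i0 J \<in> {..d} - J" by (rule i0) (use cards(2) k in \<open>simp_all add: J_def subset_iff\<close>)
    \<comment> \<open>The logarithmic system of (I, J) normalizes a coordinate outside J; dividing
      by x' 0 afterwards restores x 0 = 1.\<close>
    define x' where "x' = (\<lambda>j. x j / x (i0 J))"
    have x': "x' \<in> torus_sols d k e (degen k w \<tau> \<theta>) (i0 J)" unfolding x'_def
      by (rule torus_sols_rescale[OF x _ e]) (use i0J in auto)
    have small: "a \<le> \<delta> * b" if "a < \<delta>1 * m" "c * m \<le> b" "\<delta>1 \<le> \<delta> * c" "m > 0" for a b m c :: real
    proof -
      have "\<delta>1 * m \<le> \<delta> * c * m" using that by (simp add: mult_right_mono)
      also have "\<dots> \<le> \<delta> * b" using that \<delta>(1) by (simp add: mult.assoc mult_left_mono)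
      finally show ?thesis using that(1) by simp
    qed
    have "\<forall>j\<in>J. cmod (x' j) \<le> \<delta>"
    proof
      fix j assume "j \<in> J"
      then have "cmod (x j) \<le> \<delta> * cmod (x (i0 J))"
        using small[OF _ cJ(2)[OF cards(2) i0J] \<delta>1(2) pos(1)] by (simp add: J_def)
      then show "cmod (x' j) \<le> \<delta>" using x1(2)[of "i0 J"] i0J by (simp add: x'_def norm_divide divide_le_eq)
    qed
    moreover have "\<forall>l\<in>I. cmod (of_real (exp (\<tau> * real (w l))) * mon d e l x') \<le> \<delta> * cmod (of_real (exp (\<tau> * real (w (i0 I)))) * mon d e (i0 I) x')"
    proof
      fix l assume l: "l \<in> I"
      then have ld: "l \<le> d" by (simp add: I_def)
      have le: "cmod (y l) \<le> \<delta> * cmod (y (i0 I))"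
        using l small[OF _ cI(2)[OF cards(1) i0I] \<delta>1(3) pos(2)] by (simp add: I_def)
      define s where "s = 1 / x (i0 J)"
      have "x' = (\<lambda>j. s * x j)" by (simp add: x'_def s_def)
      then have ms: "of_real (exp (\<tau> * real (w i))) * mon d e i x' = s ^ q * y i" if "i \<le> d" for i
        using mon_scale[of e i d q s x, OF e[OF that]] by (simp add: y_def)
      show "cmod (of_real (exp (\<tau> * real (w l))) * mon d e l x') \<le> \<delta> * cmod (of_real (exp (\<tau> * real (w (i0 I)))) * mon d e (i0 I) x')"
        using mult_left_mono[OF le, of "cmod (s ^ q)"] i0I by (simp only: ms[OF ld] ms[of "i0 I"] Diff_iff atMost_iff norm_mult) (simp add: mult_ac)
    qed
    ultimately have "x' \<in> Y (I, J)" using Y[THEN bspec, OF good] x' by simp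
    moreover have "x = (\<lambda>j. x' j / x' 0)" using x1(1) x1(2)[of "i0 J"] i0J by (auto simp: x'_def)
    ultimately show "x \<in> (\<Union>p\<in>good. (\<lambda>x j. x j / x 0) ` Y p)" using good by blast
  qed
  have fY: "finite (\<Union>p\<in>good. (\<lambda>x j. x j / x 0) ` Y p)" using Y fgood by auto
  have "card (torus_sols d k e (degen k w \<tau> \<theta>) 0) \<le> card (\<Union>p\<in>good. (\<lambda>x j. x j / x 0) ` Y p)" by (rule card_mono[OF fY cover])
  also have "\<dots> \<le> (\<Sum>p\<in>good. card ((\<lambda>x j. x j / x 0) ` Y p))" by (rule card_UN_le[OF fgood])
  also have "\<dots> \<le> (\<Sum>p\<in>good. nat \<bar>mixed_det d k e p\<bar>)"
    by (rule sum_mono) (meson Y card_image_le order_trans)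
  also have "\<dots> \<le> (\<Sum>p\<in>index_pairs d k. nat \<bar>mixed_det d k e p\<bar>)"
    by (rule sum_mono2[OF finite_index_pairs]) (auto simp: good_def)
  finally have "card (torus_sols d k e (degen k w \<tau> \<theta>) 0) \<le> (\<Sum>p\<in>index_pairs d k. nat \<bar>mixed_det d k e p\<bar>)" .
  moreover have "finite (torus_sols d k e (degen k w \<tau> \<theta>) 0)" by (rule finite_subset[OF cover fY])
  moreover have "G (degen k w \<tau> \<theta>) \<noteq> 0" using \<tau>1 by (simp add: \<tau>_def)
  ultimately show ?thesis by blast
qed

section \<open>The generic number of solutions\<close>

definition at_least :: "nat \<Rightarrow> nat \<Rightarrow> (nat \<Rightarrow> nat \<Rightarrow> nat) \<Rightarrow> nat \<Rightarrow> (nat \<times> nat \<Rightarrow> complex) \<Rightarrow> bool" where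
  "at_least d k e m \<theta> \<longleftrightarrow> (\<exists>X \<subseteq> torus_sols d k e \<theta> 0. finite X \<and> card X = m)"

text \<open>The coordinates of the \<open>s\<close>-th of \<open>m\<close> distinct solutions are kept in the row \<open>d + s\<close> of
  \<open>\<theta>\<close> and are then projected away.\<close>

lemma at_least_constructible: assumes k: "k \<le> d" shows "constructible (at_least d k e m)"
proof -
  define row where "row = (\<lambda>(\<theta> :: nat \<times> nat \<Rightarrow> complex) s j. \<theta> (d + s, j))"
  define C where "C = (\<lambda>\<theta>. (\<forall>s\<in>{..<m}. row \<theta> s 0 - 1 = 0 \<and> (\<forall>j\<in>{..d}. row \<theta> s j \<noteq> 0) \<and>
      (\<forall>a\<in>{..<k}. (\<Sum>i\<le>d. \<theta> (a, i) * mon d e i (row \<theta> s)) = 0) \<and>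
      (\<forall>a\<in>{k..<d}. (\<Sum>j\<le>d. \<theta> (a, j) * row \<theta> s j) = 0)) \<and>
      (\<forall>s\<in>{..<m}. \<forall>s'\<in>{..<m} - {s}. \<exists>j\<in>{..d}. row \<theta> s j - row \<theta> s' j \<noteq> 0))"
  have pr: "pfun (\<lambda>\<theta>. row \<theta> s j)" for s j unfolding row_def by (rule pfun.var)
  have cC: "constructible C" unfolding C_def
    by (intro constructible.conj constructible_ball constructible_bex constructible_nonzero constructible.zero
        pfun_diff pfun_sum pfun.mult pfun_mon pr pfun.var pfun.const finite_lessThan finite_atMost
        finite_atLeastLessThan finite_Diff)
  define Y where "Y = {d..<d + m} \<times> {..d}"
  have "at_least d k e m \<theta> \<longleftrightarrow> (\<exists>\<theta>'. (\<forall>v. v \<notin> Y \<longrightarrow> \<theta>' v = \<theta> v) \<and> C \<theta>')" for \<theta>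
  proof
    assume "at_least d k e m \<theta>"
    then obtain X where X: "X \<subseteq> torus_sols d k e \<theta> 0" "finite X" "card X = m" by (auto simp: at_least_def)
    obtain f where f: "bij_betw f {..<m} X" using ex_bij_betw_nat_finite[OF X(2)] X(3) by (auto simp: atLeast0LessThan)
    have fX: "f s \<in> torus_sols d k e \<theta> 0" if "s < m" for s using bij_betwE[OF f] X(1) that by auto
    define \<theta>' where "\<theta>' = (\<lambda>(a, j). if (a, j) \<in> Y then f (a - d) j else \<theta> (a, j))"
    have row: "row \<theta>' s j = f s j" if "s < m" "j \<le> d" for s j using that by (simp add: row_def \<theta>'_def Y_def)
    have low: "\<theta>' (a, j) = \<theta> (a, j)" if "a < d" for a j using that by (simp add: \<theta>'_def Y_def)
    have mon: "mon d e i (row \<theta>' s) = mon d e i (f s)" if "s < m" for i s by (rule mon_cong) (simp add: row that)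
    have "\<exists>j\<in>{..d}. row \<theta>' s j - row \<theta>' s' j \<noteq> 0" if s: "s < m" "s' < m" "s' \<noteq> s" for s s'
    proof (rule ccontr)
      assume "\<not> ?thesis"
      then have "f s j = f s' j" if "j \<le> d" for j using row s that by auto
      moreover have "f s j = f s' j" if "\<not> j \<le> d" for j using fX s that by (simp add: torus_sols_def)
      ultimately have "f s = f s'" by (intro ext) blast
      then show False using bij_betw_imp_inj_on[OF f] s by (auto simp: inj_on_def)
    qed
    moreover have "row \<theta>' s 0 - 1 = 0 \<and> (\<forall>j\<in>{..d}. row \<theta>' s j \<noteq> 0) \<and>
      (\<forall>a\<in>{..<k}. (\<Sum>i\<le>d. \<theta>' (a, i) * mon d e i (row \<theta>' s)) = 0) \<and>
      (\<forall>a\<in>{k..<d}. (\<Sum>j\<le>d. \<theta>' (a, j) * row \<theta>' s j) = 0)" if "s < m" for s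
      using fX[OF that] that k by (simp add: torus_sols_def row low mon sat_def lsat_def)
    ultimately have "C \<theta>'" unfolding C_def by auto
    then show "\<exists>\<theta>'. (\<forall>v. v \<notin> Y \<longrightarrow> \<theta>' v = \<theta> v) \<and> C \<theta>'"
      by (intro exI[of _ \<theta>']) (auto simp: \<theta>'_def)
  next
    assume "\<exists>\<theta>'. (\<forall>v. v \<notin> Y \<longrightarrow> \<theta>' v = \<theta> v) \<and> C \<theta>'"
    then obtain \<theta>' where \<theta>': "\<forall>v. v \<notin> Y \<longrightarrow> \<theta>' v = \<theta> v" "C \<theta>'" by blast
    define f where "f = (\<lambda>s j. if j \<le> d then row \<theta>' s j else 0)"
    have low: "\<theta>' (a, j) = \<theta> (a, j)" if "a < d" for a j using that \<theta>'(1) by (simp add: Y_def)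
    have mon: "mon d e i (row \<theta>' s) = mon d e i (f s)" for i s by (rule mon_cong) (simp add: f_def)
    have C1: "\<forall>s<m. row \<theta>' s 0 - 1 = 0 \<and> (\<forall>j\<in>{..d}. row \<theta>' s j \<noteq> 0) \<and>
      (\<forall>a\<in>{..<k}. (\<Sum>i\<le>d. \<theta>' (a, i) * mon d e i (row \<theta>' s)) = 0) \<and>
      (\<forall>a\<in>{k..<d}. (\<Sum>j\<le>d. \<theta>' (a, j) * row \<theta>' s j) = 0)" using \<theta>'(2) unfolding C_def by blast
    have "f s \<in> torus_sols d k e \<theta> 0" if "s < m" for s
      using C1[rule_format, OF that] k by (simp add: torus_sols_def sat_def lsat_def low mon) (simp add: f_def)
    moreover have "inj_on f {..<m}"
    proof (rule inj_onI, rule ccontr)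
      fix s s' assume s: "s \<in> {..<m}" "s' \<in> {..<m}" "f s = f s'" "s \<noteq> s'"
      then have "\<exists>j\<in>{..d}. row \<theta>' s j - row \<theta>' s' j \<noteq> 0" using \<theta>'(2) unfolding C_def by blast
      then obtain j where "j \<le> d" "row \<theta>' s j \<noteq> row \<theta>' s' j" by auto
      then show False using fun_cong[OF s(3), of j] by (simp add: f_def)
    qed
    ultimately show "at_least d k e m \<theta>" unfolding at_least_def
      by (intro exI[of _ "f ` {..<m}"]) (auto simp: card_image)
  qed
  then have "at_least d k e m = (\<lambda>\<theta>. \<exists>\<theta>'. (\<forall>v. v \<notin> Y \<longrightarrow> \<theta>' v = \<theta> v) \<and> C \<theta>')" by (rule ext)
  then show ?thesis using chevalley_finite[OF cC, of Y] by (simp add: Y_def)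
qed

text \<open>N is the largest m for which at least m solutions exist generically; by the zero-one law
  there are generically no N + 1. Each nonempty open set contains degenerate parameters of both
  kinds: one with few solutions caps m, and one with many solutions forces N up.\<close>

lemma generic_card:
  assumes k: "k \<le> d" and e: "\<And>i. i \<le> d \<Longrightarrow> (\<Sum>j\<le>d. e i j) = q"
  shows "\<exists>N. generic (\<lambda>\<theta>. finite (torus_sols d k e \<theta> 0) \<and> card (torus_sols d k e \<theta> 0) = N) \<and>
    N \<le> (\<Sum>p\<in>index_pairs d k. nat \<bar>mixed_det d k e p\<bar>) \<and>
    (\<forall>I J. (I, J) \<in> index_pairs d k \<longrightarrow> 0 \<notin> I \<longrightarrow> 0 \<notin> J \<longrightarrow>
      nat \<bar>det (submat ({..d} - I - {0}) J (exp_diff_mat e 0))\<bar> \<le> N)"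
proof -
  define U where "U = (\<Sum>p\<in>index_pairs d k. nat \<bar>mixed_det d k e p\<bar>)"
  have dec: "generic (at_least d k e m) \<or> generic (\<lambda>\<theta>. \<not> at_least d k e m \<theta>)" for m
    by (rule constructible_generic[OF at_least_constructible[OF k]])
  have up: "\<not> generic (at_least d k e m)" if "m > U" for m
  proof
    assume "generic (at_least d k e m)"
    then obtain G where G: "pfun G" "\<exists>a. G a \<noteq> 0" "\<forall>\<theta>. G \<theta> \<noteq> 0 \<longrightarrow> at_least d k e m \<theta>" by (rule genericE)
    obtain \<theta> where \<theta>: "G \<theta> \<noteq> 0" "finite (torus_sols d k e \<theta> 0)" "card (torus_sols d k e \<theta> 0) \<le> U"
    proof -
      have "\<exists>\<theta>. G \<theta> \<noteq> 0 \<and> finite (torus_sols d k e \<theta> 0) \<and> card (torus_sols d k e \<theta> 0) \<le> U"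
        unfolding U_def by (rule torus_sols_upper[OF G(1,2) k]) (rule e)
      then show thesis using that by blast
    qed
    then obtain X where X: "X \<subseteq> torus_sols d k e \<theta> 0" "card X = m" using G(3) by (auto simp: at_least_def)
    show False using card_mono[OF \<theta>(2) X(1)] X(2) \<theta>(3) that by simp
  qed
  have "at_least d k e 0 \<theta>" for \<theta> unfolding at_least_def by (rule exI[of _ "{}"]) simp
  then have g0: "generic (at_least d k e 0)" using generic_mono[OF generic_True] by blast
  define N where "N = Max {m. m \<le> U \<and> generic (at_least d k e m)}"
  have "N \<in> {m. m \<le> U \<and> generic (at_least d k e m)}" unfolding N_def by (rule Max_in) (use g0 in auto)
  then have N: "N \<le> U" "generic (at_least d k e N)" by auto
  have "\<not> generic (at_least d k e (Suc N))"
  proof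
    assume a: "generic (at_least d k e (Suc N))"
    then have "Suc N \<le> U" using up not_less by blast
    then have "Suc N \<le> N" unfolding N_def using a by (intro Max_ge) (auto simp: N_def)
    then show False by simp
  qed
  then have gS: "generic (\<lambda>\<theta>. \<not> at_least d k e (Suc N) \<theta>)" using dec by blast
  have "generic (\<lambda>\<theta>. at_least d k e N \<theta> \<and> \<not> at_least d k e (Suc N) \<theta>)" by (rule generic_conj[OF N(2) gS])
  then have gN: "generic (\<lambda>\<theta>. finite (torus_sols d k e \<theta> 0) \<and> card (torus_sols d k e \<theta> 0) = N)"
  proof (rule generic_mono)
    fix \<theta> assume a: "at_least d k e N \<theta> \<and> \<not> at_least d k e (Suc N) \<theta>"
    have fin: "finite (torus_sols d k e \<theta> 0)"
      using a infinite_arbitrarily_large[of "torus_sols d k e \<theta> 0" "Suc N"] unfolding at_least_def by blast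
    obtain X where "X \<subseteq> torus_sols d k e \<theta> 0" "card X = N" using a unfolding at_least_def by blast
    then have "N \<le> card (torus_sols d k e \<theta> 0)" using card_mono[OF fin] by blast
    moreover have "\<not> Suc N \<le> card (torus_sols d k e \<theta> 0)"
    proof
      assume "Suc N \<le> card (torus_sols d k e \<theta> 0)"
      then obtain X where "X \<subseteq> torus_sols d k e \<theta> 0" "card X = Suc N" "finite X" by (rule obtain_subset_with_card_n)
      then show False using a unfolding at_least_def by blast
    qed
    ultimately show "finite (torus_sols d k e \<theta> 0) \<and> card (torus_sols d k e \<theta> 0) = N" using fin by simp
  qed
  have low: "nat \<bar>det (submat ({..d} - I - {0}) J (exp_diff_mat e 0))\<bar> \<le> N"
    if IJ: "(I, J) \<in> index_pairs d k" "0 \<notin> I" "0 \<notin> J" for I J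
  proof (cases "det (submat ({..d} - I - {0}) J (exp_diff_mat e 0)) = 0")
    case False
    obtain G where G: "pfun G" "\<exists>a. G a \<noteq> 0" "\<forall>\<theta>. G \<theta> \<noteq> 0 \<longrightarrow> \<not> at_least d k e (Suc N) \<theta>" using gS by (rule genericE)
    have "I \<subseteq> {..d}" "card I = d - k" "J \<subseteq> {..d}" "card J = k" using IJ by (auto simp: index_pairs_def)
    from torus_sols_lower[OF G(1,2) k this(1,2) IJ(2) this(3,4) IJ(3) False]
    obtain \<theta> X where X: "G \<theta> \<noteq> 0" "X \<subseteq> torus_sols d k e \<theta> 0" "finite X"
      "nat \<bar>det (submat ({..d} - I - {0}) J (exp_diff_mat e 0))\<bar> \<le> card X" by blast
    show ?thesis
    proof (rule ccontr)
      assume "\<not> ?thesis"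
      then have "Suc N \<le> card X" using X(4) by simp
      then obtain X' where "X' \<subseteq> X" "card X' = Suc N" "finite X'" by (rule obtain_subset_with_card_n)
      then have "at_least d k e (Suc N) \<theta>" using X(2) unfolding at_least_def by blast
      then show False using G(3) X(1) by blast
    qed
  qed simp
  show ?thesis using gN N(1) low unfolding U_def by blast
qed

section \<open>Matrices and forms as polynomial functions\<close>

text \<open>A block of r rows, starting at a0, varies while all other variables stay at
  \<open>\<theta>0\<close>. Both blocks of parameters are treated in this way.\<close>

lemma pfun_entry_polynomial:
  assumes f: "pfun f"
  shows "entry_polynomial r s (\<lambda>M. f (\<lambda>(a, j). if a0 \<le> a \<and> a < a0 + r \<and> j < s then M $$ (a - a0, j) else \<theta>0 (a, j)))"
proof -
  define V where "V = {..<r} \<times> {..<s}"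
  define f' where "f' = (\<lambda>\<eta>. f (\<lambda>v. if a0 \<le> fst v \<and> fst v < a0 + r \<and> snd v < s then \<eta> (fst v - a0, snd v) else \<theta>0 v))"
  have "pfun f'" unfolding f'_def by (rule pfun_subst[OF f]) (intro pfun_if pfun.var pfun.const)
  from pfun_expands[OF this, of V "\<lambda>_. 0"] obtain q where "expands V {\<theta>. \<forall>v. v \<notin> V \<longrightarrow> \<theta> v = (\<lambda>_. 0) v} q f'"
    by (auto simp: V_def)
  then obtain c where c: "\<forall>\<theta>\<in>{\<theta>. \<forall>v. v \<notin> V \<longrightarrow> \<theta> v = (\<lambda>_. 0) v}. f' \<theta> = (\<Sum>\<alpha>\<in>exps V q. c \<alpha> * monom_val V \<alpha> \<theta>)"
    by (rule expandsE)
  have "f (\<lambda>(a, j). if a0 \<le> a \<and> a < a0 + r \<and> j < s then M $$ (a - a0, j) else \<theta>0 (a, j))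
    = (\<Sum>\<alpha>\<in>exps V q. c \<alpha> * (\<Prod>(i, j)\<in>{..<r} \<times> {..<s}. M $$ (i, j) ^ \<alpha> (i, j)))" for M
  proof -
    define \<eta> where "\<eta> = (\<lambda>v. if v \<in> V then M $$ v else 0)"
    have "f (\<lambda>(a, j). if a0 \<le> a \<and> a < a0 + r \<and> j < s then M $$ (a - a0, j) else \<theta>0 (a, j)) = f' \<eta>"
      unfolding f'_def by (rule arg_cong[of _ _ f], rule ext) (auto simp: \<eta>_def V_def)
    also have "\<dots> = (\<Sum>\<alpha>\<in>exps V q. c \<alpha> * monom_val V \<alpha> \<eta>)" using c by (simp add: \<eta>_def)
    also have "\<dots> = (\<Sum>\<alpha>\<in>exps V q. c \<alpha> * (\<Prod>(i, j)\<in>{..<r} \<times> {..<s}. M $$ (i, j) ^ \<alpha> (i, j)))"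
      unfolding monom_val_def V_def[symmetric] by (intro sum.cong refl arg_cong2[of _ _ _ _ "(*)"] prod.cong) (auto simp: \<eta>_def)
    finally show ?thesis .
  qed
  then show ?thesis unfolding entry_polynomial_def
    by (intro exI[of _ "exps V q"] exI[of _ c]) (auto simp: finite_exps V_def)
qed

lemma entry_polynomial_pfun:
  assumes "entry_polynomial r s G"
  shows "\<exists>f. pfun f \<and> (\<forall>\<eta>. f \<eta> = G (mat r s \<eta>))"
proof -
  obtain S c where S: "\<forall>M\<in>carrier_mat r s. G M = (\<Sum>\<alpha>\<in>S. c \<alpha> * (\<Prod>(i,j)\<in>{..<r} \<times> {..<s}. M $$ (i,j) ^ \<alpha> (i,j)))"
    using assms unfolding entry_polynomial_def by (elim exE conjE) (rule that)
  define f where "f = (\<lambda>\<eta>. \<Sum>\<alpha>\<in>S. c \<alpha> * (\<Prod>v\<in>{..<r} \<times> {..<s}. \<eta> v ^ \<alpha> v))"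
  have "pfun f" unfolding f_def by (intro pfun_sum pfun.mult pfun.const pfun_prod pfun_power pfun.var)
  moreover have "f \<eta> = G (mat r s \<eta>)" for \<eta>
    unfolding f_def S[THEN bspec, of "mat r s \<eta>", OF mat_carrier]
    by (intro sum.cong refl arg_cong2[of _ _ _ _ "(*)"] prod.cong) auto
  ultimately show ?thesis by (intro exI[of _ f]) simp
qed

text \<open>Two nonzero polynomials in the entries have a common point where neither vanishes. This
  yields the uniqueness behind \<open>THE\<close> in \<open>deg_k\<close>.\<close>

lemma generic_subspace_common:
  assumes "generic_subspace d k P" "generic_subspace d k Q"
  shows "\<exists>L. P L \<and> Q L"
proof -
  have gen: "generic (\<lambda>\<eta>. P (linear_subspace d k (mat k (Suc d) \<eta>)))" if "generic_subspace d k P" for P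
  proof -
    obtain F A where F: "entry_polynomial k (Suc d) F" "A \<in> carrier_mat k (Suc d)" "F A \<noteq> 0"
      "\<forall>M\<in>carrier_mat k (Suc d). F M \<noteq> 0 \<longrightarrow> P (linear_subspace d k M)"
      using \<open>generic_subspace d k P\<close> unfolding generic_subspace_def by (elim exE conjE bexE) (rule that)
    obtain f where f: "pfun f" "\<forall>\<eta>. f \<eta> = F (mat k (Suc d) \<eta>)"
      using entry_polynomial_pfun[OF F(1)] by (elim exE conjE) (rule that)
    have "mat k (Suc d) (\<lambda>v. A $$ v) = A" using F(2) by (intro eq_matI) auto
    then show ?thesis using f F by (intro genericI[of f "\<lambda>v. A $$ v"]) auto
  qed
  show ?thesis using generic_ex[OF generic_conj[OF gen[OF assms(1)] gen[OF assms(2)]]] by blast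
qed

definition stack_params :: "nat \<Rightarrow> nat \<Rightarrow> complex mat \<Rightarrow> complex mat \<Rightarrow> nat \<times> nat \<Rightarrow> complex" where
  "stack_params d k M M' = (\<lambda>(a, j). if a < k then M $$ (a, j) else M' $$ (a - k, j))"

text \<open>Genericity in the pair becomes nested genericity: M is admissible if the polynomial
  remains nonzero when M replaces the first block of \<open>\<theta>0\<close>, and then it is a
  nonzero polynomial in the second block.\<close>

lemma generic_subspace_pair:
  assumes g: "generic P" and k: "k \<le> d"
    and cong: "\<And>\<theta> \<theta>'. P \<theta> \<Longrightarrow> (\<And>a j. a < d \<Longrightarrow> j \<le> d \<Longrightarrow> \<theta> (a, j) = \<theta>' (a, j)) \<Longrightarrow> P \<theta>'"
    and Q: "\<And>M M'. M \<in> carrier_mat k (Suc d) \<Longrightarrow> M' \<in> carrier_mat (d - k) (Suc d) \<Longrightarrow> P (stack_params d k M M') \<Longrightarrow>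
      Q (linear_subspace d k M) (linear_subspace d (d - k) M')"
  shows "generic_subspace d k (\<lambda>L. generic_subspace d (d - k) (Q L))"
proof -
  obtain G where G: "pfun G" "\<exists>a. G a \<noteq> 0" "\<forall>\<theta>. G \<theta> \<noteq> 0 \<longrightarrow> P \<theta>" using g by (rule genericE)
  obtain \<theta>0 where \<theta>0: "G \<theta>0 \<noteq> 0" using G(2) by blast
  define em where "em = (\<lambda>a0 r (\<theta>::nat \<times> nat \<Rightarrow> complex) M (a, j). if a0 \<le> a \<and> a < a0 + r \<and> j < Suc d then M $$ (a - a0, j) else \<theta> (a, j))"
  have ep: "entry_polynomial r (Suc d) (\<lambda>M. G (em a0 r \<theta> M))" for a0 r \<theta>
    unfolding em_def by (rule pfun_entry_polynomial[OF G(1)])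
  have em_id: "em a0 r \<theta> (mat r (Suc d) (\<lambda>(a, j). \<theta> (a0 + a, j))) = \<theta>" for a0 r \<theta>
    by (rule ext) (auto simp: em_def)
  show ?thesis unfolding generic_subspace_def[of d k]
  proof (intro exI[of _ "\<lambda>M. G (em 0 k \<theta>0 M)"] conjI ballI impI ep)
    show "\<exists>M\<in>carrier_mat k (Suc d). G (em 0 k \<theta>0 M) \<noteq> 0"
      by (rule bexI[of _ "mat k (Suc d) (\<lambda>(a, j). \<theta>0 (0 + a, j))"]) (simp_all only: em_id \<theta>0 not_False_eq_True mat_carrier)
    fix M assume M: "M \<in> carrier_mat k (Suc d)" "G (em 0 k \<theta>0 M) \<noteq> 0"
    define \<theta>1 where "\<theta>1 = em 0 k \<theta>0 M"
    show "generic_subspace d (d - k) (Q (linear_subspace d k M))" unfolding generic_subspace_def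
    proof (intro exI[of _ "\<lambda>M'. G (em k (d - k) \<theta>1 M')"] conjI ballI impI ep)
      show "\<exists>M'\<in>carrier_mat (d - k) (Suc d). G (em k (d - k) \<theta>1 M') \<noteq> 0"
        by (rule bexI[of _ "mat (d - k) (Suc d) (\<lambda>(a, j). \<theta>1 (k + a, j))"])
          (simp_all only: em_id M(2)[folded \<theta>1_def] not_False_eq_True mat_carrier)
      fix M' assume M': "M' \<in> carrier_mat (d - k) (Suc d)" "G (em k (d - k) \<theta>1 M') \<noteq> 0"
      have "P (em k (d - k) \<theta>1 M')" using G(3) M'(2) by blast
      then have "P (stack_params d k M M')"
        by (rule cong) (use k in \<open>auto simp: em_def \<theta>1_def stack_params_def\<close>)
      then show "Q (linear_subspace d k M) (linear_subspace d (d - k) M')" by (rule Q[OF M(1) M'(1)])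
    qed
  qed
qed

text \<open>Comparing the coefficients of u ^ m in R (u x) discards all monomials of other degrees.
  What remains is a translation between exponent functions on \<open>{..d}\<close> and the exponent
  lists in \<open>form\<close>.\<close>

lemma form_of_pfun:
  assumes R: "pfun R" "depends_only {..d} R" "\<forall>u x. R (\<lambda>j. u * x j) = u ^ m * R x"
  shows "form d m (\<lambda>v. R (vec_index v))"
proof -
  obtain q where "expands {..d} UNIV q R" using pfun_expands_UNIV[OF R(1,2)] by auto
  then obtain c where c: "\<forall>x\<in>UNIV. R x = (\<Sum>\<alpha>\<in>exps {..d} q. c \<alpha> * monom_val {..d} \<alpha> x)" by (rule expandsE)
  define sz where "sz = (\<lambda>\<alpha> :: nat \<Rightarrow> nat. \<Sum>i\<le>d. \<alpha> i)"
  have fe: "finite (exps {..d} q)" by (rule finite_exps) simp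
  have comp: "R x = (\<Sum>\<alpha> | \<alpha> \<in> exps {..d} q \<and> sz \<alpha> = m. c \<alpha> * monom_val {..d} \<alpha> x)" for x
  proof -
    define p where "p = (\<Sum>\<alpha>\<in>exps {..d} q. Polynomial.monom (c \<alpha> * monom_val {..d} \<alpha> x) (sz \<alpha>))"
    have "p = Polynomial.monom (R x) m"
    proof (rule poly_eqI_all)
      fix t
      have "monom_val {..d} \<alpha> (\<lambda>j. t * x j) = t ^ sz \<alpha> * monom_val {..d} \<alpha> x" for \<alpha>
        by (simp add: monom_val_def sz_def power_mult_distrib prod.distrib power_sum)
      then have "poly p t = R (\<lambda>j. t * x j)" using c
        by (simp add: p_def poly_sum poly_monom mult_ac)
      also have "\<dots> = poly (Polynomial.monom (R x) m) t" using R(3) by (simp add: poly_monom mult.commute)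
      finally show "poly p t = poly (Polynomial.monom (R x) m) t" .
    qed
    then have "R x = coeff p m" by simp
    also have "\<dots> = (\<Sum>\<alpha>\<in>exps {..d} q. if sz \<alpha> = m then c \<alpha> * monom_val {..d} \<alpha> x else 0)"
      by (simp add: p_def coeff_sum)
    also have "\<dots> = (\<Sum>\<alpha> | \<alpha> \<in> exps {..d} q \<and> sz \<alpha> = m. c \<alpha> * monom_val {..d} \<alpha> x)"
      using fe by (simp add: sum.inter_filter)
    finally show ?thesis .
  qed
  define fl where "fl = (\<lambda>l :: nat list. \<lambda>i\<in>{..d}. l ! i)"
  \<comment> \<open>Lists with an entry above q do not come from \<open>exps\<close> and get
    coefficient 0.\<close>
  define c' where "c' = (\<lambda>l. if \<forall>i\<le>d. l ! i \<le> q then c (fl l) else 0)"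
  have szl: "sz (fl l) = sum_list l" if "length l = Suc d" for l
  proof -
    have "sz (fl l) = (\<Sum>i\<le>d. l ! i)" unfolding sz_def by (rule sum.cong) (auto simp: fl_def)
    then show ?thesis using that by (simp add: sum_list_sum_nth atLeast0LessThan lessThan_Suc_atMost)
  qed
  have bij: "bij_betw fl {l. (length l = Suc d \<and> sum_list l = m) \<and> (\<forall>i\<le>d. l ! i \<le> q)} {\<alpha> \<in> exps {..d} q. sz \<alpha> = m}"
  proof (rule bij_betwI[of _ _ _ "\<lambda>\<alpha>. map \<alpha> [0..<Suc d]"])
    show "fl \<in> {l. (length l = Suc d \<and> sum_list l = m) \<and> (\<forall>i\<le>d. l ! i \<le> q)} \<rightarrow> {\<alpha> \<in> exps {..d} q. sz \<alpha> = m}"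
      using szl by (auto simp: exps_def fl_def)
    have inv: "fl (map \<alpha> [0..<Suc d]) = \<alpha>" if "\<alpha> \<in> exps {..d} q" for \<alpha>
    proof
      fix i show "fl (map \<alpha> [0..<Suc d]) i = \<alpha> i"
        using that PiE_arb[of \<alpha> "{..d}" "\<lambda>_. {..q}" i] by (cases "i \<le> d") (auto simp: fl_def exps_def simp del: upt_Suc)
    qed
    show "(\<lambda>\<alpha>. map \<alpha> [0..<Suc d]) \<in> {\<alpha> \<in> exps {..d} q. sz \<alpha> = m} \<rightarrow> {l. (length l = Suc d \<and> sum_list l = m) \<and> (\<forall>i\<le>d. l ! i \<le> q)}"
    proof
      fix \<alpha> assume a: "\<alpha> \<in> {\<alpha> \<in> exps {..d} q. sz \<alpha> = m}"
      have "sum_list (map \<alpha> [0..<Suc d]) = m" using szl[of "map \<alpha> [0..<Suc d]"] inv[of \<alpha>] a by (simp del: upt_Suc)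
      moreover have "\<forall>i\<le>d. map \<alpha> [0..<Suc d] ! i \<le> q" using a by (auto simp: exps_def PiE_def Pi_def simp del: upt_Suc)
      ultimately show "map \<alpha> [0..<Suc d] \<in> {l. (length l = Suc d \<and> sum_list l = m) \<and> (\<forall>i\<le>d. l ! i \<le> q)}" by (simp del: upt_Suc)
    qed
    show "fl (map \<alpha> [0..<Suc d]) = \<alpha>" if "\<alpha> \<in> {\<alpha> \<in> exps {..d} q. sz \<alpha> = m}" for \<alpha> using inv that by blast
    show "map (fl l) [0..<Suc d] = l" if "l \<in> {l. (length l = Suc d \<and> sum_list l = m) \<and> (\<forall>i\<le>d. l ! i \<le> q)}" for l
      by (rule nth_equalityI) (use that in \<open>auto simp: fl_def simp del: upt_Suc\<close>)
  qed
  have finl: "finite {l :: nat list. length l = Suc d \<and> sum_list l = m}"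
  proof (rule finite_subset)
    show "{l :: nat list. length l = Suc d \<and> sum_list l = m} \<subseteq> {l. set l \<subseteq> {..m} \<and> length l = Suc d}"
      using member_le_sum_list by auto
    show "finite {l :: nat list. set l \<subseteq> {..m} \<and> length l = Suc d}" by (rule finite_lists_length_eq) simp
  qed
  have "R (vec_index v) = (\<Sum>\<alpha> | length \<alpha> = Suc d \<and> sum_list \<alpha> = m. c' \<alpha> * (\<Prod>i\<le>d. vec_index v i ^ (\<alpha> ! i)))" for v
  proof -
    have "(\<Sum>\<alpha> | length \<alpha> = Suc d \<and> sum_list \<alpha> = m. c' \<alpha> * (\<Prod>i\<le>d. vec_index v i ^ (\<alpha> ! i)))
      = (\<Sum>\<alpha>\<in>{l. (length l = Suc d \<and> sum_list l = m) \<and> (\<forall>i\<le>d. l ! i \<le> q)}. c' \<alpha> * (\<Prod>i\<le>d. vec_index v i ^ (\<alpha> ! i)))"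
      by (rule sum.mono_neutral_right) (use finl in \<open>auto simp: c'_def\<close>)
    also have "\<dots> = (\<Sum>\<alpha>\<in>{l. (length l = Suc d \<and> sum_list l = m) \<and> (\<forall>i\<le>d. l ! i \<le> q)}. c (fl \<alpha>) * monom_val {..d} (fl \<alpha>) (vec_index v))"
      by (rule sum.cong) (auto simp: c'_def monom_val_def fl_def)
    also have "\<dots> = (\<Sum>\<alpha> | \<alpha> \<in> exps {..d} q \<and> sz \<alpha> = m. c \<alpha> * monom_val {..d} \<alpha> (vec_index v))"
      by (rule sum.reindex_bij_betw[OF bij])
    finally show ?thesis using comp by simp
  qed
  then show ?thesis unfolding form_def by (intro exI[of _ c'] ballI) simp
qed

section \<open>Preimages of linear subspaces under monomial maps\<close>

definition pvec :: "nat \<Rightarrow> (nat \<Rightarrow> nat \<Rightarrow> nat) \<Rightarrow> complex vec \<Rightarrow> complex vec" where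
  "pvec d e v = vec (Suc d) (\<lambda>i. mon d e i (vec_index v))"

lemma mem_line: "v \<in> line v"
  unfolding line_def by (auto intro!: exI[of _ 1])

lemma line_smult: assumes "c \<noteq> 0" shows "line (c \<cdot>\<^sub>v v) = line v"
proof
  show "line (c \<cdot>\<^sub>v v) \<subseteq> line v" by (auto simp: line_def smult_smult_assoc)
  show "line v \<subseteq> line (c \<cdot>\<^sub>v v)"
  proof
    fix u assume "u \<in> line v"
    then obtain b where "u = b \<cdot>\<^sub>v v" by (auto simp: line_def)
    then have "u = (b / c) \<cdot>\<^sub>v (c \<cdot>\<^sub>v v)" using assms by (simp add: smult_smult_assoc)
    then show "u \<in> line (c \<cdot>\<^sub>v v)" unfolding line_def by blast
  qed
qed

lemma line_eqD: "line v = line w \<Longrightarrow> \<exists>c. v = c \<cdot>\<^sub>v w"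
  using mem_line[of v] by (auto simp: line_def)

lemma vec_vec_index: "v \<in> carrier_vec n \<Longrightarrow> vec n (vec_index v) = v"
  by (rule eq_vecI) auto

lemma tendsto_mon: "(\<And>j. j \<le> d \<Longrightarrow> (\<lambda>n. U n j) \<longlonglongrightarrow> x j) \<Longrightarrow> (\<lambda>n. mon d e i (U n)) \<longlonglongrightarrow> mon d e i x"
  unfolding mon_def by (intro tendsto_prod tendsto_power) auto

lemma tendsto_form:
  assumes F: "form d m F" and U: "\<And>j. j \<le> d \<Longrightarrow> (\<lambda>n. U n j) \<longlonglongrightarrow> x j"
  shows "(\<lambda>n. F (vec (Suc d) (U n))) \<longlonglongrightarrow> F (vec (Suc d) x)"
proof -
  obtain c where "\<forall>v \<in> carrier_vec (Suc d). F v = (\<Sum>\<alpha> | length \<alpha> = Suc d \<and> sum_list \<alpha> = m. c \<alpha> * (\<Prod>i\<le>d. vec_index v i ^ (\<alpha> ! i)))"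
    using F unfolding form_def by (rule exE)
  then have "F (vec (Suc d) y) = (\<Sum>\<alpha> | length \<alpha> = Suc d \<and> sum_list \<alpha> = m. c \<alpha> * (\<Prod>i\<le>d. y i ^ (\<alpha> ! i)))" for y
    by (auto intro!: sum.cong prod.cong)
  then show ?thesis using U by (simp only:) (intro tendsto_sum tendsto_mult tendsto_const tendsto_prod tendsto_power; simp)
qed

lemma line_in_linear_subspace:
  assumes u: "u \<in> hcoords d" and M: "M \<in> carrier_mat k (Suc d)"
  shows "line u \<in> linear_subspace d k M \<longleftrightarrow> (\<forall>a<k. (\<Sum>j\<le>d. M $$ (a, j) * vec_index u j) = 0)"
proof -
  have uc: "u \<in> carrier_vec (Suc d)" using u by (simp add: hcoords_def)
  have "(\<forall>v\<in>line u. M *\<^sub>v v = 0\<^sub>v k) \<longleftrightarrow> M *\<^sub>v u = 0\<^sub>v k"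
    using mem_line[of u] M uc by (auto simp: line_def mult_mat_vec)
  moreover have "vec_index (M *\<^sub>v u) a = (\<Sum>j\<le>d. M $$ (a, j) * vec_index u j)" if "a < k" for a
    using that M uc by (auto simp: scalar_prod_def atLeast0LessThan lessThan_Suc_atMost intro!: sum.cong)
  then have "M *\<^sub>v u = 0\<^sub>v k \<longleftrightarrow> (\<forall>a<k. (\<Sum>j\<le>d. M $$ (a, j) * vec_index u j) = 0)"
    using M by (metis (no_types, lifting) carrier_matD(1) dim_mult_mat_vec eq_vecI index_zero_vec)
  ultimately show ?thesis using u by (auto simp: linear_subspace_def proj_space_def)
qed

text \<open>If all \<open>mon d e i\<close> vanish at \<open>v\<close>, then along a suitable monomial curve through \<open>v\<close> any
  given component of \<open>F\<close> is a multiple of a positive power of the curve parameter.\<close>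

lemma represents_monomial:
  assumes A1: "\<And>v. v \<in> hcoords d \<Longrightarrow> (\<And>j. j \<le> d \<Longrightarrow> vec_index v j \<noteq> 0) \<Longrightarrow> f (line v) = Some (line (pvec d e v))"
    and e: "\<And>i. i \<le> d \<Longrightarrow> (\<Sum>j\<le>d. e i j) = q" and emin: "\<And>j. j \<le> d \<Longrightarrow> \<exists>i\<le>d. e i j = 0"
    and F: "represents d f F" and v: "v \<in> hcoords d" and Fv: "F v \<noteq> 0\<^sub>v (Suc d)"
  shows "pvec d e v \<noteq> 0\<^sub>v (Suc d) \<and> line (F v) = line (pvec d e v)"
proof -
  have vc: "v \<in> carrier_vec (Suc d)" using v by (simp add: hcoords_def)
  have Fc: "F u \<in> carrier_vec (Suc d)" if "u \<in> carrier_vec (Suc d)" for u using F that by (simp add: represents_def)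
  obtain m where m: "\<forall>i\<le>d. form d m (\<lambda>v. vec_index (F v) i)" using F unfolding represents_def by (elim exE conjE) (rule that)
  \<comment> \<open>On the torus f is known, so there F is proportional to the tuple of monomials;
    the vanishing 2 by 2 minors are then carried to v by limits.\<close>
  have cross: "vec_index (F u) i * mon d e j (vec_index u) = vec_index (F u) j * mon d e i (vec_index u)"
    if u: "u \<in> carrier_vec (Suc d)" "\<And>j. j \<le> d \<Longrightarrow> vec_index u j \<noteq> 0" and ij: "i \<le> d" "j \<le> d" for u i j
  proof (cases "F u = 0\<^sub>v (Suc d)")
    case False
    have uh: "u \<in> hcoords d" using u(1) u(2)[of 0] by (auto simp: hcoords_def)
    have "f (line u) = Some (line (pvec d e u))" by (rule A1[OF uh u(2)])
    moreover have "f (line u) = Some (line (F u))" using F uh False calculation by (auto simp: represents_def)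
    ultimately have "line (F u) = line (pvec d e u)" by simp
    then obtain c where "F u = c \<cdot>\<^sub>v pvec d e u" using line_eqD by blast
    then show ?thesis using ij by (simp add: pvec_def)
  qed (use ij in simp)
  define S where "S = {l. l \<le> d \<and> vec_index v l = 0}"
  define s where "s = (\<lambda>n. complex_of_real (inverse (real (Suc n))))"
  have s0: "s \<longlonglongrightarrow> 0" unfolding s_def using tendsto_of_real[OF LIMSEQ_inverse_real_of_nat, where 'a = complex] by simp
  have snz: "s n \<noteq> 0" for n unfolding s_def of_real_eq_0_iff by simp
  have sp: "(\<lambda>n. s n ^ b) \<longlonglongrightarrow> 0" if "b > 0" for b using tendsto_power[OF s0, of b] that by (simp add: zero_power)
  \<comment> \<open>Approaches v through the torus: a coordinate j that vanishes at v is replaced by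
    the power w j of the curve parameter.\<close>
  define U where "U = (\<lambda>(w :: nat \<Rightarrow> nat) n j. if vec_index v j \<noteq> 0 then vec_index v j else s n ^ w j)"
  have U: "(\<lambda>n. U w n j) \<longlonglongrightarrow> vec_index v j" if "w j > 0" for w j
    using sp[OF that] by (cases "vec_index v j = 0") (simp_all add: U_def)
  have crossU: "vec_index (F (vec (Suc d) (U w n))) i * mon d e j (U w n) = vec_index (F (vec (Suc d) (U w n))) j * mon d e i (U w n)"
    if "i \<le> d" "j \<le> d" for w n i j
  proof -
    have "mon d e l (vec_index (vec (Suc d) (U w n))) = mon d e l (U w n)" for l by (rule mon_cong) simp
    then show ?thesis using cross[of "vec (Suc d) (U w n)" i j] that snz by (simp add: U_def)
  qed
  have FU: "(\<lambda>n. vec_index (F (vec (Suc d) (U w n))) i) \<longlonglongrightarrow> vec_index (F v) i" if "i \<le> d" "\<And>j. w j > 0" for w i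
    using tendsto_form[OF m[rule_format, OF that(1)], of "U w" "vec_index v"] U that vec_vec_index[OF vc] by simp
  have P: "pvec d e v \<noteq> 0\<^sub>v (Suc d)"
  proof
    assume P0: "pvec d e v = 0\<^sub>v (Suc d)"
    have "vec_index (F v) i = 0" if i: "i \<le> d" for i
    proof -
      have "mon d e i (vec_index v) = vec_index (pvec d e v) i" using i by (simp add: pvec_def)
      then have "\<exists>l\<in>S. e i l \<noteq> 0" using P0 i mon_nonzero_iff[of d e i "vec_index v"] by (auto simp: S_def)
      then obtain l where l: "l \<in> S" "e i l \<noteq> 0" by blast
      obtain j where j: "j \<le> d" "e j l = 0" using emin[of l] l(1) by (auto simp: S_def)
      \<comment> \<open>The weight q + 1 on l makes the monomial i vanish to order at least q + 1
        along the curve, while the monomial j, which does not involve l, has order at most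
        q.\<close>
      define w where "w = (\<lambda>l'. if l' = l then q + 1 else 1)"
      define b where "b = (\<lambda>i. \<Sum>l\<in>S. w l * e i l)"
      define \<kappa> where "\<kappa> = (\<lambda>i. \<Prod>l\<in>{..d} - S. vec_index v l ^ e i l)"
      have fS: "finite S" and SD: "S \<subseteq> {..d}" by (auto simp: S_def)
      have \<kappa>: "\<kappa> i \<noteq> 0" for i by (auto simp: \<kappa>_def S_def)
      have mU: "mon d e i (U w n) = s n ^ b i * \<kappa> i" for i n
      proof -
        have "mon d e i (U w n) = (\<Prod>l\<in>{..d} - S. U w n l ^ e i l) * (\<Prod>l\<in>S. U w n l ^ e i l)"
          unfolding mon_def by (rule prod.subset_diff[OF SD finite_atMost])
        also have "(\<Prod>l\<in>S. U w n l ^ e i l) = (\<Prod>l\<in>S. s n ^ (w l * e i l))"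
          by (rule prod.cong) (auto simp: U_def S_def power_mult)
        also have "\<dots> = s n ^ b i" by (simp add: b_def power_sum)
        also have "(\<Prod>l\<in>{..d} - S. U w n l ^ e i l) = \<kappa> i" unfolding \<kappa>_def by (rule prod.cong) (auto simp: U_def S_def)
        finally show ?thesis by simp
      qed
      have "w l * e i l \<le> b i" unfolding b_def using fS l(1) by (intro member_le_sum) auto
      moreover have "q + 1 \<le> w l * e i l" using l(2) mult_le_mono2[of 1 "e i l" "q + 1"] by (simp add: w_def)
      moreover have "b j \<le> q"
      proof -
        have "b j = (\<Sum>l'\<in>S. e j l')" unfolding b_def by (rule sum.cong) (use j in \<open>auto simp: w_def\<close>)
        also have "\<dots> \<le> (\<Sum>l'\<le>d. e j l')" by (rule sum_mono2) (use SD in auto)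
        finally show ?thesis using e[OF j(1)] by simp
      qed
      ultimately have bb: "b j < b i" by linarith
      have eq: "vec_index (F (vec (Suc d) (U w n))) i = vec_index (F (vec (Suc d) (U w n))) j * (s n ^ (b i - b j) * (\<kappa> i / \<kappa> j))" for n
      proof -
        have "s n ^ b i = s n ^ (b i - b j) * s n ^ b j" using bb by (simp add: power_add[symmetric])
        then have "(vec_index (F (vec (Suc d) (U w n))) i * \<kappa> j) * s n ^ b j = (vec_index (F (vec (Suc d) (U w n))) j * s n ^ (b i - b j) * \<kappa> i) * s n ^ b j"
          using crossU[OF i j(1), of w n] unfolding mU by (simp add: mult_ac)
        then have "vec_index (F (vec (Suc d) (U w n))) i * \<kappa> j = vec_index (F (vec (Suc d) (U w n))) j * s n ^ (b i - b j) * \<kappa> i"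
          using snz[of n] by simp
        then show ?thesis using \<kappa>[of j] by (simp add: field_simps)
      qed
      have "(\<lambda>n. vec_index (F (vec (Suc d) (U w n))) j * (s n ^ (b i - b j) * (\<kappa> i / \<kappa> j))) \<longlonglongrightarrow> vec_index (F v) j * (0 * (\<kappa> i / \<kappa> j))"
        using bb by (intro tendsto_mult FU[OF j(1)] sp tendsto_const) (auto simp: w_def)
      then have "(\<lambda>n. vec_index (F (vec (Suc d) (U w n))) i) \<longlonglongrightarrow> 0" unfolding eq by simp
      moreover have "(\<lambda>n. vec_index (F (vec (Suc d) (U w n))) i) \<longlonglongrightarrow> vec_index (F v) i"
        by (rule FU[OF i]) (simp add: w_def)
      ultimately show ?thesis using LIMSEQ_unique by blast
    qed
    then have "F v = 0\<^sub>v (Suc d)" using Fc[OF vc] by (intro eq_vecI) auto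
    then show False using Fv by simp
  qed
  obtain j where j: "j \<le> d" "mon d e j (vec_index v) \<noteq> 0"
  proof -
    have "\<exists>j<Suc d. vec_index (pvec d e v) j \<noteq> 0"
    proof (rule ccontr)
      assume "\<not> ?thesis"
      then have "pvec d e v = 0\<^sub>v (Suc d)" by (intro eq_vecI) (auto simp: pvec_def)
      then show False using P by simp
    qed
    then show thesis using that by (auto simp: pvec_def less_Suc_eq_le)
  qed
  have crossv: "vec_index (F v) i * mon d e j (vec_index v) = vec_index (F v) j * mon d e i (vec_index v)" if i: "i \<le> d" for i
  proof -
    have mU: "(\<lambda>n. mon d e l (U (\<lambda>_. 1) n)) \<longlonglongrightarrow> mon d e l (vec_index v)" for l
      by (rule tendsto_mon) (simp add: U)
    have "(\<lambda>n. vec_index (F (vec (Suc d) (U (\<lambda>_. 1) n))) i * mon d e j (U (\<lambda>_. 1) n)) \<longlonglongrightarrow> vec_index (F v) i * mon d e j (vec_index v)"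
      by (intro tendsto_mult FU[OF i] mU) simp
    moreover have "(\<lambda>n. vec_index (F (vec (Suc d) (U (\<lambda>_. 1) n))) j * mon d e i (U (\<lambda>_. 1) n)) \<longlonglongrightarrow> vec_index (F v) j * mon d e i (vec_index v)"
      by (intro tendsto_mult FU[OF j(1)] mU) simp
    ultimately show ?thesis unfolding crossU[OF i j(1)] using LIMSEQ_unique by blast
  qed
  define c where "c = vec_index (F v) j / mon d e j (vec_index v)"
  have Fcv: "F v = c \<cdot>\<^sub>v pvec d e v"
  proof (rule eq_vecI)
    fix i assume "i < dim_vec (c \<cdot>\<^sub>v pvec d e v)"
    then have i: "i \<le> d" by (simp add: pvec_def)
    show "vec_index (F v) i = vec_index (c \<cdot>\<^sub>v pvec d e v) i"
      using crossv[OF i] i j(2) by (simp add: pvec_def c_def field_simps)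
  qed (use Fc[OF vc] in \<open>simp add: pvec_def\<close>)
  have "c \<noteq> 0"
  proof
    assume "c = 0"
    then have "F v = 0\<^sub>v (Suc d)" unfolding Fcv by (intro eq_vecI) (auto simp: pvec_def)
    then show False using Fv by simp
  qed
  then show ?thesis using P unfolding Fcv by (simp add: line_smult)
qed

lemma sat_cong_params:
  assumes "\<And>a j. a < d \<Longrightarrow> j \<le> d \<Longrightarrow> \<theta> (a, j) = \<theta>' (a, j)" "k \<le> d"
  shows "sat d k e \<theta> = sat d k e \<theta>'" "lsat d k \<theta> = lsat d k \<theta>'"
proof -
  have "(\<Sum>i\<le>d. \<theta> (a, i) * y i) = (\<Sum>i\<le>d. \<theta>' (a, i) * y i)" if "a < d" for a y
    by (rule sum.cong) (use assms that in auto)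
  then show "sat d k e \<theta> = sat d k e \<theta>'" "lsat d k \<theta> = lsat d k \<theta>'"
    using assms(2) by (auto simp: sat_def lsat_def fun_eq_iff)
qed

text \<open>A point of the closure on the linear subspace with some coordinate 0 would have all
  coordinates 0 by the vanishing forms, so it lies in the torus; the equations \<open>sat\<close>
  are themselves forms and pass to the closure.\<close>

lemma closure_inter_eq:
  assumes vf: "\<forall>s\<le>d. \<forall>i\<le>d. vanishing_form d k s i \<theta> {x. sat d k e \<theta> x \<and> (\<exists>i\<le>d. mon d e i x \<noteq> 0)}"
    and e: "\<And>i. i \<le> d \<Longrightarrow> (\<Sum>j\<le>d. e i j) = q"
  shows "{p \<in> zariski_closure d {line v | v. v \<in> hcoords d \<and> sat d k e \<theta> (vec_index v) \<and> (\<exists>i\<le>d. mon d e i (vec_index v) \<noteq> 0)}.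
      \<exists>v\<in>hcoords d. p = line v \<and> lsat d k \<theta> (vec_index v)}
    = (\<lambda>x. line (vec (Suc d) x)) ` torus_sols d k e \<theta> 0"
proof -
  define X where "X = {x. sat d k e \<theta> x \<and> (\<exists>i\<le>d. mon d e i x \<noteq> 0)}"
  define W where "W = {line v | v. v \<in> hcoords d \<and> sat d k e \<theta> (vec_index v) \<and> (\<exists>i\<le>d. mon d e i (vec_index v) \<noteq> 0)}"
  have cl: "F (vec_index v) = 0"
    if p: "line v \<in> zariski_closure d W" and F: "pfun F" "depends_only {..d} F" "\<forall>u x. F (\<lambda>j. u * x j) = u ^ m * F x" "\<forall>x\<in>X. F x = 0" for v F m
  proof -
    have "\<forall>q\<in>W. \<forall>u\<in>q. F (vec_index u) = 0"
    proof (intro ballI)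
      fix p u assume "p \<in> W" "u \<in> p"
      then obtain v' c where v': "v' \<in> hcoords d" "vec_index v' \<in> X" "u = c \<cdot>\<^sub>v v'" by (auto simp: W_def X_def line_def)
      have "F (vec_index u) = F (\<lambda>j. c * vec_index v' j)"
        by (rule depends_onlyD[OF F(2)]) (use v' in \<open>auto simp: hcoords_def\<close>)
      then show "F (vec_index u) = 0" using F(3,4) v'(2) by simp
    qed
    then have v1: "form d m (\<lambda>v. F (vec_index v)) \<and> (\<forall>q\<in>W. \<forall>u\<in>q. F (vec_index u) = 0)"
      using form_of_pfun[OF F(1-3)] by (rule conjI[rotated])
    have v2: "\<forall>m F. form d m F \<and> (\<forall>q\<in>W. \<forall>v\<in>q. F v = 0) \<longrightarrow> (\<forall>v\<in>line v. F v = 0)"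
      using p unfolding zariski_closure_def mem_Collect_eq by (rule conjunct2)
    have "\<forall>u\<in>line v. F (vec_index u) = 0" by (rule mp[OF v2[THEN spec[of _ m], THEN spec[of _ "\<lambda>v. F (vec_index v)"]] v1])
    then show ?thesis by (rule bspec[OF _ mem_line])
  qed
  show ?thesis unfolding W_def[symmetric]
  proof (intro equalityI subsetI)
    fix p assume "p \<in> {p \<in> zariski_closure d W. \<exists>v\<in>hcoords d. p = line v \<and> lsat d k \<theta> (vec_index v)}"
    then obtain v where v: "v \<in> hcoords d" "p = line v" "lsat d k \<theta> (vec_index v)" "line v \<in> zariski_closure d W" by auto
    have vc: "v \<in> carrier_vec (Suc d)" "v \<noteq> 0\<^sub>v (Suc d)" using v(1) by (auto simp: hcoords_def)
    have nz: "vec_index v s \<noteq> 0" if s: "s \<le> d" for s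
    proof
      assume s0: "vec_index v s = 0"
      have "vec_index v i = 0" if i: "i \<le> d" for i
      proof -
        have "vanishing_form d k s i \<theta> X" using vf s i by (simp add: X_def)
        then obtain F m c where F: "pfun F" "depends_only {..d} F" "\<forall>u x. F (\<lambda>j. u * x j) = u ^ m * F x"
          "\<forall>x\<in>X. F x = 0" "c \<noteq> 0" "\<forall>p. p s = 0 \<longrightarrow> lsat d k \<theta> p \<longrightarrow> F p = c * p i ^ m"
          unfolding vanishing_form_def by (elim exE conjE) (rule that)
        have "c * vec_index v i ^ m = 0" using cl[OF v(4) F(1-4)] F(6) s0 v(3) by metis
        then show ?thesis using F(5) by auto
      qed
      then have "v = 0\<^sub>v (Suc d)" using vc(1) by (intro eq_vecI) auto
      then show False using vc(2) by simp
    qed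
    have "(\<Sum>i\<le>d. \<theta> (a, i) * mon d e i (vec_index v)) = 0" if a: "a < k" for a
    proof (rule cl[OF v(4), of "\<lambda>x. \<Sum>i\<le>d. \<theta> (a, i) * mon d e i x" q])
      show "pfun (\<lambda>x. \<Sum>i\<le>d. \<theta> (a, i) * mon d e i x)"
        by (intro pfun_sum pfun.mult pfun.const pfun_mon pfun.var)
      show "depends_only {..d} (\<lambda>x. \<Sum>i\<le>d. \<theta> (a, i) * mon d e i x)"
        by (rule depends_onlyI) (auto intro!: sum.cong simp: mon_def)
      show "\<forall>u x. (\<Sum>i\<le>d. \<theta> (a, i) * mon d e i (\<lambda>j. u * x j)) = u ^ q * (\<Sum>i\<le>d. \<theta> (a, i) * mon d e i x)"
        by (auto simp: sum_distrib_left mon_scale[OF e] mult_ac intro!: sum.cong)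
      show "\<forall>x\<in>X. (\<Sum>i\<le>d. \<theta> (a, i) * mon d e i x) = 0" using a by (auto simp: X_def sat_def)
    qed
    then have sat: "sat d k e \<theta> (vec_index v)" by (simp add: sat_def)
    define x where "x = (\<lambda>j. if j \<le> d then vec_index v j / vec_index v 0 else 0)"
    define y where "y = (\<lambda>j. if j \<le> d then vec_index v j else 0)"
    have "mon d e i y = mon d e i (vec_index v)" for i by (rule mon_cong) (simp add: y_def)
    then have "sat d k e \<theta> y" using sat by (simp add: sat_def)
    moreover have "lsat d k \<theta> y" using v(3) by (simp add: lsat_def y_def)
    ultimately have y: "lin_eqs d {..<k} \<theta> (\<lambda>i. mon d e i y)" "lin_eqs d {k..<d} \<theta> y" by (simp_all add: sat_iff_lin_eqs lsat_iff_lin_eqs)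
    define s where "s = 1 / vec_index v 0"
    have s: "s \<noteq> 0" using nz[of 0] by (simp add: s_def)
    have xy: "x = (\<lambda>j. s * y j)" by (auto simp: x_def y_def s_def)
    have "lin_eqs d {..<k} \<theta> (\<lambda>i. mon d e i x) \<longleftrightarrow> lin_eqs d {..<k} \<theta> (\<lambda>i. s ^ q * mon d e i y)"
      unfolding xy by (rule lin_eqs_cong) (simp add: mon_scale[OF e])
    then have "sat d k e \<theta> x" using y(1) s lin_eqs_scale[of "s ^ q" d "{..<k}" \<theta> "\<lambda>i. mon d e i y"] by (simp add: sat_iff_lin_eqs)
    moreover have "lsat d k \<theta> x" using y(2) s lin_eqs_scale[of s d "{k..<d}" \<theta> y] by (simp add: lsat_iff_lin_eqs xy)
    ultimately have "x \<in> torus_sols d k e \<theta> 0" using nz by (simp add: torus_sols_def) (simp add: x_def)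
    moreover have "vec (Suc d) x = s \<cdot>\<^sub>v v" using vc(1) by (intro eq_vecI) (auto simp: x_def s_def)
    then have "p = line (vec (Suc d) x)" using line_smult[OF s, of v] v(2) by simp
    ultimately show "p \<in> (\<lambda>x. line (vec (Suc d) x)) ` torus_sols d k e \<theta> 0" by blast
  next
    fix p assume "p \<in> (\<lambda>x. line (vec (Suc d) x)) ` torus_sols d k e \<theta> 0"
    then obtain x where x: "x \<in> torus_sols d k e \<theta> 0" "p = line (vec (Suc d) x)" by blast
    define v where "v = vec (Suc d) x"
    have "vec_index v 0 = 1" using x(1) by (simp add: v_def torus_sols_def)
    then have "v \<noteq> 0\<^sub>v (Suc d)" by auto
    then have v: "v \<in> hcoords d" by (simp add: hcoords_def v_def)
    have mon: "mon d e i (vec_index v) = mon d e i x" for i by (rule mon_cong) (simp add: v_def)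
    have sat: "sat d k e \<theta> (vec_index v)" using x(1) by (simp add: torus_sols_def sat_def mon)
    have lsat: "lsat d k \<theta> (vec_index v)" using x(1) by (simp add: torus_sols_def lsat_def v_def)
    have "mon d e 0 (vec_index v) \<noteq> 0" unfolding mon mon_nonzero_iff using x(1) by (auto simp: torus_sols_def)
    then have "p \<in> W" using v sat x(2) unfolding W_def v_def[symmetric] by blast
    moreover have "p \<in> proj_space d" using x(2) v by (simp add: proj_space_def v_def)
    ultimately have "p \<in> zariski_closure d W" by (auto simp: zariski_closure_def)
    then show "p \<in> {p \<in> zariski_closure d W. \<exists>v\<in>hcoords d. p = line v \<and> lsat d k \<theta> (vec_index v)}"
      using v lsat x(2) v_def by blast
  qed
qed

text \<open>By \<open>represents_monomial\<close> every tuple representing f agrees with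
  \<open>pvec\<close> as a point wherever it is nonzero, so the preimage of a linear subspace is the
  closure of the set given by \<open>sat\<close> where some monomial is nonzero. Its points on a
  generic complementary subspace are the torus solutions counted before.\<close>

theorem deg_k_monomial:
  assumes A1: "\<And>v. v \<in> hcoords d \<Longrightarrow> (\<And>j. j \<le> d \<Longrightarrow> vec_index v j \<noteq> 0) \<Longrightarrow> f (line v) = Some (line (pvec d e v))"
    and A2: "represents d f (pvec d e)"
    and e: "\<And>i. i \<le> d \<Longrightarrow> (\<Sum>j\<le>d. e i j) = q" and emin: "\<And>j. j \<le> d \<Longrightarrow> \<exists>i\<le>d. e i j = 0" and k: "k \<le> d"
  shows "deg_k d k f \<le> (\<Sum>p\<in>index_pairs d k. nat \<bar>mixed_det d k e p\<bar>)"
    and "(I, J) \<in> index_pairs d k \<Longrightarrow> 0 \<notin> I \<Longrightarrow> 0 \<notin> J \<Longrightarrow>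
      nat \<bar>det (submat ({..d} - I - {0}) J (exp_diff_mat e 0))\<bar> \<le> deg_k d k f"
proof -
  have "\<exists>N. generic (\<lambda>\<theta>. finite (torus_sols d k e \<theta> 0) \<and> card (torus_sols d k e \<theta> 0) = N) \<and>
    N \<le> (\<Sum>p\<in>index_pairs d k. nat \<bar>mixed_det d k e p\<bar>) \<and>
    (\<forall>I J. (I, J) \<in> index_pairs d k \<longrightarrow> 0 \<notin> I \<longrightarrow> 0 \<notin> J \<longrightarrow>
      nat \<bar>det (submat ({..d} - I - {0}) J (exp_diff_mat e 0))\<bar> \<le> N)"
    by (rule generic_card[OF k]) (rule e)
  then obtain N where N: "generic (\<lambda>\<theta>. finite (torus_sols d k e \<theta> 0) \<and> card (torus_sols d k e \<theta> 0) = N)"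
    and bounds: "N \<le> (\<Sum>p\<in>index_pairs d k. nat \<bar>mixed_det d k e p\<bar>)"
    "\<forall>I J. (I, J) \<in> index_pairs d k \<longrightarrow> 0 \<notin> I \<longrightarrow> 0 \<notin> J \<longrightarrow>
      nat \<bar>det (submat ({..d} - I - {0}) J (exp_diff_mat e 0))\<bar> \<le> N"
    by (elim exE conjE) (rule that)
  define P where "P = (\<lambda>\<theta>. (finite (torus_sols d k e \<theta> 0) \<and> card (torus_sols d k e \<theta> 0) = N) \<and>
    (\<forall>s\<le>d. \<forall>i\<le>d. vanishing_form d k s i \<theta> {x. sat d k e \<theta> x \<and> (\<exists>i\<le>d. mon d e i x \<noteq> 0)}))"
  have "generic (\<lambda>\<theta>. \<forall>s\<le>d. \<forall>i\<le>d. vanishing_form d k s i \<theta> {x. sat d k e \<theta> x \<and> (\<exists>i\<le>d. mon d e i x \<noteq> 0)})"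
    by (rule generic_vanishing_forms[OF k]) (rule e)
  then have gP: "generic P" unfolding P_def by (rule generic_conj[OF N])
  define Pre where "Pre = rational_preimage d f"
  have "generic_subspace d k (\<lambda>L. generic_subspace d (d - k) (\<lambda>L'. finite (Pre L \<inter> L') \<and> card (Pre L \<inter> L') = N))"
  proof (rule generic_subspace_pair[OF gP k, of "\<lambda>L L'. finite (Pre L \<inter> L') \<and> card (Pre L \<inter> L') = N"])
    fix \<theta> \<theta>' :: "nat \<times> nat \<Rightarrow> complex" assume p: "P \<theta>" and c: "\<And>a j. a < d \<Longrightarrow> j \<le> d \<Longrightarrow> \<theta> (a, j) = \<theta>' (a, j)"
    have sl: "sat d k e \<theta> = sat d k e \<theta>'" "lsat d k \<theta> = lsat d k \<theta>'" 
      using sat_cong_params[of d \<theta> \<theta>' k, OF _ k] c by (simp, simp)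
    show "P \<theta>'" using p unfolding P_def torus_sols_def vanishing_form_def sl .
  next
    fix M M' assume M: "M \<in> carrier_mat k (Suc d)" and M': "M' \<in> carrier_mat (d - k) (Suc d)" and p: "P (stack_params d k M M')"
    define \<theta> where "\<theta> = stack_params d k M M'"
    have sat: "sat d k e \<theta> x \<longleftrightarrow> (\<forall>a<k. (\<Sum>j\<le>d. M $$ (a, j) * mon d e j x) = 0)" for x
      by (simp add: sat_def \<theta>_def stack_params_def)
    have lsat: "lsat d k \<theta> x \<longleftrightarrow> (\<forall>a<d - k. (\<Sum>j\<le>d. M' $$ (a, j) * x j) = 0)" for x
    proof -
      have "(\<forall>a\<in>{k..<d}. Q (a - k)) \<longleftrightarrow> (\<forall>a<d - k. Q a)" for Q
      proof
        assume a: "\<forall>a\<in>{k..<d}. Q (a - k)"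
        show "\<forall>a<d - k. Q a"
        proof (intro allI impI)
          fix a assume "a < d - k" then show "Q a" using a[THEN bspec, of "a + k"] by simp
        qed
      qed auto
      from this[of "\<lambda>a. (\<Sum>j\<le>d. M' $$ (a, j) * x j) = 0"] show ?thesis by (simp add: lsat_def \<theta>_def stack_params_def)
    qed
    have pv: "pvec d e v \<in> hcoords d \<longleftrightarrow> pvec d e v \<noteq> 0\<^sub>v (Suc d)" for v by (simp add: hcoords_def pvec_def)
    have pv0: "pvec d e v \<noteq> 0\<^sub>v (Suc d) \<longleftrightarrow> (\<exists>i\<le>d. mon d e i (vec_index v) \<noteq> 0)" for v
    proof -
      have "pvec d e v = 0\<^sub>v (Suc d) \<longleftrightarrow> (\<forall>i<Suc d. vec_index (pvec d e v) i = 0)"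
        unfolding vec_eq_iff by (auto simp: pvec_def)
      then show ?thesis by (auto simp: pvec_def less_Suc_eq_le)
    qed
    have lin: "line (pvec d e v) \<in> linear_subspace d k M \<longleftrightarrow> sat d k e \<theta> (vec_index v)" if "pvec d e v \<noteq> 0\<^sub>v (Suc d)" for v
      using line_in_linear_subspace[OF _ M, of "pvec d e v"] that unfolding pv[symmetric] sat by (simp add: pvec_def)
    have "(\<exists>F. represents d f F \<and> F v \<noteq> 0\<^sub>v (Suc d) \<and> line (F v) \<in> linear_subspace d k M)
        \<longleftrightarrow> sat d k e \<theta> (vec_index v) \<and> (\<exists>i\<le>d. mon d e i (vec_index v) \<noteq> 0)" if v: "v \<in> hcoords d" for v
    proof
      assume "\<exists>F. represents d f F \<and> F v \<noteq> 0\<^sub>v (Suc d) \<and> line (F v) \<in> linear_subspace d k M"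
      then obtain F where F: "represents d f F" "F v \<noteq> 0\<^sub>v (Suc d)" "line (F v) \<in> linear_subspace d k M" by (elim exE conjE) (rule that)
      have "pvec d e v \<noteq> 0\<^sub>v (Suc d) \<and> line (F v) = line (pvec d e v)"
        by (rule represents_monomial[OF _ _ _ F(1) v F(2)]) (rule A1 e emin; assumption)+
      then show "sat d k e \<theta> (vec_index v) \<and> (\<exists>i\<le>d. mon d e i (vec_index v) \<noteq> 0)" using F(3) lin[of v] pv0[of v] by simp
    next
      assume "sat d k e \<theta> (vec_index v) \<and> (\<exists>i\<le>d. mon d e i (vec_index v) \<noteq> 0)"
      then show "\<exists>F. represents d f F \<and> F v \<noteq> 0\<^sub>v (Suc d) \<and> line (F v) \<in> linear_subspace d k M"
        using A2 lin[of v] pv0[of v] by (intro exI[of _ "pvec d e"]) simp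
    qed
    then have Pre: "Pre (linear_subspace d k M) = zariski_closure d {line v | v. v \<in> hcoords d \<and> sat d k e \<theta> (vec_index v) \<and> (\<exists>i\<le>d. mon d e i (vec_index v) \<noteq> 0)}"
      unfolding Pre_def rational_preimage_def by (simp only: cong: conj_cong)
    have "p \<in> linear_subspace d (d - k) M' \<longleftrightarrow> (\<exists>v\<in>hcoords d. p = line v \<and> lsat d k \<theta> (vec_index v))" for p
    proof
      assume a: "p \<in> linear_subspace d (d - k) M'"
      then obtain v where "v \<in> hcoords d" "p = line v" by (auto simp: linear_subspace_def proj_space_def)
      then show "\<exists>v\<in>hcoords d. p = line v \<and> lsat d k \<theta> (vec_index v)"
        using a line_in_linear_subspace[OF _ M', of v] lsat by auto
    next
      assume "\<exists>v\<in>hcoords d. p = line v \<and> lsat d k \<theta> (vec_index v)"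
      then show "p \<in> linear_subspace d (d - k) M'" using line_in_linear_subspace[OF _ M'] lsat by auto
    qed
    then have int: "Pre (linear_subspace d k M) \<inter> linear_subspace d (d - k) M' = {p \<in> Pre (linear_subspace d k M). \<exists>v\<in>hcoords d. p = line v \<and> lsat d k \<theta> (vec_index v)}"
      by blast
    have p': "finite (torus_sols d k e \<theta> 0)" "card (torus_sols d k e \<theta> 0) = N"
      "\<forall>s\<le>d. \<forall>i\<le>d. vanishing_form d k s i \<theta> {x. sat d k e \<theta> x \<and> (\<exists>i\<le>d. mon d e i x \<noteq> 0)}"
      using p unfolding P_def \<theta>_def by blast+
    have eq: "Pre (linear_subspace d k M) \<inter> linear_subspace d (d - k) M' = (\<lambda>x. line (vec (Suc d) x)) ` torus_sols d k e \<theta> 0"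
      unfolding int unfolding Pre by (rule closure_inter_eq[OF p'(3)]) (rule e)
    have "inj_on (\<lambda>x. line (vec (Suc d) x)) (torus_sols d k e \<theta> 0)"
    proof (rule inj_onI)
      fix x y assume x: "x \<in> torus_sols d k e \<theta> 0" and y: "y \<in> torus_sols d k e \<theta> 0" and l: "line (vec (Suc d) x) = line (vec (Suc d) y)"
      obtain c where c: "vec (Suc d) x = c \<cdot>\<^sub>v vec (Suc d) y" using line_eqD[OF l] by blast
      have "x j = c * y j" if "j \<le> d" for j using arg_cong[OF c, of "\<lambda>v. vec_index v j"] that by simp
      moreover have "x 0 = 1" "y 0 = 1" "\<forall>j>d. x j = 0" "\<forall>j>d. y j = 0" using x y by (auto simp: torus_sols_def)
      ultimately show "x = y" by (metis ext leI mult.right_neutral mult_1 zero_le)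
    qed
    then show "finite (Pre (linear_subspace d k M) \<inter> linear_subspace d (d - k) M') \<and> card (Pre (linear_subspace d k M) \<inter> linear_subspace d (d - k) M') = N"
      unfolding eq using p' by (simp add: card_image)
  qed
  then have g: "generic_subspace d k (\<lambda>L. has_degree d (d - k) (rational_preimage d f L) N)"
    unfolding has_degree_def Pre_def .
  have "deg_k d k f = N" unfolding deg_k_def
  proof (rule the_equality)
    show "generic_subspace d k (\<lambda>L. has_degree d (d - k) (rational_preimage d f L) N)" by (rule g)
  next
    fix N' assume "generic_subspace d k (\<lambda>L. has_degree d (d - k) (rational_preimage d f L) N')"
    from generic_subspace_common[OF this g] obtain L where "has_degree d (d - k) (rational_preimage d f L) N'" "has_degree d (d - k) (rational_preimage d f L) N" by blast
    from generic_subspace_common[OF this[unfolded has_degree_def]] show "N' = N" by blast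
  qed
  then show "deg_k d k f \<le> (\<Sum>p\<in>index_pairs d k. nat \<bar>mixed_det d k e p\<bar>)"
    "(I, J) \<in> index_pairs d k \<Longrightarrow> 0 \<notin> I \<Longrightarrow> 0 \<notin> J \<Longrightarrow>
      nat \<bar>det (submat ({..d} - I - {0}) J (exp_diff_mat e 0))\<bar> \<le> deg_k d k f"
    using bounds by blast+
qed

section \<open>Minors of integer matrices\<close>

lemma det_mat_transpose:
  fixes N :: "nat \<Rightarrow> nat \<Rightarrow> 'a::comm_ring_1"
  shows "det (mat k k (\<lambda>(a, b). N b a)) = det (mat k k (\<lambda>(a, b). N a b))"
proof -
  have "mat k k (\<lambda>(a, b). N b a) = transpose_mat (mat k k (\<lambda>(a, b). N a b))" by (rule eq_matI) auto
  then show ?thesis using det_transpose[of "mat k k (\<lambda>(a, b). N a b)" k] by simp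
qed

text \<open>Multilinearity in the rows, the first half of Cauchy-Binet. The sum over all maps \<rho>
  has d ^ k terms, the origin of this factor in the bounds.\<close>

lemma det_sum_rows:
  fixes N P :: "nat \<Rightarrow> nat \<Rightarrow> 'a::comm_ring_1"
  shows "det (mat k k (\<lambda>(a, b). \<Sum>x<d. P a x * N x b)) =
    (\<Sum>\<rho>\<in>{0..<k} \<rightarrow>\<^sub>E {..<d}. (\<Prod>a=0..<k. P a (\<rho> a)) * det (mat k k (\<lambda>(a, b). N (\<rho> a) b)))"
proof -
  have "det (mat k k (\<lambda>(a, b). \<Sum>x<d. P a x * N x b)) =
    (\<Sum>p | p permutes {0..<k}. signof p * (\<Prod>a=0..<k. \<Sum>x<d. P a x * N x (p a)))"
    by (subst det_def'[of _ k]) (auto intro!: sum.cong prod.cong arg_cong2[where f = "(*)"] simp: permutes_in_image)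
  also have "\<dots> = (\<Sum>p | p permutes {0..<k}. \<Sum>\<rho>\<in>{0..<k} \<rightarrow>\<^sub>E {..<d}. signof p * (\<Prod>a=0..<k. P a (\<rho> a) * N (\<rho> a) (p a)))"
    by (subst prod_sum_PiE) (simp_all add: sum_distrib_left)
  also have "\<dots> = (\<Sum>\<rho>\<in>{0..<k} \<rightarrow>\<^sub>E {..<d}. \<Sum>p | p permutes {0..<k}. signof p * (\<Prod>a=0..<k. P a (\<rho> a) * N (\<rho> a) (p a)))"
    by (rule sum.swap)
  also have "\<dots> = (\<Sum>\<rho>\<in>{0..<k} \<rightarrow>\<^sub>E {..<d}. (\<Prod>a=0..<k. P a (\<rho> a)) * det (mat k k (\<lambda>(a, b). N (\<rho> a) b)))"
  proof (rule sum.cong[OF refl])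
    fix \<rho> assume "\<rho> \<in> {0..<k} \<rightarrow>\<^sub>E {..<d}"
    have "det (mat k k (\<lambda>(a, b). N (\<rho> a) b)) = (\<Sum>p | p permutes {0..<k}. signof p * (\<Prod>a=0..<k. N (\<rho> a) (p a)))"
      by (subst det_def'[of _ k]) (auto intro!: sum.cong prod.cong arg_cong2[where f = "(*)"] simp: permutes_in_image)
    then show "(\<Sum>p | p permutes {0..<k}. signof p * (\<Prod>a=0..<k. P a (\<rho> a) * N (\<rho> a) (p a))) =
      (\<Prod>a=0..<k. P a (\<rho> a)) * det (mat k k (\<lambda>(a, b). N (\<rho> a) b))"
      by (simp add: prod.distrib sum_distrib_left mult_ac)
  qed
  finally show ?thesis .
qed

lemma det_sum_rows_bound:
  fixes N P :: "nat \<Rightarrow> nat \<Rightarrow> int"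
  assumes P: "\<And>a x. \<bar>P a x\<bar> \<le> 1"
    and N: "\<And>\<rho>. (\<And>a. a < k \<Longrightarrow> \<rho> a < d) \<Longrightarrow> \<bar>det (mat k k (\<lambda>(a, b). N (\<rho> a) b))\<bar> \<le> M"
  shows "\<bar>det (mat k k (\<lambda>(a, b). \<Sum>x<d. P a x * N x b))\<bar> \<le> int (d ^ k) * M"
proof -
  have "\<bar>det (mat k k (\<lambda>(a, b). \<Sum>x<d. P a x * N x b))\<bar> \<le>
    (\<Sum>\<rho>\<in>{0..<k} \<rightarrow>\<^sub>E {..<d}. \<bar>(\<Prod>a=0..<k. P a (\<rho> a)) * det (mat k k (\<lambda>(a, b). N (\<rho> a) b))\<bar>)"
    unfolding det_sum_rows by (rule sum_abs)
  also have "\<dots> \<le> (\<Sum>\<rho>\<in>{0..<k} \<rightarrow>\<^sub>E {..<d}. M)"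
  proof (rule sum_mono)
    fix \<rho> assume "\<rho> \<in> {0..<k} \<rightarrow>\<^sub>E {..<d}"
    then have "\<bar>det (mat k k (\<lambda>(a, b). N (\<rho> a) b))\<bar> \<le> M" by (intro N) auto
    moreover have "\<bar>\<Prod>a=0..<k. P a (\<rho> a)\<bar> \<le> 1"
      unfolding abs_prod by (rule prod_le_1) (use P in auto)
    ultimately have "\<bar>\<Prod>a=0..<k. P a (\<rho> a)\<bar> * \<bar>det (mat k k (\<lambda>(a, b). N (\<rho> a) b))\<bar> \<le> 1 * M"
      by (intro mult_mono) auto
    then show "\<bar>(\<Prod>a=0..<k. P a (\<rho> a)) * det (mat k k (\<lambda>(a, b). N (\<rho> a) b))\<bar> \<le> M" by (simp add: abs_mult)
  qed
  also have "\<dots> = int (d ^ k) * M" by (simp add: card_PiE)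
  finally show ?thesis .
qed

text \<open>The maps r and c need not be increasing: repeated indices give 0 and other orders only a
  sign, so the maximum over increasing enumerations also bounds these minors.\<close>

definition minor :: "nat \<Rightarrow> int mat \<Rightarrow> (nat \<Rightarrow> nat) \<Rightarrow> (nat \<Rightarrow> nat) \<Rightarrow> int" where
  "minor k B r c = det (mat k k (\<lambda>(a, b). B $$ (r a, c b)))"

definition max_minor :: "nat \<Rightarrow> nat \<Rightarrow> int mat \<Rightarrow> int" where
  "max_minor d k B = Max ((\<lambda>(S, T). \<bar>minor k B (enum S) (enum T)\<bar>) `
     ({S. S \<subseteq> {..<d} \<and> card S = k} \<times> {T. T \<subseteq> {..<d} \<and> card T = k}))"

lemma minor_transpose: "minor k B r c = det (mat k k (\<lambda>(a, b). B $$ (r b, c a)))"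
  unfolding minor_def by (rule det_mat_transpose[symmetric])

text \<open>A repeated row gives determinant 0; an injective r is a permutation of the increasing
  enumeration of its image.\<close>

lemma minor_rows_enum:
  assumes r: "\<And>a. a < k \<Longrightarrow> r a < d"
  obtains "minor k B r c = 0" | S where "S \<subseteq> {..<d}" "card S = k" "\<bar>minor k B r c\<bar> = \<bar>minor k B (enum S) c\<bar>"
proof (cases "inj_on r {..<k}")
  case False
  then obtain a a' where a: "a < k" "a' < k" "a \<noteq> a'" "r a = r a'" by (auto simp: inj_on_def)
  have "minor k B r c = 0" unfolding minor_def
    by (rule det_identical_rows[of _ k a a']) (use a in \<open>auto intro!: eq_vecI\<close>)
  then show ?thesis by (rule that(1))
next
  case True
  define S where "S = r ` {..<k}"
  have S: "S \<subseteq> {..<d}" "card S = k" "finite S" using r True by (auto simp: S_def card_image)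
  have bS: "bij_betw (enum S) {..<k} S" using bij_betw_enum[OF S(3)] S(2) by simp
  have br: "bij_betw r {..<k} S" using True by (simp add: S_def bij_betw_def)
  define p where "p = (\<lambda>a. if a < k then the_inv_into {..<k} (enum S) (r a) else a)"
  have "bij_betw (the_inv_into {..<k} (enum S) \<circ> r) {..<k} {..<k}"
    by (rule bij_betw_trans[OF br bij_betw_the_inv_into[OF bS]])
  then have "bij_betw p {..<k} {..<k}" by (rule bij_betw_cong[THEN iffD1, rotated]) (simp add: p_def)
  then have pp: "p permutes {0..<k}" by (intro bij_imp_permutes) (simp_all add: p_def atLeast0LessThan)
  have pe: "enum S (p a) = r a" if "a < k" for a
    using that f_the_inv_into_f_bij_betw[OF bS] br by (auto simp: p_def bij_betw_def)
  have pk: "p a < k" if "a < k" for a using permutes_in_image[OF pp, of a] that by simp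
  let ?M = "mat k k (\<lambda>(a, b). B $$ (enum S a, c b))"
  have "mat k k (\<lambda>(a, b). B $$ (r a, c b)) = mat k k (\<lambda>(a, b). ?M $$ (p a, b))"
    by (rule eq_matI) (auto simp: pe pk)
  then have "minor k B r c = signof p * minor k B (enum S) c"
    unfolding minor_def using det_permute_rows[of ?M k p] pp by simp
  then have "\<bar>minor k B r c\<bar> = \<bar>minor k B (enum S) c\<bar>" by (simp add: abs_mult sign_def)
  then show ?thesis by (rule that(2)[OF S(1,2)])
qed

lemma minor_mat_transpose:
  assumes "B \<in> carrier_mat d d" "\<And>a. a < k \<Longrightarrow> r a < d" "\<And>a. a < k \<Longrightarrow> c a < d"
  shows "minor k (transpose_mat B) c r = minor k B r c"
proof -
  have "mat k k (\<lambda>(a, b). transpose_mat B $$ (c a, r b)) = mat k k (\<lambda>(a, b). B $$ (r b, c a))"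
    using assms by (intro eq_matI) auto
  then show ?thesis unfolding minor_transpose[of k B] by (simp add: minor_def)
qed

lemma finite_minor_sets: "finite {S :: nat set. S \<subseteq> {..<d} \<and> card S = k}"
  by (rule finite_subset[of _ "Pow {..<d}"]) auto

lemma minor_enum_le_max: 
  assumes "S \<subseteq> {..<d}" "card S = k" "T \<subseteq> {..<d}" "card T = k"
  shows "\<bar>minor k B (enum S) (enum T)\<bar> \<le> max_minor d k B"
  unfolding max_minor_def by (rule Max_ge) (use assms finite_minor_sets in \<open>auto intro!: image_eqI[of _ _ "(S, T)"]\<close>)

lemma max_minor_attained:
  assumes "k \<le> d"
  obtains S T where "S \<subseteq> {..<d}" "card S = k" "T \<subseteq> {..<d}" "card T = k" "max_minor d k B = \<bar>minor k B (enum S) (enum T)\<bar>"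
proof -
  let ?X = "{S. S \<subseteq> {..<d} \<and> card S = k} \<times> {T. T \<subseteq> {..<d} \<and> card T = k}"
  have "({..<k}, {..<k}) \<in> ?X" using assms by auto
  then have "max_minor d k B \<in> (\<lambda>(S, T). \<bar>minor k B (enum S) (enum T)\<bar>) ` ?X"
    unfolding max_minor_def by (intro Max_in) (use finite_minor_sets in blast)+
  then show ?thesis using that by auto
qed

lemma enum_less: "S \<subseteq> {..<d} \<Longrightarrow> a < card S \<Longrightarrow> enum S a < d"
  using enum_mem[of S a] finite_subset[of S "{..<d}"] by auto

lemma minor_le_max:
  assumes B: "B \<in> carrier_mat d d" and k: "k \<le> d"
    and r: "\<And>a. a < k \<Longrightarrow> r a < d" and c: "\<And>a. a < k \<Longrightarrow> c a < d"
  shows "\<bar>minor k B r c\<bar> \<le> max_minor d k B"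
proof -
  have nn: "0 \<le> max_minor d k B" by (rule max_minor_attained[OF k, of B]) simp
  show ?thesis
  proof (rule minor_rows_enum[of k r d B c, OF r])
    fix S assume S: "S \<subseteq> {..<d}" "card S = k" and eq: "\<bar>minor k B r c\<bar> = \<bar>minor k B (enum S) c\<bar>"
    have t1: "minor k (transpose_mat B) c (enum S) = minor k B (enum S) c"
      using S c by (intro minor_mat_transpose[OF B]) (auto intro: enum_less)
    show ?thesis
    proof (rule minor_rows_enum[of k c d "transpose_mat B" "enum S", OF c])
      fix T assume T: "T \<subseteq> {..<d}" "card T = k"
        and eq2: "\<bar>minor k (transpose_mat B) c (enum S)\<bar> = \<bar>minor k (transpose_mat B) (enum T) (enum S)\<bar>"
      have "minor k (transpose_mat B) (enum T) (enum S) = minor k B (enum S) (enum T)"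
        using S T by (intro minor_mat_transpose[OF B]) (auto intro: enum_less)
      then show ?thesis using eq eq2 t1 minor_enum_le_max[OF S T, of B] by simp
    qed (use eq t1 nn in auto)
  qed (use nn in auto)
qed

lemma minor_Suc_zero:
  assumes k: "\<And>r c. (\<And>a. a < k \<Longrightarrow> r a < d) \<Longrightarrow> (\<And>a. a < k \<Longrightarrow> c a < d) \<Longrightarrow> minor k B r c = 0"
    and r: "\<And>a. a < Suc k \<Longrightarrow> r a < d" and c: "\<And>a. a < Suc k \<Longrightarrow> c a < d"
  shows "minor (Suc k) B r c = 0"
proof -
  let ?M = "mat (Suc k) (Suc k) (\<lambda>(a, b). B $$ (r a, c b))"
  have "cofactor ?M 0 j = 0" if "j < Suc k" for j
  proof -
    have "mat_delete ?M 0 j = mat k k (\<lambda>(a, b). B $$ (r (Suc a), c (if b < j then b else Suc b)))"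
      by (rule eq_matI) (auto simp: mat_delete_def)
    then have "det (mat_delete ?M 0 j) = minor k B (\<lambda>a. r (Suc a)) (\<lambda>b. c (if b < j then b else Suc b))"
      by (simp add: minor_def)
    also have "\<dots> = 0" by (rule k) (use r c in auto)
    finally show ?thesis by (simp add: cofactor_def)
  qed
  then show ?thesis unfolding minor_def using laplace_expansion_row[of ?M "Suc k" 0] by simp
qed

text \<open>If all k-minors vanished, Laplace expansion would propagate this to all larger minors
  and finally to the determinant. Integrality then turns nonzero into at least 1.\<close>

lemma max_minor_ge_1:
  assumes B: "B \<in> carrier_mat d d" and det: "det B \<noteq> 0" and k: "k \<le> d"
  shows "max_minor d k B \<ge> 1"
proof (rule ccontr)
  assume neg: "\<not> ?thesis"
  have z: "minor k B r c = 0" if "\<And>a. a < k \<Longrightarrow> r a < d" "\<And>a. a < k \<Longrightarrow> c a < d" for r c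
    using minor_le_max[OF B k, of r c] that neg by simp
  have "\<forall>r c. (\<forall>a<k + l. r a < d) \<longrightarrow> (\<forall>a<k + l. c a < d) \<longrightarrow> minor (k + l) B r c = 0" for l
  proof (induction l)
    case 0 show ?case using z by simp
  next
    case (Suc l)
    show ?case
    proof (intro allI impI)
      fix r c :: "nat \<Rightarrow> nat" assume "\<forall>a<k + Suc l. r a < d" "\<forall>a<k + Suc l. c a < d"
      then have "minor (Suc (k + l)) B r c = 0" by (intro minor_Suc_zero[of "k + l" d]) (use Suc in auto)
      then show "minor (k + Suc l) B r c = 0" by simp
    qed
  qed
  from this[of "d - k"] have "minor d B id id = 0" using k by simp
  moreover have "mat d d (\<lambda>(a, b). B $$ (id a, id b)) = B" using B by (intro eq_matI) auto
  ultimately show False using det by (simp add: minor_def)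
qed

section \<open>Entries of the exterior power as minors\<close>

lemma sorted_list_of_set_Suc_image: "finite T \<Longrightarrow> sorted_list_of_set (Suc ` T) = map Suc (sorted_list_of_set T)"
  using sorted_list_of_set.idem_if_sorted_distinct[of "map Suc (sorted_list_of_set T)"]
  by (simp add: sorted_wrt_map distinct_map)

lemma enum_Suc_image: "finite T \<Longrightarrow> a < card T \<Longrightarrow> enum (Suc ` T) a = Suc (enum T a)"
  by (simp add: enum_def sorted_list_of_set_Suc_image)

lemma subseqs_sorted: "xs \<in> set (subseqs ys) \<Longrightarrow> sorted ys \<Longrightarrow> set xs \<subseteq> set ys \<and> sorted xs"
proof (induction ys arbitrary: xs)
  case (Cons y ys)
  then show ?case by (fastforce simp: Let_def)
qed simp

text \<open>Sublists of an increasing list are increasing, hence determined by their sets.\<close>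

lemma increasing_seqs_iff:
  "xs \<in> set (increasing_seqs d k) \<longleftrightarrow> (\<exists>S. S \<subseteq> {..<d} \<and> card S = k \<and> xs = sorted_list_of_set S)"
proof
  assume xs: "xs \<in> set (increasing_seqs d k)"
  then have sub: "xs \<in> set (subseqs [0..<d])" and l: "length xs = k" by (auto simp: increasing_seqs_def)
  have "sorted xs" "distinct xs" "set xs \<subseteq> {..<d}"
    using subseqs_sorted[OF sub] subseqs_distinctD[OF sub] by auto
  then show "\<exists>S. S \<subseteq> {..<d} \<and> card S = k \<and> xs = sorted_list_of_set S"
    using l by (intro exI[of _ "set xs"]) (simp add: distinct_card sorted_list_of_set.idem_if_sorted_distinct)
next
  assume "\<exists>S. S \<subseteq> {..<d} \<and> card S = k \<and> xs = sorted_list_of_set S"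
  then obtain S where S: "S \<subseteq> {..<d}" "card S = k" "xs = sorted_list_of_set S" by blast
  have "S \<in> set ` set (subseqs [0..<d])" using S(1) by (simp add: subseqs_powset atLeast0LessThan)
  then obtain ys where ys: "ys \<in> set (subseqs [0..<d])" "set ys = S" by auto
  have "sorted ys" "distinct ys"
    using subseqs_sorted[OF ys(1)] subseqs_distinctD[OF ys(1)] by auto
  then have "sorted_list_of_set (set ys) = ys" by (rule sorted_list_of_set.idem_if_sorted_distinct)
  then have "ys = xs" using S(3) ys(2) by simp
  then show "xs \<in> set (increasing_seqs d k)" using ys(1) S by (simp add: increasing_seqs_def)
qed

lemma exterior_power_entry:
  assumes B: "B \<in> carrier_mat d d" and r: "r < d choose k" and c: "c < d choose k"
    and S: "increasing_seqs d k ! r = sorted_list_of_set S" "card S = k" "S \<subseteq> {..<d}"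
    and T: "increasing_seqs d k ! c = sorted_list_of_set T" "card T = k" "T \<subseteq> {..<d}"
  shows "exterior_power d k (map_mat real_of_int B) $$ (r, c) = real_of_int (minor k B (enum S) (enum T))"
proof -
  have lS: "length (sorted_list_of_set S) = k" "length (sorted_list_of_set T) = k" using S T by simp_all
  have "exterior_power d k (map_mat real_of_int B) $$ (r, c) =
    det (mat k k (\<lambda>(a, b). (map_mat real_of_int B *\<^sub>v unit_vec d (sorted_list_of_set T ! b)) $ (sorted_list_of_set S ! a)))"
    unfolding exterior_power_def wedge_def using r c S T lS
    by (auto simp: mat_of_cols_def length_increasing_seqs Let_def intro!: arg_cong[where f = det] eq_matI)
  also have "mat k k (\<lambda>(a, b). (map_mat real_of_int B *\<^sub>v unit_vec d (sorted_list_of_set T ! b)) $ (sorted_list_of_set S ! a)) =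
    map_mat real_of_int (mat k k (\<lambda>(a, b). B $$ (enum S a, enum T b)))"
  proof (rule eq_matI)
    fix a b assume "a < dim_row (map_mat real_of_int (mat k k (\<lambda>(a, b). B $$ (enum S a, enum T b))))"
      "b < dim_col (map_mat real_of_int (mat k k (\<lambda>(a, b). B $$ (enum S a, enum T b))))"
    then have ab: "a < k" "b < k" by auto
    have "enum S a < d" "enum T b < d" using ab S T by (auto intro: enum_less)
    then show "mat k k (\<lambda>(a, b). (map_mat real_of_int B *\<^sub>v unit_vec d (sorted_list_of_set T ! b)) $ (sorted_list_of_set S ! a)) $$ (a, b) =
      map_mat real_of_int (mat k k (\<lambda>(a, b). B $$ (enum S a, enum T b))) $$ (a, b)"
      using ab B by (simp add: enum_def[symmetric])
  qed auto
  also have "det \<dots> = real_of_int (minor k B (enum S) (enum T))" by (simp add: minor_def)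
  finally show ?thesis .
qed

lemma exterior_power_entry_le:
  assumes B: "B \<in> carrier_mat d d" and r: "r < d choose k" and c: "c < d choose k"
  shows "\<bar>exterior_power d k (map_mat real_of_int B) $$ (r, c)\<bar> \<le> real_of_int (max_minor d k B)"
proof -
  have "increasing_seqs d k ! r \<in> set (increasing_seqs d k)" "increasing_seqs d k ! c \<in> set (increasing_seqs d k)"
    using r c by (auto simp: length_increasing_seqs)
  then obtain S T where ST: "increasing_seqs d k ! r = sorted_list_of_set S" "card S = k" "S \<subseteq> {..<d}"
    "increasing_seqs d k ! c = sorted_list_of_set T" "card T = k" "T \<subseteq> {..<d}"
    unfolding increasing_seqs_iff by blast
  show ?thesis unfolding exterior_power_entry[OF B r c ST]
    using minor_enum_le_max[OF ST(3,2,6,5), of B] by linarith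
qed

lemma exterior_power_entry_attained:
  assumes B: "B \<in> carrier_mat d d" and k: "k \<le> d"
  obtains r c where "r < d choose k" "c < d choose k"
    "\<bar>exterior_power d k (map_mat real_of_int B) $$ (r, c)\<bar> = real_of_int (max_minor d k B)"
proof (rule max_minor_attained[OF k, of B])
  fix S T assume ST: "S \<subseteq> {..<d}" "card S = k" "T \<subseteq> {..<d}" "card T = k"
    "max_minor d k B = \<bar>minor k B (enum S) (enum T)\<bar>"
  have "sorted_list_of_set S \<in> set (increasing_seqs d k)" "sorted_list_of_set T \<in> set (increasing_seqs d k)"
    unfolding increasing_seqs_iff using ST by blast+
  then obtain r c where rc: "r < d choose k" "increasing_seqs d k ! r = sorted_list_of_set S"
    "c < d choose k" "increasing_seqs d k ! c = sorted_list_of_set T"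
    by (auto simp: in_set_conv_nth length_increasing_seqs)
  show thesis using that[OF rc(1,3)] exterior_power_entry[OF B rc(1,3,2) ST(2,1) rc(4) ST(4,3)] ST(5) by simp
qed

section \<open>Equivalence of norms\<close>

text \<open>Expansion in matrix units, with C the sum of their norms plus 1 for positivity.\<close>

lemma matrix_norm_upper:
  assumes \<nu>: "matrix_space_norm m \<nu>"
  shows "\<exists>C>0. \<forall>B\<in>carrier_mat m m. \<nu> B \<le> C * (\<Sum>p\<in>{..<m} \<times> {..<m}. \<bar>B $$ p\<bar>)"
proof -
  define U :: "nat \<times> nat \<Rightarrow> real mat" where "U = (\<lambda>p. mat m m (\<lambda>q. if q = p then 1 else 0))"
  define C where "C = 1 + (\<Sum>p\<in>{..<m} \<times> {..<m}. \<nu> (U p))"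
  have Uc: "U p \<in> carrier_mat m m" for p by (simp add: U_def)
  have tri: "\<nu> (X + Y) \<le> \<nu> X + \<nu> Y" if "X \<in> carrier_mat m m" "Y \<in> carrier_mat m m" for X Y
    using \<nu> that by (simp add: matrix_space_norm_def)
  have nn: "\<nu> (U p) \<ge> 0" for p using \<nu> Uc by (auto simp: matrix_space_norm_def)
  have Up: "\<nu> (U p) \<le> C" if "p \<in> {..<m} \<times> {..<m}" for p
    unfolding C_def using that nn by (intro add_increasing member_le_sum) auto
  have C: "C > 0" unfolding C_def using nn by (intro add_pos_nonneg sum_nonneg) auto
  have "\<nu> B \<le> C * (\<Sum>p\<in>{..<m} \<times> {..<m}. \<bar>B $$ p\<bar>)" if B: "B \<in> carrier_mat m m" for B
  proof -
    have part: "\<nu> (mat m m (\<lambda>q. if q \<in> T then B $$ q else 0)) \<le> C * (\<Sum>p\<in>T. \<bar>B $$ p\<bar>)"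
      if "finite T" "T \<subseteq> {..<m} \<times> {..<m}" for T
      using that
    proof (induction T)
      case empty
      have "mat m m (\<lambda>q. if q \<in> {} then B $$ q else 0) = 0\<^sub>m m m" by (rule eq_matI) auto
      moreover have "\<nu> (0\<^sub>m m m) = 0" using \<nu> zero_carrier_mat[of m m] by (simp add: matrix_space_norm_def)
      ultimately show ?case by simp
    next
      case (insert p T)
      let ?B = "\<lambda>T. mat m m (\<lambda>q. if q \<in> T then B $$ q else 0)"
      have "?B (insert p T) = ?B T + (B $$ p) \<cdot>\<^sub>m U p"
        using insert.hyps by (intro eq_matI) (auto simp: U_def)
      then have "\<nu> (?B (insert p T)) \<le> \<nu> (?B T) + \<nu> ((B $$ p) \<cdot>\<^sub>m U p)"
        using tri[of "?B T" "(B $$ p) \<cdot>\<^sub>m U p"] Uc[of p] by simp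
      also have "\<nu> ((B $$ p) \<cdot>\<^sub>m U p) = \<bar>B $$ p\<bar> * \<nu> (U p)"
        using \<nu> Uc by (simp add: matrix_space_norm_def)
      also have "\<dots> \<le> \<bar>B $$ p\<bar> * C" using Up insert.prems by (intro mult_left_mono) auto
      finally show ?case using insert by (simp add: algebra_simps)
    qed
    have "mat m m (\<lambda>q. if q \<in> {..<m} \<times> {..<m} then B $$ q else 0) = B" using B by (intro eq_matI) auto
    then show ?thesis using part[of "{..<m} \<times> {..<m}"] by simp
  qed
  then show ?thesis using C by blast
qed

lemma bounded_family_convergent_subsequence:
  fixes f :: "nat \<Rightarrow> 'b \<Rightarrow> real"
  assumes "finite T" "\<And>n t. t \<in> T \<Longrightarrow> \<bar>f n t\<bar> \<le> 1"
  shows "\<exists>r l. strict_mono r \<and> (\<forall>t\<in>T. (\<lambda>n. f (r n) t) \<longlonglongrightarrow> l t)"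
  using assms
proof (induction T)
  case empty
  show ?case by (intro exI[of _ "\<lambda>n. n"]) (simp add: strict_mono_def)
next
  case (insert t T)
  have "\<exists>r l. strict_mono r \<and> (\<forall>t\<in>T. (\<lambda>n. f (r n) t) \<longlonglongrightarrow> l t)" by (rule insert.IH) (use insert.prems in auto)
  then obtain r l where r: "strict_mono r" "\<forall>t\<in>T. (\<lambda>n. f (r n) t) \<longlonglongrightarrow> l t" by (elim exE conjE) (rule that)
  have "bounded (range (\<lambda>n. f (r n) t))" using insert.prems by (auto simp: bounded_iff intro!: exI[of _ 1])
  then obtain x s where s: "strict_mono s" "((\<lambda>n. f (r n) t) \<circ> s) \<longlonglongrightarrow> x"
    using bounded_imp_convergent_subsequence[of "\<lambda>n. f (r n) t"] by (auto simp del: o_apply)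
  have "(\<lambda>n. f ((r \<circ> s) n) u) \<longlonglongrightarrow> (if u = t then x else l u)" if "u \<in> insert t T" for u
    using that s(2) LIMSEQ_subseq_LIMSEQ[OF r(2)[rule_format, of u] s(1)] by (auto simp: o_def)
  then show ?case using strict_mono_o[OF r(1) s(1)] by (intro exI[of _ "r \<circ> s"] exI[of _ "\<lambda>u. if u = t then x else l u"]) blast
qed

text \<open>Compactness of the unit sphere of the sum norm, on which \<open>\<nu>\<close> cannot come arbitrarily close to 0.\<close>

lemma matrix_norm_lower:
  assumes \<nu>: "matrix_space_norm m \<nu>"
  shows "\<exists>c>0. \<forall>B\<in>carrier_mat m m. c * (\<Sum>p\<in>{..<m} \<times> {..<m}. \<bar>B $$ p\<bar>) \<le> \<nu> B"
proof -
  define s where "s = (\<lambda>B :: real mat. \<Sum>p\<in>{..<m} \<times> {..<m}. \<bar>B $$ p\<bar>)"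
  have hom: "\<nu> (c \<cdot>\<^sub>m B) = \<bar>c\<bar> * \<nu> B" if "B \<in> carrier_mat m m" for c B
    using \<nu> that by (simp add: matrix_space_norm_def)
  have nn: "\<nu> B \<ge> 0" if "B \<in> carrier_mat m m" for B using \<nu> that by (simp add: matrix_space_norm_def)
  obtain C where C: "C > 0" "\<And>B. B \<in> carrier_mat m m \<Longrightarrow> \<nu> B \<le> C * s B"
    using matrix_norm_upper[OF \<nu>] unfolding s_def by metis
  have shom: "s (c \<cdot>\<^sub>m B) = \<bar>c\<bar> * s B" if "B \<in> carrier_mat m m" for c B
    unfolding s_def sum_distrib_left using that by (intro sum.cong) (auto simp: abs_mult)
  have "\<exists>c>0. \<forall>B\<in>carrier_mat m m. s B = 1 \<longrightarrow> c \<le> \<nu> B"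
  proof (rule ccontr)
    assume "\<not> ?thesis"
    then have "\<forall>n. \<exists>B. B \<in> carrier_mat m m \<and> s B = 1 \<and> \<nu> B < inverse (real (Suc n))"
      by (meson inverse_positive_iff_positive of_nat_0_less_iff zero_less_Suc not_le)
    then obtain D where D: "\<And>n. D n \<in> carrier_mat m m" "\<And>n. s (D n) = 1" "\<And>n. \<nu> (D n) < inverse (real (Suc n))"
      by metis
    have bd: "\<bar>D n $$ p\<bar> \<le> 1" if "p \<in> {..<m} \<times> {..<m}" for n p
      using member_le_sum[OF that, of "\<lambda>p. \<bar>D n $$ p\<bar>"] D(2)[of n] by (simp add: s_def)
    obtain r l where r: "strict_mono r" and l: "\<forall>p\<in>{..<m} \<times> {..<m}. (\<lambda>n. D (r n) $$ p) \<longlonglongrightarrow> l p"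
      using bounded_family_convergent_subsequence[of "{..<m} \<times> {..<m}" "\<lambda>n p. D n $$ p", OF _ bd] by auto
    define L where "L = mat m m l"
    have Lc: "L \<in> carrier_mat m m" by (simp add: L_def)
    have Lp: "L $$ p = l p" if "p \<in> {..<m} \<times> {..<m}" for p using that by (auto simp: L_def)
    have "(\<lambda>n. s (D (r n))) \<longlonglongrightarrow> s L"
      unfolding s_def using l Lp by (intro tendsto_sum tendsto_rabs) auto
    then have sL: "s L = 1" using D(2) LIMSEQ_unique[of "\<lambda>n. s (D (r n))" "s L" 1] by simp
    have "(\<lambda>n. s (L + (-1) \<cdot>\<^sub>m D (r n))) \<longlonglongrightarrow> (\<Sum>p\<in>{..<m} \<times> {..<m}. \<bar>l p + (-1) * l p\<bar>)"
    proof -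
      have "s (L + (-1) \<cdot>\<^sub>m D (r n)) = (\<Sum>p\<in>{..<m} \<times> {..<m}. \<bar>l p + (-1) * D (r n) $$ p\<bar>)" for n
        unfolding s_def using D(1)[of "r n"] Lp by (intro sum.cong) (auto simp: L_def)
      moreover have "(\<lambda>n. \<Sum>p\<in>{..<m} \<times> {..<m}. \<bar>l p + (-1) * D (r n) $$ p\<bar>) \<longlonglongrightarrow> (\<Sum>p\<in>{..<m} \<times> {..<m}. \<bar>l p + (-1) * l p\<bar>)"
        using l by (intro tendsto_sum tendsto_rabs tendsto_add tendsto_mult tendsto_const) auto
      ultimately show ?thesis by simp
    qed
    then have sd: "(\<lambda>n. s (L + (-1) \<cdot>\<^sub>m D (r n))) \<longlonglongrightarrow> 0" by simp
    \<comment> \<open>The upper bound makes \<nu> continuous for the sum norm, so the limit L has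
      norm 0 although the absolute values of its entries sum to 1.\<close>
    have "\<nu> L \<le> inverse (real (Suc n)) + C * s (L + (-1) \<cdot>\<^sub>m D (r n))" for n
    proof -
      have Dc: "D (r n) \<in> carrier_mat m m" by (rule D(1))
      have "L = D (r n) + (L + (-1) \<cdot>\<^sub>m D (r n))" using Lc Dc by (intro eq_matI) auto
      moreover have "\<nu> (D (r n) + (L + (-1) \<cdot>\<^sub>m D (r n))) \<le> \<nu> (D (r n)) + \<nu> (L + (-1) \<cdot>\<^sub>m D (r n))"
        using \<nu> Dc Lc by (simp add: matrix_space_norm_def)
      moreover have "\<nu> (L + (-1) \<cdot>\<^sub>m D (r n)) \<le> C * s (L + (-1) \<cdot>\<^sub>m D (r n))" by (rule C(2)) (use Lc Dc in simp)
      moreover have "\<nu> (D (r n)) \<le> inverse (real (Suc n))"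
      proof -
        have "inverse (real (Suc (r n))) \<le> inverse (real (Suc n))"
          using seq_suble[OF r, of n] by (intro le_imp_inverse_le) auto
        then show ?thesis using D(3)[of "r n"] by linarith
      qed
      ultimately show ?thesis by simp
    qed
    moreover have "(\<lambda>n. inverse (real (Suc n)) + C * s (L + (-1) \<cdot>\<^sub>m D (r n))) \<longlonglongrightarrow> 0 + C * 0"
      by (intro tendsto_add tendsto_mult tendsto_const sd LIMSEQ_inverse_real_of_nat)
    ultimately have "\<nu> L \<le> 0" using LIMSEQ_le_const[of _ "0 + C * 0" "\<nu> L"] by auto
    then have "L = 0\<^sub>m m m" using nn[OF Lc] \<nu> Lc by (auto simp: matrix_space_norm_def)
    then have "s L = 0" unfolding s_def by (intro sum.neutral) auto
    then show False using sL by simp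
  qed
  then obtain c where c: "c > 0" "\<And>B. B \<in> carrier_mat m m \<Longrightarrow> s B = 1 \<Longrightarrow> c \<le> \<nu> B" by blast
  have "c * s B \<le> \<nu> B" if B: "B \<in> carrier_mat m m" for B
  proof (cases "s B = 0")
    case True then show ?thesis using nn[OF B] by simp
  next
    case False
    have "s B \<ge> 0" unfolding s_def by (rule sum_nonneg) simp
    then have pos: "s B > 0" using False by simp
    have "c \<le> \<nu> (inverse (s B) \<cdot>\<^sub>m B)" by (rule c(2)) (use B pos shom[OF B] in auto)
    also have "\<dots> = \<nu> B / s B" using hom[OF B] pos by (simp add: field_simps)
    finally show ?thesis using pos by (simp add: field_simps)
  qed
  then show ?thesis using c(1) unfolding s_def by blast
qed

text \<open>\<open>max_minor\<close> is the largest absolute value of an entry of the exterior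
  power, and the sum norm exceeds it by at most the number of entries as a factor.\<close>

lemma matrix_norm_exterior_power:
  assumes \<nu>: "matrix_space_norm (d choose k) \<nu>" and k: "k \<le> d"
  shows "\<exists>c>0. \<exists>C>0. \<forall>B\<in>carrier_mat d d. c * real_of_int (max_minor d k B) \<le> \<nu> (exterior_power d k (map_mat real_of_int B)) \<and>
    \<nu> (exterior_power d k (map_mat real_of_int B)) \<le> C * real_of_int (max_minor d k B)"
proof -
  let ?m = "d choose k"
  let ?P = "{..<?m} \<times> {..<?m}"
  let ?E = "\<lambda>B. exterior_power d k (map_mat real_of_int B)"
  obtain c where c: "c > 0" "\<And>B. B \<in> carrier_mat ?m ?m \<Longrightarrow> c * (\<Sum>p\<in>?P. \<bar>B $$ p\<bar>) \<le> \<nu> B" using matrix_norm_lower[OF \<nu>] by blast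
  obtain C where C: "C > 0" "\<And>B. B \<in> carrier_mat ?m ?m \<Longrightarrow> \<nu> B \<le> C * (\<Sum>p\<in>?P. \<bar>B $$ p\<bar>)" using matrix_norm_upper[OF \<nu>] by blast
  have m: "?m > 0" using k by (simp add: zero_less_binomial)
  have "c * real_of_int (max_minor d k B) \<le> \<nu> (?E B)" if B: "B \<in> carrier_mat d d" for B
  proof (rule exterior_power_entry_attained[OF B k])
    fix r s assume rs: "r < ?m" "s < ?m" "\<bar>?E B $$ (r, s)\<bar> = real_of_int (max_minor d k B)"
    have "real_of_int (max_minor d k B) \<le> (\<Sum>p\<in>?P. \<bar>?E B $$ p\<bar>)"
      using member_le_sum[of "(r, s)" ?P "\<lambda>p. \<bar>?E B $$ p\<bar>"] rs by simp
    then have "c * real_of_int (max_minor d k B) \<le> c * (\<Sum>p\<in>?P. \<bar>?E B $$ p\<bar>)" using c(1) by (intro mult_left_mono) auto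
    also have "\<dots> \<le> \<nu> (?E B)" by (rule c(2)[OF exterior_power_carrier])
    finally show ?thesis .
  qed
  moreover have "\<nu> (?E B) \<le> (C * real (card ?P)) * real_of_int (max_minor d k B)" if B: "B \<in> carrier_mat d d" for B
  proof -
    have "\<nu> (?E B) \<le> C * (\<Sum>p\<in>?P. \<bar>?E B $$ p\<bar>)" by (rule C(2)[OF exterior_power_carrier])
    also have "\<dots> \<le> C * (\<Sum>p\<in>?P. real_of_int (max_minor d k B))"
      using C(1) exterior_power_entry_le[OF B] by (intro mult_left_mono sum_mono) auto
    finally show ?thesis by (simp add: mult_ac)
  qed
  moreover have "C * real (card ?P) > 0" using C(1) m by simp
  ultimately show ?thesis using c(1) by blast
qed

section \<open>Iterates of monomial maps\<close>

lemma power_int_sum: "x \<noteq> 0 \<Longrightarrow> x powi (\<Sum>i\<in>I. f i) = (\<Prod>i\<in>I. x powi f i)" for x :: "'a::field"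
  by (induction I rule: infinite_finite_induct) (simp_all add: power_int_add)

lemma prod_power_int: "(\<Prod>i\<in>I. f i) powi n = (\<Prod>i\<in>I. f i powi n)" for f :: "'b \<Rightarrow> 'a::field"
  by (induction I rule: infinite_finite_induct) (simp_all add: power_int_mult_distrib)

lemma monomial_map_torus: "x \<in> torus d \<Longrightarrow> monomial_map d A x \<in> torus d"
  by (auto simp: torus_def monomial_map_def)

text \<open>Since the exponents stand in the columns, composition multiplies the matrices with that
  of the inner map on the left; for iterates this is \<open>A ^\<^sub>m n * A\<close>.\<close>

lemma monomial_map_comp:
  assumes A: "A \<in> carrier_mat d d" and B: "B \<in> carrier_mat d d" and x: "x \<in> torus d"
  shows "monomial_map d A (monomial_map d B x) = monomial_map d (B * A) x"
proof (rule eq_vecI)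
  fix i assume "i < dim_vec (monomial_map d (B * A) x)"
  then have i: "i < d" by (simp add: monomial_map_def)
  have "vec_index (monomial_map d A (monomial_map d B x)) i = (\<Prod>j<d. (\<Prod>l<d. vec_index x l powi (B $$ (l, j))) powi (A $$ (j, i)))"
    using i by (simp add: monomial_map_def)
  also have "\<dots> = (\<Prod>j<d. \<Prod>l<d. vec_index x l powi (B $$ (l, j) * A $$ (j, i)))"
    by (simp add: prod_power_int power_int_mult)
  also have "\<dots> = (\<Prod>l<d. \<Prod>j<d. vec_index x l powi (B $$ (l, j) * A $$ (j, i)))" by (rule prod.swap)
  also have "\<dots> = (\<Prod>l<d. vec_index x l powi ((B * A) $$ (l, i)))"
  proof (rule prod.cong[OF refl])
    fix l assume "l \<in> {..<d}"
    then have l: "l < d" "vec_index x l \<noteq> 0" using x by (auto simp: torus_def)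
    have "(B * A) $$ (l, i) = (\<Sum>j<d. B $$ (l, j) * A $$ (j, i))"
      using l(1) i A B by (simp add: scalar_prod_def atLeast0LessThan)
    then show "(\<Prod>j<d. vec_index x l powi (B $$ (l, j) * A $$ (j, i))) = vec_index x l powi ((B * A) $$ (l, i))"
      by (simp add: power_int_sum[OF l(2)])
  qed
  finally show "vec_index (monomial_map d A (monomial_map d B x)) i = vec_index (monomial_map d (B * A) x) i"
    using i by (simp add: monomial_map_def)
qed (simp add: monomial_map_def)

lemma inj_on_torus_embedding: "inj_on torus_embedding (torus d)"
proof (rule inj_onI)
  fix x y assume x: "x \<in> torus d" and y: "y \<in> torus d" and eq: "torus_embedding x = torus_embedding y"
  then obtain c where c: "vCons 1 x = c \<cdot>\<^sub>v vCons 1 y" using line_eqD unfolding torus_embedding_def by blast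
  have c1: "c = 1" using arg_cong[OF c, of "\<lambda>v. vec_index v 0"] by simp
  show "x = y"
  proof (rule eq_vecI)
    fix i assume "i < dim_vec y"
    then show "vec_index x i = vec_index y i" using arg_cong[OF c, of "\<lambda>v. vec_index v (Suc i)"] c1 by simp
  qed (use x y in \<open>auto simp: torus_def\<close>)
qed

lemma torus_embedding_in_proj_space: "x \<in> torus d \<Longrightarrow> torus_embedding x \<in> proj_space d"
  unfolding proj_space_def torus_embedding_def
proof (rule imageI)
  assume x: "x \<in> torus d"
  have "vec_index (vCons 1 x) 0 = 1" by simp
  then have "vCons 1 x \<noteq> 0\<^sub>v (Suc d)" by (metis index_zero_vec(1) zero_less_Suc zero_neq_one)
  then show "vCons 1 x \<in> hcoords d" using x by (auto simp: hcoords_def torus_def)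
qed

lemma monomial_rational_map_torus:
  "x \<in> torus d \<Longrightarrow> monomial_rational_map d A (torus_embedding x) = Some (torus_embedding (monomial_map d A x))"
  by (simp add: monomial_rational_map_def the_inv_into_f_f[OF inj_on_torus_embedding])

lemma rational_iterate_Suc: "rational_iterate d f (Suc n) = f \<circ>\<^sub>m rational_iterate d f n"
  by (simp add: rational_iterate_def)

lemma iterate_monomial_torus:
  assumes A: "A \<in> carrier_mat d d" and x: "x \<in> torus d"
  shows "rational_iterate d (monomial_rational_map d A) n (torus_embedding x) = Some (torus_embedding (monomial_map d (A ^\<^sub>m n) x))"
proof (induction n)
  case 0
  have "monomial_map d (1\<^sub>m d) x = x"
  proof (rule eq_vecI)
    fix i assume i: "i < dim_vec x"
    then have i': "i < d" using x by (auto simp: torus_def)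
    have "vec_index (monomial_map d (1\<^sub>m d) x) i = (\<Prod>j<d. vec_index x j powi (1\<^sub>m d $$ (j, i)))"
      using i' by (simp add: monomial_map_def)
    also have "\<dots> = (\<Prod>j<d. if j = i then vec_index x j else 1)" by (rule prod.cong) (use i' in auto)
    finally show "vec_index (monomial_map d (1\<^sub>m d) x) i = vec_index x i" using i' by (simp add: prod.delta)
  qed (use x in \<open>auto simp: monomial_map_def torus_def\<close>)
  then show ?case using A torus_embedding_in_proj_space[OF x] by (simp add: rational_iterate_def)
next
  case (Suc n)
  have An: "A ^\<^sub>m n \<in> carrier_mat d d" using A by simp
  show ?case unfolding rational_iterate_Suc
    using Suc monomial_rational_map_torus[OF monomial_map_torus[OF x], of A] monomial_map_comp[OF A An x]
    by (simp add: map_comp_def)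
qed

text \<open>The zeroth iterate is defined on all of projective space, hence
  \<open>Suc n\<close>.\<close>

lemma dom_iterate_monomial: "dom (rational_iterate d (monomial_rational_map d A) (Suc n)) \<subseteq> torus_embedding ` torus d"
proof (induction n)
  case 0
  show ?case unfolding rational_iterate_Suc
    by (auto simp: map_comp_def rational_iterate_def monomial_rational_map_def split: if_splits option.splits)
next
  case (Suc n)
  have "dom (rational_iterate d (monomial_rational_map d A) (Suc (Suc n))) \<subseteq> dom (rational_iterate d (monomial_rational_map d A) (Suc n))"
    unfolding rational_iterate_Suc[of d _ "Suc n"] by (auto simp: map_comp_def split: option.splits)
  then show ?case using Suc by blast
qed

text \<open>Dehomogenising, the map \<open>\<phi>\<^sub>B\<close> has the Laurent exponents \<open>laurent_exp\<close> in the homogeneous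
  coordinates (with 0-th component 1); multiplying by a common monomial gives
  the minimal nonnegative exponents \<open>proj_exp\<close>.\<close>

definition laurent_exp :: "nat \<Rightarrow> int mat \<Rightarrow> nat \<Rightarrow> nat \<Rightarrow> int" where
  "laurent_exp d B i j = (case i of 0 \<Rightarrow> 0 | Suc i' \<Rightarrow> (case j of 0 \<Rightarrow> - (\<Sum>l<d. B $$ (l, i')) | Suc j' \<Rightarrow> B $$ (j', i')))"

definition min_exp :: "nat \<Rightarrow> int mat \<Rightarrow> nat \<Rightarrow> int" where
  "min_exp d B j = Min ((\<lambda>i. laurent_exp d B i j) ` {..d})"

definition proj_exp :: "nat \<Rightarrow> int mat \<Rightarrow> nat \<Rightarrow> nat \<Rightarrow> nat" where
  "proj_exp d B i j = nat (laurent_exp d B i j - min_exp d B j)"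

lemma min_exp_le: "i \<le> d \<Longrightarrow> min_exp d B j \<le> laurent_exp d B i j"
  unfolding min_exp_def by (rule Min_le) auto

lemma int_proj_exp: "i \<le> d \<Longrightarrow> int (proj_exp d B i j) = laurent_exp d B i j - min_exp d B j"
  using min_exp_le by (simp add: proj_exp_def)

text \<open>No coordinate divides all d + 1 monomials. For \<open>represents_monomial\<close> this
  provides, for a given coordinate, a monomial that does not involve it.\<close>

lemma proj_exp_attains_0: "\<exists>i\<le>d. proj_exp d B i j = 0"
proof -
  have "min_exp d B j \<in> (\<lambda>i. laurent_exp d B i j) ` {..d}" unfolding min_exp_def by (rule Min_in) auto
  then obtain i where "i \<le> d" "min_exp d B j = laurent_exp d B i j" by auto
  then show ?thesis by (intro exI[of _ i]) (simp add: proj_exp_def)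
qed

lemma sum_laurent_exp: "(\<Sum>j\<le>d. laurent_exp d B i j) = 0"
  unfolding lessThan_Suc_atMost[symmetric] sum.lessThan_Suc_shift by (cases i) (simp_all add: laurent_exp_def)

lemma sum_proj_exp: "i \<le> d \<Longrightarrow> (\<Sum>j\<le>d. proj_exp d B i j) = nat (- (\<Sum>j\<le>d. min_exp d B j))"
proof -
  assume i: "i \<le> d"
  have "int (\<Sum>j\<le>d. proj_exp d B i j) = (\<Sum>j\<le>d. laurent_exp d B i j - min_exp d B j)"
    unfolding of_nat_sum by (rule sum.cong) (use int_proj_exp[OF i] in auto)
  also have "\<dots> = - (\<Sum>j\<le>d. min_exp d B j)" by (simp add: sum_subtractf sum_laurent_exp)
  finally show ?thesis by linarith
qed

lemma exp_diff_proj_exp: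
  "i \<le> d \<Longrightarrow> i0 \<le> d \<Longrightarrow> exp_diff_mat (proj_exp d B) i0 i j = laurent_exp d B i j - laurent_exp d B i0 j"
  by (simp add: exp_diff_mat_def int_proj_exp)

lemma line_eq_torus_embedding:
  assumes v: "v \<in> hcoords d" and nz: "\<And>j. j \<le> d \<Longrightarrow> vec_index v j \<noteq> 0"
  shows "vec d (\<lambda>j. vec_index v (Suc j) / vec_index v 0) \<in> torus d"
    and "line v = torus_embedding (vec d (\<lambda>j. vec_index v (Suc j) / vec_index v 0))"
proof -
  let ?x = "vec d (\<lambda>j. vec_index v (Suc j) / vec_index v 0)"
  have v0: "vec_index v 0 \<noteq> 0" using nz by simp
  show "?x \<in> torus d" using nz by (auto simp: torus_def)
  have "v = vec_index v 0 \<cdot>\<^sub>v vCons 1 ?x"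
  proof (rule eq_vecI)
    fix i assume "i < dim_vec (vec_index v 0 \<cdot>\<^sub>v vCons 1 ?x)"
    then show "vec_index v i = vec_index (vec_index v 0 \<cdot>\<^sub>v vCons 1 ?x) i" using v0 by (cases i) auto
  qed (use v in \<open>auto simp: hcoords_def\<close>)
  then have "line v = line (vec_index v 0 \<cdot>\<^sub>v vCons 1 ?x)" by (rule arg_cong)
  then show "line v = torus_embedding ?x" unfolding line_smult[OF v0] torus_embedding_def .
qed

lemma mon_proj_exp:
  assumes nz: "\<And>j. j \<le> d \<Longrightarrow> x j \<noteq> 0" and i: "i \<le> d"
  shows "mon d (proj_exp d B) i x = (\<Prod>j\<le>d. x j powi (- min_exp d B j)) * (\<Prod>j\<le>d. x j powi laurent_exp d B i j)"
proof -
  have "x j ^ proj_exp d B i j = x j powi (- min_exp d B j) * x j powi laurent_exp d B i j" if j: "j \<le> d" for j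
  proof -
    have "x j ^ proj_exp d B i j = x j powi int (proj_exp d B i j)" by simp
    also have "int (proj_exp d B i j) = - min_exp d B j + laurent_exp d B i j" using int_proj_exp[OF i] by simp
    finally show ?thesis by (simp only: power_int_add nz[OF j] not_False_eq_True simp_thms)
  qed
  then show ?thesis unfolding mon_def by (simp add: prod.distrib)
qed

lemma line_pvec_proj_exp:
  assumes v: "v \<in> hcoords d" and nz: "\<And>j. j \<le> d \<Longrightarrow> vec_index v j \<noteq> 0"
  shows "line (pvec d (proj_exp d B) v) = torus_embedding (monomial_map d B (vec d (\<lambda>j. vec_index v (Suc j) / vec_index v 0)))"
proof -
  let ?x = "vec d (\<lambda>j. vec_index v (Suc j) / vec_index v 0)"
  define c where "c = (\<Prod>j\<le>d. vec_index v j powi (- min_exp d B j))"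
  have c: "c \<noteq> 0" using nz by (auto simp: c_def)
  have v0: "vec_index v 0 \<noteq> 0" using nz by simp
  have "pvec d (proj_exp d B) v = c \<cdot>\<^sub>v vCons 1 (monomial_map d B ?x)"
  proof (rule eq_vecI)
    fix i assume "i < dim_vec (c \<cdot>\<^sub>v vCons 1 (monomial_map d B ?x))"
    then have i: "i \<le> d" by (simp add: monomial_map_def)
    have p: "vec_index (pvec d (proj_exp d B) v) i = c * (\<Prod>j\<le>d. vec_index v j powi laurent_exp d B i j)"
      using i mon_proj_exp[of d "vec_index v" i B, OF _ i] nz by (simp add: pvec_def c_def)
    show "vec_index (pvec d (proj_exp d B) v) i = vec_index (c \<cdot>\<^sub>v vCons 1 (monomial_map d B ?x)) i"
    proof (cases i)
      case 0
      then show ?thesis using p by (simp add: laurent_exp_def)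
    next
      case (Suc i')
      have "(\<Prod>j\<le>d. vec_index v j powi laurent_exp d B i j) = vec_index v 0 powi (- (\<Sum>l<d. B $$ (l, i'))) * (\<Prod>l<d. vec_index v (Suc l) powi (B $$ (l, i')))"
        unfolding lessThan_Suc_atMost[symmetric] prod.lessThan_Suc_shift by (simp add: Suc laurent_exp_def)
      also have "vec_index v 0 powi (- (\<Sum>l<d. B $$ (l, i'))) = inverse (\<Prod>l<d. vec_index v 0 powi (B $$ (l, i')))"
        by (simp add: power_int_minus power_int_sum[OF v0])
      also have "\<dots> * (\<Prod>l<d. vec_index v (Suc l) powi (B $$ (l, i'))) = (\<Prod>l<d. (vec_index v (Suc l) / vec_index v 0) powi (B $$ (l, i')))"
        by (simp add: power_int_divide_distrib prod_dividef field_simps)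
      also have "\<dots> = vec_index (monomial_map d B ?x) i'" using i Suc by (simp add: monomial_map_def)
      finally show ?thesis using p i Suc by (simp add: monomial_map_def)
    qed
  qed (simp add: pvec_def monomial_map_def)
  then show ?thesis unfolding torus_embedding_def by (simp add: line_smult[OF c])
qed

lemma form_pvec:
  assumes e: "\<And>i. i \<le> d \<Longrightarrow> (\<Sum>j\<le>d. e i j) = q" and i: "i \<le> d"
  shows "form d q (\<lambda>v. vec_index (pvec d e v) i)"
proof -
  have "form d q (\<lambda>v. mon d e i (vec_index v))"
  proof (rule form_of_pfun)
    show "pfun (mon d e i)" by (rule pfun_mon) (rule pfun.intros)
    show "depends_only {..d} (mon d e i)" by (rule depends_onlyI) (auto intro: mon_cong)
    show "\<forall>u x. mon d e i (\<lambda>j. u * x j) = u ^ q * mon d e i x"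
    proof (intro allI)
      fix u :: complex and x :: "nat \<Rightarrow> complex"
      show "mon d e i (\<lambda>j. u * x j) = u ^ q * mon d e i x"
        using e[OF i] by (simp add: mon_def power_mult_distrib prod.distrib power_sum[symmetric])
    qed
  qed
  then show ?thesis using i by (simp add: pvec_def)
qed

lemma torus_embedding_coord_nonzero:
  assumes x: "x \<in> torus d" and l: "line v = torus_embedding x" and v: "v \<in> hcoords d" and j: "j \<le> d"
  shows "vec_index v j \<noteq> 0"
proof -
  obtain c where c: "v = c \<cdot>\<^sub>v vCons 1 x" using line_eqD[OF l[unfolded torus_embedding_def]] by blast
  have dim: "dim_vec x = d" using x by (auto simp: torus_def)
  have "c \<noteq> 0"
  proof
    assume "c = 0"
    then have "v = 0\<^sub>v (Suc d)" unfolding c by (intro eq_vecI) (auto simp: dim)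
    then show False using v by (simp add: hcoords_def)
  qed
  then show ?thesis unfolding c using x j dim by (cases j) (auto simp: torus_def)
qed

text \<open>Serves the zeroth iterate, whose domain contains points off the torus. For d = 0 the
  single exponent is 0 and \<open>pvec\<close> is constantly 1, hence d \<ge> 1.\<close>

lemma pvec_proj_exp_one:
  assumes d: "d \<ge> 1" and v: "v \<in> carrier_vec (Suc d)"
  shows "pvec d (proj_exp d (1\<^sub>m d)) v = v"
proof -
  let ?B = "1\<^sub>m d :: int mat"
  have col: "(\<Sum>l<d. ?B $$ (l, i)) = 1" if "i < d" for i
  proof -
    have "(\<Sum>l<d. ?B $$ (l, i)) = (\<Sum>l<d. if l = i then 1 else 0)" by (rule sum.cong) (use that in auto)
    then show ?thesis using that by simp
  qed
  have L: "laurent_exp d ?B i j = (if i = 0 then 0 else if j = 0 then -1 else if i = j then 1 else 0)" if "i \<le> d" "j \<le> d" for i j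
    using that col by (auto simp: laurent_exp_def split: nat.splits)
  have m: "min_exp d ?B j = (if j = 0 then -1 else 0)" if "j \<le> d" for j
    unfolding min_exp_def
  proof (rule Min_eqI)
    show "(if j = 0 then -1 else 0) \<in> (\<lambda>i. laurent_exp d ?B i j) ` {..d}"
      using that d L[of 1 j] L[of 0 j] by (cases "j = 0") (force intro: image_eqI[of _ _ 1] image_eqI[of _ _ 0])+
  qed (use that L in \<open>auto split: if_splits\<close>)
  have P: "proj_exp d ?B i j = (if i = j then 1 else 0)" if "i \<le> d" "j \<le> d" for i j
    using that L[OF that] m[of j] by (auto simp: proj_exp_def)
  show ?thesis
  proof (rule eq_vecI)
    fix i assume "i < dim_vec v"
    then have i: "i \<le> d" using v by auto
    have "mon d (proj_exp d ?B) i (vec_index v) = (\<Prod>j\<le>d. if j = i then vec_index v j else 1)"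
      unfolding mon_def by (rule prod.cong) (use i P in auto)
    then show "vec_index (pvec d (proj_exp d ?B) v) i = vec_index v i" using i by (simp add: pvec_def prod.delta)
  qed (use v in \<open>auto simp: pvec_def\<close>)
qed

lemma iterate_monomial_coords:
  assumes A: "A \<in> carrier_mat d d" and v: "v \<in> hcoords d" and nz: "\<And>j. j \<le> d \<Longrightarrow> vec_index v j \<noteq> 0"
  shows "rational_iterate d (monomial_rational_map d A) n (line v) = Some (line (pvec d (proj_exp d (A ^\<^sub>m n)) v))"
  using iterate_monomial_torus[OF A line_eq_torus_embedding(1)[OF v], of n]
    line_pvec_proj_exp[OF v, of "A ^\<^sub>m n"] line_eq_torus_embedding(2)[OF v] nz by simp

lemma represents_iterate_monomial:
  assumes A: "A \<in> carrier_mat d d"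
  shows "represents d (rational_iterate d (monomial_rational_map d A) n) (pvec d (proj_exp d (A ^\<^sub>m n)))"
  unfolding represents_def
proof (intro conjI ballI impI exI allI)
  let ?B = "A ^\<^sub>m n"
  show "pvec d (proj_exp d ?B) v \<in> carrier_vec (Suc d)" for v by (simp add: pvec_def)
  show "form d (nat (- (\<Sum>j\<le>d. min_exp d ?B j))) (\<lambda>v. vec_index (pvec d (proj_exp d ?B) v) i)" if "i \<le> d" for i
    by (rule form_pvec[OF _ that]) (rule sum_proj_exp)
  fix v assume v: "v \<in> hcoords d" and dv: "line v \<in> dom (rational_iterate d (monomial_rational_map d A) n) \<and> pvec d (proj_exp d ?B) v \<noteq> 0\<^sub>v (Suc d)"
  show "rational_iterate d (monomial_rational_map d A) n (line v) = Some (line (pvec d (proj_exp d ?B) v))"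
  \<comment> \<open>In all cases other than the identity for d \<ge> 1 the domain lies in the torus;
    for d = 0 the only point of projective space is in it.\<close>
  proof (cases "n = 0 \<and> d \<ge> 1")
    case True
    then have "pvec d (proj_exp d ?B) v = v" using A v pvec_proj_exp_one[of d v] by (simp add: hcoords_def)
    moreover have "line v \<in> proj_space d" using v by (auto simp: proj_space_def)
    ultimately show ?thesis using True by (simp add: rational_iterate_def)
  next
    case False
    have "vec_index v j \<noteq> 0" if j: "j \<le> d" for j
    proof (cases n)
      case 0
      then have "d = 0" "j = 0" using False j by auto
      show ?thesis
      proof
        assume "vec_index v j = 0"
        then have "v = 0\<^sub>v (Suc d)" using v \<open>d = 0\<close> \<open>j = 0\<close> by (intro eq_vecI) (auto simp: hcoords_def)
        then show False using v by (simp add: hcoords_def)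
      qed
    next
      case (Suc n')
      then have "line v \<in> torus_embedding ` torus d" using dv dom_iterate_monomial[of d A n'] by blast
      then obtain x where "x \<in> torus d" "line v = torus_embedding x" by auto
      then show ?thesis by (rule torus_embedding_coord_nonzero[OF _ _ v j])
    qed
    then show ?thesis by (rule iterate_monomial_coords[OF A v])
  qed
qed

section \<open>Degrees of monomial maps and minors\<close>

text \<open>The Laurent exponents are X times the transpose of B times Y, where X and Y have entries
  0, 1 and -1 and encode the dehomogenization; after subtraction of the row i0 the entries of X stay
  in that range. Expanding the determinant along each of the two factors costs d ^ k.\<close>

lemma det_laurent_bound:
  assumes B: "B \<in> carrier_mat d d" and k: "k \<le> d"
    and R: "R \<subseteq> {..d}" "card R = k" and i0: "i0 \<le> d" and J: "J \<subseteq> {..d}" "card J = k"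
  shows "\<bar>det (submat R J (exp_diff_mat (proj_exp d B) i0))\<bar> \<le> int (d ^ k) * (int (d ^ k) * max_minor d k B)"
proof -
  define X where "X = (\<lambda>i x. if i = Suc x then 1 else 0 :: int)"
  define Y where "Y = (\<lambda>y j. if j = 0 then -1 else if j = Suc y then 1 else 0 :: int)"
  have fin: "finite R" "finite J" using R J finite_subset by blast+
  have l: "laurent_exp d B i j = (\<Sum>x<d. X i x * (\<Sum>y<d. Y y j * B $$ (y, x)))" if "i \<le> d" "j \<le> d" for i j
  proof (cases i)
    case 0 then show ?thesis by (simp add: laurent_exp_def X_def)
  next
    case (Suc i')
    have "(\<Sum>x<d. X i x * (\<Sum>y<d. Y y j * B $$ (y, x))) = (\<Sum>x<d. if x = i' then (\<Sum>y<d. Y y j * B $$ (y, x)) else 0)"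
      by (rule sum.cong) (auto simp: X_def Suc)
    also have "\<dots> = (\<Sum>y<d. Y y j * B $$ (y, i'))" using that(1) Suc by simp
    also have "\<dots> = laurent_exp d B i j"
    proof (cases j)
      case 0 then show ?thesis by (simp add: Suc laurent_exp_def Y_def sum_negf)
    next
      case (Suc j')
      have "(\<Sum>y<d. Y y j * B $$ (y, i')) = (\<Sum>y<d. if y = j' then B $$ (y, i') else 0)"
        by (rule sum.cong) (auto simp: Y_def Suc)
      then show ?thesis using that(2) Suc \<open>i = Suc i'\<close> by (simp add: laurent_exp_def)
    qed
    finally show ?thesis by simp
  qed
  have eR: "enum R a \<le> d" if "a < k" for a using enum_mem[OF fin(1), of a] R that by auto
  have eJ: "enum J a \<le> d" if "a < k" for a using enum_mem[OF fin(2), of a] J that by auto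
  have "submat R J (exp_diff_mat (proj_exp d B) i0) =
    mat k k (\<lambda>(a, b). \<Sum>x<d. (X (enum R a) x - X i0 x) * (\<Sum>y<d. Y y (enum J b) * B $$ (y, x)))"
    unfolding submat_def R(2)
    by (rule eq_matI) (auto simp: exp_diff_proj_exp eR i0 l eJ sum_subtractf left_diff_distrib)
  also have "\<bar>det \<dots>\<bar> \<le> int (d ^ k) * (int (d ^ k) * max_minor d k B)"
  proof (rule det_sum_rows_bound)
    show "\<bar>X (enum R a) x - X i0 x\<bar> \<le> 1" for a x by (simp add: X_def)
    fix \<rho> :: "nat \<Rightarrow> nat" assume \<rho>: "\<And>a. a < k \<Longrightarrow> \<rho> a < d"
    have "\<bar>det (mat k k (\<lambda>(a, b). \<Sum>y<d. Y y (enum J a) * B $$ (y, \<rho> b)))\<bar> \<le> int (d ^ k) * max_minor d k B"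
    proof (rule det_sum_rows_bound)
      show "\<bar>Y x (enum J a)\<bar> \<le> 1" for a x by (simp add: Y_def)
      fix \<sigma> :: "nat \<Rightarrow> nat" assume \<sigma>: "\<And>a. a < k \<Longrightarrow> \<sigma> a < d"
      show "\<bar>det (mat k k (\<lambda>(a, b). B $$ (\<sigma> a, \<rho> b)))\<bar> \<le> max_minor d k B"
        using minor_le_max[OF B k \<sigma> \<rho>] by (simp add: minor_def)
    qed
    then show "\<bar>det (mat k k (\<lambda>(a, b). \<Sum>y<d. Y y (enum J b) * B $$ (y, \<rho> a)))\<bar> \<le> int (d ^ k) * max_minor d k B"
      by (subst det_mat_transpose)
  qed
  finally show ?thesis .
qed

lemma mixed_det_bound:
  assumes B: "B \<in> carrier_mat d d" and k: "k \<le> d" and p: "p \<in> index_pairs d k"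
  shows "\<bar>mixed_det d k (proj_exp d B) p\<bar> \<le> int (d ^ k) * (int (d ^ k) * max_minor d k B)"
proof (cases p)
  case (Pair I J)
  have IJ: "I \<subseteq> {..d}" "card I = d - k" "J \<subseteq> {..d}" "card J = k" using p Pair by (auto simp: index_pairs_def)
  have fI: "finite I" using IJ(1) finite_subset by blast
  have c: "card ({..d} - I) = Suc k" using IJ(1,2) fI k by (simp add: card_Diff_subset)
  then have "{..d} - I \<noteq> {}" by (metis card.empty nat.distinct(1))
  then have m: "Min ({..d} - I) \<in> {..d} - I" by (intro Min_in) auto
  then have "card ({..d} - I - {Min ({..d} - I)}) = k" using c by simp
  then show ?thesis unfolding Pair mixed_det_def Let_def prod.case
    using m by (intro det_laurent_bound[OF B k _ _ _ IJ(3,4)]) auto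
qed

lemma deg_k_iterate_bounds:
  assumes A: "A \<in> carrier_mat d d" and k: "k \<le> d"
  shows "max_minor d k (A ^\<^sub>m n) \<le> int (deg_k d k (rational_iterate d (monomial_rational_map d A) n))"
    and "int (deg_k d k (rational_iterate d (monomial_rational_map d A) n)) \<le>
      int (card (index_pairs d k) * d ^ k * d ^ k) * max_minor d k (A ^\<^sub>m n)"
proof -
  let ?B = "A ^\<^sub>m n"
  let ?f = "rational_iterate d (monomial_rational_map d A) n"
  let ?e = "proj_exp d ?B"
  have B: "?B \<in> carrier_mat d d" using A by simp
  have up: "deg_k d k ?f \<le> (\<Sum>p\<in>index_pairs d k. nat \<bar>mixed_det d k ?e p\<bar>)"
    by (rule deg_k_monomial(1)[OF iterate_monomial_coords[OF A] represents_iterate_monomial[OF A] sum_proj_exp proj_exp_attains_0 k])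
  have lo: "nat \<bar>det (submat ({..d} - I - {0}) J (exp_diff_mat ?e 0))\<bar> \<le> deg_k d k ?f"
    if "(I, J) \<in> index_pairs d k" "0 \<notin> I" "0 \<notin> J" for I J
    by (rule deg_k_monomial(2)[OF iterate_monomial_coords[OF A] represents_iterate_monomial[OF A] sum_proj_exp proj_exp_attains_0 k that])
  have "int (deg_k d k ?f) \<le> (\<Sum>p\<in>index_pairs d k. \<bar>mixed_det d k ?e p\<bar>)"
    using up by (simp add: of_nat_sum flip: of_nat_le_iff[where 'a = int])
  also have "\<dots> \<le> (\<Sum>p\<in>index_pairs d k. int (d ^ k) * (int (d ^ k) * max_minor d k ?B))"
    by (rule sum_mono) (rule mixed_det_bound[OF B k])
  finally show "int (deg_k d k ?f) \<le> int (card (index_pairs d k) * d ^ k * d ^ k) * max_minor d k ?B"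
    by (simp add: mult_ac)
  show "max_minor d k ?B \<le> int (deg_k d k ?f)"
  proof (rule max_minor_attained[OF k, of ?B])
    fix S T assume ST: "S \<subseteq> {..<d}" "card S = k" "T \<subseteq> {..<d}" "card T = k"
      and mx: "max_minor d k ?B = \<bar>minor k ?B (enum S) (enum T)\<bar>"
    have fin: "finite S" "finite T" using ST finite_subset by blast+
    \<comment> \<open>The given minor is realized by indices shifted by one, which avoid 0: row 0 of
      the Laurent exponents is zero, so differences with it are the exponents themselves. Monomials
      correspond to columns of the matrix, so T indexes the monomials and S the coordinates.\<close>
    define I where "I = {..d} - Suc ` T - {0}"
    have R: "{..d} - I - {0} = Suc ` T" using ST(3) by (auto simp: I_def)
    have cT: "card (Suc ` T) = k" "card (Suc ` S) = k" using ST by (simp_all add: card_image)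
    have "Suc ` T \<subseteq> {..d} - {0}" using ST(3) by auto
    then have "card ({..d} - {0} - Suc ` T) = d - k" using cT fin by (subst card_Diff_subset) auto
    moreover have "{..d} - {0} - Suc ` T = I" by (auto simp: I_def)
    ultimately have "(I, Suc ` S) \<in> index_pairs d k" using ST cT by (auto simp: index_pairs_def I_def)
    then have "nat \<bar>det (submat (Suc ` T) (Suc ` S) (exp_diff_mat ?e 0))\<bar> \<le> deg_k d k ?f"
      using lo[of I "Suc ` S"] R by (simp add: I_def)
    moreover have "submat (Suc ` T) (Suc ` S) (exp_diff_mat ?e 0) = mat k k (\<lambda>(a, b). ?B $$ (enum S b, enum T a))"
      unfolding submat_def cT(1)
    proof (rule eq_matI)
      fix a b assume "a < dim_row (mat k k (\<lambda>(a, b). ?B $$ (enum S b, enum T a)))"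
        "b < dim_col (mat k k (\<lambda>(a, b). ?B $$ (enum S b, enum T a)))"
      then have ab: "a < k" "b < k" by auto
      have "enum T a < d" using enum_less[OF ST(3)] ab ST(4) by simp
      then have "exp_diff_mat ?e 0 (Suc (enum T a)) (Suc (enum S b)) = ?B $$ (enum S b, enum T a)"
        by (simp add: exp_diff_proj_exp) (simp add: laurent_exp_def)
      then show "mat k k (\<lambda>(a, b). exp_diff_mat ?e 0 (enum (Suc ` T) a) (enum (Suc ` S) b)) $$ (a, b) =
        mat k k (\<lambda>(a, b). ?B $$ (enum S b, enum T a)) $$ (a, b)"
        using ab fin ST by (simp add: enum_Suc_image)
    qed auto
    ultimately show ?thesis using mx minor_transpose[of k ?B "enum S" "enum T"] by simp
  qed
qed

theorem theoremA:
  fixes d k :: nat and A :: "int mat" and \<nu> :: "real mat \<Rightarrow> real"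
  assumes "A \<in> carrier_mat d d" and "det A \<noteq> 0"
    and "k \<le> d"
    and "matrix_space_norm (d choose k) \<nu>"
  shows "(\<lambda>n. real (deg_k d k (rational_iterate d (monomial_rational_map d A) n)))
           \<asymp> (\<lambda>n. \<nu> (exterior_power d k (map_mat real_of_int A ^\<^sub>m n)))"
proof -
  let ?f = "\<lambda>n. deg_k d k (rational_iterate d (monomial_rational_map d A) n)"
  let ?\<nu> = "\<lambda>n. \<nu> (exterior_power d k (map_mat real_of_int A ^\<^sub>m n))"
  let ?M = "\<lambda>n. real_of_int (max_minor d k (A ^\<^sub>m n))"
  define D where "D = real (card (index_pairs d k) * d ^ k * d ^ k)"
  obtain c C where c: "c > 0" "C > 0"
    "\<forall>B\<in>carrier_mat d d. c * real_of_int (max_minor d k B) \<le> \<nu> (exterior_power d k (map_mat real_of_int B)) \<and>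
      \<nu> (exterior_power d k (map_mat real_of_int B)) \<le> C * real_of_int (max_minor d k B)"
    using matrix_norm_exterior_power[OF assms(4,3)] by blast
  have Bn: "A ^\<^sub>m n \<in> carrier_mat d d" for n using assms(1) by simp
  have hom: "map_mat real_of_int A ^\<^sub>m n = map_mat real_of_int (A ^\<^sub>m n)" for n
    by (rule of_int_hom.mat_hom_pow[OF assms(1), symmetric])
  have M1: "?M n \<ge> 1" for n
  proof -
    have "det (A ^\<^sub>m n) \<noteq> 0"
    proof (induction n)
      case (Suc n) then show ?case using det_mult[OF Bn[of n] assms(1)] assms(2) by simp
    qed (use assms(1) in simp)
    then show ?thesis using max_minor_ge_1[OF Bn _ assms(3)] by simp
  qed
  have \<nu>: "c * ?M n \<le> ?\<nu> n" "?\<nu> n \<le> C * ?M n" for n using c(3) Bn[of n] hom[of n] by simp_all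
  have f: "?M n \<le> real (?f n)" "real (?f n) \<le> D * ?M n" for n
    using deg_k_iterate_bounds[OF assms(1,3), of n, folded of_int_le_iff[where 'a = real]] by (simp_all add: D_def)
  have \<nu>pos: "?\<nu> n > 0" for n 
  proof -
    have "0 < ?M n" using M1[of n] by linarith
    then have "0 < c * ?M n" by (rule mult_pos_pos[OF c(1)])
    then show ?thesis using \<nu>(1)[of n] by (rule less_le_trans)
  qed
  \<comment> \<open>Has to dominate C for the lower and D / c for the upper estimate; the summand 2
    ensures K > 1.\<close>
  define K where "K = 2 + C + D / c"
  have D0: "D \<ge> 0" by (simp add: D_def)
  have "D / c \<ge> 0" using D0 c(1) by simp
  then have K: "K > 1" "K \<ge> C" "K \<ge> D / c" using c(2) unfolding K_def by linarith+
  show ?thesis unfolding asymp_comparable_def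
  proof (intro exI[of _ K] conjI allI)
    fix n
    have "?\<nu> n \<le> K * real (?f n)"
    proof -
      have "C * ?M n \<le> K * real (?f n)" using K f(1)[of n] M1[of n] c(2) by (intro mult_mono) auto
      then show ?thesis using \<nu>(2)[of n] by linarith
    qed
    then show "inverse K \<le> real (?f n) / ?\<nu> n" using K(1) \<nu>pos[of n] by (simp add: field_simps)
    have "real (?f n) \<le> D / c * (c * ?M n)" using f(2)[of n] c(1) by simp
    also have "\<dots> \<le> K * ?\<nu> n" using K \<nu>(1)[of n] M1[of n] c(1) D0 by (intro mult_mono) auto
    finally show "real (?f n) / ?\<nu> n \<le> K" using \<nu>pos[of n] by (simp add: field_simps)
  qed (rule K(1))
qed

end
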